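(* Let $n\geqslant2$ and let $\pi=\mathrm{ind}_{\mathrm{Z}_n\mathrm{K}_n}^{\mathrm{G}_n}(\omega_\pi\tau)$ be a depth zero cuspidal $\mathrm{R}$-representation of $\mathrm{G}_n$, with $\tau$ a cuspidal $\mathrm{R}$-representation of $\mathrm{GL}_n(k_\mathrm{F})$ realized on $W(\tau,\overline{\psi})$. Then: (1) $c(\pi)=n$, $\dim_\mathrm{R}\pi^{\mathrm{K}_n(n)}=1$, and every $f\in\pi^{\mathrm{K}_n(n)}$ has support contained in $\mathrm{Z}_n\mathrm{K}_n\Sigma_n\mathrm{K}_n(n)$. (2) For every integer $m>n$, $\dim_\mathrm{R}\pi^{\mathrm{K}_n(m)}=\binom{m-1}{n-1}$. (3) There is a unique $f_{\mathrm{new}}\in\pi^{\mathrm{K}_n(n)}$ with $$f_{\mathrm{new}}(\Sigma_n)=\sum_{b\in\mathrm{B}^{\mathrm{op}}_{n-1}(k_\mathrm{F})}b\cdot B_{\tau,\overline{\psi}},$$ and it is non-zero. Moreover, there exists a unique $\mathrm{R}$-valued Haar measure $dk$ on $\mathrm{K}_n(n)$ such that for all $g\in\mathrm{G}_n$, $$f_{\mathrm{new}}(g)=\int_{\mathrm{K}_n(n)}\mathcal{B}_{\widetilde{\tau}}(gk\Sigma_n^{-1})\,dk .$$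
   Context: $\mathrm{F}$ is a non-archimedean local field with ring of integers $\mathfrak{o}_\mathrm{F}$, maximal ideal $\mathfrak{p}_\mathrm{F}=\varpi_\mathrm{F}\mathfrak{o}_\mathrm{F}$, residue field $k_\mathrm{F}$ with $q$ elements ($q$ a power of the prime $p$). $\mathrm{R}$ is an algebraically closed field of characteristic $\ell\neq p$; representations are smooth on $\mathrm{R}$-vector spaces. $\mathrm{G}_n=\mathrm{GL}_n(\mathrm{F})$, $\mathrm{K}_n=\mathrm{GL}_n(\mathfrak{o}_\mathrm{F})$, $\mathrm{Z}_n$ the centre of $\mathrm{G}_n$, $\mathrm{K}_n^1=1+\mathrm{M}_n(\mathfrak{p}_\mathrm{F})$; for $k\in\mathrm{K}_n$, $\overline{k}$ is its image in $\mathrm{K}_n/\mathrm{K}_n^1=\mathrm{GL}_n(k_\mathrm{F})$. For $m\geqslant1$, $\mathrm{K}_n(m)=\{\left(\begin{smallmatrix}a&b\\c&d\end{smallmatrix}\right)\in\mathrm{K}_n: c\in\mathrm{M}_{1\times(n-1)}(\mathfrak{p}_\mathrm{F}^m),\ d\in1+\mathfrak{p}_\mathrm{F}^m\}$ (blocks of size $(n-1)+1$), $\mathrm{K}_n(0)=\mathrm{K}_n$; the conductor $c(\pi)$ is the least $m\geqslant0$ with $\pi^{\mathrm{K}_n(m)}\neq0$. $\Sigma_n=\mathrm{diag}(\varpi_\mathrm{F}^{n-1},\varpi_\mathrm{F}^{n-2},\dots,\varpi_\mathrm{F},1)$. Finite field data: $\mathrm{U}(k_\mathrm{F})$ is the upper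 unitriangular subgroup of $\mathrm{GL}_n(k_\mathrm{F})$; $\overline{\psi}:k_\mathrm{F}\to\mathrm{R}^\times$ is a fixed non-trivial character, extended to $\mathrm{U}(k_\mathrm{F})$ by $\overline{\psi}(u)=\overline{\psi}(u_{1,2}+\dots+u_{n-1,n})$. For a cuspidal $\tau$ of $\mathrm{GL}_n(k_\mathrm{F})$, $W(\tau,\overline{\psi})$ is its (unique) Whittaker model: the subspace of functions $W:\mathrm{GL}_n(k_\mathrm{F})\to\mathrm{R}$ with $W(ug)=\overline{\psi}(u)W(g)$ isomorphic to $\tau$, with $\mathrm{GL}_n(k_\mathrm{F})$ acting by right translation $(h\cdot W)(x)=W(xh)$. The Bessel function $B_{\tau,\overline{\psi}}$ is the unique $W\in W(\tau,\overline{\psi})$ with $W(gu)=\overline{\psi}(u)W(g)$ for $u\in\mathrm{U}(k_\mathrm{F})$ and $W(1)=1$. $\mathrm{B}^{\mathrm{op}}_{n-1}(k_\mathrm{F})$ is the group of invertible lower triangular $(n-1)\times(n-1)$ matrices over $k_\mathrm{F}$, embedded in $\mathrm{GL}_n(k_\mathrm{F})$ via $g\mapsto\mathrm{diag}(g,1)$ (for $n=2$ it is $\mathrm{GL}_1(k_\mathrm{F})$). Depth zero model: $\widetilde{\tau}=\omega_\pi\tau$ is the representation $zk\mapsto\omega_\pi(z)\tau(\overline{k})$ of $\mathrm{Z}_n\mathrm{K}_n$ (with $\omega_\pi$ a character of $\mathrm{Z}_n\simeq\mathrm{F}^\times$ compatible with the central character of $\tau$), and $\mathrm{ind}_{\mathrm{Z}_n\mathrm{K}_n}^{\mathrm{G}_n}(\widetilde\tau)$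 is the space of functions $f:\mathrm{G}_n\to W(\tau,\overline{\psi})$, compactly supported modulo $\mathrm{Z}_n$, with $f(zkg)=\omega_\pi(z)\,\overline{k}\cdot f(g)$, $\mathrm{G}_n$ acting by right translation. Every depth zero cuspidal $\mathrm{R}$-representation is of this form. The Bessel vector $\mathcal{B}_{\widetilde\tau}\in\mathrm{ind}_{\mathrm{Z}_n\mathrm{K}_n}^{\mathrm{G}_n}(\widetilde\tau)$ is supported in $\mathrm{Z}_n\mathrm{K}_n$ with $\mathcal{B}_{\widetilde\tau}(zk)=\omega_\pi(z)\,\overline{k}\cdot B_{\tau,\overline{\psi}}$. *)

theory Defs
  imports "Jordan_Normal_Form.Determinant" "HOL-Library.Function_Algebras"
          "HOL-Computational_Algebra.Polynomial"
begin

text \<open>F is modelled by a field type 'f together with a normalised discrete valuation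
 v (v x is meaningful for x \<noteq> 0; v 0 plays the role of +infinity and is never used),
 a uniformiser w, and a reduction map red from the ring of integers onto a finite
 field 'k, the residue field, whose kernel is the maximal ideal.\<close>

definition inO :: "('f::field \<Rightarrow> int) \<Rightarrow> 'f \<Rightarrow> bool" where
  "inO v x \<longleftrightarrow> x = 0 \<or> v x \<ge> 0"

definition inP :: "('f::field \<Rightarrow> int) \<Rightarrow> nat \<Rightarrow> 'f \<Rightarrow> bool" where
  "inP v m x \<longleftrightarrow> x = 0 \<or> v x \<ge> int m"

definition isUnit :: "('f::field \<Rightarrow> int) \<Rightarrow> 'f \<Rightarrow> bool" where
  "isUnit v x \<longleftrightarrow> x \<noteq> 0 \<and> v x = 0"

definition nonarch_local_field ::
  "('f::field \<Rightarrow> int) \<Rightarrow> ('f \<Rightarrow> 'k::{field,finite}) \<Rightarrow> 'f \<Rightarrow> bool" where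
  "nonarch_local_field v red w \<longleftrightarrow>
     (\<forall>x y. x \<noteq> 0 \<longrightarrow> y \<noteq> 0 \<longrightarrow> v (x * y) = v x + v y)
   \<and> (\<forall>x y. x \<noteq> 0 \<longrightarrow> y \<noteq> 0 \<longrightarrow> x + y \<noteq> 0 \<longrightarrow> v (x + y) \<ge> min (v x) (v y))
   \<and> w \<noteq> 0 \<and> v w = 1
   \<and> (\<forall>x y. inO v x \<longrightarrow> inO v y \<longrightarrow> red (x + y) = red x + red y \<and> red (x * y) = red x * red y)
   \<and> red 1 = 1
   \<and> (\<forall>a. \<exists>x. inO v x \<and> red x = a)
   \<and> (\<forall>x. inO v x \<longrightarrow> (red x = 0 \<longleftrightarrow> inP v 1 x))
   \<and> (\<forall>s::nat \<Rightarrow> 'f. (\<forall>N::nat. \<exists>M. \<forall>i\<ge>M. \<forall>j\<ge>M. inP v N (s i - s j)) \<longrightarrow>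
        (\<exists>L. \<forall>N::nat. \<exists>M. \<forall>i\<ge>M. inP v N (s i - L)))"

definition GLn :: "nat \<Rightarrow> 'a::field mat set" where
  "GLn n = {A \<in> carrier_mat n n. det A \<noteq> 0}"

definition Kn :: "('f::field \<Rightarrow> int) \<Rightarrow> nat \<Rightarrow> 'f mat set" where
  "Kn v n = {A \<in> GLn n. (\<forall>i<n. \<forall>j<n. inO v (A $$ (i,j))) \<and> isUnit v (det A)}"

definition Knm :: "('f::field \<Rightarrow> int) \<Rightarrow> nat \<Rightarrow> nat \<Rightarrow> 'f mat set" where
  "Knm v n m = (if m = 0 then Kn v n else
     {A \<in> Kn v n. (\<forall>j<n-1. inP v m (A $$ (n-1, j))) \<and> inP v m (A $$ (n-1, n-1) - 1)})"

text \<open>Principal congruence subgroups K_n^j = 1 + M_n(p^j) (j \<ge> 1); they give the topology.\<close>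
definition Kcong :: "('f::field \<Rightarrow> int) \<Rightarrow> nat \<Rightarrow> nat \<Rightarrow> 'f mat set" where
  "Kcong v n j = {A \<in> Kn v n. \<forall>i<n. \<forall>i'<n. inP v j ((A - 1\<^sub>m n) $$ (i,i'))}"

definition scal :: "nat \<Rightarrow> 'a::field \<Rightarrow> 'a mat" where
  "scal n z = z \<cdot>\<^sub>m 1\<^sub>m n"

definition Sigma :: "'f::field \<Rightarrow> nat \<Rightarrow> 'f mat" where
  "Sigma w n = mat n n (\<lambda>(i,j). if i = j then w ^ (n - 1 - i) else 0)"

definition SigmaInv :: "'f::field \<Rightarrow> nat \<Rightarrow> 'f mat" where
  "SigmaInv w n = mat n n (\<lambda>(i,j). if i = j then inverse w ^ (n - 1 - i) else 0)"

definition kbar :: "('f \<Rightarrow> 'k) \<Rightarrow> nat \<Rightarrow> 'f mat \<Rightarrow> 'k::field mat" where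
  "kbar red n A = mat n n (\<lambda>(i,j). red (A $$ (i,j)))"

definition Uk :: "nat \<Rightarrow> 'k::field mat set" where
  "Uk n = {u \<in> carrier_mat n n. \<forall>i<n. \<forall>j<n. (i = j \<longrightarrow> u $$ (i,j) = 1) \<and> (j < i \<longrightarrow> u $$ (i,j) = 0)}"

definition psiU :: "('k::field \<Rightarrow> 'r) \<Rightarrow> nat \<Rightarrow> 'k mat \<Rightarrow> 'r" where
  "psiU psi n u = psi (\<Sum>i<n-1. u $$ (i, i+1))"

definition nontriv_add_char :: "('k::field \<Rightarrow> 'r::field) \<Rightarrow> bool" where
  "nontriv_add_char psi \<longleftrightarrow> (\<forall>x y. psi (x + y) = psi x * psi y) \<and> psi 0 = 1 \<and> (\<exists>x. psi x \<noteq> 1)"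

text \<open>Right translation of functions on GL_n(k_F) (functions are taken to vanish off GL_n(k_F)).\<close>
definition rt :: "nat \<Rightarrow> 'k::field mat \<Rightarrow> ('k mat \<Rightarrow> 'r::field) \<Rightarrow> ('k mat \<Rightarrow> 'r)" where
  "rt n h W = (\<lambda>x. if x \<in> GLn n then W (x * h) else 0)"

definition whittaker_fun :: "nat \<Rightarrow> ('k::field \<Rightarrow> 'r::field) \<Rightarrow> ('k mat \<Rightarrow> 'r) \<Rightarrow> bool" where
  "whittaker_fun n psi W \<longleftrightarrow> (\<forall>x. x \<notin> GLn n \<longrightarrow> W x = 0)
     \<and> (\<forall>u\<in>Uk n. \<forall>g\<in>GLn n. W (u * g) = psiU psi n u * W g)"

definition subrep :: "nat \<Rightarrow> ('k::field mat \<Rightarrow> 'r::field) set \<Rightarrow> bool" where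
  "subrep n S \<longleftrightarrow> 0 \<in> S \<and> (\<forall>a b. a \<in> S \<longrightarrow> b \<in> S \<longrightarrow> a + b \<in> S)
     \<and> (\<forall>c a. a \<in> S \<longrightarrow> (\<lambda>x. c * a x) \<in> S) \<and> (\<forall>h\<in>GLn n. \<forall>a\<in>S. rt n h a \<in> S)"

text \<open>Unipotent radical of the standard parabolic attached to a non-empty set S of cut
 points in {1..n-1} (S = {1..n-1} is the Borel, singletons are the maximal parabolics).\<close>
definition unipRad :: "nat \<Rightarrow> nat set \<Rightarrow> 'k::field mat set" where
  "unipRad n S = {u \<in> Uk n. \<forall>i<n. \<forall>j<n. i < j \<longrightarrow> \<not> (\<exists>s\<in>S. i < s \<and> s \<le> j) \<longrightarrow> u $$ (i,j) = 0}"

definition cuspidal_whittaker_model ::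
  "nat \<Rightarrow> ('k::{field,finite} \<Rightarrow> 'r::field) \<Rightarrow> ('k mat \<Rightarrow> 'r) set \<Rightarrow> bool" where
  "cuspidal_whittaker_model n psi Wt \<longleftrightarrow>
     subrep n Wt \<and> Wt \<noteq> {0} \<and> (\<forall>W\<in>Wt. whittaker_fun n psi W)
   \<and> (\<forall>S. subrep n S \<longrightarrow> S \<subseteq> Wt \<longrightarrow> S = {0} \<or> S = Wt)
   \<and> (\<forall>S. S \<noteq> {} \<longrightarrow> S \<subseteq> {1..n-1} \<longrightarrow>
        (\<forall>W\<in>Wt. (\<forall>u\<in>unipRad n S. rt n u W = W) \<longrightarrow> W = 0))"

definition bessel :: "nat \<Rightarrow> ('k::field \<Rightarrow> 'r::field) \<Rightarrow> ('k mat \<Rightarrow> 'r) set \<Rightarrow> ('k mat \<Rightarrow> 'r)" where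
  "bessel n psi Wt = (THE W. W \<in> Wt \<and> (\<forall>g\<in>GLn n. \<forall>u\<in>Uk n. W (g * u) = psiU psi n u * W g)
                       \<and> W (1\<^sub>m n) = 1)"

text \<open>B^op_{n-1}(k_F) embedded in GL_n(k_F) via g \<mapsto> diag(g,1).\<close>
definition Bop :: "nat \<Rightarrow> 'k::field mat set" where
  "Bop n = {b \<in> carrier_mat n n. (\<forall>i<n. \<forall>j<n. i < j \<longrightarrow> b $$ (i,j) = 0)
     \<and> (\<forall>i<n-1. b $$ (i,i) \<noteq> 0) \<and> (\<forall>j<n-1. b $$ (n-1, j) = 0) \<and> b $$ (n-1, n-1) = 1}"

definition alg_closed :: "'r::field itself \<Rightarrow> bool" where
  "alg_closed _ \<longleftrightarrow> (\<forall>p :: 'r poly. degree p \<ge> 1 \<longrightarrow> (\<exists>x. poly p x = 0))"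

definition central_char_compatible ::
  "('f::field \<Rightarrow> int) \<Rightarrow> ('f \<Rightarrow> 'k::field) \<Rightarrow> nat \<Rightarrow> ('f \<Rightarrow> 'r::field) \<Rightarrow> ('k mat \<Rightarrow> 'r) set \<Rightarrow> bool" where
  "central_char_compatible v red n om Wt \<longleftrightarrow>
     (\<forall>x. x \<noteq> 0 \<longrightarrow> om x \<noteq> 0)
   \<and> (\<forall>x y. x \<noteq> 0 \<longrightarrow> y \<noteq> 0 \<longrightarrow> om (x * y) = om x * om y)
   \<and> (\<exists>j\<ge>1. \<forall>x. isUnit v x \<longrightarrow> inP v j (x - 1) \<longrightarrow> om x = 1)
   \<and> (\<forall>a. isUnit v a \<longrightarrow> (\<forall>W\<in>Wt. rt n (scal n (red a)) W = (\<lambda>y. om a * W y)))"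

text \<open>Elements of ind_{Z_n K_n}^{G_n}(omega tau): functions G_n \<rightarrow> W(tau,psi) (taken to be 0
 off G_n), left (Z_n K_n, omega tau)-equivariant, smooth, compactly supported mod Z_n.\<close>
definition ind_space ::
  "('f::field \<Rightarrow> int) \<Rightarrow> ('f \<Rightarrow> 'k::field) \<Rightarrow> nat \<Rightarrow> ('f \<Rightarrow> 'r::field) \<Rightarrow> ('k mat \<Rightarrow> 'r) set
   \<Rightarrow> ('f mat \<Rightarrow> 'k mat \<Rightarrow> 'r) set" where
  "ind_space v red n om Wt = {f.
     (\<forall>g. g \<notin> GLn n \<longrightarrow> f g = 0)
   \<and> (\<forall>g\<in>GLn n. f g \<in> Wt)
   \<and> (\<forall>z k g. z \<noteq> 0 \<longrightarrow> k \<in> Kn v n \<longrightarrow> g \<in> GLn n \<longrightarrow>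
        f (scal n z * k * g) = (\<lambda>y. om z * rt n (kbar red n k) (f g) y))
   \<and> (\<exists>j\<ge>1. \<forall>g\<in>GLn n. \<forall>k\<in>Kcong v n j. f (g * k) = f g)
   \<and> (\<exists>T. finite T \<and> T \<subseteq> GLn n \<and> (\<forall>g\<in>GLn n. f g \<noteq> 0 \<longrightarrow>
        (\<exists>z k t. z \<noteq> 0 \<and> k \<in> Kn v n \<and> t \<in> T \<and> g = scal n z * k * t)))}"

definition fixed_vectors ::
  "('f::field \<Rightarrow> int) \<Rightarrow> ('f \<Rightarrow> 'k::field) \<Rightarrow> nat \<Rightarrow> ('f \<Rightarrow> 'r::field) \<Rightarrow> ('k mat \<Rightarrow> 'r) set
   \<Rightarrow> nat \<Rightarrow> ('f mat \<Rightarrow> 'k mat \<Rightarrow> 'r) set" where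
  "fixed_vectors v red n om Wt m =
     {f \<in> ind_space v red n om Wt. \<forall>g\<in>GLn n. \<forall>k\<in>Knm v n m. f (g * k) = f g}"

definition conductor ::
  "('f::field \<Rightarrow> int) \<Rightarrow> ('f \<Rightarrow> 'k::field) \<Rightarrow> nat \<Rightarrow> ('f \<Rightarrow> 'r::field) \<Rightarrow> ('k mat \<Rightarrow> 'r) set \<Rightarrow> nat" where
  "conductor v red n om Wt = (LEAST m. fixed_vectors v red n om Wt m \<noteq> {0})"

definition fun_dim :: "('a \<Rightarrow> 'b \<Rightarrow> 'r::field) set \<Rightarrow> nat" where
  "fun_dim V = vector_space.dim (\<lambda>c f. \<lambda>g y. c * f g y) V"

definition bessel_vector ::
  "('f::field \<Rightarrow> int) \<Rightarrow> ('f \<Rightarrow> 'k::field) \<Rightarrow> nat \<Rightarrow> ('f \<Rightarrow> 'r::field) \<Rightarrow> ('k \<Rightarrow> 'r)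
   \<Rightarrow> ('k mat \<Rightarrow> 'r) set \<Rightarrow> 'f mat \<Rightarrow> 'k mat \<Rightarrow> 'r" where
  "bessel_vector v red n om psi Wt g =
     (if \<exists>z k. z \<noteq> 0 \<and> k \<in> Kn v n \<and> g = scal n z * k
      then (SOME W. \<exists>z k. z \<noteq> 0 \<and> k \<in> Kn v n \<and> g = scal n z * k \<and>
              W = (\<lambda>y. om z * rt n (kbar red n k) (bessel n psi Wt) y))
      else 0)"

text \<open>Compact open subsets of the compact group H = K_n(m): the clopen subsets of H
 for the topology given by the congruence subgroups.\<close>
definition compact_open_in ::
  "('f::field \<Rightarrow> int) \<Rightarrow> nat \<Rightarrow> 'f mat set \<Rightarrow> 'f mat set \<Rightarrow> bool" where
  "compact_open_in v n H A \<longleftrightarrow> A \<subseteq> H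
     \<and> (\<forall>a\<in>A. \<exists>j\<ge>1. (\<lambda>k. a * k) ` Kcong v n j \<subseteq> A)
     \<and> (\<forall>a\<in>H - A. \<exists>j\<ge>1. (\<lambda>k. a * k) ` Kcong v n j \<subseteq> H - A)"

definition haar_measure ::
  "('f::field \<Rightarrow> int) \<Rightarrow> nat \<Rightarrow> 'f mat set \<Rightarrow> ('f mat set \<Rightarrow> 'r::field) \<Rightarrow> bool" where
  "haar_measure v n H mu \<longleftrightarrow>
     (\<forall>A. \<not> compact_open_in v n H A \<longrightarrow> mu A = 0)
   \<and> (\<forall>A B. compact_open_in v n H A \<longrightarrow> compact_open_in v n H B \<longrightarrow> A \<inter> B = {} \<longrightarrow>
        mu (A \<union> B) = mu A + mu B)
   \<and> (\<forall>h\<in>H. \<forall>A. compact_open_in v n H A \<longrightarrow> mu ((\<lambda>k. h * k) ` A) = mu A)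
   \<and> (\<exists>A. mu A \<noteq> 0)"

text \<open>Integral of a locally constant (hence finitely valued) R-valued function on H.\<close>
definition haar_integral :: "'f mat set \<Rightarrow> ('f mat set \<Rightarrow> 'r::field) \<Rightarrow> ('f mat \<Rightarrow> 'r) \<Rightarrow> 'r" where
  "haar_integral H mu phi = (\<Sum>c\<in>phi ` H. c * mu {k\<in>H. phi k = c})"

end

theory Submission
  imports Defs "HOL-Algebra.Sylow" "HOL-Combinatorics.List_Permutation"
begin

text \<open>
  Over the finite field, the anti-involution \<open>g \<mapsto> w\<^sub>0 g\<^sup>T w\<^sub>0\<close> fixes every \<open>(U, \<psi>)\<close>-bi-equivariant function
  (by the Bruhat decomposition), so the Hecke algebra of \<open>(U, \<psi>)\<close> is commutative and the space of
  \<open>(U, \<psi>)\<close>-vectors of \<open>\<tau>\<close> is a line, spanned by the Bessel function. Cuspidality together with Fourier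
  expansion along the columns shows that a Whittaker function of \<open>\<tau>\<close> is determined by its restriction
  to the mirabolic subgroup; hence the vectors fixed by the lower triangular Borel subgroup
  \<open>B\<^sup>o\<^sup>p\<close> of \<open>GL\<^sub>n\<^sub>-\<^sub>1\<close> form a line, spanned by the average \<open>W0\<close> of the Bessel function over \<open>B\<^sup>o\<^sup>p\<close>.

  Over the local field, every double coset of \<open>Z K\<close> and \<open>K(m)\<close> has a representative with a diagonal
  upper left block and last row \<open>(0, \<dots>, 0, 1)\<close>. The reduction of its stabiliser contains a unipotent
  radical, or a simple root subgroup together with \<open>B\<^sup>o\<^sup>p\<close>, unless the representative can be taken to be
  \<open>diag(\<varpi>\<^bsup>a(1)\<^esup>, \<dots>, \<varpi>\<^bsup>a(n-1)\<^esup>, 1)\<close> with \<open>m > a(1) > \<dots> > a(n-1) > 0\<close>, in which case it is \<open>B\<^sup>o\<^sup>p\<close>. So a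
  fixed vector is an arbitrary choice of multiples of \<open>W0\<close> at these points, of which there are
  \<open>m - 1\<close> choose \<open>n - 1\<close>. For \<open>m = n\<close> the only one is \<open>\<Sigma>\<close>, and the integral of the Bessel vector picks up
  the cosets of \<open>B\<^sup>o\<^sup>p\<close> in the stabiliser of \<open>\<Sigma>\<close>, each with the same non-zero volume.
\<close>

section \<open>General linear groups and the Bruhat decomposition\<close>

text \<open>The characteristic of R may divide the orders of GL_n(k) and of B^op, so there is
  neither complete reducibility nor a projection onto B^op-invariants: only powers of q can be
  inverted. Averaging is safe over U, and multiplicity one for (U, psi) rests on it together with
  Schur's lemma. For B^op, uniqueness comes without averaging: an invariant Whittaker function is
  determined by its value at 1. Existence needs a sum over B^op that is visibly non-zero in R, and
  its value at 1 is exactly 1, because the Bessel function vanishes at all other elements of B^op.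
  The same obstacle fixes the normalisation of the Haar measure: the volume of K(n) may be zero in
  R, so the measure is normalised on a pro-p subgroup of it. Over the local field everything is read
  off one computation: conjugation by a diagonal matrix with exponents a multiplies the entry (i,j)
  by a power of the uniformiser with exponent a difference of a(i) and a(j). The order of the
  exponents, with 0 for the corner, decides which entries are free modulo the maximal ideal, and the
  last row of K(m) brings in the bound m.\<close>

lemma mat_mult_entry:
  assumes "A \<in> carrier_mat n n" "B \<in> carrier_mat n n" "i < n" "j < n"
  shows "(A * B) $$ (i,j) = (\<Sum>k<n. A $$ (i,k) * B $$ (k,j))"
  using assms by (simp add: scalar_prod_def atLeast0LessThan)

lemma GLn_carrier: "A \<in> GLn n \<Longrightarrow> A \<in> carrier_mat n n"
  by (simp add: GLn_def)

lemma GLn_mult: "A \<in> GLn n \<Longrightarrow> B \<in> GLn n \<Longrightarrow> A * B \<in> GLn n"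
  by (auto simp: GLn_def det_mult)

lemma GLn_one: "1\<^sub>m n \<in> GLn n"
  by (simp add: GLn_def)

lemma GLn_assoc: "A \<in> GLn n \<Longrightarrow> B \<in> GLn n \<Longrightarrow> C \<in> GLn n \<Longrightarrow> A * B * C = A * (B * C)"
  using assoc_mult_mat GLn_carrier by blast

lemma GLn_one_mult: "A \<in> GLn n \<Longrightarrow> 1\<^sub>m n * A = A" "A \<in> GLn n \<Longrightarrow> A * 1\<^sub>m n = A"
  using GLn_carrier left_mult_one_mat right_mult_one_mat by blast+

lemma GLn_I_right:
  fixes A :: "'a::field mat"
  assumes "A \<in> carrier_mat n n" "B \<in> carrier_mat n n" "A * B = 1\<^sub>m n"
  shows "A \<in> GLn n"
proof -
  have "det A * det B = 1" using det_mult[OF assms(1,2)] assms(3) by simp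
  then have "det A \<noteq> 0" by (metis mult_zero_left zero_neq_one)
  then show ?thesis using assms by (simp add: GLn_def)
qed

lemma GLn_I_left:
  fixes A :: "'a::field mat"
  assumes "A \<in> carrier_mat n n" "B \<in> carrier_mat n n" "B * A = 1\<^sub>m n"
  shows "A \<in> GLn n"
  using GLn_I_right[OF assms(1,2)] mat_mult_left_right_inverse[OF assms(2,1,3)] by simp

text \<open>The adjugate formula is taken as the definition because it shows integrality over the
  local field: the cofactors of an integral matrix are integral, and only the determinant is
  inverted.\<close>

definition ginv :: "'a::field mat \<Rightarrow> 'a mat" where
  "ginv A = (1 / det A) \<cdot>\<^sub>m adj_mat A"

lemma ginv:
  assumes "A \<in> GLn n"
  shows "A * ginv A = 1\<^sub>m n" "ginv A * A = 1\<^sub>m n" "ginv A \<in> GLn n"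
proof -
  have A: "A \<in> carrier_mat n n" "det A \<noteq> 0" using assms by (auto simp: GLn_def)
  note ad = adj_mat[OF A(1)]
  show 1: "A * ginv A = 1\<^sub>m n"
    unfolding ginv_def using A ad by (auto simp: mult_smult_distrib[OF A(1) ad(1)])
  have c: "ginv A \<in> carrier_mat n n" using ad by (simp add: ginv_def)
  show "ginv A * A = 1\<^sub>m n" using mat_mult_left_right_inverse[OF A(1) c 1] .
  then show "ginv A \<in> GLn n" using GLn_I_right[OF c A(1)] by simp
qed

lemma ginv_cancel:
  assumes "A \<in> GLn n" "B \<in> GLn n"
  shows "A * (ginv A * B) = B" "ginv A * (A * B) = B" "B * A * ginv A = B" "B * ginv A * A = B"
  using assms ginv[OF assms(1)] by (simp_all add: GLn_assoc[symmetric] GLn_one_mult GLn_mult)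
    (simp_all add: GLn_assoc GLn_one_mult)

lemma ginv_mult:
  assumes "A \<in> GLn n" "B \<in> GLn n"
  shows "ginv (A * B) = ginv B * ginv A"
proof -
  have "A * B * (ginv B * ginv A) = 1\<^sub>m n"
    using assms by (simp add: GLn_assoc GLn_mult ginv ginv_cancel)
  then have "ginv (A * B) * (A * B * (ginv B * ginv A)) = ginv (A * B)"
    using assms by (simp add: GLn_one_mult ginv GLn_mult)
  moreover have "ginv (A * B) * (A * B * (ginv B * ginv A)) = ginv B * ginv A"
    using assms by (intro ginv_cancel) (auto intro: GLn_mult ginv)
  ultimately show ?thesis by simp
qed

lemma finite_carrier_mat: "finite (carrier_mat n m :: 'a::finite mat set)"
proof -
  have "carrier_mat n m \<subseteq> (mat n m) ` (({..<n} \<times> {..<m}) \<rightarrow>\<^sub>E (UNIV :: 'a set))"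
  proof
    fix A :: "'a mat" assume A: "A \<in> carrier_mat n m"
    have "A = mat n m (restrict (\<lambda>p. A $$ p) ({..<n} \<times> {..<m}))"
      using A by (intro eq_matI) auto
    moreover have "restrict (\<lambda>p. A $$ p) ({..<n} \<times> {..<m}) \<in> ({..<n} \<times> {..<m}) \<rightarrow>\<^sub>E (UNIV :: 'a set)"
      by auto
    ultimately show "A \<in> (mat n m) ` (({..<n} \<times> {..<m}) \<rightarrow>\<^sub>E (UNIV :: 'a set))"
      by blast
  qed
  then show ?thesis by (rule finite_subset) (intro finite_imageI finite_PiE; simp)
qed

lemma finite_GLn: "finite (GLn n :: 'a::{field,finite} mat set)"
  by (rule finite_subset[OF _ finite_carrier_mat[of n n]]) (auto simp: GLn_def)

text \<open>The identity plus a vector \<open>c\<close> placed in column \<open>r\<close>: left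
  multiplication adds \<open>c i\<close> times row \<open>r\<close> to row \<open>i\<close>.
  Likewise \<open>col_tv\<close> has \<open>c\<close> in row \<open>r\<close> and acts on columns
  from the right. They carry all elimination steps and all root subgroup elements below.\<close>

definition row_tv :: "nat \<Rightarrow> nat \<Rightarrow> (nat \<Rightarrow> 'a::field) \<Rightarrow> 'a mat" where
  "row_tv n r c = mat n n (\<lambda>(i,j). (if i = j then 1 else 0) + (if j = r then c i else 0))"

definition col_tv :: "nat \<Rightarrow> nat \<Rightarrow> (nat \<Rightarrow> 'a::field) \<Rightarrow> 'a mat" where
  "col_tv n r c = mat n n (\<lambda>(i,j). (if i = j then 1 else 0) + (if i = r then c j else 0))"

lemma row_tv_carrier [simp]: "row_tv n r c \<in> carrier_mat n n"
  by (simp add: row_tv_def)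

lemma col_tv_carrier [simp]: "col_tv n r c \<in> carrier_mat n n"
  by (simp add: col_tv_def)

lemma row_tv_entry: "i < n \<Longrightarrow> j < n \<Longrightarrow>
    row_tv n r c $$ (i,j) = (if i = j then 1 else 0) + (if j = r then c i else 0)"
  by (simp add: row_tv_def)

lemma col_tv_entry: "i < n \<Longrightarrow> j < n \<Longrightarrow>
    col_tv n r c $$ (i,j) = (if i = j then 1 else 0) + (if i = r then c j else 0)"
  by (simp add: col_tv_def)

lemma row_tv_mult:
  fixes A :: "'a::field mat"
  assumes "A \<in> carrier_mat n n" "i < n" "j < n" "r < n"
  shows "(row_tv n r c * A) $$ (i,j) = A $$ (i,j) + c i * A $$ (r,j)"
proof -
  have "(row_tv n r c * A) $$ (i,j) = (\<Sum>k<n. row_tv n r c $$ (i,k) * A $$ (k,j))"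
    using assms by (intro mat_mult_entry) auto
  also have "\<dots> = (\<Sum>k<n. (if i = k then A $$ (k,j) else 0) + (if k = r then c i * A $$ (k,j) else 0))"
    using assms by (intro sum.cong) (auto simp: row_tv_def algebra_simps)
  finally show ?thesis using assms by (simp add: sum.distrib)
qed

lemma col_tv_mult:
  fixes A :: "'a::field mat"
  assumes "A \<in> carrier_mat n n" "i < n" "j < n" "r < n"
  shows "(A * col_tv n r c) $$ (i,j) = A $$ (i,j) + A $$ (i,r) * c j"
proof -
  have "(A * col_tv n r c) $$ (i,j) = (\<Sum>k<n. A $$ (i,k) * col_tv n r c $$ (k,j))"
    using assms by (intro mat_mult_entry) auto
  also have "\<dots> = (\<Sum>k<n. (if k = j then A $$ (i,k) else 0) + (if k = r then A $$ (i,k) * c j else 0))"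
    using assms by (intro sum.cong) (auto simp: col_tv_def algebra_simps)
  finally show ?thesis using assms by (simp add: sum.distrib)
qed

lemma row_tv_inverse:
  assumes "r < n" "c r = 0"
  shows "row_tv n r c * row_tv n r (\<lambda>i. - c i) = 1\<^sub>m n"
proof (rule eq_matI)
  fix i j assume "i < dim_row (1\<^sub>m n :: 'a mat)" "j < dim_col (1\<^sub>m n :: 'a mat)"
  then show "(row_tv n r c * row_tv n r (\<lambda>i. - c i)) $$ (i,j) = 1\<^sub>m n $$ (i,j)"
    using assms by (auto simp: row_tv_mult row_tv_entry)
qed (auto simp: row_tv_def)

lemma col_tv_inverse:
  assumes "r < n" "c r = 0"
  shows "col_tv n r c * col_tv n r (\<lambda>i. - c i) = 1\<^sub>m n"
proof (rule eq_matI)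
  fix i j assume "i < dim_row (1\<^sub>m n :: 'a mat)" "j < dim_col (1\<^sub>m n :: 'a mat)"
  then show "(col_tv n r c * col_tv n r (\<lambda>i. - c i)) $$ (i,j) = 1\<^sub>m n $$ (i,j)"
    using assms by (auto simp: col_tv_mult col_tv_entry)
qed (auto simp: col_tv_def)

lemma col_tv_GLn: "r < n \<Longrightarrow> c r = 0 \<Longrightarrow> col_tv n r c \<in> GLn n"
  by (rule GLn_I_right[OF _ _ col_tv_inverse]) auto

lemma GLn_nonzero_col:
  assumes "A \<in> GLn n" "j < n"
  shows "\<exists>i<n. A $$ (i,j) \<noteq> 0"
proof (rule ccontr)
  assume "\<not> ?thesis"
  then have z: "\<And>i. i < n \<Longrightarrow> A $$ (i,j) = 0" by blast
  have "(ginv A * A) $$ (j,j) = (\<Sum>k<n. ginv A $$ (j,k) * A $$ (k,j))"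
    using assms ginv by (intro mat_mult_entry GLn_carrier)
  also have "\<dots> = 0" using z by simp
  finally show False using ginv(2)[OF assms(1)] assms(2) by simp
qed

lemma Uk_carrier: "u \<in> Uk n \<Longrightarrow> u \<in> carrier_mat n n"
  by (simp add: Uk_def)

lemma Uk_entry: "u \<in> Uk n \<Longrightarrow> i < n \<Longrightarrow> u $$ (i,i) = 1"
  "u \<in> Uk n \<Longrightarrow> i < n \<Longrightarrow> j < i \<Longrightarrow> u $$ (i,j) = 0"
  by (auto simp: Uk_def)

lemma Uk_GLn: assumes "u \<in> Uk n" shows "u \<in> GLn n"
proof -
  have "det u = prod_list (diag_mat u)"
    using assms by (intro det_upper_triangular[of _ n]) (auto simp: Uk_def upper_triangular_def)
  also have "diag_mat u = map (\<lambda>i. 1) [0..<n]"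
    using assms by (auto simp: diag_mat_def Uk_def)
  finally have "det u = 1" by (simp add: map_replicate_const)
  then show ?thesis using assms by (simp add: GLn_def Uk_def)
qed

lemma Uk_one: "1\<^sub>m n \<in> Uk n"
  by (auto simp: Uk_def)

lemma Uk_mult_entry:
  assumes "u \<in> Uk n" "u' \<in> Uk n" "i < n" "j < n"
  shows "(u * u') $$ (i,j) = (\<Sum>k\<in>{i..j}. u $$ (i,k) * u' $$ (k,j))"
proof -
  have "(u * u') $$ (i,j) = (\<Sum>k<n. u $$ (i,k) * u' $$ (k,j))"
    using assms by (intro mat_mult_entry Uk_carrier)
  also have "\<dots> = (\<Sum>k\<in>{i..j}. u $$ (i,k) * u' $$ (k,j))"
    using assms by (intro sum.mono_neutral_right) (auto simp: Uk_def)
  finally show ?thesis .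
qed

lemma Uk_mult: assumes "u \<in> Uk n" "u' \<in> Uk n" shows "u * u' \<in> Uk n"
proof -
  have "u * u' \<in> carrier_mat n n" using assms by (intro mult_carrier_mat[of _ n n] Uk_carrier)
  moreover have "(u * u') $$ (i,i) = 1" if "i < n" for i
    using that assms by (simp add: Uk_mult_entry Uk_entry)
  moreover have "(u * u') $$ (i,j) = 0" if "i < n" "j < i" for i j
    using that assms by (simp add: Uk_mult_entry Uk_entry)
  ultimately show ?thesis by (auto simp: Uk_def)
qed

lemma finite_Uk: "finite (Uk n :: 'a::{field,finite} mat set)"
  by (rule finite_subset[OF _ finite_carrier_mat[of n n]]) (auto simp: Uk_def)

text \<open>Left multiplication by \<open>u\<close> is an injective self-map of a finite set, hence
  surjective, so the inverse of \<open>u\<close> is found inside \<open>Uk n\<close>.\<close>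

lemma Uk_ginv:
  fixes u :: "'a::{field,finite} mat"
  assumes "u \<in> Uk n" shows "ginv u \<in> Uk n"
proof -
  have "inj_on ((*) u) (Uk n)"
    by (rule inj_onI) (metis Uk_GLn assms ginv_cancel(2))
  moreover have "(*) u ` Uk n \<subseteq> Uk n" using assms Uk_mult by blast
  ultimately have "(*) u ` Uk n = Uk n" using finite_Uk by (metis endo_inj_surj)
  then obtain u' where u': "u' \<in> Uk n" "u * u' = 1\<^sub>m n" using Uk_one by (metis imageE)
  have "ginv u = ginv u * (u * u')" using u' assms by (simp add: GLn_one_mult ginv Uk_GLn)
  moreover have "ginv u * (u * u') = u'"
    using u' assms by (intro ginv_cancel) (auto intro: Uk_GLn)
  ultimately show ?thesis using u' by simp
qed

text \<open>The free entries are those above the diagonal. Only the shape of the number matters: a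
  power of q stays invertible in R.\<close>

lemma card_Uk: "\<exists>N. card (Uk n :: 'a::{field,finite} mat set) = card (UNIV :: 'a set) ^ N"
proof -
  let ?I = "{(i,j). i < j \<and> j < n}"
  let ?g = "\<lambda>f::nat \<times> nat \<Rightarrow> 'a. mat n n (\<lambda>(i,j). if i = j then 1 else if i < j then f (i,j) else 0)"
  have fin: "finite ?I" by (rule finite_subset[of _ "{..<n} \<times> {..<n}"]) auto
  have "bij_betw ?g (?I \<rightarrow>\<^sub>E UNIV) (Uk n)"
  proof (rule bij_betw_byWitness[where f' = "\<lambda>u. restrict (\<lambda>p. u $$ p) ?I"])
    show "\<forall>f\<in>?I \<rightarrow>\<^sub>E UNIV. restrict (\<lambda>p. ?g f $$ p) ?I = f"
      by (auto simp: fun_eq_iff restrict_def PiE_def extensional_def)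
    show "\<forall>u\<in>Uk n. ?g (restrict (\<lambda>p. u $$ p) ?I) = u"
      by (auto simp: Uk_def intro!: eq_matI)
  qed (auto simp: Uk_def PiE_def extensional_def)
  then have "card (Uk n :: 'a mat set) = card (?I \<rightarrow>\<^sub>E (UNIV :: 'a set))"
    by (simp add: bij_betw_same_card)
  also have "\<dots> = card (UNIV :: 'a set) ^ card ?I" using fin by (simp add: card_PiE)
  finally show ?thesis by blast
qed

definition monomial_mat :: "nat \<Rightarrow> (nat \<Rightarrow> nat) \<Rightarrow> 'a::field mat \<Rightarrow> bool" where
  "monomial_mat n p m \<longleftrightarrow> m \<in> carrier_mat n n \<and> inj_on p {..<n} \<and> p ` {..<n} \<subseteq> {..<n} \<and>
     (\<forall>i<n. \<forall>j<n. m $$ (i,j) \<noteq> 0 \<longleftrightarrow> i = p j)"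

text \<open>Gaussian elimination, one column at a time. The pivot is the lowest non-zero entry of
  the column, so clearing the column takes only row operations from U, and clearing the rest of the
  pivot row takes only column operations from U.\<close>

theorem bruhat_decomposition:
  fixes g :: "'a::{field,finite} mat"
  assumes g: "g \<in> GLn n"
  obtains u u' m p where "u \<in> Uk n" "u' \<in> Uk n" "m \<in> GLn n" "monomial_mat n p m" "g = u * m * u'"
proof -
  have "\<exists>u u' m p. u \<in> Uk n \<and> u' \<in> Uk n \<and> m \<in> GLn n \<and> g = u * m * u' \<and>
     (\<forall>j<c. p j < n \<and> (\<forall>i<n. m $$ (i,j) \<noteq> 0 \<longleftrightarrow> i = p j) \<and> (\<forall>j'<n. m $$ (p j,j') \<noteq> 0 \<longleftrightarrow> j' = j))"
    if "c \<le> n" for c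
    using that
  proof (induction c)
    case 0
    show ?case
      by (rule exI[of _ "1\<^sub>m n"], rule exI[of _ "1\<^sub>m n"], rule exI[of _ g])
        (use g in \<open>simp add: Uk_one GLn_one_mult\<close>)
  next
    case (Suc c)
    then have cn: "c < n" by simp
    from Suc.IH[OF less_imp_le[OF cn]] obtain u u' m p where *: "u \<in> Uk n" "u' \<in> Uk n" "m \<in> GLn n" "g = u * m * u'"
     "\<And>j. j < c \<Longrightarrow> p j < n" "\<And>i j. j < c \<Longrightarrow> i < n \<Longrightarrow> m $$ (i,j) \<noteq> 0 \<longleftrightarrow> i = p j"
     "\<And>j j'. j < c \<Longrightarrow> j' < n \<Longrightarrow> m $$ (p j,j') \<noteq> 0 \<longleftrightarrow> j' = j" by blast
    define r where "r = Max {i. i < n \<and> m $$ (i,c) \<noteq> 0}"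
    have ne: "{i. i < n \<and> m $$ (i,c) \<noteq> 0} \<noteq> {}" using GLn_nonzero_col[OF *(3) cn] by blast
    have r: "r < n" "m $$ (r,c) \<noteq> 0"
      using Max_in[of "{i. i < n \<and> m $$ (i,c) \<noteq> 0}"] ne by (auto simp: r_def)
    have rmax: "m $$ (i,c) = 0" if "r < i" "i < n" for i
    proof (rule ccontr)
    assume "m $$ (i,c) \<noteq> 0"
    then have "i \<le> r" unfolding r_def using that by (intro Max_ge) auto
    then show False using that by simp
  qed
    have rp: "r \<noteq> p j" if "j < c" for j using *(7)[OF that cn] r that by auto
    have pc: "m $$ (p j, c) = 0" if "j < c" for j using *(7)[OF that cn] that by auto
    \<comment> \<open>The pivot row differs from the earlier ones, so it vanishes in the columns
      already treated and the row operations leave those columns unchanged.\<close>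
    have mr: "m $$ (r, j) = 0" if "j < c" for j using *(6)[OF that r(1)] rp[OF that] by auto
    define a where "a = (\<lambda>i. if i < r then - m $$ (i,c) / m $$ (r,c) else 0)"
    define b where "b = (\<lambda>j. if c < j then - m $$ (r,j) / m $$ (r,c) else 0)"
    let ?A = "row_tv n r a" and ?B = "col_tv n c b"
    have AU: "?A \<in> Uk n" "?B \<in> Uk n"
      using r cn by (auto simp: Uk_def row_tv_entry col_tv_entry a_def b_def)
    define m1 where "m1 = ?A * m"
    define m2 where "m2 = m1 * ?B"
    have m1: "m1 \<in> GLn n" unfolding m1_def using AU *(3) by (simp add: GLn_mult Uk_GLn)
    have m2: "m2 \<in> GLn n" unfolding m2_def using AU m1 by (simp add: GLn_mult Uk_GLn)
    have e1: "m1 $$ (i,j) = m $$ (i,j) + a i * m $$ (r,j)" if "i < n" "j < n" for i j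
      unfolding m1_def using that r *(3) by (simp add: row_tv_mult GLn_carrier)
    have e2: "m2 $$ (i,j) = m1 $$ (i,j) + m1 $$ (i,c) * b j" if "i < n" "j < n" for i j
      unfolding m2_def using that cn m1 by (simp add: col_tv_mult GLn_carrier)
    have m1c: "m1 $$ (i,c) = (if i = r then m $$ (r,c) else 0)" if "i < n" for i
      using that r cn rmax[of i] by (auto simp: e1 a_def not_less)
    have m2_lt: "m2 $$ (i,j) = m $$ (i,j)" if "i < n" "j < c" for i j
      using that cn mr by (simp add: e1 e2 b_def)
    have m2_c: "m2 $$ (i,c) = (if i = r then m $$ (r,c) else 0)" if "i < n" for i
      using that cn m1c by (simp add: e2 b_def)
    have m2_r: "m2 $$ (r,j) = (if j = c then m $$ (r,c) else 0)" if "j < n" for j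
      using that r cn mr[of j] m1c[of r] by (auto simp: e2 e1 a_def b_def not_less)
    have m2_p: "m2 $$ (p j,j') = m $$ (p j,j')" if "j < c" "j' < n" for j j'
    proof -
      have "a (p j) = 0" using pc[OF that(1)] by (simp add: a_def)
      then show ?thesis using that *(5)[OF that(1)] rp[OF that(1)] m1c[of "p j"]
        by (auto simp: e2 e1)
    qed
    have eq: "g = (u * ginv ?A) * m2 * (ginv ?B * u')"
      using *(1-4) AU unfolding m2_def m1_def
      by (simp add: GLn_assoc[where n = n] GLn_mult Uk_GLn ginv[where n = n] ginv_cancel[where n = n])
    show ?case
    proof (intro exI conjI allI impI)
      show "u * ginv ?A \<in> Uk n" "ginv ?B * u' \<in> Uk n" "m2 \<in> GLn n" "g = (u * ginv ?A) * m2 * (ginv ?B * u')"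
        using * AU m2 eq by (auto intro: Uk_mult Uk_ginv)
      fix j assume j: "j < Suc c"
      show "(p(c := r)) j < n" using j * r by auto
      show "(m2 $$ (i,j) \<noteq> 0) = (i = (p(c := r)) j)" if "i < n" for i
        using j that *(6) r m2_lt m2_c by (cases "j = c") auto
      show "(m2 $$ ((p(c := r)) j, j') \<noteq> 0) = (j' = j)" if "j' < n" for j'
        using j that *(7) r m2_p m2_r by (cases "j = c") auto
    qed
  qed
  from this[of n] obtain u u' m p where *: "u \<in> Uk n" "u' \<in> Uk n" "m \<in> GLn n" "g = u * m * u'"
    "\<And>j. j < n \<Longrightarrow> p j < n" "\<And>i j. j < n \<Longrightarrow> i < n \<Longrightarrow> m $$ (i,j) \<noteq> 0 \<longleftrightarrow> i = p j"
    "\<And>j j'. j < n \<Longrightarrow> j' < n \<Longrightarrow> m $$ (p j,j') \<noteq> 0 \<longleftrightarrow> j' = j" by blast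
  have "inj_on p {..<n}" by (rule inj_onI) (metis *(7) lessThan_iff)
  then have "monomial_mat n p m" using * by (auto simp: monomial_mat_def GLn_carrier)
  then show ?thesis using that * by blast
qed

section \<open>Uniqueness of Whittaker models\<close>

text \<open>If the characteristic l of R divided q, Sylow's theorem would give a subgroup of order l
  in the additive group of k. Translation by one of its elements x permutes it, and comparing the
  sums gives l x = 0, so k would have characteristic l as well.\<close>

lemma of_nat_card_neq_0:
  assumes "CHAR('r::field) \<noteq> CHAR('k::{field,finite})"
  shows "of_nat (card (UNIV :: 'k set)) \<noteq> (0 :: 'r)"
proof
  assume "of_nat (card (UNIV :: 'k set)) = (0 :: 'r)"
  then have d: "CHAR('r) dvd card (UNIV :: 'k set)" by (simp add: of_nat_eq_0_iff_char_dvd)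
  have "card (UNIV :: 'k set) > 0" by (simp add: card_gt_0_iff)
  then have "CHAR('r) \<noteq> 0" using d by auto
  then have pr: "Factorial_Ring.prime CHAR('r)" by (simp add: prime_CHAR_semidom)
  let ?G = "\<lparr>carrier = (UNIV :: 'k set), monoid.mult = (+), one = 0\<rparr>"
  have G: "group ?G"
    by (rule groupI) (auto simp: algebra_simps intro: exI[of _ "- x" for x])
  obtain c where "card (UNIV :: 'k set) = CHAR('r) * c" using d by (auto simp: dvd_def)
  then have "Coset.order ?G = CHAR('r) ^ 1 * c" by (simp add: Coset.order_def)
  then obtain H where H: "subgroup H ?G" "card H = CHAR('r) ^ 1"
    using sylow_thm[OF pr G, of 1 c] by auto
  have "card H > 1" using H pr prime_gt_1_nat by simp
  then have "\<not> H \<subseteq> {0}" using card_mono[of "{0}" H] by auto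
  then obtain x where x: "x \<in> H" "x \<noteq> 0" by blast
  have "finite H" by simp
  moreover have "(+) x ` H \<subseteq> H" using x subgroup.m_closed[OF H(1)] by auto
  ultimately have "(+) x ` H = H" by (rule endo_inj_surj) simp
  then have "bij_betw ((+) x) H H" by (simp add: bij_betw_def)
  then have "(\<Sum>y\<in>H. x + y) = (\<Sum>y\<in>H. y)" by (rule sum.reindex_bij_betw)
  then have "of_nat CHAR('r) * x = 0" using H by (simp add: sum.distrib)
  then have "of_nat CHAR('r) = (0::'k)" using x by simp
  then have "CHAR('k) dvd CHAR('r)" by (simp add: of_nat_eq_0_iff_char_dvd)
  then have "CHAR('k) = 1 \<or> CHAR('k) = CHAR('r)" using pr unfolding prime_nat_iff by blast
  then show False using assms by auto
qed

section \<open>The anti-involution and the monomial matrices it fixes\<close>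

definition flip :: "nat \<Rightarrow> 'a mat \<Rightarrow> 'a mat" where
  "flip n A = mat n n (\<lambda>(i,j). A $$ (n - 1 - j, n - 1 - i))"

lemma flip_carrier [simp]: "flip n A \<in> carrier_mat n n"
  by (simp add: flip_def)

lemma flip_entry: "i < n \<Longrightarrow> j < n \<Longrightarrow> flip n A $$ (i,j) = A $$ (n - 1 - j, n - 1 - i)"
  by (simp add: flip_def)

lemma flip_flip: "A \<in> carrier_mat n n \<Longrightarrow> flip n (flip n A) = A"
  by (rule eq_matI) (auto simp: flip_def)

lemma flip_mult:
  fixes A :: "'a::field mat"
  assumes "A \<in> carrier_mat n n" "B \<in> carrier_mat n n"
  shows "flip n (A * B) = flip n B * flip n A"
proof (rule eq_matI)
  fix i j assume "i < dim_row (flip n B * flip n A)" "j < dim_col (flip n B * flip n A)"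
  then have ij: "i < n" "j < n" by (auto simp: flip_def)
  have "flip n (A * B) $$ (i,j) = (\<Sum>k<n. A $$ (n-1-j,k) * B $$ (k,n-1-i))"
    using ij assms by (simp only: flip_entry) (rule mat_mult_entry; simp)
  also have "\<dots> = (\<Sum>k<n. flip n B $$ (i,k) * flip n A $$ (k,j))"
    using ij by (intro sum.reindex_bij_witness[of _ "\<lambda>k. n-1-k" "\<lambda>k. n-1-k"])
      (auto simp: flip_entry mult.commute)
  also have "\<dots> = (flip n B * flip n A) $$ (i,j)"
    using ij by (intro mat_mult_entry[symmetric]) auto
  finally show "flip n (A * B) $$ (i,j) = (flip n B * flip n A) $$ (i,j)" .
qed (auto simp: flip_def)

lemma flip_one: "flip n (1\<^sub>m n) = (1\<^sub>m n :: 'a::field mat)"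
  by (rule eq_matI) (auto simp: flip_def)

lemma flip_GLn: assumes "A \<in> GLn n" shows "flip n A \<in> GLn n"
proof (rule GLn_I_left)
  show "flip n (ginv A) * flip n A = 1\<^sub>m n"
    using flip_mult[of A n "ginv A"] assms ginv[OF assms] by (simp add: GLn_carrier flip_one)
qed auto

lemma flip_Uk: "u \<in> Uk n \<Longrightarrow> flip n u \<in> Uk n"
  unfolding Uk_def by (auto simp: flip_entry) (metis diff_Suc_less gr_implies_not0 not_gr_zero)

lemma psiU_flip: "psiU psi n (flip n u) = psiU psi n u"
proof -
  have "(\<Sum>i<n-1. flip n u $$ (i,i+1)) = (\<Sum>i<n-1. u $$ (i,i+1))"
    by (rule sum.reindex_bij_witness[of _ "\<lambda>i. n-2-i" "\<lambda>i. n-2-i"])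
      (auto simp: flip_entry Suc_diff_Suc numeral_2_eq_2)
  then show ?thesis by (simp add: psiU_def)
qed

text \<open>A permutation all of whose steps are descents or steps by exactly one consists of
  increasing runs whose images are arranged in decreasing order. As a matrix it is an antidiagonal
  arrangement of scalar blocks, with \<open>d\<close> the scalar of each block, and such a matrix is
  symmetric about the antidiagonal. The conclusion states this symmetry for indices and for
  values.\<close>

lemma antidiagonal_blocks:
  fixes p :: "nat \<Rightarrow> nat" and d :: "nat \<Rightarrow> 'a"
  assumes inj: "inj_on p {..<n}" and im: "p ` {..<n} \<subseteq> {..<n}"
    and step: "\<And>i. Suc i < n \<Longrightarrow> p (Suc i) < p i \<or> (p (Suc i) = Suc (p i) \<and> d (Suc i) = d i)"
    and i: "i < n"
  shows "p (n - 1 - p i) = n - 1 - i \<and> d (n - 1 - p i) = d i"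
proof -
  \<comment> \<open>The offset \<open>e\<close> never increases and is constant exactly along the
    runs.\<close>
  define e where "e j = int (p j) - int j" for j
  have e_step: "e (Suc t) \<le> e t" if "Suc t < n" for t
    using step[OF that] by (auto simp: e_def)
  have anti: "e t \<le> e s" if "s \<le> t" "t < n" for s t
    using that
  proof (induction t rule: dec_induct)
    case (step t)
    then show ?case using e_step[of t] by simp
  qed simp
  have d_eq: "d t = d s" if "s \<le> t" "t < n" "e s = e t" for s t
    using that
  proof (induction t rule: dec_induct)
    case (step t)
    have "e (Suc t) \<le> e t" "e t \<le> e s" using step.hyps step.prems e_step[of t] anti[of s t] by auto
    then have "e t = e s" "e (Suc t) = e t" using step.prems by auto
    then have "d t = d s" "p (Suc t) = Suc (p t)" using step by (auto simp: e_def)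
    then show ?case using assms(3)[of t] step.prems by auto
  qed simp
  \<comment> \<open>An earlier index either has a larger image or lies in the same run. If the image
    fell below that of an earlier member of the run, injectivity would be violated at the point
    \<open>r\<close> of the run with the same image.\<close>
  have key: "p s > p t \<or> e s = e t" if "s \<le> t" "t < n" for s t
    using that
  proof (induction t rule: dec_induct)
    case (step t)
    then have IH: "p s > p t \<or> e s = e t" by simp
    from assms(3)[OF step.prems] show ?case
    proof (elim disjE conjE)
      assume less: "p (Suc t) < p t"
      show ?thesis
      proof (rule disjE[OF IH])
        assume "p s > p t" then show ?thesis using less by simp
      next
        assume es: "e s = e t"
        have "\<not> p s \<le> p (Suc t)"
        proof
          assume le: "p s \<le> p (Suc t)"
          define r where "r = s + (p (Suc t) - p s)"
          have r: "s \<le> r" "r \<le> t" using le less es step.hyps by (auto simp: r_def e_def)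
          then have "e r = e s" using anti[of s r] anti[of r t] es step.prems by force
          then have "p r = p (Suc t)" using le by (auto simp: e_def r_def)
          then have "r = Suc t" using inj r step.prems by (auto dest: inj_onD)
          then show False using r by simp
        qed
        then show ?thesis by simp
      qed
    next
      assume s: "p (Suc t) = Suc (p t)"
      show ?thesis
      proof (rule disjE[OF IH])
        assume "p s > p t"
        moreover have "p s \<noteq> p (Suc t)" using inj step by (auto dest: inj_onD)
        ultimately show ?thesis using s by auto
      next
        assume "e s = e t" then show ?thesis using s by (simp add: e_def)
      qed
    qed
  qed simp
  define S where "S = {j. j < n \<and> e j = e i}"
  have S: "finite S" "i \<in> S" using i by (auto simp: S_def)
  define a b where "a = Min S" and "b = Max S"
  have ab: "a \<in> S" "b \<in> S" "a \<le> i" "i \<le> b"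
    unfolding a_def b_def using S by (auto intro!: Min_in Max_in)
  have bn: "b < n" "e a = e i" "e b = e i" using ab by (auto simp: S_def)
  have eqS: "e j = e i \<longleftrightarrow> a \<le> j \<and> j \<le> b" if "j < n" for j
  proof
    assume "e j = e i"
    then have "j \<in> S" using that by (simp add: S_def)
    then show "a \<le> j \<and> j \<le> b" using S by (auto simp: a_def b_def)
  next
    assume "a \<le> j \<and> j \<le> b"
    then show "e j = e i" using anti[of a j] anti[of j b] bn by force
  qed
  \<comment> \<open>The indices with larger image are those of all earlier runs, together with the
    part of the own run \<open>{a..b}\<close> after \<open>i\<close>. Counting them determines
    \<open>p i\<close>.\<close>
  have "{j. j < n \<and> p j > p i} = {..<a} \<union> {i<..b}"
  proof (rule Set.set_eqI)
    fix j
    show "j \<in> {j. j < n \<and> p j > p i} \<longleftrightarrow> j \<in> {..<a} \<union> {i<..b}"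
    proof (cases "j < n")
      case True
      show ?thesis
      proof (cases "j \<le> i")
        case j: True
        have "p j > p i \<longleftrightarrow> \<not> e j = e i" using key[OF j i] j by (auto simp: e_def)
        then show ?thesis using eqS[OF True] j True ab by auto
      next
        case j: False
        have "p j > p i \<longleftrightarrow> e j = e i" using key[of i j] j True by (auto simp: e_def)
        then show ?thesis using eqS[OF True] j True ab by auto
      qed
    next
      case False
      then show ?thesis using bn ab by auto
    qed
  qed
  then have "card {j. j < n \<and> p j > p i} = a + (b - i)"
    using ab by (simp add: card_Un_disjoint disjoint_iff)
  moreover have "card {j. j < n \<and> p j > p i} = n - 1 - p i"
  proof -
    have img: "p ` {..<n} = {..<n}" using inj im by (metis endo_inj_surj finite_lessThan)
    have "p ` {j. j < n \<and> p j > p i} = {p i<..<n}"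
    proof (intro equalityI subsetI)
      fix y assume "y \<in> p ` {j. j < n \<and> p j > p i}"
      then show "y \<in> {p i<..<n}" using im by auto
    next
      fix y assume y: "y \<in> {p i<..<n}"
      then obtain j where "j < n" "p j = y" using img by (metis greaterThanLessThan_iff imageE lessThan_iff)
      then show "y \<in> p ` {j. j < n \<and> p j > p i}" using y by auto
    qed
    moreover have "inj_on p {j. j < n \<and> p j > p i}" by (rule inj_on_subset[OF inj]) auto
    ultimately have "card {j. j < n \<and> p j > p i} = card {p i<..<n}" by (metis card_image)
    then show ?thesis by simp
  qed
  \<comment> \<open>So the mirror image of \<open>p i\<close> is the reflection of \<open>i\<close>
    inside its own run, where \<open>e\<close> and \<open>d\<close> keep their values.\<close>
  ultimately have eq: "n - 1 - p i = a + b - i" using ab by simp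
  then have m: "a \<le> n - 1 - p i" "n - 1 - p i \<le> b" using ab by auto
  then have e': "e (n - 1 - p i) = e i" using eqS[of "n - 1 - p i"] bn by auto
  have "p i < n" using im i by auto
  then have "int (p (n - 1 - p i)) = int n - 1 - int i" using e' by (simp add: e_def)
  then have "p (n - 1 - p i) = n - 1 - i" using i by linarith
  moreover have "d (n - 1 - p i) = d i"
    using d_eq[of i "n - 1 - p i"] d_eq[of "n - 1 - p i" i] e' m bn i
    by (cases "i \<le> n - 1 - p i") auto
  ultimately show ?thesis by simp
qed

lemma flip_monomial:
  fixes m :: "'a::field mat"
  assumes mono: "monomial_mat n p m"
    and step: "\<And>i. Suc i < n \<Longrightarrow> p (Suc i) < p i \<or>
       (p (Suc i) = Suc (p i) \<and> m $$ (p (Suc i), Suc i) = m $$ (p i, i))"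
  shows "flip n m = m"
proof (rule eq_matI)
  have m: "m \<in> carrier_mat n n" "inj_on p {..<n}" "p ` {..<n} \<subseteq> {..<n}"
    and nz: "\<And>i j. i < n \<Longrightarrow> j < n \<Longrightarrow> m $$ (i,j) \<noteq> 0 \<longleftrightarrow> i = p j"
    using mono by (auto simp: monomial_mat_def)
  have ab: "p (n - 1 - p i) = n - 1 - i" "m $$ (p (n - 1 - p i), n - 1 - p i) = m $$ (p i, i)" if "i < n" for i
    using antidiagonal_blocks[OF m(2,3) step that] by auto
  fix r c assume "r < dim_row m" "c < dim_col m"
  then have rc: "r < n" "c < n" using m by auto
  show "flip n m $$ (r,c) = m $$ (r,c)"
  proof (cases "r = p c")
    case True
    then show ?thesis using ab[OF rc(2)] rc by (simp add: flip_entry)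
  next
    case False
    have "\<not> n - 1 - c = p (n - 1 - r)"
    proof
      assume "n - 1 - c = p (n - 1 - r)"
      then have "n - 1 - p (n - 1 - r) = c" "n - 1 - (n - 1 - r) = r" using rc by auto
      then show False using ab(1)[of "n - 1 - r"] rc False by auto
    qed
    then show ?thesis using nz[of r c] nz[of "n-1-c" "n-1-r"] False rc by (auto simp: flip_entry)
  qed
qed (use mono in \<open>auto simp: flip_def monomial_mat_def\<close>)

lemma rt_apply: "y \<in> GLn n \<Longrightarrow> rt n h W y = W (y * h)"
  by (simp add: rt_def)

lemma rt_outside: "y \<notin> GLn n \<Longrightarrow> rt n h W y = 0"
  by (simp add: rt_def)

lemma rt_rt:
  assumes "g \<in> GLn n" "h \<in> GLn n"
  shows "rt n g (rt n h x) = rt n (g * h) x"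
  using assms by (auto simp: rt_def fun_eq_iff GLn_mult GLn_assoc)

lemma rt_one: "(\<And>y. y \<notin> GLn n \<Longrightarrow> x y = 0) \<Longrightarrow> rt n (1\<^sub>m n) x = x"
  by (auto simp: rt_def fun_eq_iff GLn_one_mult)

locale nontriv_character =
  fixes psi :: "'k::{field,finite} \<Rightarrow> 'r::field"
  assumes psi: "nontriv_add_char psi"
begin

lemma psi_add: "psi (x + y) = psi x * psi y" and psi_0: "psi 0 = 1"
  using psi by (auto simp: nontriv_add_char_def)

lemma psi_minus: "psi x * psi (- x) = 1" "psi (- x) * psi x = 1"
  using psi_add[of x "- x"] psi_0 by (auto simp: mult.commute)

lemma psi_nonzero: "psi x \<noteq> 0"
  using psi_minus(1)[of x] by auto

lemma psi_nontriv: "\<exists>x. psi x \<noteq> 1"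
  using psi by (simp add: nontriv_add_char_def)

lemma psiU_mult:
  assumes "u \<in> Uk n" "u' \<in> Uk n"
  shows "psiU psi n (u * u') = psiU psi n u * psiU psi n u'"
proof -
  have "(u * u') $$ (i,i+1) = u $$ (i,i+1) + u' $$ (i,i+1)" if "i < n - 1" for i
  proof -
    have "(u * u') $$ (i,i+1) = (\<Sum>k\<in>{i..i+1}. u $$ (i,k) * u' $$ (k,i+1))"
      using that assms by (intro Uk_mult_entry[where n = n]) auto
    also have "\<dots> = u $$ (i,i) * u' $$ (i,i+1) + u $$ (i,i+1) * u' $$ (i+1,i+1)" by simp
    finally show ?thesis using that assms by (simp add: Uk_entry add.commute)
  qed
  then have "(\<Sum>i<n-1. (u * u') $$ (i,i+1)) = (\<Sum>i<n-1. u $$ (i,i+1)) + (\<Sum>i<n-1. u' $$ (i,i+1))"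
    by (simp add: sum.distrib)
  then show ?thesis by (simp add: psiU_def psi_add)
qed

lemma psiU_one: "psiU psi n (1\<^sub>m n) = 1"
  by (simp add: psiU_def psi_0)

lemma psiU_ginv:
  assumes "u \<in> Uk n"
  shows "psiU psi n (ginv u) * psiU psi n u = 1" "psiU psi n u * psiU psi n (ginv u) = 1"
  using psiU_mult[OF assms Uk_ginv[OF assms]] ginv(1)[OF Uk_GLn[OF assms]] psiU_one[of n]
  by (auto simp: mult.commute)

lemma psiU_nonzero: "psiU psi n u \<noteq> 0"
  by (simp add: psiU_def psi_nonzero)

lemma psiU_single:
  assumes "\<And>i. i < n - 1 \<Longrightarrow> u $$ (i,i+1) = (if i = s then c else 0)" "s < n - 1"
  shows "psiU psi n u = psi c"
  unfolding psiU_def using assms by simp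

lemma psiU_trivial:
  assumes "\<And>i. i < n - 1 \<Longrightarrow> u $$ (i,i+1) = 0"
  shows "psiU psi n u = 1"
  unfolding psiU_def using assms by (simp add: psi_0)

text \<open>In the second case no bi-equivariant function lives on the double coset of \<open>m\<close>.\<close>

lemma monomial_intertwine_or_flip:
  fixes m :: "'k mat"
  assumes mono: "monomial_mat n p m"
  shows "flip n m = m \<or> (\<exists>u\<in>Uk n. \<exists>u'\<in>Uk n. m * u = u' * m \<and> psiU psi n u \<noteq> psiU psi n u')"
proof (rule disjCI)
  assume not: "\<not> (\<exists>u\<in>Uk n. \<exists>u'\<in>Uk n. m * u = u' * m \<and> psiU psi n u \<noteq> psiU psi n u')"
  have m: "m \<in> carrier_mat n n" "inj_on p {..<n}" and pn: "\<And>j. j < n \<Longrightarrow> p j < n"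
    and nz: "\<And>i j. i < n \<Longrightarrow> j < n \<Longrightarrow> m $$ (i,j) \<noteq> 0 \<longleftrightarrow> i = p j"
    using mono by (auto simp: monomial_mat_def)
  show "flip n m = m"
  proof (rule flip_monomial[OF mono])
    fix i assume i: "Suc i < n"
    show "p (Suc i) < p i \<or> (p (Suc i) = Suc (p i) \<and> m $$ (p (Suc i), Suc i) = m $$ (p i, i))"
    proof (rule ccontr)
      assume no: "\<not> ?thesis"
      define d where "d = m $$ (p i, i) / m $$ (p (Suc i), Suc i)"
      have d0: "m $$ (p (Suc i), Suc i) \<noteq> 0" "m $$ (p i, i) \<noteq> 0"
        using nz i pn by auto
      have "p i \<noteq> p (Suc i)" using m(2) i by (auto dest: inj_onD)
      then have less: "p i < p (Suc i)" using no by auto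
      \<comment> \<open>\<open>U c\<close> lies in the simple root subgroup at
        \<open>(i, Suc i)\<close>, and \<open>V c\<close> is its conjugate by \<open>m\<close>,
        located at \<open>(p i, p (Suc i))\<close>. It is again upper triangular because
        \<open>p i < p (Suc i)\<close>, so equality of the two characters is forced.\<close>
      define U where "U c = col_tv n i (\<lambda>j. if j = Suc i then c else 0)" for c :: 'k
      define V where "V c = row_tv n (p (Suc i)) (\<lambda>a. if a = p i then c * d else 0)" for c :: 'k
      have UV: "U c \<in> Uk n" "V c \<in> Uk n" for c
        using i pn[of "Suc i"] pn[of i] less
        by (auto simp: Uk_def U_def V_def col_tv_entry row_tv_entry)
      have "m * U c = V c * m" for c
      proof (rule eq_matI)
        fix a b assume "a < dim_row (V c * m)" "b < dim_col (V c * m)"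
        then have ab: "a < n" "b < n" using m by (auto simp: V_def row_tv_def)
        have 1: "(m * U c) $$ (a,b) = m $$ (a,b) + m $$ (a,i) * (if b = Suc i then c else 0)"
          unfolding U_def using ab i m by (simp add: col_tv_mult)
        have 2: "(V c * m) $$ (a,b) = m $$ (a,b) + (if a = p i then c * d else 0) * m $$ (p (Suc i), b)"
          unfolding V_def using ab i m pn[of "Suc i"] by (simp add: row_tv_mult)
        have 3: "m $$ (a,i) = 0" if "a \<noteq> p i" using nz[of a i] ab i that by auto
        have 4: "m $$ (p (Suc i),b) = 0" if "b \<noteq> Suc i"
          using nz[of "p (Suc i)" b] ab i that pn[of "Suc i"] m(2) by (auto dest: inj_onD)
        show "(m * U c) $$ (a,b) = (V c * m) $$ (a,b)"
          unfolding 1 2 using 3 4 d0 by (auto simp: d_def)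
      qed (use m in \<open>auto simp: U_def V_def row_tv_def col_tv_def\<close>)
      then have eq: "psiU psi n (U c) = psiU psi n (V c)" for c using not UV by blast
      have PU: "psiU psi n (U c) = psi c" for c
        by (rule psiU_single[of _ _ i]) (use i in \<open>auto simp: U_def col_tv_entry\<close>)
      show False
      proof (cases "p (Suc i) = Suc (p i)")
        case True
        have "psiU psi n (V c) = psi (c * d)" for c
          by (rule psiU_single[of _ _ "p i"])
            (use i True pn[of "Suc i"] in \<open>auto simp: V_def row_tv_entry\<close>)
        then have e: "psi c = psi (c * d)" for c using eq PU by simp
        have "d \<noteq> 1" using no True d0 by (auto simp: d_def)
        obtain x where x: "psi x \<noteq> 1" using psi_nontriv by blast
        \<comment> \<open>Chosen so that \<open>c - c * d = x\<close>: the two character values then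
          differ by the factor \<open>psi x\<close>, which is not 1.\<close>
        define c where "c = x / (1 - d)"
        have "c = x + c * d" using \<open>d \<noteq> 1\<close> by (simp add: c_def field_simps)
        then have "psi c = psi x * psi (c * d)" by (metis psi_add)
        then show False using e[of c] x psi_nonzero by simp
      next
        case False
        have "psiU psi n (V c) = 1" for c
          by (rule psiU_trivial) (use False less pn[of "Suc i"] i in \<open>auto simp: V_def row_tv_entry\<close>)
        then show False using eq PU psi_nontriv by simp
      qed
    qed
  qed
qed

section \<open>Hecke operators of the pair (U, psi)\<close>

text \<open>The projection onto the vectors on which U acts through psi by right translation, left
  unnormalised: on such vectors it is multiplication by the order of U.\<close>

definition Eop :: "nat \<Rightarrow> ('k mat \<Rightarrow> 'r) \<Rightarrow> 'k mat \<Rightarrow> 'r" where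
  "Eop n x = (\<lambda>y. \<Sum>u\<in>Uk n. psiU psi n (ginv u) * rt n u x y)"

text \<open>Right translation by \<open>g\<close> compressed to the (U, psi)-vectors; up to a scalar
  this is the action of the double coset of \<open>g\<close> in the Hecke algebra.\<close>

definition Top :: "nat \<Rightarrow> 'k mat \<Rightarrow> ('k mat \<Rightarrow> 'r) \<Rightarrow> 'k mat \<Rightarrow> 'r" where
  "Top n g x = Eop n (rt n g x)"

definition equivariant :: "nat \<Rightarrow> ('k mat \<Rightarrow> 'r) \<Rightarrow> bool" where
  "equivariant n x \<longleftrightarrow> (\<forall>y. y \<notin> GLn n \<longrightarrow> x y = 0) \<and>
     (\<forall>g\<in>GLn n. \<forall>u\<in>Uk n. x (g * u) = psiU psi n u * x g)"

lemma Eop_apply: "y \<in> GLn n \<Longrightarrow> Eop n x y = (\<Sum>u\<in>Uk n. psiU psi n (ginv u) * x (y * u))"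
  by (simp add: Eop_def rt_apply)

lemma Eop_outside: "y \<notin> GLn n \<Longrightarrow> Eop n x y = 0"
  by (simp add: Eop_def rt_outside)

lemma Eop_equivariant: "equivariant n (Eop n x)"
  unfolding equivariant_def
proof (intro conjI allI impI ballI)
  fix g u :: "'k mat" assume g: "g \<in> GLn n" and u: "u \<in> Uk n"
  note uG = Uk_GLn[OF u]
  have "Eop n x (g * u) = (\<Sum>u'\<in>Uk n. psiU psi n (ginv u') * x (g * u * u'))"
    using g uG by (simp add: Eop_apply GLn_mult)
  also have "\<dots> = (\<Sum>u'\<in>Uk n. psiU psi n (ginv (ginv u * u')) * x (g * u * (ginv u * u')))"
    by (rule sum.reindex_bij_witness[of _ "\<lambda>u'. ginv u * u'" "\<lambda>u'. u * u'"])
      (use u uG in \<open>auto simp: ginv_cancel[where n = n] Uk_GLn intro: Uk_mult Uk_ginv\<close>)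
  also have "\<dots> = (\<Sum>u'\<in>Uk n. psiU psi n u * (psiU psi n (ginv u') * x (g * u')))"
  proof (rule sum.cong[OF refl])
    fix u' :: "'k mat" assume u': "u' \<in> Uk n"
    have "ginv (ginv u * u') = ginv u' * u"
    proof -
      have "ginv (ginv u) = u"
        using ginv_cancel(2)[of "ginv u" n u] uG ginv[OF uG] ginv[OF ginv(3)[OF uG]]
        by (simp add: GLn_one_mult[where n = n])
      then show ?thesis using ginv_mult[of "ginv u" n u'] uG u' by (simp add: Uk_GLn ginv)
    qed
    then have "psiU psi n (ginv (ginv u * u')) = psiU psi n (ginv u') * psiU psi n u"
      using u u' by (simp add: psiU_mult Uk_ginv)
    moreover have "g * u * (ginv u * u') = g * u'"
      using g uG u' by (simp add: GLn_assoc[where n = n] ginv_cancel[where n = n] GLn_mult ginv Uk_GLn)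
    ultimately show "psiU psi n (ginv (ginv u * u')) * x (g * u * (ginv u * u')) =
        psiU psi n u * (psiU psi n (ginv u') * x (g * u'))" by simp
  qed
  finally show "Eop n x (g * u) = psiU psi n u * Eop n x g"
    using g by (simp add: Eop_apply sum_distrib_left)
qed (simp add: Eop_outside)

lemma Eop_fix:
  assumes "equivariant n x"
  shows "Eop n x = (\<lambda>y. of_nat (card (Uk n :: 'k mat set)) * x y)"
proof
  fix y
  show "Eop n x y = of_nat (card (Uk n :: 'k mat set)) * x y"
  proof (cases "y \<in> GLn n")
    case True
    have "Eop n x y = (\<Sum>u\<in>Uk n. psiU psi n (ginv u) * (psiU psi n u * x y))"
      using assms True by (simp add: Eop_apply equivariant_def)
    also have "\<dots> = (\<Sum>u\<in>(Uk n :: 'k mat set). x y)"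
      by (intro sum.cong refl) (simp add: mult.assoc[symmetric] psiU_ginv)
    finally show ?thesis by simp
  next
    case False
    then show ?thesis using assms by (simp add: Eop_outside equivariant_def)
  qed
qed

lemma Eop_rt_Uk:
  assumes u: "u \<in> Uk n"
  shows "Eop n (rt n u x) = (\<lambda>y. psiU psi n u * Eop n x y)"
proof
  fix y
  note uG = Uk_GLn[OF u]
  show "Eop n (rt n u x) y = psiU psi n u * Eop n x y"
  proof (cases "y \<in> GLn n")
    case True
    have "Eop n (rt n u x) y = (\<Sum>u'\<in>Uk n. psiU psi n (ginv u') * x (y * u' * u))"
      using True by (simp add: Eop_apply rt_apply GLn_mult Uk_GLn)
    also have "\<dots> = (\<Sum>u'\<in>Uk n. psiU psi n (ginv (u' * ginv u)) * x (y * (u' * ginv u) * u))"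
      by (rule sum.reindex_bij_witness[of _ "\<lambda>u'. u' * ginv u" "\<lambda>u'. u' * u"])
        (use u uG in \<open>auto simp: ginv_cancel[where n = n] Uk_GLn intro: Uk_mult Uk_ginv\<close>)
    also have "\<dots> = (\<Sum>u'\<in>Uk n. psiU psi n u * (psiU psi n (ginv u') * x (y * u')))"
    proof (rule sum.cong[OF refl])
      fix u' :: "'k mat" assume u': "u' \<in> Uk n"
      have "psiU psi n (u' * ginv u) * psiU psi n (ginv (u' * ginv u)) = 1"
        using u u' by (intro psiU_ginv Uk_mult Uk_ginv)
      moreover have "psiU psi n (u' * ginv u) = psiU psi n u' * psiU psi n (ginv u)"
        using u u' by (intro psiU_mult Uk_ginv)
      ultimately have one: "psiU psi n u' * psiU psi n (ginv u) * psiU psi n (ginv (u' * ginv u)) = 1"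
        by simp
      have "psiU psi n (ginv (u' * ginv u)) = psiU psi n (ginv (u' * ginv u)) *
          (psiU psi n u' * psiU psi n (ginv u')) * (psiU psi n u * psiU psi n (ginv u))"
        using psiU_ginv[OF u] psiU_ginv[OF u'] by simp
      also have "\<dots> = (psiU psi n u' * psiU psi n (ginv u) * psiU psi n (ginv (u' * ginv u))) *
          (psiU psi n (ginv u') * psiU psi n u)" by (simp only: mult_ac)
      finally have "psiU psi n (ginv (u' * ginv u)) = psiU psi n (ginv u') * psiU psi n u"
        using one by simp
      moreover have "y * (u' * ginv u) * u = y * u'"
        using True uG u' by (simp add: GLn_assoc[where n = n] ginv GLn_one_mult Uk_GLn GLn_mult)
      ultimately show "psiU psi n (ginv (u' * ginv u)) * x (y * (u' * ginv u) * u) =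
          psiU psi n u * (psiU psi n (ginv u') * x (y * u'))" by simp
    qed
    finally show ?thesis using True by (simp add: Eop_apply sum_distrib_left)
  qed (simp add: Eop_outside)
qed

lemma Top_left: "u \<in> Uk n \<Longrightarrow> g \<in> GLn n \<Longrightarrow> Top n (u * g) x = (\<lambda>y. psiU psi n u * Top n g x y)"
  unfolding Top_def by (simp add: rt_rt[symmetric] Uk_GLn Eop_rt_Uk)

lemma Top_right:
  assumes "u \<in> Uk n" "g \<in> GLn n" "equivariant n x"
  shows "Top n (g * u) x = (\<lambda>y. psiU psi n u * Top n g x y)"
proof
  fix y
  show "Top n (g * u) x y = psiU psi n u * Top n g x y"
  proof (cases "y \<in> GLn n")
    case True
    have "x (y * u' * (g * u)) = psiU psi n u * x (y * u' * g)" if "u' \<in> Uk n" for u'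
      using assms that True
      by (simp add: GLn_assoc[where n = n, symmetric] Uk_GLn GLn_mult equivariant_def)
    then show ?thesis using True assms
      by (simp add: Top_def Eop_apply rt_apply GLn_mult Uk_GLn sum_distrib_left mult.left_commute)
  qed (simp add: Top_def Eop_outside)
qed

text \<open>Up to character values that the reflection preserves, \<open>Top\<close> depends only on
  the double coset of \<open>g\<close> under U, so \<open>g\<close> may be taken monomial. Then
  either the reflection fixes it or two conflicting character values make both operators
  zero.\<close>

lemma Top_flip:
  assumes g: "g \<in> GLn n" and x: "equivariant n x"
  shows "Top n (flip n g) x = Top n g x"
proof -
  obtain u u' m p where *: "u \<in> Uk n" "u' \<in> Uk n" "m \<in> GLn n" "monomial_mat n p m" "g = u * m * u'"
    using bruhat_decomposition[OF g] by blast
  note fl = flip_GLn[OF *(3)] flip_Uk[OF *(1)] flip_Uk[OF *(2)]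
  have 1: "Top n g x = (\<lambda>y. psiU psi n u' * (psiU psi n u * Top n m x y))"
    using * x by (simp add: Top_right Top_left GLn_mult Uk_GLn)
  have "flip n g = flip n u' * flip n m * flip n u"
    using * by (simp add: flip_mult GLn_carrier GLn_mult Uk_GLn GLn_assoc[where n = n] flip_GLn)
  then have 2: "Top n (flip n g) x = (\<lambda>y. psiU psi n u * (psiU psi n u' * Top n (flip n m) x y))"
    using fl x by (simp add: Top_right Top_left GLn_mult Uk_GLn psiU_flip)
  have "Top n (flip n m) x = Top n m x"
    using monomial_intertwine_or_flip[OF *(4)]
  proof (elim disjE bexE conjE)
    fix a b assume ab: "a \<in> Uk n" "b \<in> Uk n" "m * a = b * m" "psiU psi n a \<noteq> psiU psi n b"
    have zero: "Top n h x y = 0" if "h \<in> GLn n" "a' \<in> Uk n" "b' \<in> Uk n" "h * a' = b' * h"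
        "psiU psi n a' \<noteq> psiU psi n b'" for h a' b' y
    proof -
      have "psiU psi n a' * Top n h x y = psiU psi n b' * Top n h x y"
        using Top_right[OF that(2,1) x] Top_left[OF that(3,1), of x] that(4) by metis
      then show ?thesis using that(5) by simp
    qed
    \<comment> \<open>The reflection reverses products, so it turns the conflict for
      \<open>m\<close> into one for \<open>flip n m\<close> with \<open>a\<close> and
      \<open>b\<close> exchanged.\<close>
    have "flip n a * flip n m = flip n m * flip n b"
      using ab *(3) flip_mult[of m n a] flip_mult[of b n m] by (simp add: GLn_carrier Uk_carrier)
    then have "Top n (flip n m) x y = 0" for y
      by (intro zero[of _ "flip n b" "flip n a"]) (use ab fl in \<open>auto simp: psiU_flip intro: flip_Uk\<close>)
    moreover have "Top n m x y = 0" for y by (rule zero[OF *(3) ab])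
    ultimately show ?thesis by auto
  qed simp
  then show ?thesis unfolding 1 2 by (simp add: mult.left_commute)
qed

lemma Top_Top:
  assumes "g \<in> GLn n" "h \<in> GLn n"
  shows "Top n g (Top n h x) = (\<lambda>y. \<Sum>u\<in>Uk n. psiU psi n (ginv u) * Top n (g * u * h) x y)"
proof
  fix y
  show "Top n g (Top n h x) y = (\<Sum>u\<in>Uk n. psiU psi n (ginv u) * Top n (g * u * h) x y)"
  proof (cases "y \<in> GLn n")
    case True
    have "Top n g (Top n h x) y = (\<Sum>u\<in>Uk n. psiU psi n (ginv u) *
        (\<Sum>u'\<in>Uk n. psiU psi n (ginv u') * x (y * u * g * u' * h)))"
      using True assms by (simp add: Top_def Eop_apply rt_apply GLn_mult Uk_GLn)
    also have "\<dots> = (\<Sum>u'\<in>Uk n. psiU psi n (ginv u') *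
        (\<Sum>u\<in>Uk n. psiU psi n (ginv u) * x (y * u * g * u' * h)))"
      by (simp add: sum_distrib_left) (subst sum.swap, simp add: mult.left_commute)
    also have "\<dots> = (\<Sum>u'\<in>Uk n. psiU psi n (ginv u') *
        (\<Sum>u\<in>Uk n. psiU psi n (ginv u) * x (y * u * (g * u' * h))))"
    proof -
      have "y * u * g * u' * h = y * u * (g * u' * h)" if "u \<in> Uk n" "u' \<in> Uk n" for u u'
        using True assms that by (simp add: GLn_assoc[where n = n] Uk_GLn GLn_mult)
      then show ?thesis by (simp cong: sum.cong)
    qed
    finally show ?thesis
      using True assms by (simp add: Top_def Eop_apply rt_apply GLn_mult Uk_GLn)
  qed (simp add: Top_def Eop_outside)
qed

lemma Top_equivariant: "equivariant n (Top n g x)"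
  by (simp add: Top_def Eop_equivariant)

text \<open>Gelfand's trick: the product formula runs over \<open>g * u * h\<close> with
  \<open>u\<close> in U. The reflection reverses this product and permutes U without changing psi,
  so it becomes the formula for the opposite order.\<close>

lemma Top_commute:
  assumes g: "g \<in> GLn n" and h: "h \<in> GLn n" and x: "equivariant n x"
  shows "Top n g (Top n h x) = Top n h (Top n g x)"
proof -
  have "Top n g (Top n h x) = (\<lambda>y. \<Sum>u\<in>Uk n. psiU psi n (ginv u) * Top n (flip n (g * u * h)) x y)"
    using g h x by (simp add: Top_Top Top_flip GLn_mult Uk_GLn cong: sum.cong)
  also have "\<dots> = (\<lambda>y. \<Sum>u\<in>Uk n. psiU psi n (ginv (flip n u)) * Top n (flip n h * flip n u * flip n g) x y)"
  proof (intro ext sum.cong refl arg_cong2[where f = "(*)"])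
    fix y and u :: "'k mat" assume u: "u \<in> Uk n"
    have "psiU psi n (ginv (flip n u)) * psiU psi n u = psiU psi n (ginv u) * psiU psi n u"
      using psiU_ginv[OF u] psiU_ginv[OF flip_Uk[OF u]] by (simp add: psiU_flip)
    then show "psiU psi n (ginv u) = psiU psi n (ginv (flip n u))" using psiU_nonzero by simp
    show "Top n (flip n (g * u * h)) x y = Top n (flip n h * flip n u * flip n g) x y"
      using g h u by (simp add: flip_mult GLn_carrier GLn_mult Uk_GLn GLn_assoc[where n = n] flip_GLn)
  qed
  also have "\<dots> = (\<lambda>y. \<Sum>u\<in>Uk n. psiU psi n (ginv u) * Top n (flip n h * u * flip n g) x y)"
    by (intro ext sum.reindex_bij_witness[of _ "flip n" "flip n"])
      (auto simp: flip_flip Uk_carrier intro: flip_Uk)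
  also have "\<dots> = Top n (flip n h) (Top n (flip n g) x)"
    using g h by (simp add: Top_Top flip_GLn)
  also have "\<dots> = Top n h (Top n g x)"
    using g h x by (simp add: Top_flip Top_equivariant)
  finally show ?thesis .
qed

end

section \<open>Linear algebra in spaces of functions\<close>

lemma sum_fun_apply: "(\<Sum>i\<in>A. (F i :: 'a \<Rightarrow> 'b::comm_monoid_add)) x = (\<Sum>i\<in>A. F i x)"
  by (induction A rule: infinite_finite_induct) auto

lemma vector_space_fun: "vector_space (\<lambda>c (f :: 'a \<Rightarrow> 'r::field) y. c * f y)"
  by unfold_locales (auto simp: fun_eq_iff algebra_simps)

text \<open>Used to compare numbers of residue classes before and after translation or rescaling
  without an explicit bijection.\<close>

lemma card_image_eq_card_image:
  assumes "\<And>x y. x \<in> A \<Longrightarrow> y \<in> A \<Longrightarrow> f x = f y \<longleftrightarrow> g x = g y"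
  shows "card (f ` A) = card (g ` A)" "finite (f ` A) \<longleftrightarrow> finite (g ` A)"
proof -
  define h where "h u = g (SOME x. x \<in> A \<and> f x = u)" for u
  have h: "h (f x) = g x" if "x \<in> A" for x
  proof -
    have "(SOME y. y \<in> A \<and> f y = f x) \<in> A \<and> f (SOME y. y \<in> A \<and> f y = f x) = f x"
      by (rule someI[of _ x]) (use that in simp)
    then show ?thesis unfolding h_def using assms that by blast
  qed
  have "inj_on h (f ` A)" using h assms by (auto simp: inj_on_def)
  moreover have "h ` (f ` A) = g ` A" using h by (auto simp: image_image)
  ultimately have "bij_betw h (f ` A) (g ` A)" by (simp add: bij_betw_def)
  then show "card (f ` A) = card (g ` A)" "finite (f ` A) \<longleftrightarrow> finite (g ` A)"
    by (auto simp: bij_betw_same_card bij_betw_finite)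
qed

lemma vector_space_fun2: "vector_space (\<lambda>c (f :: 'a \<Rightarrow> 'b \<Rightarrow> 'c::field) g y. c * f g y)"
  by unfold_locales (auto simp: fun_eq_iff algebra_simps)

lemma exists_minimizer:
  assumes "finite P" "P \<noteq> {}"
  obtains p where "p \<in> P" "\<And>q. q \<in> P \<Longrightarrow> (f p :: int) \<le> f q"
proof -
  have "Min (f ` P) \<in> f ` P" using assms by (intro Min_in) auto
  then obtain p where "p \<in> P" "f p = Min (f ` P)" by auto
  then show ?thesis using that assms by (metis Min_le finite_imageI imageI)
qed

text \<open>A polynomial \<open>p\<close> of least degree with \<open>p(T) x = 0\<close> has a root
  \<open>l\<close>; dividing by the linear factor gives \<open>q\<close> of smaller degree, so
  \<open>q(T) x\<close> is non-zero and \<open>T\<close> acts on it by \<open>l\<close>. The space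
  \<open>S\<close> is given only by closure properties, and finite support bounds its
  dimension.\<close>

lemma exists_eigenvector:
  fixes T :: "('a \<Rightarrow> 'r::field) \<Rightarrow> ('a \<Rightarrow> 'r)"
  assumes ac: "alg_closed TYPE('r)" and fin: "finite D"
    and supp: "\<And>x y. x \<in> S \<Longrightarrow> y \<notin> D \<Longrightarrow> x y = 0"
    and add: "\<And>x z. x \<in> S \<Longrightarrow> z \<in> S \<Longrightarrow> (\<lambda>y. x y + z y) \<in> S"
    and scale: "\<And>c x. x \<in> S \<Longrightarrow> (\<lambda>y. c * x y) \<in> S"
    and T: "\<And>x. x \<in> S \<Longrightarrow> T x \<in> S"
    and T_add: "\<And>x z. x \<in> S \<Longrightarrow> z \<in> S \<Longrightarrow> T (\<lambda>y. x y + z y) = (\<lambda>y. T x y + T z y)"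
    and T_scale: "\<And>c x. x \<in> S \<Longrightarrow> T (\<lambda>y. c * x y) = (\<lambda>y. c * T x y)"
    and x: "x \<in> S" "x \<noteq> 0"
  shows "\<exists>z\<in>S. z \<noteq> 0 \<and> (\<exists>l. T z = (\<lambda>y. l * z y))"
proof -
  interpret vs: vector_space "\<lambda>c (f :: 'a \<Rightarrow> 'r) y. c * f y" by (rule vector_space_fun)
  define X where "X i = (T ^^ i) x" for i
  have XS: "X i \<in> S" for i by (induction i) (auto simp: X_def x T)
  have X0: "X 0 = x" and XSuc: "X (Suc i) = T (X i)" for i by (auto simp: X_def)
  define ev where "ev p = (\<lambda>y. \<Sum>i\<le>degree p. coeff p i * X i y)" for p
  have ev_eq: "ev p y = (\<Sum>i<N. coeff p i * X i y)" if "degree p < N" for p N y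
    unfolding ev_def using that
    by (intro sum.mono_neutral_left) (auto simp: coeff_eq_0)
  have part: "(\<lambda>y. \<Sum>i<N. c i * X i y) \<in> S \<and>
      T (\<lambda>y. \<Sum>i<N. c i * X i y) = (\<lambda>y. \<Sum>i<N. c i * X (Suc i) y)" for c :: "nat \<Rightarrow> 'r" and N
  proof (induction N)
    case 0
    have "(\<lambda>y. 0 * x y) \<in> S" "T (\<lambda>y. 0 * x y) = (\<lambda>y. 0 * T x y)" using scale T_scale x by blast+
    then show ?case by simp
  next
    case (Suc N)
    have "(\<lambda>y. (\<Sum>i<N. c i * X i y) + c N * X N y) \<in> S"
      using Suc scale[OF XS] by (intro add) auto
    moreover have "T (\<lambda>y. (\<Sum>i<N. c i * X i y) + c N * X N y)
        = (\<lambda>y. T (\<lambda>y. \<Sum>i<N. c i * X i y) y + T (\<lambda>y. c N * X N y) y)"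
      using Suc scale[OF XS] by (intro T_add) auto
    ultimately show ?case using Suc T_scale[OF XS] by (simp add: XSuc)
  qed
  have evS: "ev p \<in> S" for p
    using part[where N = "Suc (degree p)" and c = "coeff p"] by (simp add: ev_def lessThan_Suc_atMost)
  have ev_add: "ev (p + q) y = ev p y + ev q y" for p q y
  proof -
    define N where "N = Suc (max (degree (p + q)) (max (degree p) (degree q)))"
    have "degree (p + q) < N" "degree p < N" "degree q < N" by (auto simp: N_def)
    then show ?thesis by (simp add: ev_eq[where N = N] algebra_simps sum.distrib)
  qed
  have ev_smult: "ev (smult c p) y = c * ev p y" for p c y
  proof -
    have "degree (smult c p) < Suc (degree p)" using degree_smult_le[of c p] by simp
    then show ?thesis by (simp add: ev_eq[where N = "Suc (degree p)"] sum_distrib_left mult.assoc del: sum.lessThan_Suc)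
  qed
  have ev_pCons: "ev (pCons a p) y = a * x y + T (ev p) y" for a p y
  proof -
    define N where "N = Suc (degree p)"
    have "degree (pCons a p) < Suc N" using degree_pCons_le[of a p] by (simp add: N_def)
    then have "ev (pCons a p) y = a * x y + (\<Sum>i<N. coeff p i * X (Suc i) y)"
      by (simp add: ev_eq[where N = "Suc N"] sum.lessThan_Suc_shift X0 del: sum.lessThan_Suc)
    moreover have "ev p = (\<lambda>y. \<Sum>i<N. coeff p i * X i y)" using ev_eq[of p N] by (auto simp: N_def)
    ultimately show ?thesis using part by simp
  qed
  have "\<exists>p. p \<noteq> 0 \<and> ev p = 0"
  proof (cases "inj_on X {..card D}")
    case False
    then obtain i j where ij: "X i = X j" "i \<noteq> j" by (auto simp: inj_on_def)
    define p :: "'r poly" where "p = monom 1 i - monom 1 j"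
    have "coeff p i \<noteq> 0" using ij by (simp add: p_def)
    then have "p \<noteq> 0" by auto
    moreover have "ev p = 0"
    proof
      fix y
      define N where "N = Suc (max (degree p) (max i j))"
      have "ev p y = (\<Sum>k<N. coeff p k * X k y)" by (rule ev_eq) (simp add: N_def)
      also have "\<dots> = (\<Sum>k<N. (if i = k then X k y else 0) - (if j = k then X k y else 0))"
        by (intro sum.cong) (auto simp: p_def)
      also have "\<dots> = X i y - X j y"
        by (simp only: sum_subtractf sum.delta finite_lessThan) (auto simp: N_def)
      finally show "ev p y = 0 y" using ij by simp
    qed
    ultimately show ?thesis by blast
  next
    case True
    \<comment> \<open>The indicator functions of the points of \<open>D\<close> span, so
      \<open>card D + 1\<close> distinct iterates of \<open>x\<close> are linearly
      dependent.\<close>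
    define b where "b d = (\<lambda>y. if y = d then 1 else 0 :: 'r)" for d :: 'a
    have "X ` {..card D} \<subseteq> vs.span (b ` D)"
    proof
      fix f assume "f \<in> X ` {..card D}"
      then have f: "f \<in> S" using XS by auto
      have "f = (\<Sum>d\<in>D. (\<lambda>y. f d * b d y))"
      proof
        fix y
        have "(\<Sum>d\<in>D. f d * b d y) = (\<Sum>d\<in>D. if y = d then f d else 0)"
          by (intro sum.cong) (auto simp: b_def)
        also have "\<dots> = f y" using fin supp[OF f, of y] by simp
        finally show "f y = (\<Sum>d\<in>D. (\<lambda>y. f d * b d y)) y" by (simp add: sum_fun_apply)
      qed
      also have "\<dots> \<in> vs.span (b ` D)"
        by (intro vs.span_sum vs.span_scale vs.span_base) auto
      finally show "f \<in> vs.span (b ` D)" .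
    qed
    moreover have "card (b ` D) < card (X ` {..card D})"
      using True card_image_le[OF fin, of b] by (simp add: card_image)
    ultimately have dep: "vs.dependent (X ` {..card D})"
      using vs.independent_span_bound[of "b ` D" "X ` {..card D}"] fin by auto
    obtain u v where u: "v \<in> X ` {..card D}" "u v \<noteq> 0" "(\<Sum>v\<in>X ` {..card D}. (\<lambda>y. u v * v y)) = 0"
      using vs.dependent_finite[of "X ` {..card D}"] dep by auto
    define p where "p = (\<Sum>i\<le>card D. monom (u (X i)) i)"
    have cp: "coeff p i = (if i \<le> card D then u (X i) else 0)" for i
      by (simp add: p_def coeff_sum)
    obtain i where i: "i \<le> card D" "v = X i" using u by auto
    then have "coeff p i \<noteq> 0" using u by (simp add: cp)
    then have "p \<noteq> 0" by auto
    moreover have "ev p = 0"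
    proof
      fix y
      have dp: "degree p < Suc (card D)" by (rule le_imp_less_Suc, rule degree_le) (simp add: cp)
      have "ev p y = (\<Sum>i\<le>card D. u (X i) * X i y)"
        unfolding ev_eq[OF dp] lessThan_Suc_atMost by (intro sum.cong) (auto simp: cp)
      also have "\<dots> = (\<Sum>v\<in>X ` {..card D}. u v * v y)" using True by (simp add: sum.reindex)
      also have "\<dots> = (\<Sum>v\<in>X ` {..card D}. (\<lambda>y. u v * v y)) y" by (simp add: sum_fun_apply)
      finally show "ev p y = 0 y" using u by simp
    qed
    ultimately show ?thesis by blast
  qed
  then have "\<exists>d p. p \<noteq> 0 \<and> ev p = 0 \<and> degree p = d" by blast
  then obtain p where p: "p \<noteq> 0" "ev p = 0" and min: "\<And>q. q \<noteq> 0 \<Longrightarrow> ev q = 0 \<Longrightarrow> degree p \<le> degree q"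
    using exists_least_iff[of "\<lambda>d. \<exists>p. p \<noteq> 0 \<and> ev p = 0 \<and> degree p = d"] by (metis not_le)
  have "degree p \<noteq> 0"
  proof
    assume "degree p = 0"
    then obtain a where a: "p = [:a:]" by (rule degree_eq_zeroE)
    obtain y where "x y \<noteq> 0" using x by (auto simp: fun_eq_iff)
    moreover have "ev p y = a * x y" by (simp add: ev_def a X0)
    ultimately show False using p a by simp
  qed
  then have "degree p \<ge> 1" by simp
  then obtain l where l: "poly p l = 0" using ac unfolding alg_closed_def by blast
  define q where "q = synthetic_div p l"
  have q: "q \<noteq> 0" "degree q < degree p"
    using \<open>degree p \<noteq> 0\<close> by (auto simp: q_def synthetic_div_eq_0_iff degree_synthetic_div)
  \<comment> \<open>Since \<open>l\<close> is a root, synthetic division leaves no remainder. The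
    identity is written without subtraction so that it can be evaluated through
    \<open>ev_add\<close> and \<open>ev_pCons\<close>.\<close>
  have "p + smult l q = pCons 0 q" using synthetic_div_correct[of p l] l by (simp add: q_def)
  then have "ev p y + l * ev q y = T (ev q) y" for y
    using ev_add[of p "smult l q" y] ev_smult[of l q y] ev_pCons[of 0 q y] by simp
  then have "T (ev q) = (\<lambda>y. l * ev q y)" using p by (auto simp: fun_eq_iff)
  moreover have "ev q \<noteq> 0" using min[of q] q by auto
  ultimately show ?thesis using evS by blast
qed

section \<open>Multiplicity one and the Bessel function\<close>

locale cuspidal_model = nontriv_character psi
  for psi :: "'k::{field,finite} \<Rightarrow> 'r::field" +
  fixes n :: nat and Wt :: "('k mat \<Rightarrow> 'r) set"
  assumes n2: "n \<ge> 2" and ac: "alg_closed TYPE('r)" and char_neq: "CHAR('r) \<noteq> CHAR('k)"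
    and cuspidal: "cuspidal_whittaker_model n psi Wt"
begin

lemma subrep_Wt: "subrep n Wt"
  and Wt_ne: "Wt \<noteq> {0}"
  and whittaker: "W \<in> Wt \<Longrightarrow> whittaker_fun n psi W"
  and irreducible: "subrep n S \<Longrightarrow> S \<subseteq> Wt \<Longrightarrow> S = {0} \<or> S = Wt"
  and cuspidal_radical: "C \<noteq> {} \<Longrightarrow> C \<subseteq> {1..n-1} \<Longrightarrow> W \<in> Wt \<Longrightarrow>
        (\<And>u. u \<in> unipRad n C \<Longrightarrow> rt n u W = W) \<Longrightarrow> W = 0"
  using cuspidal by (auto simp: cuspidal_whittaker_model_def)

lemma Wt_0: "0 \<in> Wt"
  and Wt_add: "a \<in> Wt \<Longrightarrow> b \<in> Wt \<Longrightarrow> (\<lambda>y. a y + b y) \<in> Wt"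
  and Wt_scale: "a \<in> Wt \<Longrightarrow> (\<lambda>y. c * a y) \<in> Wt"
  and Wt_rt: "h \<in> GLn n \<Longrightarrow> a \<in> Wt \<Longrightarrow> rt n h a \<in> Wt"
  using subrep_Wt unfolding subrep_def plus_fun_def by auto

lemma Wt_sum: "(\<And>i. i \<in> I \<Longrightarrow> F i \<in> Wt) \<Longrightarrow> (\<lambda>y. \<Sum>i\<in>I. c i * F i y) \<in> Wt"
proof (induction I rule: infinite_finite_induct)
  case (insert i I)
  then have "(\<lambda>y. c i * F i y + (\<Sum>i\<in>I. c i * F i y)) \<in> Wt"
    by (intro Wt_add Wt_scale) auto
  then show ?case using insert by simp
qed (use Wt_0 in \<open>auto simp: zero_fun_def\<close>)

lemma Wt_outside: "W \<in> Wt \<Longrightarrow> y \<notin> GLn n \<Longrightarrow> W y = 0"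
  using whittaker by (auto simp: whittaker_fun_def)

lemma Wt_left: "W \<in> Wt \<Longrightarrow> u \<in> Uk n \<Longrightarrow> g \<in> GLn n \<Longrightarrow> W (u * g) = psiU psi n u * W g"
  using whittaker by (auto simp: whittaker_fun_def)

lemma Wt_rt_one: "W \<in> Wt \<Longrightarrow> rt n (1\<^sub>m n) W = W"
  by (rule rt_one) (rule Wt_outside)

lemma card_power_neq_0: "(of_nat (card (UNIV :: 'k set) ^ N) :: 'r) \<noteq> 0"
  using of_nat_card_neq_0[OF char_neq] by simp

lemma card_Uk_neq_0: "of_nat (card (Uk n :: 'k mat set)) \<noteq> (0 :: 'r)"
  using card_Uk[where 'a = 'k, of n] card_power_neq_0 by metis

lemma rt_lincomb: "rt n g (\<lambda>y. \<Sum>i\<in>I. c i * F i y) = (\<lambda>y. \<Sum>i\<in>I. c i * rt n g (F i) y)"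
  by (auto simp: rt_def fun_eq_iff)

lemma Eop_lincomb: "Eop n (\<lambda>y. \<Sum>i\<in>I. c i * F i y) = (\<lambda>y. \<Sum>i\<in>I. c i * Eop n (F i) y)"
  unfolding Eop_def rt_lincomb
  by (simp add: sum_distrib_left fun_eq_iff) (subst sum.swap, simp add: mult.left_commute)

lemma Top_lincomb: "Top n g (\<lambda>y. \<Sum>i\<in>I. c i * F i y) = (\<lambda>y. \<Sum>i\<in>I. c i * Top n g (F i) y)"
  unfolding Top_def rt_lincomb Eop_lincomb ..

lemma Top_scale: "Top n g (\<lambda>y. c * F y) = (\<lambda>y. c * Top n g F y)"
  using Top_lincomb[where I = "{()}"] by simp

lemma Top_add: "Top n g (\<lambda>y. F y + H y) = (\<lambda>y. Top n g F y + Top n g H y)"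
  using Top_lincomb[where I = "{False,True}" and c = "\<lambda>_. 1" and F = "\<lambda>b. if b then H else F"] by simp

lemma Eop_Wt: "x \<in> Wt \<Longrightarrow> Eop n x \<in> Wt"
  unfolding Eop_def by (intro Wt_sum Wt_rt Uk_GLn)

lemma Top_Wt: "x \<in> Wt \<Longrightarrow> g \<in> GLn n \<Longrightarrow> Top n g x \<in> Wt"
  unfolding Top_def by (intro Eop_Wt Wt_rt)

text \<open>The combinations of translates of \<open>x0\<close> form a subrepresentation containing
  \<open>x0\<close>, so irreducibility applies. Explicit coefficients indexed by the finite group
  let operators be applied term by term.\<close>

lemma Wt_generated:
  assumes "x0 \<in> Wt" "x0 \<noteq> 0" "x \<in> Wt"
  shows "\<exists>c. x = (\<lambda>y. \<Sum>h\<in>GLn n. c h * rt n h x0 y)"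
proof -
  define S where "S = {x. \<exists>c. x = (\<lambda>y. \<Sum>h\<in>GLn n. c h * rt n h x0 y)}"
  have "subrep n S"
    unfolding subrep_def
  proof (intro conjI allI impI ballI)
    show "0 \<in> S" by (auto simp: S_def fun_eq_iff intro: exI[of _ "\<lambda>_. 0"])
  next
    fix a b assume "a \<in> S" "b \<in> S"
    then obtain c d where "a = (\<lambda>y. \<Sum>h\<in>GLn n. c h * rt n h x0 y)" "b = (\<lambda>y. \<Sum>h\<in>GLn n. d h * rt n h x0 y)"
      by (auto simp: S_def)
    then have "a + b = (\<lambda>y. \<Sum>h\<in>GLn n. (c h + d h) * rt n h x0 y)"
      by (simp add: fun_eq_iff algebra_simps sum.distrib)
    then show "a + b \<in> S" unfolding S_def by (intro CollectI exI[of _ "\<lambda>h. c h + d h"])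
  next
    fix r a assume "a \<in> S"
    then obtain c where "a = (\<lambda>y. \<Sum>h\<in>GLn n. c h * rt n h x0 y)" by (auto simp: S_def)
    then have "(\<lambda>y. r * a y) = (\<lambda>y. \<Sum>h\<in>GLn n. (r * c h) * rt n h x0 y)"
      by (simp add: fun_eq_iff sum_distrib_left mult.assoc)
    then show "(\<lambda>y. r * a y) \<in> S" unfolding S_def by (intro CollectI exI[of _ "\<lambda>h. r * c h"])
  next
    fix g :: "'k mat" and a assume g: "g \<in> GLn n" and "a \<in> S"
    then obtain c where a: "a = (\<lambda>y. \<Sum>h\<in>GLn n. c h * rt n h x0 y)" by (auto simp: S_def)
    have "rt n g a y = (\<Sum>h\<in>GLn n. c (ginv g * h) * rt n h x0 y)" for y
    proof -
      have "rt n g a y = (\<Sum>h\<in>GLn n. c h * rt n (g * h) x0 y)"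
        unfolding a rt_lincomb using g by (simp add: rt_rt)
      also have "\<dots> = (\<Sum>h\<in>GLn n. c (ginv g * h) * rt n h x0 y)"
        by (rule sum.reindex_bij_witness[of _ "\<lambda>h. ginv g * h" "\<lambda>h. g * h"])
          (use g in \<open>auto simp: ginv_cancel[where n = n] intro: GLn_mult ginv\<close>)
      finally show ?thesis .
    qed
    then show "rt n g a \<in> S" unfolding S_def by (intro CollectI exI[of _ "\<lambda>h. c (ginv g * h)"] ext)
  qed
  moreover have "S \<subseteq> Wt" using assms by (auto simp: S_def intro!: Wt_sum Wt_rt)
  moreover have "x0 \<in> S"
  proof -
    have "x0 y = (\<Sum>h\<in>GLn n. (if h = 1\<^sub>m n then 1 else 0) * rt n h x0 y)" for y
    proof -
      have "(\<Sum>h\<in>GLn n. (if h = 1\<^sub>m n then 1 else 0) * rt n h x0 y) =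
          (\<Sum>h\<in>GLn n. if h = 1\<^sub>m n then rt n h x0 y else 0)" by (intro sum.cong) auto
      also have "\<dots> = rt n (1\<^sub>m n) x0 y" by (simp add: GLn_one finite_GLn)
      finally show ?thesis using assms by (simp add: Wt_rt_one)
    qed
    then have "x0 = (\<lambda>y. \<Sum>h\<in>GLn n. (if h = 1\<^sub>m n then 1 else 0) * rt n h x0 y)" by (rule ext)
    then show ?thesis unfolding S_def by (intro CollectI exI[of _ "\<lambda>h. if h = 1\<^sub>m n then 1 else 0"])
  qed
  ultimately have "S = Wt" using irreducible[of S] assms by blast
  then show ?thesis using assms by (auto simp: S_def)
qed

text \<open>Schur's lemma for the commuting operators \<open>Top\<close> on the space of \<open>(U,\<psi>)\<close>-vectors.\<close>

lemma equivariant_unique: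
  assumes x0: "x0 \<in> Wt" "x0 \<noteq> 0" "equivariant n x0" and x: "x \<in> Wt" "equivariant n x"
  shows "\<exists>c. x = (\<lambda>y. c * x0 y)"
proof -
  let ?N = "of_nat (card (Uk n :: 'k mat set)) :: 'r"
  define S where "S = {x \<in> Wt. equivariant n x}"
  \<comment> \<open>Applying the projection to an expansion in translates turns the translates into
    Hecke operators and multiplies the left side by the order of U.\<close>
  have expand: "(\<lambda>y. ?N * z y) = (\<lambda>y. \<Sum>h\<in>GLn n. c h * Top n h z0 y)"
    if "z \<in> S" "z = (\<lambda>y. \<Sum>h\<in>GLn n. c h * rt n h z0 y)" for z z0 c
  proof -
    have "(\<lambda>y. ?N * z y) = Eop n z" using that Eop_fix by (simp add: S_def)
    also have "\<dots> = (\<lambda>y. \<Sum>h\<in>GLn n. c h * Top n h z0 y)"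
      by (subst that(2)) (simp add: Eop_lincomb Top_def)
    finally show ?thesis .
  qed
  \<comment> \<open>An eigenvector \<open>z\<close> of \<open>Top n g\<close> generates the whole
    representation. Every vector of \<open>S\<close> is, up to the order of U, a combination of
    Hecke operators applied to \<open>z\<close>, and these commute with \<open>Top n g\<close>, so
    the eigenvalue spreads to all of \<open>S\<close>.\<close>
  have scalar: "\<exists>l. \<forall>z\<in>S. Top n g z = (\<lambda>y. l * z y)" if g: "g \<in> GLn n" for g
  proof -
    have "\<exists>z\<in>S. z \<noteq> 0 \<and> (\<exists>l. Top n g z = (\<lambda>y. l * z y))"
    proof (rule exists_eigenvector[where D = "GLn n"])
      show "x0 \<in> S" "x0 \<noteq> 0" using x0 by (auto simp: S_def)
      show "alg_closed TYPE('r)" "finite (GLn n :: 'k mat set)" by (auto simp: ac finite_GLn)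
      show "\<And>x y. x \<in> S \<Longrightarrow> y \<notin> GLn n \<Longrightarrow> x y = 0" by (auto simp: S_def Wt_outside)
      show "\<And>x z. x \<in> S \<Longrightarrow> z \<in> S \<Longrightarrow> (\<lambda>y. x y + z y) \<in> S"
        by (auto simp: S_def equivariant_def distrib_left intro: Wt_add)
      show "\<And>c x. x \<in> S \<Longrightarrow> (\<lambda>y. c * x y) \<in> S"
        by (auto simp: S_def equivariant_def mult.left_commute intro: Wt_scale)
      show "\<And>x. x \<in> S \<Longrightarrow> Top n g x \<in> S" using g by (auto simp: S_def Top_equivariant intro: Top_Wt)
    qed (auto simp: Top_scale Top_add)
    then obtain z l where z: "z \<in> S" "z \<noteq> 0" "Top n g z = (\<lambda>y. l * z y)" by blast
    have "Top n g t = (\<lambda>y. l * t y)" if t: "t \<in> S" for t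
    proof -
      obtain c where c: "t = (\<lambda>y. \<Sum>h\<in>GLn n. c h * rt n h z y)"
        using Wt_generated[of z t] z t by (auto simp: S_def)
      note e = expand[OF t c]
      have "(\<lambda>y. ?N * Top n g t y) = Top n g (\<lambda>y. ?N * t y)" by (simp add: Top_scale)
      also have "\<dots> = (\<lambda>y. \<Sum>h\<in>GLn n. c h * Top n g (Top n h z) y)" unfolding e Top_lincomb ..
      also have "\<dots> = (\<lambda>y. \<Sum>h\<in>GLn n. c h * Top n h (Top n g z) y)"
        using g z by (simp add: Top_commute S_def cong: sum.cong)
      also have "\<dots> = (\<lambda>y. l * (\<Sum>h\<in>GLn n. c h * Top n h z y))"
        unfolding z(3) Top_scale by (simp add: sum_distrib_left mult.left_commute)
      also have "\<dots> = (\<lambda>y. l * (?N * t y))" using e by (metis (no_types, lifting))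
      finally have "?N * Top n g t y = ?N * (l * t y)" for y by (auto simp: fun_eq_iff mult.left_commute)
      then show ?thesis using card_Uk_neq_0 by (simp add: fun_eq_iff)
    qed
    then show ?thesis by blast
  qed
  then obtain l where l: "\<And>g z. g \<in> GLn n \<Longrightarrow> z \<in> S \<Longrightarrow> Top n g z = (\<lambda>y. l g * z y)" by metis
  obtain c where c: "x = (\<lambda>y. \<Sum>h\<in>GLn n. c h * rt n h x0 y)"
    using Wt_generated[of x0 x] x0 x by auto
  have "x \<in> S" "x0 \<in> S" using x x0 by (auto simp: S_def)
  \<comment> \<open>Expanding \<open>x\<close> in translates of \<open>x0\<close> and projecting
    leaves a combination of Hecke operators on \<open>x0\<close>, each of which is a scalar.\<close>
  from expand[OF this(1) c] have "?N * x y = (\<Sum>h\<in>GLn n. c h * l h) * x0 y" for y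
    using l[OF _ \<open>x0 \<in> S\<close>] by (simp add: fun_eq_iff sum_distrib_right mult.assoc cong: sum.cong)
  then have "x y = ((\<Sum>h\<in>GLn n. c h * l h) / ?N) * x0 y" for y
    using card_Uk_neq_0 by (simp add: field_simps)
  then show ?thesis by blast
qed

text \<open>At the identity, right translation by U is left translation, where Whittaker functions
  are already equivariant. This is what shows that the projection of a suitable vector is
  non-zero.\<close>

lemma Eop_at_one:
  assumes "W \<in> Wt"
  shows "Eop n W (1\<^sub>m n) = of_nat (card (Uk n :: 'k mat set)) * W (1\<^sub>m n)"
proof -
  have "Eop n W (1\<^sub>m n) = (\<Sum>u\<in>Uk n. psiU psi n (ginv u) * W (u * 1\<^sub>m n))"
    by (simp add: Eop_apply GLn_one GLn_one_mult Uk_GLn cong: sum.cong)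
  also have "\<dots> = (\<Sum>u\<in>Uk n. psiU psi n (ginv u) * (psiU psi n u * W (1\<^sub>m n)))"
    using assms by (intro sum.cong refl) (simp only: Wt_left GLn_one)
  also have "\<dots> = (\<Sum>u\<in>(Uk n :: 'k mat set). W (1\<^sub>m n))"
    by (intro sum.cong refl) (simp add: mult.assoc[symmetric] psiU_ginv)
  finally show ?thesis by simp
qed

abbreviation B :: "'k mat \<Rightarrow> 'r" where "B \<equiv> bessel n psi Wt"

text \<open>For existence, translate a function so that a non-zero value moves to the identity,
  project and rescale. Uniqueness is multiplicity one together with the normalisation at the
  identity.\<close>

lemma bessel: "B \<in> Wt" "equivariant n B" "B (1\<^sub>m n) = 1"
proof -
  obtain W where W: "W \<in> Wt" "W \<noteq> 0" using Wt_ne Wt_0 by blast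
  then obtain g where Wg: "W g \<noteq> 0" by (auto simp: fun_eq_iff)
  then have g: "g \<in> GLn n" using Wt_outside W by blast
  define Z where "Z = Eop n (rt n g W)"
  have Z: "Z \<in> Wt" "equivariant n Z" using W g by (auto simp: Z_def intro: Eop_Wt Wt_rt Eop_equivariant)
  have "Z (1\<^sub>m n) = of_nat (card (Uk n :: 'k mat set)) * W g"
    unfolding Z_def using W g by (simp add: Eop_at_one Wt_rt rt_apply GLn_one GLn_one_mult)
  then have Z1: "Z (1\<^sub>m n) \<noteq> 0" using Wg card_Uk_neq_0 by simp
  let ?P = "\<lambda>W. W \<in> Wt \<and> (\<forall>g\<in>GLn n. \<forall>u\<in>Uk n. W (g * u) = psiU psi n u * W g) \<and> W (1\<^sub>m n) = 1"
  have eq: "equivariant n X" if "?P X" for X using that Wt_outside by (auto simp: equivariant_def)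
  have "\<exists>!W. ?P W"
  proof (rule ex_ex1I)
    have "?P (\<lambda>y. inverse (Z (1\<^sub>m n)) * Z y)"
      using Z Z1 by (auto simp: equivariant_def intro: Wt_scale)
    then show "\<exists>W. ?P W" by blast
  next
    fix X Y assume X: "?P X" and Y: "?P Y"
    then have "X \<noteq> 0" by auto
    then obtain c where c: "Y = (\<lambda>y. c * X y)" using equivariant_unique[of X Y] X Y eq by blast
    then have "c = 1" using X Y by auto
    then show "X = Y" using c by simp
  qed
  from theI'[OF this] have *: "?P B" unfolding bessel_def .
  then show "B \<in> Wt" "equivariant n B" "B (1\<^sub>m n) = 1" using eq by auto
qed

lemma equivariant_eq_bessel:
  assumes "W \<in> Wt" "equivariant n W"
  shows "W = (\<lambda>y. W (1\<^sub>m n) * B y)"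
proof -
  have "B \<noteq> 0" using bessel(3) by auto
  then obtain c where "W = (\<lambda>y. c * B y)" using equivariant_unique[of B W] bessel assms by blast
  then show ?thesis using bessel(3) by auto
qed

end

section \<open>Restriction to the mirabolic subgroup\<close>

definition Mir :: "nat \<Rightarrow> 'a::field mat set" where
  "Mir n = {p \<in> GLn n. \<forall>j<n. p $$ (n-1,j) = (if j = n - 1 then 1 else 0)}"

text \<open>Unitriangular matrices whose columns before \<open>c\<close> are those of the identity.
  The descent on columns starts at \<open>c = n\<close>, where only the identity is left, and ends
  at \<open>c = 1\<close>, where the group is all of U.\<close>

definition Ucol :: "nat \<Rightarrow> nat \<Rightarrow> 'a::field mat set" where
  "Ucol n c = {u \<in> Uk n. \<forall>i j. i < j \<longrightarrow> j < c \<longrightarrow> u $$ (i,j) = 0}"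

text \<open>The part of U in column \<open>c\<close>, isomorphic to the additive group k^c. Its
  coordinate vectors are functions padded by zero, collected in \<open>Xcol c\<close>, so that the
  parametrisation is injective.\<close>

definition Ncol :: "nat \<Rightarrow> nat \<Rightarrow> (nat \<Rightarrow> 'a::field) \<Rightarrow> 'a mat" where
  "Ncol n c x = row_tv n c (\<lambda>i. if i < c then x i else 0)"

definition Xcol :: "nat \<Rightarrow> (nat \<Rightarrow> 'a::zero) set" where
  "Xcol c = {x. \<forall>i\<ge>c. x i = 0}"

lemma Ucol_Uk: "u \<in> Ucol n c \<Longrightarrow> u \<in> Uk n"
  by (simp add: Ucol_def)

lemma Ucol_entry: "u \<in> Ucol n c \<Longrightarrow> i < n \<Longrightarrow> j < c \<Longrightarrow> j < n \<Longrightarrow> u $$ (i,j) = (if i = j then 1 else 0)"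
  by (cases i j rule: linorder_cases) (auto simp: Ucol_def Uk_def)

lemma UcolI:
  assumes "u \<in> Uk n" "\<And>i j. i < n \<Longrightarrow> j < c \<Longrightarrow> j < n \<Longrightarrow> i < j \<Longrightarrow> u $$ (i,j) = 0" "c \<le> n"
  shows "u \<in> Ucol n c"
  using assms by (auto simp: Ucol_def)

lemma Ncol_carrier [simp]: "Ncol n c x \<in> carrier_mat n n"
  by (simp add: Ncol_def)

lemma Ncol_Uk: "c < n \<Longrightarrow> Ncol n c x \<in> Uk n"
  by (auto simp: Ncol_def Uk_def row_tv_entry)

lemma Ncol_entry: "c < n \<Longrightarrow> i < n \<Longrightarrow> j < n \<Longrightarrow>
   Ncol n c x $$ (i,j) = (if i = j then 1 else 0) + (if j = c \<and> i < c then x i else 0)"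
  by (auto simp: Ncol_def row_tv_entry)

lemma Ncol_mult_entry:
  "A \<in> carrier_mat n n \<Longrightarrow> c < n \<Longrightarrow> i < n \<Longrightarrow> j < n \<Longrightarrow>
   (Ncol n c x * A) $$ (i,j) = A $$ (i,j) + (if i < c then x i * A $$ (c,j) else 0)"
  by (simp add: Ncol_def row_tv_mult)

lemma Ncol_mult: assumes "c < n" shows "Ncol n c x * Ncol n c y = Ncol n c (\<lambda>i. x i + y i)"
proof (rule eq_matI)
  fix i j assume "i < dim_row (Ncol n c (\<lambda>i. x i + y i))" "j < dim_col (Ncol n c (\<lambda>i. x i + y i))"
  then have "i < n" "j < n" by (auto simp: Ncol_def row_tv_def)
  then show "(Ncol n c x * Ncol n c y) $$ (i,j) = Ncol n c (\<lambda>i. x i + y i) $$ (i,j)"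
    using assms by (auto simp: Ncol_mult_entry Ncol_entry)
qed (auto simp: Ncol_def row_tv_def)

lemma Ncol_zero: "c < n \<Longrightarrow> Ncol n c (\<lambda>i. 0) = 1\<^sub>m n"
  by (rule eq_matI) (auto simp: Ncol_def row_tv_def)

lemma Ncol_inj:
  assumes "c < n" "x \<in> Xcol c" "y \<in> Xcol c" "Ncol n c x = Ncol n c y" shows "x = y"
proof
  fix i
  show "x i = y i"
  proof (cases "i < c")
    case True
    then have "Ncol n c x $$ (i,c) = x i" "Ncol n c y $$ (i,c) = y i" using assms(1) by (auto simp: Ncol_entry)
    then show ?thesis using assms(4) by simp
  qed (use assms in \<open>auto simp: Xcol_def\<close>)
qed

lemma Ncol_Mir: "c < n \<Longrightarrow> Ncol n c x \<in> Mir n"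
  using Uk_GLn[OF Ncol_Uk] by (auto simp: Mir_def Ncol_entry)

lemma Xcol_card: "finite (Xcol c :: (nat \<Rightarrow> 'a::{zero,finite}) set)"
  "card (Xcol c :: (nat \<Rightarrow> 'a) set) = card (UNIV :: 'a set) ^ c"
proof -
  have "bij_betw (\<lambda>x i. if i < c then x i else 0) ({..<c} \<rightarrow>\<^sub>E (UNIV :: 'a set)) (Xcol c)"
    by (rule bij_betw_byWitness[where f' = "\<lambda>x. restrict x {..<c}"])
      (auto simp: Xcol_def fun_eq_iff PiE_def extensional_def)
  moreover have "finite ({..<c} \<rightarrow>\<^sub>E (UNIV :: 'a set))" by (intro finite_PiE) auto
  ultimately show "finite (Xcol c :: (nat \<Rightarrow> 'a) set)"
    "card (Xcol c :: (nat \<Rightarrow> 'a) set) = card (UNIV :: 'a set) ^ c"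
    by (auto simp: bij_betw_finite card_PiE dest: bij_betw_same_card[symmetric])
qed

lemma unipRad_Ucol: "c \<le> n \<Longrightarrow> unipRad n {c} \<subseteq> Ucol n c"
  by (auto simp: unipRad_def Ucol_def Uk_def)

text \<open>Removing column \<open>c\<close> by a left factor from \<open>Ncol\<close> leaves an
  element of the next smaller group; characters of \<open>Ucol n c\<close> can thus be checked on
  the two factors.\<close>

lemma Ucol_factor:
  assumes u: "u \<in> Ucol n c" and c: "c < n"
  defines "x \<equiv> \<lambda>i. if i < c then u $$ (i,c) else 0"
  shows "Ncol n c (\<lambda>i. - x i) * u \<in> Ucol n (Suc c)" "u = Ncol n c x * (Ncol n c (\<lambda>i. - x i) * u)"
    "x \<in> Xcol c"
proof -
  have uc: "u \<in> Uk n" "u \<in> carrier_mat n n" using u by (auto simp: Ucol_def Uk_carrier)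
  have N: "Ncol n c (\<lambda>i. - x i) \<in> Uk n" "Ncol n c x \<in> Uk n" using c by (auto intro: Ncol_Uk)
  show "Ncol n c (\<lambda>i. - x i) * u \<in> Ucol n (Suc c)"
  proof (rule UcolI)
    fix i j assume ij: "i < n" "j < Suc c" "j < n" "i < j"
    then have *: "(Ncol n c (\<lambda>i. - x i) * u) $$ (i,j) = u $$ (i,j) - x i * u $$ (c,j)"
      using uc c by (auto simp: Ncol_mult_entry)
    show "(Ncol n c (\<lambda>i. - x i) * u) $$ (i,j) = 0"
    proof (cases "j = c")
      case True
      then show ?thesis unfolding * using ij Uk_entry(1)[OF uc(1) c] by (simp add: x_def)
    next
      case False
      then have "u $$ (i,j) = 0" "u $$ (c,j) = 0" using ij u c by (auto simp: Ucol_entry)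
      then show ?thesis unfolding * by simp
    qed
  qed (use c N uc in \<open>auto intro: Uk_mult\<close>)
  have "Ncol n c x * (Ncol n c (\<lambda>i. - x i) * u) = (Ncol n c x * Ncol n c (\<lambda>i. - x i)) * u"
    using N uc by (simp add: GLn_assoc[where n = n] Uk_GLn)
  also have "\<dots> = u" using c uc by (simp add: Ncol_mult Ncol_zero GLn_one_mult Uk_GLn)
  finally show "u = Ncol n c x * (Ncol n c (\<lambda>i. - x i) * u)" by simp
  show "x \<in> Xcol c" by (simp add: x_def Xcol_def)
qed

text \<open>Up to column \<open>c\<close> the matrix \<open>u\<close> is the identity, so
  \<open>u\<close> times the column matrix agrees there with the column matrix, which its inverse
  cancels.\<close>

lemma Ucol_conj_Ncol:
  fixes u :: "'a::{field,finite} mat"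
  assumes u: "u \<in> Ucol n (Suc c)" and c: "c < n"
  shows "Ncol n c (\<lambda>i. - x i) * u * Ncol n c x \<in> Ucol n (Suc c)"
proof (rule UcolI)
  let ?N = "Ncol n c x" and ?M = "Ncol n c (\<lambda>i. - x i)"
  have N: "?N \<in> Uk n" "?M \<in> Uk n" "u \<in> Uk n" using c u by (auto intro: Ncol_Uk Ucol_Uk)
  note NG = N[THEN Uk_GLn] and NC = N[THEN Uk_carrier]
  show "?M * u * ?N \<in> Uk n" using N by (intro Uk_mult)
  have uN: "(u * ?N) $$ (i,j) = ?N $$ (i,j)" if "i < n" "j \<le> c" for i j
  proof -
    have j: "j < n" using that c by simp
    have "(u * ?N) $$ (i,j) = (\<Sum>k<n. u $$ (i,k) * ?N $$ (k,j))" using NC that j by (intro mat_mult_entry)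
    also have "\<dots> = (\<Sum>k<n. if i = k then ?N $$ (k,j) else 0)"
    proof (rule sum.cong[OF refl])
      fix k assume "k \<in> {..<n}"
      then have k: "k < n" by simp
      show "u $$ (i,k) * ?N $$ (k,j) = (if i = k then ?N $$ (k,j) else 0)"
      proof (cases "k \<le> c")
        case True
        then show ?thesis using u that k by (auto simp: Ucol_entry)
      next
        case False
        then have "?N $$ (k,j) = 0" using that k j c by (auto simp: Ncol_entry)
        then show ?thesis by simp
      qed
    qed
    finally show ?thesis using that by simp
  qed
  fix i j assume ij: "i < n" "j < Suc c" "j < n" "i < j"
  have "(?M * u * ?N) $$ (i,j) = (?M * (u * ?N)) $$ (i,j)" using NG by (simp add: GLn_assoc[where n = n])
  also have "\<dots> = (u * ?N) $$ (i,j) + (if i < c then - x i * (u * ?N) $$ (c,j) else 0)"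
    using ij c NC by (intro Ncol_mult_entry) auto
  also have "\<dots> = ?N $$ (i,j) + (if i < c then - x i * ?N $$ (c,j) else 0)"
    using uN[of i j] uN[of c j] ij c by simp
  also have "\<dots> = 0" using ij c by (auto simp: Ncol_entry)
  finally show "(?M * u * ?N) $$ (i,j) = 0" .
qed (use c in simp)

text \<open>The subgroup GL_c embedded in the upper left corner; it acts on the characters of column
  \<open>c\<close>.\<close>

definition blk :: "nat \<Rightarrow> nat \<Rightarrow> 'a::field mat set" where
  "blk n c = {G \<in> GLn n. \<forall>i<n. \<forall>j<n. c \<le> i \<or> c \<le> j \<longrightarrow> G $$ (i,j) = (if i = j then 1 else 0)}"

lemma blk_GLn: "G \<in> blk n c \<Longrightarrow> G \<in> GLn n"
  by (simp add: blk_def)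

lemma blk_entry: "G \<in> blk n c \<Longrightarrow> i < n \<Longrightarrow> j < n \<Longrightarrow> c \<le> i \<or> c \<le> j \<Longrightarrow> G $$ (i,j) = (if i = j then 1 else 0)"
  by (auto simp: blk_def)

lemma blk_Mir: "G \<in> blk n c \<Longrightarrow> c < n \<Longrightarrow> G \<in> Mir n"
  by (auto simp: blk_def Mir_def)

context nontriv_character
begin

text \<open>Conjugation by \<open>G\<close> acts linearly on the coordinates of column
  \<open>c\<close>. That every \<open>x\<close> occurs follows from injectivity of this action on a
  finite set, which avoids writing down the inverse matrix.\<close>

lemma blk_Ncol:
  fixes G :: "'k mat"
  assumes G: "G \<in> blk n c" and c: "c < n" and x: "x \<in> Xcol c"
  shows "\<exists>y\<in>Xcol c. Ncol n c x * G = G * Ncol n c y \<and> (\<forall>i<c. x i = (\<Sum>k<c. G $$ (i,k) * y k))"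
proof -
  define F where "F y = (\<lambda>i. if i < c then \<Sum>k<c. G $$ (i,k) * y k else 0)" for y :: "nat \<Rightarrow> 'k"
  have GG: "G \<in> GLn n" "G \<in> carrier_mat n n" using G by (auto simp: blk_def GLn_carrier)
  have FX: "F y \<in> Xcol c" for y by (simp add: F_def Xcol_def)
  have comm: "Ncol n c (F y) * G = G * Ncol n c y" for y
  proof (rule eq_matI)
    fix i j assume "i < dim_row (G * Ncol n c y)" "j < dim_col (G * Ncol n c y)"
    then have ij: "i < n" "j < n" using GG by (auto simp: Ncol_def row_tv_def)
    have "(G * Ncol n c y) $$ (i,j) = (\<Sum>k<n. G $$ (i,k) * Ncol n c y $$ (k,j))"
      using GG c ij by (intro mat_mult_entry) (auto intro: Ncol_Uk Uk_carrier)
    also have "\<dots> = (\<Sum>k<n. (if k = j then G $$ (i,k) else 0) + (if j = c \<and> k < c then G $$ (i,k) * y k else 0))"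
      using ij c by (intro sum.cong) (auto simp: Ncol_entry algebra_simps)
    also have "\<dots> = G $$ (i,j) + (\<Sum>k<n. if j = c \<and> k < c then G $$ (i,k) * y k else 0)"
      using ij by (simp add: sum.distrib)
    also have "(\<Sum>k<n. if j = c \<and> k < c then G $$ (i,k) * y k else 0) = (if j = c then \<Sum>k<c. G $$ (i,k) * y k else 0)"
      using c by (auto intro!: sum.mono_neutral_cong_right split: if_splits)
    also have "\<dots> = (if i < c then F y i * G $$ (c,j) else 0)"
    proof (cases "i < c")
      case True
      then show ?thesis using ij c by (simp add: F_def blk_entry[OF G])
    next
      case False
      then have "(\<Sum>k<c. G $$ (i,k) * y k) = 0" using ij c by (intro sum.neutral) (auto simp: blk_entry[OF G])
      then show ?thesis using False by simp
    qed
    also have "G $$ (i,j) + \<dots> = (Ncol n c (F y) * G) $$ (i,j)"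
      using GG ij c by (simp add: Ncol_mult_entry)
    finally show "(Ncol n c (F y) * G) $$ (i,j) = (G * Ncol n c y) $$ (i,j)" by simp
  qed (use GG in \<open>auto simp: Ncol_def row_tv_def\<close>)
  have "inj_on F (Xcol c)"
  proof (rule inj_onI)
    fix y z assume yz: "y \<in> Xcol c" "z \<in> Xcol c" "F y = F z"
    then have "G * Ncol n c y = G * Ncol n c z" using comm by metis
    then have "Ncol n c y = Ncol n c z"
      using ginv_cancel(2)[OF GG(1) Uk_GLn[OF Ncol_Uk[OF c]]] by metis
    then show "y = z" using Ncol_inj c yz by blast
  qed
  then have "F ` Xcol c = Xcol c" using FX Xcol_card(1) by (intro endo_inj_surj) auto
  then obtain y where "y \<in> Xcol c" "F y = x" using x by (metis imageE)
  then show ?thesis using comm[of y] by (auto simp: F_def)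
qed

text \<open>On \<open>Ucol n (Suc c)\<close> the character sees only superdiagonal entries in rows
  from \<open>c\<close> on, and there \<open>G\<close> is the identity. Hence conjugation by GL_c
  preserves both the group and the character.\<close>

lemma blk_Ucol:
  fixes G :: "'k mat"
  assumes G: "G \<in> blk n c" and c: "c < n" and u: "u \<in> Ucol n (Suc c)"
  shows "\<exists>v\<in>Ucol n (Suc c). u * G = G * v \<and> psiU psi n u = psiU psi n v"
proof -
  have GG: "G \<in> GLn n" "G \<in> carrier_mat n n" using G by (auto simp: blk_def GLn_carrier)
  \<comment> \<open>This is the conjugate of \<open>v\<close> by \<open>G\<close>, written by
    columns: beyond column \<open>c\<close>, right multiplication by the inverse of \<open>G\<close>
    changes nothing.\<close>
  define F where "F v = mat n n (\<lambda>(i,j). if j \<le> c then (if i = j then 1 else 0) else (G * v) $$ (i,j))" for v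
  have low: "(G * v) $$ (i,j) = v $$ (i,j)" if v: "v \<in> Ucol n (Suc c)" and "c \<le> i" "i < n" "j < n" for v i j
  proof -
    have "(G * v) $$ (i,j) = (\<Sum>k<n. G $$ (i,k) * v $$ (k,j))"
      using that by (intro mat_mult_entry[OF GG(2) Uk_carrier[OF Ucol_Uk[OF v]]]) auto
    also have "\<dots> = (\<Sum>k<n. if i = k then v $$ (k,j) else 0)"
      using that by (intro sum.cong) (auto simp: blk_entry[OF G])
    finally show ?thesis using that by simp
  qed
  have left: "(G * v) $$ (i,j) = G $$ (i,j)" if v: "v \<in> Ucol n (Suc c)" and "j \<le> c" "i < n" for v i j
  proof -
    have "(G * v) $$ (i,j) = (\<Sum>k<n. G $$ (i,k) * v $$ (k,j))"
      using that c by (intro mat_mult_entry[OF GG(2) Uk_carrier[OF Ucol_Uk[OF v]]]) auto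
    also have "\<dots> = (\<Sum>k<n. if k = j then G $$ (i,k) else 0)"
      using that c by (intro sum.cong) (auto simp: Ucol_entry)
    finally show ?thesis using that c by simp
  qed
  have F: "F v \<in> Ucol n (Suc c)" "F v * G = G * v" "psiU psi n (F v) = psiU psi n v"
    if v: "v \<in> Ucol n (Suc c)" for v
  proof -
    have vU: "v \<in> Uk n" using v by (rule Ucol_Uk)
    have Fe: "F v $$ (i,j) = (if j \<le> c then (if i = j then 1 else 0) else (G * v) $$ (i,j))"
      if "i < n" "j < n" for i j using that by (simp add: F_def)
    show "F v \<in> Ucol n (Suc c)"
      unfolding Ucol_def Uk_def using c vU
      by (auto simp: Fe low[OF v] Uk_entry F_def[THEN arg_cong[where f = "\<lambda>x. x \<in> _"]])
    show "F v * G = G * v"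
    proof (rule eq_matI)
      fix i j assume "i < dim_row (G * v)" "j < dim_col (G * v)"
      then have ij: "i < n" "j < n" using GG vU by (auto simp: Uk_def)
      have Fc: "F v \<in> carrier_mat n n" by (simp add: F_def)
      have "(F v * G) $$ (i,j) = (\<Sum>k<n. F v $$ (i,k) * G $$ (k,j))"
        using Fc GG ij by (intro mat_mult_entry)
      also have "\<dots> = (\<Sum>k<n. if k = (if j \<le> c then i else j) then (G * v) $$ (i,j) else 0)"
      proof (rule sum.cong[OF refl])
        fix k assume "k \<in> {..<n}"
        then have k: "k < n" by simp
        show "F v $$ (i,k) * G $$ (k,j) = (if k = (if j \<le> c then i else j) then (G * v) $$ (i,j) else 0)"
          using ij k c by (cases "j \<le> c"; cases "k \<le> c") (auto simp: Fe left[OF v] blk_entry[OF G])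
      qed
      finally show "(F v * G) $$ (i,j) = (G * v) $$ (i,j)" using ij by simp
    qed (use GG vU in \<open>auto simp: F_def Uk_def\<close>)
    have "F v $$ (i,i+1) = v $$ (i,i+1)" if "i < n - 1" for i
      using that v c by (cases "i + 1 \<le> c") (auto simp: Fe low[OF v] Ucol_entry)
    then show "psiU psi n (F v) = psiU psi n v" by (simp add: psiU_def)
  qed
  have "inj_on F (Ucol n (Suc c))"
  proof (rule inj_onI)
    fix v z assume vz: "v \<in> Ucol n (Suc c)" "z \<in> Ucol n (Suc c)" "F v = F z"
    then have "G * v = G * z" using F(2) by metis
    then show "v = z" using ginv_cancel(2)[OF GG(1) Uk_GLn[OF Ucol_Uk]] vz by metis
  qed
  moreover have "finite (Ucol n (Suc c) :: 'k mat set)"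
    by (rule finite_subset[OF _ finite_Uk[of n]]) (auto simp: Ucol_def)
  ultimately have "F ` Ucol n (Suc c) = Ucol n (Suc c)" using F(1) by (intro endo_inj_surj) auto
  then obtain v where "v \<in> Ucol n (Suc c)" "F v = u" using u by (metis imageE)
  then show ?thesis using F by metis
qed

text \<open>This gives transitivity of GL_c on the non-trivial characters of column
  \<open>c\<close>: any non-zero \<open>y\<close> can be made the last row of an invertible
  block.\<close>

lemma blk_with_row:
  fixes y :: "nat \<Rightarrow> 'k"
  assumes y: "y \<in> Xcol c" "y \<noteq> (\<lambda>i. 0)" and c: "1 \<le> c" "c < n"
  obtains G where "G \<in> blk n c" "\<And>k. k < c \<Longrightarrow> G $$ (c - 1,k) = y k"
proof -
  have low: "\<exists>G\<in>blk n c. \<forall>k<c. G $$ (c - 1,k) = z k" if z: "z (c - 1) \<noteq> 0" for z :: "nat \<Rightarrow> 'k"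
  proof -
    define G where "G = mat n n (\<lambda>(i,j). if i = c - 1 then (if j < c then z j else 0) else if i = j then 1 else 0)"
    have "det G = prod_list (diag_mat G)"
      using c by (intro det_lower_triangular[of n]) (auto simp: G_def)
    also have "\<dots> \<noteq> 0" using z c by (auto simp: diag_mat_def G_def prod_list_zero_iff)
    finally have "G \<in> blk n c" using c by (auto simp: blk_def GLn_def G_def)
    moreover have "\<forall>k<c. G $$ (c - 1,k) = z k" using c by (auto simp: G_def)
    ultimately show ?thesis by blast
  qed
  show ?thesis
  proof (cases "y (c - 1) = 0")
    case False
    then show ?thesis using low that by blast
  next
    case True
    obtain r where r: "y r \<noteq> 0" using y by auto
    then have rc: "r < c" "r \<noteq> c - 1" using y True by (auto simp: Xcol_def not_le[symmetric])
    \<comment> \<open>If the diagonal entry of the wanted row is zero, a non-zero coordinate is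
      copied into it, and subtracting column \<open>r\<close> afterwards removes it again.\<close>
    obtain L where L: "L \<in> blk n c" "\<And>k. k < c \<Longrightarrow> L $$ (c - 1,k) = (y(c - 1 := y r)) k"
      using low[of "y(c - 1 := y r)"] r by auto
    define G where "G = L * col_tv n r (\<lambda>j. if j = c - 1 then - 1 else 0)"
    have e: "G $$ (i,j) = L $$ (i,j) + L $$ (i,r) * (if j = c - 1 then - 1 else 0)" if "i < n" "j < n" for i j
      unfolding G_def using that L rc c by (intro col_tv_mult) (auto intro: blk_GLn GLn_carrier)
    have "G \<in> GLn n" unfolding G_def using L rc c by (intro GLn_mult blk_GLn col_tv_GLn) auto
    then have "G \<in> blk n c" using c rc by (auto simp: blk_def e blk_entry[OF L(1)])
    moreover have "G $$ (c - 1,k) = y k" if "k < c" for k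
      using that c rc True L(2)[of k] L(2)[of r] by (auto simp: e)
    ultimately show ?thesis using that by blast
  qed
qed

lemma character_sum:
  assumes x: "x \<in> Xcol c"
  shows "(\<Sum>y\<in>Xcol c. psi (- (\<Sum>i<c. y i * x i))) = (if x = (\<lambda>i. 0) then of_nat (card (Xcol c :: (nat \<Rightarrow> 'k) set)) else 0)"
proof (cases "x = (\<lambda>i. 0)")
  case True
  then show ?thesis by (simp add: psi_0)
next
  case False
  then obtain r where r: "x r \<noteq> 0" by auto
  then have rc: "r < c" using x by (auto simp: Xcol_def not_le[symmetric])
  obtain t where t: "psi t \<noteq> 1" using psi_nontriv by blast
  \<comment> \<open>Shifting the summation variable by \<open>z\<close> multiplies every term by
    \<open>psi t\<close>, so the sum equals \<open>psi t\<close> times itself.\<close>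
  define z where "z = (\<lambda>i. if i = r then - t / x r else 0)"
  have "(\<Sum>i<c. z i * x i) = (\<Sum>i<c. if i = r then - t else 0)" using r by (intro sum.cong) (auto simp: z_def)
  then have z: "(\<Sum>i<c. z i * x i) = - t" "z \<in> Xcol c" using rc by (auto simp: z_def Xcol_def)
  let ?S = "\<Sum>y\<in>Xcol c. psi (- (\<Sum>i<c. y i * x i))"
  have "?S = (\<Sum>y\<in>Xcol c. psi (- (\<Sum>i<c. (y i + z i) * x i)))"
    by (rule sum.reindex_bij_witness[of _ "\<lambda>y i. y i + z i" "\<lambda>y i. y i - z i"])
      (use z in \<open>auto simp: Xcol_def\<close>)
  also have "\<dots> = (\<Sum>y\<in>Xcol c. psi t * psi (- (\<Sum>i<c. y i * x i)))"
    using z(1) by (simp add: algebra_simps sum.distrib psi_add[symmetric])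
  also have "\<dots> = psi t * ?S" by (simp add: sum_distrib_left)
  finally have "(1 - psi t) * ?S = 0" by (simp add: algebra_simps)
  then show ?thesis using t False by simp
qed

end

context cuspidal_model
begin

lemma rt_fun_scale: "rt n g (\<lambda>y. c * F y) = (\<lambda>y. c * rt n g F y)"
  by (auto simp: rt_def fun_eq_iff)

text \<open>One step of the Gelfand--Kazhdan argument: Fourier expansion along the column \<open>c\<close>. The constant
  term vanishes by cuspidality and the other characters are permuted transitively by \<open>GL\<^sub>c\<close>.\<close>

lemma fourier_step:
  assumes c: "1 \<le> c" "c < n"
    and V0: "V0 \<subseteq> Wt" "\<And>W p. W \<in> V0 \<Longrightarrow> p \<in> Mir n \<Longrightarrow> rt n p W \<in> V0"
      "\<And>(I :: (nat \<Rightarrow> 'k) set) a F. finite I \<Longrightarrow> (\<And>i. i \<in> I \<Longrightarrow> F i \<in> V0) \<Longrightarrow> (\<lambda>y. \<Sum>i\<in>I. a i * F i y) \<in> V0"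
    and w: "w \<in> V0" "w \<noteq> 0" "\<And>u. u \<in> Ucol n (Suc c) \<Longrightarrow> rt n u w = (\<lambda>y. psiU psi n u * w y)"
  shows "\<exists>w\<in>V0. w \<noteq> 0 \<and> (\<forall>u\<in>Ucol n c. rt n u w = (\<lambda>y. psiU psi n u * w y))"
proof -
  define N where "N x = Ncol n c x" for x :: "nat \<Rightarrow> 'k"
  define X where "X = (Xcol c :: (nat \<Rightarrow> 'k) set)"
  define dot where "dot y x = (\<Sum>i<c. y i * x i)" for y x :: "nat \<Rightarrow> 'k"
  have dot_add: "dot y (\<lambda>i. x i + x' i) = dot y x + dot y x'" for y x x'
    by (simp add: dot_def algebra_simps sum.distrib)
  have X: "finite X" "of_nat (card X) \<noteq> (0::'r)"
    using Xcol_card[where 'a = 'k, of c] card_power_neq_0 by (auto simp: X_def)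
  have XI: "(\<lambda>i. x i + x' i) \<in> X" "(\<lambda>i. x i - x' i) \<in> X" "(\<lambda>i. - x i) \<in> X" "(\<lambda>i. 0) \<in> X"
    if "x \<in> X" "x' \<in> X" for x x' using that by (auto simp: X_def Xcol_def)
  have NU: "N x \<in> Uk n" "N x \<in> GLn n" "N x \<in> Mir n" for x
    using c Ncol_Uk[of c n x] by (auto simp: N_def Uk_GLn Ncol_Mir)
  have NN: "N x * N x' = N (\<lambda>i. x i + x' i)" for x x' using c by (simp add: N_def Ncol_mult)
  have N0: "N (\<lambda>i. 0) = 1\<^sub>m n" using c by (simp add: N_def Ncol_zero)
  \<comment> \<open>The component of \<open>w\<close> on which the column group acts through the
    character with parameter \<open>y\<close>, up to the invertible factor
    \<open>card X\<close>.\<close>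
  define wy where "wy y = (\<lambda>z. \<Sum>x\<in>X. psi (- dot y x) * rt n (N x) w z)" for y
  have wyV: "wy y \<in> V0" for y unfolding wy_def using X w V0 NU by (intro V0(3)) auto
  have wyU: "rt n u (wy y) = (\<lambda>z. psiU psi n u * wy y z)" if u: "u \<in> Ucol n (Suc c)" for u y
  proof -
    have uU: "u \<in> Uk n" "u \<in> GLn n" using u by (auto dest: Ucol_Uk Uk_GLn)
    have "rt n u (rt n (N x) w) = (\<lambda>z. psiU psi n u * rt n (N x) w z)" for x
    proof -
      \<comment> \<open>Moving \<open>u\<close> past \<open>N x\<close> replaces it by this
        conjugate, which has the same character value because psi is multiplicative on U.\<close>
      define v where "v = N (\<lambda>i. - x i) * u * N x"
      have v: "v \<in> Ucol n (Suc c)" unfolding v_def N_def using u c by (intro Ucol_conj_Ncol) auto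
      then have vU: "v \<in> Uk n" "v \<in> GLn n" by (auto dest: Ucol_Uk Uk_GLn)
      have "N x * v = N x * N (\<lambda>i. - x i) * (u * N x)"
        unfolding v_def using NU uU by (simp add: GLn_assoc[where n = n] GLn_mult)
      then have eq: "N x * v = u * N x" using NU uU by (simp add: NN N0 GLn_one_mult GLn_mult)
      have "psiU psi n (N x) * psiU psi n v = psiU psi n u * psiU psi n (N x)"
        using eq NU vU uU by (metis psiU_mult)
      then have P: "psiU psi n v = psiU psi n u" using psiU_nonzero by simp
      have "rt n u (rt n (N x) w) = rt n (N x) (rt n v w)"
        using NU uU vU by (simp add: rt_rt eq)
      then show ?thesis using w(3)[OF v] by (simp add: P rt_fun_scale)
    qed
    then show ?thesis unfolding wy_def rt_lincomb by (simp add: sum_distrib_left mult.left_commute)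
  qed
  have wyN: "rt n (N x0) (wy y) = (\<lambda>z. psi (dot y x0) * wy y z)" if x0: "x0 \<in> X" for x0 y
  proof
    fix z
    have "rt n (N x0) (wy y) z = (\<Sum>x\<in>X. psi (- dot y x) * rt n (N (\<lambda>i. x0 i + x i)) w z)"
      unfolding wy_def rt_lincomb using NU by (simp add: rt_rt NN)
    also have "\<dots> = (\<Sum>x\<in>X. psi (- dot y (\<lambda>i. x i - x0 i)) * rt n (N x) w z)"
      by (rule sum.reindex_bij_witness[of _ "\<lambda>x i. x i - x0 i" "\<lambda>x i. x0 i + x i"])
        (use x0 XI in auto)
    also have "\<dots> = psi (dot y x0) * wy y z"
      unfolding wy_def sum_distrib_left
    proof (rule sum.cong[OF refl])
      fix x
      have "dot y x = dot y (\<lambda>i. x i - x0 i) + dot y x0" using dot_add[of y "\<lambda>i. x i - x0 i" x0] by simp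
      then have "- dot y (\<lambda>i. x i - x0 i) = dot y x0 + - dot y x" by simp
      then show "psi (- dot y (\<lambda>i. x i - x0 i)) * rt n (N x) w z = psi (dot y x0) * (psi (- dot y x) * rt n (N x) w z)"
        by (simp only: psi_add mult.assoc)
    qed
    finally show "rt n (N x0) (wy y) z = psi (dot y x0) * wy y z" .
  qed
  \<comment> \<open>On the radical attached to \<open>c\<close> the character depends only on the
    entry \<open>(c - 1, c)\<close>, and this entry sits in the column factor. So the other factor
    has character value 1, and the trivial component is fixed by the whole radical.\<close>
  have "wy (\<lambda>i. 0) = 0"
  proof (rule cuspidal_radical[of "{c}"])
    show "wy (\<lambda>i. 0) \<in> Wt" using wyV V0 by blast
    fix u :: "'k mat" assume u: "u \<in> unipRad n {c}"
    then have uc: "u \<in> Ucol n c" using unipRad_Ucol[of c n] c by auto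
    define x where "x = (\<lambda>i. if i < c then u $$ (i,c) else 0)"
    define u' where "u' = N (\<lambda>i. - x i) * u"
    have f: "u' \<in> Ucol n (Suc c)" "u = N x * u'" "x \<in> X"
      using Ucol_factor[OF uc c(2)] by (auto simp: u'_def N_def x_def X_def)
    have "psiU psi n u = psi (u $$ (c - 1,c))"
    proof (rule psiU_single[of _ _ "c - 1"])
      fix i assume "i < n - 1"
      then have i: "i < n" "Suc i < n" "i \<noteq> c - 1 \<Longrightarrow> \<not> (i < c \<and> c \<le> Suc i)" by auto
      have "i \<noteq> c - 1 \<Longrightarrow> u $$ (i,Suc i) = 0" using u i unfolding unipRad_def by blast
      then show "u $$ (i,i+1) = (if i = c - 1 then u $$ (c - 1,c) else 0)" using c by auto
    qed (use c in auto)
    moreover have "psiU psi n (N x) = psi (x (c - 1))"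
      by (rule psiU_single[of _ _ "c - 1"]) (use c in \<open>auto simp: N_def Ncol_entry\<close>)
    moreover have "psiU psi n u = psiU psi n (N x) * psiU psi n u'"
      using f NU by (metis psiU_mult Ucol_Uk)
    ultimately have P: "psiU psi n u' = 1" using c psi_nonzero by (simp add: x_def)
    have "rt n u (wy (\<lambda>i. 0)) = rt n (N x) (rt n u' (wy (\<lambda>i. 0)))"
      using f NU by (simp add: rt_rt Uk_GLn[OF Ucol_Uk])
    also have "\<dots> = wy (\<lambda>i. 0)" using wyU[OF f(1)] P wyN[OF f(3), of "\<lambda>i. 0"] by (simp add: dot_def psi_0)
    finally show "rt n u (wy (\<lambda>i. 0)) = wy (\<lambda>i. 0)" .
  qed (use c in auto)
  \<comment> \<open>By orthogonality of characters the components add up to \<open>card X\<close>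
    times \<open>w\<close>, so they cannot all vanish.\<close>
  moreover have "\<exists>y\<in>X. wy y \<noteq> 0"
  proof (rule ccontr)
    assume "\<not> ?thesis"
    then have z: "\<And>y. y \<in> X \<Longrightarrow> wy y = 0" by blast
    have "of_nat (card X) * w z = 0" for z
    proof -
      have "0 = (\<Sum>y\<in>X. wy y z)" using z by simp
      also have "\<dots> = (\<Sum>x\<in>X. (\<Sum>y\<in>X. psi (- dot y x)) * rt n (N x) w z)"
        unfolding wy_def by (subst sum.swap) (simp add: sum_distrib_right)
      also have "\<dots> = (\<Sum>x\<in>X. if x = (\<lambda>i. 0) then of_nat (card X) * rt n (N x) w z else 0)"
        using character_sum[of _ c] by (intro sum.cong) (auto simp: X_def dot_def)
      also have "\<dots> = of_nat (card X) * rt n (N (\<lambda>i. 0)) w z"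
        using X XI by (simp add: X_def Xcol_def)
      finally show ?thesis using w V0 by (simp add: N0 Wt_rt_one subset_iff)
    qed
    then show False using X w by (auto simp: fun_eq_iff)
  qed
  ultimately obtain y where y: "y \<in> X" "y \<noteq> (\<lambda>i. 0)" "wy y \<noteq> 0" by metis
  \<comment> \<open>The action of this \<open>G\<close> carries the character with parameter
    \<open>y\<close> to the restriction of psi, which reads off coordinate
    \<open>c - 1\<close>.\<close>
  obtain G where G: "G \<in> blk n c" "\<And>k. k < c \<Longrightarrow> G $$ (c - 1,k) = y k"
    using blk_with_row[of y c n] y c by (auto simp: X_def)
  note GG = blk_GLn[OF G(1)]
  define v where "v = rt n G (wy y)"
  have vV: "v \<in> V0" unfolding v_def using wyV V0(2) blk_Mir[OF G(1)] c by blast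
  have "v \<noteq> 0"
  proof
    assume "v = 0"
    then have "rt n (ginv G) v = 0" by (auto simp: rt_def fun_eq_iff)
    then have "rt n (1\<^sub>m n) (wy y) = 0" using GG by (simp add: v_def rt_rt ginv)
    then show False using wyV V0 y by (simp add: Wt_rt_one subset_iff)
  qed
  moreover have "rt n u v = (\<lambda>z. psiU psi n u * v z)" if u: "u \<in> Ucol n c" for u
  proof -
    define x where "x = (\<lambda>i. if i < c then u $$ (i,c) else 0)"
    define u' where "u' = N (\<lambda>i. - x i) * u"
    have f: "u' \<in> Ucol n (Suc c)" "u = N x * u'" "x \<in> X"
      using Ucol_factor[OF u c(2)] by (auto simp: u'_def N_def x_def X_def)
    have u'U: "u' \<in> Uk n" "u' \<in> GLn n" using f by (auto dest: Ucol_Uk Uk_GLn)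
    obtain u'' where u'': "u'' \<in> Ucol n (Suc c)" "u' * G = G * u''" "psiU psi n u' = psiU psi n u''"
      using blk_Ucol[OF G(1) c(2) f(1)] by blast
    obtain x' where x': "x' \<in> X" "N x * G = G * N x'" "\<forall>i<c. x i = (\<Sum>k<c. G $$ (i,k) * x' k)"
      using blk_Ncol[OF G(1) c(2)] f(3) by (auto simp: X_def N_def)
    have "x (c - 1) = dot y x'" using x'(3) c G(2) by (simp add: dot_def)
    moreover have "psiU psi n (N x) = psi (x (c - 1))"
      by (rule psiU_single[of _ _ "c - 1"]) (use c in \<open>auto simp: N_def Ncol_entry\<close>)
    ultimately have Px: "psiU psi n (N x) = psi (dot y x')" by simp
    have "rt n u' v = rt n G (rt n u'' (wy y))"
      unfolding v_def using GG u'U u'' by (simp add: rt_rt Uk_GLn[OF Ucol_Uk])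
    also have "\<dots> = (\<lambda>z. psiU psi n u' * v z)" using wyU[OF u''(1)] u'' by (simp add: rt_fun_scale v_def)
    finally have 1: "rt n u' v = (\<lambda>z. psiU psi n u' * v z)" .
    have "rt n (N x) v = rt n G (rt n (N x') (wy y))"
      unfolding v_def using GG NU x' by (simp add: rt_rt)
    also have "\<dots> = (\<lambda>z. psiU psi n (N x) * v z)" using wyN[OF x'(1)] Px by (simp add: rt_fun_scale v_def)
    finally have 2: "rt n (N x) v = (\<lambda>z. psiU psi n (N x) * v z)" .
    have "rt n u v = rt n (N x) (rt n u' v)" using f(2) NU u'U by (simp add: rt_rt)
    also have "\<dots> = (\<lambda>z. psiU psi n u' * (psiU psi n (N x) * v z))" unfolding 1 rt_fun_scale 2 ..
    also have "\<dots> = (\<lambda>z. psiU psi n u * v z)"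
    proof -
      have "psiU psi n u = psiU psi n (N x) * psiU psi n u'" using f NU u'U by (metis psiU_mult)
      then show ?thesis by (simp add: mult_ac)
    qed
    finally show ?thesis .
  qed
  ultimately show ?thesis using vV by blast
qed

lemma Mir_one: "1\<^sub>m n \<in> Mir n"
  using n2 by (auto simp: Mir_def GLn_one)

lemma Mir_mult:
  assumes "p \<in> Mir n" "p' \<in> Mir n" shows "p * p' \<in> Mir n"
proof -
  have pG: "p \<in> GLn n" "p' \<in> GLn n" using assms by (auto simp: Mir_def)
  have "(p * p') $$ (n-1,j) = (if j = n - 1 then 1 else 0)" if j: "j < n" for j
  proof -
    have "(p * p') $$ (n-1,j) = (\<Sum>k<n. p $$ (n-1,k) * p' $$ (k,j))"
      using pG j n2 by (intro mat_mult_entry GLn_carrier) auto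
    also have "\<dots> = (\<Sum>k<n. if k = n - 1 then p' $$ (k,j) else 0)"
      using assms by (intro sum.cong) (auto simp: Mir_def)
    also have "\<dots> = p' $$ (n-1,j)" using n2 by simp
    finally show ?thesis using assms j by (simp add: Mir_def)
  qed
  then show ?thesis using pG by (simp add: Mir_def GLn_mult)
qed

text \<open>The functions vanishing on the mirabolic form a space stable under it, and every step of
  the Fourier expansion stays in this space. A non-zero member would therefore lead to a non-zero
  (U, psi)-vector in it, that is, to a multiple of the Bessel function vanishing at the
  identity.\<close>

theorem mirabolic_restriction_injective:
  assumes W: "W \<in> Wt" "\<And>p. p \<in> Mir n \<Longrightarrow> W p = 0"
  shows "W = 0"
proof (rule ccontr)
  assume "W \<noteq> 0"
  define V0 where "V0 = {W\<in>Wt. \<forall>p\<in>Mir n. W p = 0}"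
  have V0: "V0 \<subseteq> Wt" "\<And>W p. W \<in> V0 \<Longrightarrow> p \<in> Mir n \<Longrightarrow> rt n p W \<in> V0"
      "\<And>(I :: (nat \<Rightarrow> 'k) set) a F. finite I \<Longrightarrow> (\<And>i. i \<in> I \<Longrightarrow> F i \<in> V0) \<Longrightarrow> (\<lambda>y. \<Sum>i\<in>I. a i * F i y) \<in> V0"
    by (auto simp: V0_def rt_def Mir_mult intro: Wt_sum) (auto simp: Mir_def intro: Wt_rt[unfolded rt_def])
  \<comment> \<open>The parameter is \<open>c = n - d\<close>; each step enlarges by one column the
    group that acts through psi.\<close>
  have "\<exists>w\<in>V0. w \<noteq> 0 \<and> (\<forall>u\<in>Ucol n (n - d). rt n u w = (\<lambda>y. psiU psi n u * w y))" if "d < n" for d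
    using that
  proof (induction d)
    case 0
    have "u = 1\<^sub>m n" if "u \<in> Ucol n n" for u :: "'k mat"
      using that Ucol_entry[OF that] by (intro eq_matI) (auto dest!: Ucol_Uk Uk_carrier)
    moreover have "W \<in> V0" using W by (simp add: V0_def)
    moreover have "rt n (1\<^sub>m n) W = (\<lambda>y. psiU psi n (1\<^sub>m n) * W y)" using W by (simp add: Wt_rt_one psiU_one)
    ultimately show ?case using \<open>W \<noteq> 0\<close> by (intro bexI[of _ W]) (auto simp only: diff_zero)
  next
    case (Suc d)
    have eq: "n - d = Suc (n - Suc d)" using Suc.prems by simp
    from Suc.IH[OF Suc_lessD[OF Suc.prems], unfolded eq] obtain w where "w\<in>V0" "w \<noteq> 0"
      "\<And>u. u\<in>Ucol n (Suc (n - Suc d)) \<Longrightarrow> rt n u w = (\<lambda>y. psiU psi n u * w y)" by blast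
    note w = this
    show ?case by (rule fourier_step[OF _ _ V0 w]) (use Suc.prems in auto)
  qed
  from this[of "n - 1"] obtain w where w: "w \<in> V0" "w \<noteq> 0"
    "\<And>u. u\<in>Ucol n 1 \<Longrightarrow> rt n u w = (\<lambda>y. psiU psi n u * w y)" using n2 by auto
  have "(Ucol n 1 :: 'k mat set) = Uk n" by (auto simp: Ucol_def)
  then have "w (g * u) = psiU psi n u * w g" if "g \<in> GLn n" "u \<in> Uk n" for g u
    using fun_cong[OF w(3)[of u], of g] that rt_apply[of g n u w] by simp
  then have "equivariant n w" using w V0 Wt_outside by (auto simp: equivariant_def)
  then have "w = (\<lambda>y. w (1\<^sub>m n) * B y)" using equivariant_eq_bessel w V0 by blast
  moreover have "w (1\<^sub>m n) = 0" using w Mir_one by (auto simp: V0_def)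
  ultimately show False using w(2) by (auto simp: fun_eq_iff)
qed

end

section \<open>The line of invariants under the lower triangular Borel subgroup\<close>

lemma Bop_carrier: "b \<in> Bop n \<Longrightarrow> b \<in> carrier_mat n n"
  by (simp add: Bop_def)

lemma Bop_GLn: assumes b: "b \<in> Bop n" and n: "n \<ge> 1" shows "b \<in> GLn n"
proof -
  have "det b = prod_list (diag_mat b)"
    using b by (intro det_lower_triangular[of n]) (auto simp: Bop_def)
  also have "\<dots> \<noteq> 0"
  proof -
    have "b $$ (i,i) \<noteq> 0" if "i < n" for i
      using b that n by (cases "i = n - 1") (auto simp: Bop_def)
    then show ?thesis using b by (auto simp: diag_mat_def prod_list_zero_iff Bop_def)
  qed
  finally show ?thesis using b by (simp add: GLn_def Bop_def)
qed

lemma Bop_one: "n \<ge> 1 \<Longrightarrow> 1\<^sub>m n \<in> Bop n"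
  by (auto simp: Bop_def)

lemma Bop_mult:
  assumes b: "b \<in> Bop n" "b' \<in> Bop n" and n: "n \<ge> 1" shows "b * b' \<in> Bop n"
proof -
  have bc: "b \<in> carrier_mat n n" "b' \<in> carrier_mat n n" using b by (auto simp: Bop_def)
  have e: "(b * b') $$ (i,j) = (\<Sum>k\<in>{j..i}. b $$ (i,k) * b' $$ (k,j))" if "i < n" "j < n" for i j
  proof -
    have "(b * b') $$ (i,j) = (\<Sum>k<n. b $$ (i,k) * b' $$ (k,j))"
      using bc that by (intro mat_mult_entry)
    also have "\<dots> = (\<Sum>k\<in>{j..i}. b $$ (i,k) * b' $$ (k,j))"
      using that b by (intro sum.mono_neutral_right) (auto simp: Bop_def)
    finally show ?thesis .
  qed
  have 1: "(b * b') $$ (i,j) = 0" if "i < n" "j < n" "i < j" for i j using that by (simp add: e)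
  have 2: "(b * b') $$ (i,i) \<noteq> 0" if "i < n - 1" for i
    using that b by (simp add: e Bop_def)
  have 3: "(b * b') $$ (n-1,j) = (if j = n - 1 then 1 else 0)" if "j < n" for j
  proof -
    have "(b * b') $$ (n-1,j) = (\<Sum>k<n. b $$ (n-1,k) * b' $$ (k,j))"
      using bc that by (intro mat_mult_entry) auto
    also have "\<dots> = (\<Sum>k<n. if k = n - 1 then b' $$ (k,j) else 0)"
      using b by (intro sum.cong) (auto simp: Bop_def)
    also have "\<dots> = b' $$ (n-1,j)" using n by simp
    finally show ?thesis using b that by (auto simp: Bop_def)
  qed
  show ?thesis unfolding Bop_def using bc 1 2 3 n by auto
qed

lemma finite_Bop: "finite (Bop n :: 'a::{field,finite} mat set)"
  by (rule finite_subset[OF _ finite_carrier_mat[of n n]]) (auto simp: Bop_def)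

text \<open>Strict growth gives \<open>j \<le> q j\<close> counted from the left end and the
  opposite bound counted from the right end. It serves for permutations here and for exponent
  sequences at level n later.\<close>

lemma perm_no_descent_id:
  fixes q :: "nat \<Rightarrow> nat"
  assumes "\<And>j. j < N \<Longrightarrow> q j < N" "\<And>j. Suc j < N \<Longrightarrow> q j < q (Suc j)" "j < N"
  shows "q j = j"
proof -
  have lo: "i \<le> q i" if "i < N" for i using that
  proof (induction i)
    case (Suc i)
    then show ?case using assms(2)[of i] by simp
  qed simp
  have hi: "q i + (N - 1 - i) \<le> N - 1" if "i < N" for i using that
  proof (induction "N - 1 - i" arbitrary: i)
    case 0
    then show ?case using assms(1)[of i] by simp
  next
    case (Suc d)
    then have "q (Suc i) + (N - 1 - Suc i) \<le> N - 1" by simp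
    then show ?case using assms(2)[of i] Suc by linarith
  qed
  show ?thesis using lo[OF assms(3)] hi[OF assms(3)] assms(3) by linarith
qed

definition rev_mat :: "nat \<Rightarrow> 'a::field mat" where
  "rev_mat N = mat N N (\<lambda>(i,j). if i + j = N - 1 then 1 else 0)"

lemma rev_mat_carrier [simp]: "rev_mat N \<in> carrier_mat N N"
  by (simp add: rev_mat_def)

lemma rev_mat_right:
  assumes "A \<in> carrier_mat N N" "i < N" "j < N"
  shows "(A * rev_mat N) $$ (i,j) = A $$ (i, N - 1 - j)"
proof -
  have "(A * rev_mat N) $$ (i,j) = (\<Sum>k<N. A $$ (i,k) * rev_mat N $$ (k,j))"
    using assms by (intro mat_mult_entry) auto
  also have "\<dots> = (\<Sum>k<N. if k = N - 1 - j then A $$ (i,k) else 0)"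
    using assms by (intro sum.cong) (auto simp: rev_mat_def)
  finally show ?thesis using assms by simp
qed

lemma rev_mat_left:
  assumes "A \<in> carrier_mat N N" "i < N" "j < N"
  shows "(rev_mat N * A) $$ (i,j) = A $$ (N - 1 - i, j)"
proof -
  have "(rev_mat N * A) $$ (i,j) = (\<Sum>k<N. rev_mat N $$ (i,k) * A $$ (k,j))"
    using assms by (intro mat_mult_entry) auto
  also have "\<dots> = (\<Sum>k<N. if k = N - 1 - i then A $$ (k,j) else 0)"
    using assms by (intro sum.cong) (auto simp: rev_mat_def)
  finally show ?thesis using assms by simp
qed

lemma rev_mat_square: "rev_mat N * rev_mat N = 1\<^sub>m N"
  by (rule eq_matI) (auto simp: rev_mat_right simp del: index_mult_mat(1), auto simp: rev_mat_def)

lemma rev_mat_GLn: "rev_mat N \<in> GLn N"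
  by (rule GLn_I_right[OF _ _ rev_mat_square]) auto

text \<open>The Bruhat decomposition of \<open>g\<close> times the longest permutation matrix;
  conjugating the right factor by that matrix makes it lower unitriangular.\<close>

lemma bruhat_opposite:
  fixes g :: "'a::{field,finite} mat"
  assumes g: "g \<in> GLn N"
  obtains u m l p where "u \<in> Uk N" "m \<in> GLn N" "monomial_mat N p m" "g = u * m * l"
    "l \<in> carrier_mat N N" "\<And>i j. i < N \<Longrightarrow> j < N \<Longrightarrow> i < j \<Longrightarrow> l $$ (i,j) = 0" "\<And>i. i < N \<Longrightarrow> l $$ (i,i) = 1"
proof -
  let ?R = "rev_mat N"
  obtain u u' m p where *: "u \<in> Uk N" "u' \<in> Uk N" "m \<in> GLn N" "monomial_mat N p m" "g * ?R = u * m * u'"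
    using bruhat_decomposition[OF GLn_mult[OF g rev_mat_GLn]] by blast
  define m' l where "m' = m * ?R" and "l = ?R * u' * ?R"
  have RR: "?R * (?R * A) = A" if "A \<in> GLn N" for A
    using that by (simp add: GLn_assoc[where n = N, symmetric] rev_mat_GLn rev_mat_square GLn_one_mult)
  have "g = g * ?R * ?R" using g by (simp add: GLn_assoc[where n = N] rev_mat_GLn rev_mat_square GLn_one_mult)
  also have "\<dots> = u * m' * l" unfolding *(5) m'_def l_def
    using * by (simp add: GLn_assoc[where n = N] rev_mat_GLn GLn_mult Uk_GLn RR)
  finally have gl: "g = u * m' * l" .
  have le: "l $$ (i,j) = u' $$ (N - 1 - i, N - 1 - j)" if "i < N" "j < N" for i j
    unfolding l_def using that *(2) by (simp add: rev_mat_right rev_mat_left Uk_carrier mult_carrier_mat[of _ N N] del: index_mult_mat(1))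
  have me: "m' $$ (i,j) = m $$ (i, N - 1 - j)" if "i < N" "j < N" for i j
    unfolding m'_def using that *(3) by (simp add: rev_mat_right GLn_carrier del: index_mult_mat(1))
  have inj: "inj_on (\<lambda>j. p (N - 1 - j)) {..<N}"
  proof (rule inj_onI)
    fix a b assume ab: "a \<in> {..<N}" "b \<in> {..<N}" "p (N - 1 - a) = p (N - 1 - b)"
    then have "N - 1 - a = N - 1 - b" using *(4) by (auto simp: monomial_mat_def dest: inj_onD)
    then show "a = b" using ab by auto
  qed
  have "monomial_mat N (\<lambda>j. p (N - 1 - j)) m'"
    using *(4) inj by (auto simp: monomial_mat_def me image_subset_iff) (simp add: m'_def)
  moreover have "m' \<in> GLn N" unfolding m'_def using * by (intro GLn_mult rev_mat_GLn)
  moreover have "l \<in> carrier_mat N N"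
    unfolding l_def using Uk_carrier[OF *(2)] by (auto intro!: mult_carrier_mat[of _ N N])
  moreover have "l $$ (i,j) = 0" if "i < N" "j < N" "i < j" for i j
    unfolding le[OF that(1,2)] using that by (intro Uk_entry(2)[OF *(2)]) auto
  moreover have "l $$ (i,i) = 1" if "i < N" for i
    unfolding le[OF that that] using that by (intro Uk_entry(1)[OF *(2)]) auto
  ultimately show ?thesis using that[of u m' "\<lambda>j. p (N - 1 - j)" l] *(1) gl by blast
qed

definition emb :: "nat \<Rightarrow> 'a::field mat \<Rightarrow> 'a mat" where
  "emb n g = mat n n (\<lambda>(i,j). if i < n - 1 \<and> j < n - 1 then g $$ (i,j) else if i = j then 1 else 0)"

lemma emb_carrier [simp]: "emb n g \<in> carrier_mat n n"
  by (simp add: emb_def)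

lemma emb_entry: "i < n \<Longrightarrow> j < n \<Longrightarrow>
  emb n g $$ (i,j) = (if i < n - 1 \<and> j < n - 1 then g $$ (i,j) else if i = j then 1 else 0)"
  by (simp add: emb_def)

lemma emb_mult:
  fixes g h :: "'a::field mat"
  assumes n: "n \<ge> 1" and g: "g \<in> carrier_mat (n-1) (n-1)" and h: "h \<in> carrier_mat (n-1) (n-1)"
  shows "emb n (g * h) = emb n g * emb n h"
proof (rule eq_matI)
  fix i j assume "i < dim_row (emb n g * emb n h)" "j < dim_col (emb n g * emb n h)"
  then have ij: "i < n" "j < n" by (auto simp: emb_def)
  obtain N where N: "n = Suc N" using n by (cases n) auto
  have "(emb n g * emb n h) $$ (i,j) = (\<Sum>k<n. emb n g $$ (i,k) * emb n h $$ (k,j))"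
    using ij by (intro mat_mult_entry) auto
  also have "\<dots> = (\<Sum>k<N. emb n g $$ (i,k) * emb n h $$ (k,j)) + emb n g $$ (i,N) * emb n h $$ (N,j)"
    by (simp add: N)
  also have "\<dots> = emb n (g * h) $$ (i,j)"
  proof (cases "i < N \<and> j < N")
    case True
    then have "(\<Sum>k<N. emb n g $$ (i,k) * emb n h $$ (k,j)) = (\<Sum>k<N. g $$ (i,k) * h $$ (k,j))"
      by (intro sum.cong) (auto simp: N emb_entry)
    also have "\<dots> = (g * h) $$ (i,j)" using True g h by (intro mat_mult_entry[symmetric]) (auto simp: N)
    finally show ?thesis using True by (simp add: N emb_entry)
  next
    case False
    then have "(\<Sum>k<N. emb n g $$ (i,k) * emb n h $$ (k,j)) = 0"
      using ij by (intro sum.neutral) (auto simp: N emb_entry)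
    then show ?thesis using False ij by (auto simp: N emb_entry)
  qed
  finally show "emb n (g * h) $$ (i,j) = (emb n g * emb n h) $$ (i,j)" by simp
qed (auto simp: emb_def)

lemma emb_one: "emb n (1\<^sub>m (n - 1)) = 1\<^sub>m n"
  by (rule eq_matI) (auto simp: emb_def)

lemma emb_GLn: assumes "n \<ge> 1" "g \<in> GLn (n-1)" shows "emb n g \<in> GLn n"
proof (rule GLn_I_right)
  show "emb n g * emb n (ginv g) = 1\<^sub>m n"
    using emb_mult[OF assms(1) GLn_carrier[OF assms(2)] GLn_carrier[OF ginv(3)[OF assms(2)]]]
    unfolding ginv(1)[OF assms(2)] emb_one by simp
qed auto

text \<open>An element of U clears the last column, so Whittaker functions on the mirabolic are
  governed by GL_(n-1).\<close>

lemma Mir_factor: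
  fixes p :: "'a::field mat"
  assumes n: "n \<ge> 1" and p: "p \<in> Mir n"
  obtains u g where "u \<in> Uk n" "g \<in> GLn (n-1)" "p = u * emb n g"
proof -
  define g where "g = mat (n-1) (n-1) (\<lambda>(i,j). p $$ (i,j))"
  define x where "x = (\<lambda>i. p $$ (i,n-1))"
  have pG: "p \<in> GLn n" using p by (simp add: Mir_def)
  have eq: "p = Ncol n (n-1) x * emb n g"
  proof (rule eq_matI)
    fix i j assume "i < dim_row (Ncol n (n-1) x * emb n g)" "j < dim_col (Ncol n (n-1) x * emb n g)"
    then have ij: "i < n" "j < n" by (auto simp: emb_def Ncol_def row_tv_def)
    show "p $$ (i,j) = (Ncol n (n-1) x * emb n g) $$ (i,j)"
    proof (cases "i = n - 1")
      case True
      then show ?thesis using ij n p by (auto simp: Ncol_mult_entry emb_entry Mir_def)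
    next
      case False
      then have "i < n - 1" using ij by simp
      then show ?thesis using ij n
        by (auto simp: Ncol_mult_entry emb_entry g_def x_def)
    qed
  qed (use GLn_carrier[OF pG] in \<open>auto simp: emb_def Ncol_def row_tv_def\<close>)
  have U: "Ncol n (n-1) x \<in> Uk n" using n by (intro Ncol_Uk) auto
  have "emb n g = ginv (Ncol n (n-1) x) * p"
  proof -
    have "det (emb n g) \<noteq> 0" using pG eq by (auto simp: GLn_def det_mult[of _ n])
    then have "emb n g \<in> GLn n" by (simp add: GLn_def)
    then show ?thesis using ginv_cancel(2)[OF Uk_GLn[OF U]] eq by simp
  qed
  then have eG: "emb n g \<in> GLn n" using U pG by (auto intro: GLn_mult ginv Uk_GLn)
  have "g \<in> GLn (n-1)"
  proof -
    obtain N where N: "n = Suc N" using n by (cases n) auto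
    have gc: "g \<in> carrier_mat N N" by (simp add: g_def N)
    have "emb n g = four_block_mat g (0\<^sub>m N 1) (0\<^sub>m 1 N) (1\<^sub>m 1)"
      using gc by (intro eq_matI) (auto simp: emb_def N)
    then have "det (emb n g) = det g * det (1\<^sub>m 1 :: 'a mat)"
      using gc by (simp add: det_four_block_mat_lower_left_zero[of _ N _ 1])
    then show ?thesis using eG gc N by (auto simp: GLn_def)
  qed
  then show ?thesis using that U eq by blast
qed

context cuspidal_model
begin

text \<open>A sum rather than an average, since the order of B^op may vanish in R.\<close>

definition W0 :: "'k mat \<Rightarrow> 'r" where
  "W0 = (\<lambda>y. \<Sum>b\<in>Bop n. rt n b B y)"

text \<open>It is enough to treat the mirabolic, hence GL_(n-1), hence by the opposite Bruhat
  decomposition a monomial matrix. If its permutation is not the identity, some simple root element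
  is conjugated into B^op, and equivariance on the left contradicts invariance on the right unless
  the value is 0. Otherwise the matrix lies in B^op and the value is the one at the
  identity.\<close>

lemma Bop_invariant_zero:
  assumes W: "W \<in> Wt" "\<And>b. b \<in> Bop n \<Longrightarrow> rt n b W = W" "W (1\<^sub>m n) = 0"
  shows "W = 0"
proof (rule mirabolic_restriction_injective[OF W(1)])
  fix p :: "'k mat" assume "p \<in> Mir n"
  then obtain u g where ug: "u \<in> Uk n" "g \<in> GLn (n-1)" "p = u * emb n g"
    using Mir_factor[of n p] n2 by auto
  have inv: "W (x * b) = W x" if "b \<in> Bop n" "x \<in> GLn n" for b x
    using W(2)[OF that(1)] rt_apply[OF that(2), of b W] by simp
  obtain u' m l q where *: "u' \<in> Uk (n-1)" "m \<in> GLn (n-1)" "monomial_mat (n-1) q m" "g = u' * m * l"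
    "l \<in> carrier_mat (n-1) (n-1)" "\<And>i j. i < n-1 \<Longrightarrow> j < n-1 \<Longrightarrow> i < j \<Longrightarrow> l $$ (i,j) = 0"
    "\<And>i. i < n-1 \<Longrightarrow> l $$ (i,i) = 1"
    using bruhat_opposite[OF ug(2)] by metis
  have l: "emb n l \<in> Bop n" using * n2 by (auto simp: Bop_def emb_entry)
  have u': "emb n u' \<in> Uk n" using * by (auto simp: Uk_def emb_entry)
  define M where "M = emb n m"
  have M: "M \<in> GLn n" "M \<in> carrier_mat n n" unfolding M_def using * n2 by (auto intro: emb_GLn)
  have "emb n g = emb n u' * M * emb n l"
  proof -
    have n1: "n \<ge> 1" using n2 by simp
    have um: "u' \<in> carrier_mat (n-1) (n-1)" "m \<in> carrier_mat (n-1) (n-1)" using * by (auto simp: GLn_def Uk_def)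
    show ?thesis unfolding *(4) M_def emb_mult[OF n1 mult_carrier_mat[OF um] *(5)] emb_mult[OF n1 um] ..
  qed
  then have "W (emb n g) = W (emb n u' * M)" using inv[OF l] u' M by (simp add: GLn_mult Uk_GLn)
  also have "\<dots> = psiU psi n (emb n u') * W M" using W u' M by (intro Wt_left)
  also have "W M = 0"
  proof -
    have mm: "inj_on q {..<n-1}" "q ` {..<n-1} \<subseteq> {..<n-1}"
      "\<And>i j. i < n-1 \<Longrightarrow> j < n-1 \<Longrightarrow> m $$ (i,j) \<noteq> 0 \<longleftrightarrow> i = q j"
      using *(3) by (auto simp: monomial_mat_def)
    have "q ` {..<n-1} = {..<n-1}" using mm(1,2) by (intro endo_inj_surj) auto
    then have "bij_betw q {..<n-1} {..<n-1}" using mm(1) by (simp add: bij_betw_def)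
    note bij = this
    define r where "r = inv_into {..<n-1} q"
    have r: "r j < n-1" "q (r j) = j" "r (q j) = j" if "j < n-1" for j
      using that bij_betwE[OF bij_betw_inv_into[OF bij]] bij_betw_inv_into_left[OF bij]
        bij_betw_inv_into_right[OF bij] by (auto simp: r_def)
    have mr: "m $$ (i,j) \<noteq> 0 \<longleftrightarrow> j = r i" if "i < n-1" "j < n-1" for i j
      using mm(3)[OF that] r that by auto
    show ?thesis
    proof (cases "\<exists>j. Suc j < n - 1 \<and> \<not> r j < r (Suc j)")
      case True
      then obtain j where j: "Suc j < n - 1" "\<not> r j < r (Suc j)" by blast
      have "r j \<noteq> r (Suc j)" using r(2)[of j] r(2)[of "Suc j"] j by auto
      then have less: "r (Suc j) < r j" using j by simp
      have jn: "j < n - 1" "j < n" "Suc j < n" "r j < n" "r (Suc j) < n" "r j < n - 1" "r (Suc j) < n - 1"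
        using j r(1)[of j] r(1)[of "Suc j"] by auto
      obtain t where t: "psi t \<noteq> 1" using psi_nontriv by blast
      define d where "d = m $$ (Suc j, r (Suc j)) / m $$ (j, r j)"
      have m0: "m $$ (j, r j) \<noteq> 0" using mr jn by auto
      \<comment> \<open>\<open>u\<close> is a simple root element and \<open>b\<close> its conjugate
        by \<open>M\<close>, located at \<open>(r j, r (Suc j))\<close>; it is lower triangular
        because \<open>r\<close> descends at \<open>j\<close>.\<close>
      define u where "u = row_tv n (Suc j) (\<lambda>i. if i = j then t else 0)"
      define b where "b = col_tv n (r j) (\<lambda>i. if i = r (Suc j) then t * d else 0)"
      have uU: "u \<in> Uk n" using jn by (auto simp: u_def Uk_def row_tv_entry)
      have bB: "b \<in> Bop n" using jn less by (auto simp: b_def Bop_def col_tv_entry)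
      have "u * M = M * b"
      proof (rule eq_matI)
        fix x y assume "x < dim_row (M * b)" "y < dim_col (M * b)"
        then have xy: "x < n" "y < n" using M by (auto simp: b_def col_tv_def)
        have 1: "(u * M) $$ (x,y) = M $$ (x,y) + (if x = j then t else 0) * M $$ (Suc j, y)"
          unfolding u_def using xy M jn by (simp add: row_tv_mult)
        have 2: "(M * b) $$ (x,y) = M $$ (x,y) + M $$ (x, r j) * (if y = r (Suc j) then t * d else 0)"
          unfolding b_def using xy M jn by (simp add: col_tv_mult)
        have 3: "M $$ (Suc j,y) = 0" if "y \<noteq> r (Suc j)"
          using that mr[of "Suc j" y] xy jn j by (auto simp: M_def emb_entry)
        have 4: "M $$ (x, r j) = 0" if "x \<noteq> j"
        proof (cases "x < n - 1")
          case True
          have "r j \<noteq> r x" using that r(2)[OF True] r(2)[OF jn(1)] by metis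
          then have "m $$ (x, r j) = 0" using mr[OF True jn(6)] by blast
          then show ?thesis using True jn xy by (simp add: M_def emb_entry)
        next
          case False
          then show ?thesis using jn xy by (simp add: M_def emb_entry)
        qed
        have 5: "M $$ (Suc j, r (Suc j)) = d * M $$ (j, r j)"
          using jn j m0 by (simp add: M_def emb_entry d_def)
        show "(u * M) $$ (x,y) = (M * b) $$ (x,y)"
          unfolding 1 2 using 3 4 5 by (auto simp: algebra_simps)
      qed (use M in \<open>auto simp: u_def b_def row_tv_def col_tv_def\<close>)
      then have "W (u * M) = W M" using inv[OF bB M(1)] by simp
      moreover have "W (u * M) = psi t * W M"
      proof -
        have "psiU psi n u = psi t"
          by (rule psiU_single[of _ _ j]) (use jn in \<open>auto simp: u_def row_tv_entry\<close>)
        then show ?thesis using Wt_left[OF W(1) uU M(1)] by simp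
      qed
      ultimately show ?thesis using t by simp
    next
      case False
      then have "r j = j" if "j < n - 1" for j
        using perm_no_descent_id[of "n-1" r j] r(1) that by blast
      then have "M \<in> Bop n" using mr n2 by (auto simp: Bop_def M_def emb_entry)
      then show ?thesis using inv[of M "1\<^sub>m n"] W(3) M by (simp add: GLn_one GLn_one_mult)
    qed
  qed
  finally have "W (emb n g) = 0" by simp
  then show "W p = 0" using ug W n2 by (simp add: Wt_left emb_GLn)
qed

text \<open>In the last row \<open>i\<close> where \<open>b\<close> differs from the identity, pick
  a differing entry in column \<open>k\<close>. As row \<open>Suc i\<close> of \<open>b\<close> is
  that of the identity, an elementary matrix at \<open>(k, Suc i)\<close> on the right of
  \<open>b\<close> can be moved to the left as an element of U, and the two character values
  disagree.\<close>

lemma bessel_Bop: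
  assumes b: "b \<in> Bop n" "b \<noteq> 1\<^sub>m n"
  shows "B b = 0"
proof -
  have bG: "b \<in> GLn n" "b \<in> carrier_mat n n" using b n2 by (auto intro: Bop_GLn Bop_carrier)
  define S where "S = {i. i < n \<and> (\<exists>k<n. b $$ (i,k) \<noteq> (if i = k then 1 else 0))}"
  have "S \<noteq> {}"
  proof
    assume "S = {}"
    then have "b = 1\<^sub>m n" using bG(2) by (intro eq_matI) (auto simp: S_def)
    then show False using b by simp
  qed
  have fS: "finite S" by (simp add: S_def)
  define i where "i = Max S"
  have "i \<in> S" unfolding i_def using fS \<open>S \<noteq> {}\<close> by (rule Max_in)
  then obtain k where i: "i < n" and k: "k < n" "b $$ (i,k) \<noteq> (if i = k then 1 else 0)" by (auto simp: S_def)
  have imax: "b $$ (l,j) = (if l = j then 1 else 0)" if "i < l" "l < n" "j < n" for l j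
  proof (rule ccontr)
    assume "\<not> ?thesis"
    then have "l \<in> S" unfolding S_def using that by blast
    then have "l \<le> i" unfolding i_def using fS by (intro Max_ge)
    then show False using that by simp
  qed
  have i1: "i < n - 1"
  proof (rule ccontr)
    assume "\<not> ?thesis"
    then have "i = n - 1" using i by simp
    then show False using b(1) k by (cases "k = n - 1") (auto simp: Bop_def)
  qed
  have ki: "k \<le> i" using k b(1) i by (auto simp: Bop_def not_less[symmetric])
  obtain t0 where t0: "psi t0 \<noteq> 1" using psi_nontriv by blast
  define e where "e = (if i = k then 1 else 0 :: 'k)"
  \<comment> \<open>The exponents \<open>t * b $$ (i,k)\<close> and \<open>t * e\<close> differ by
    exactly \<open>t0\<close>.\<close>
  define t where "t = t0 / (b $$ (i,k) - e)"
  define u where "u = row_tv n (Suc i) (\<lambda>l. t * b $$ (l,k))"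
  define u' where "u' = col_tv n k (\<lambda>j. if j = Suc i then t else 0)"
  have bk: "b $$ (l,k) = 0" if "i < l" "l < n" for l using imax[OF that k(1)] ki that by auto
  have uU: "u \<in> Uk n" using i1 bk by (auto simp: u_def Uk_def row_tv_entry)
  have u'U: "u' \<in> Uk n" using i1 ki by (auto simp: u'_def Uk_def col_tv_entry)
  have "u * b = b * u'"
  proof (rule eq_matI)
    fix x y assume "x < dim_row (b * u')" "y < dim_col (b * u')"
    then have xy: "x < n" "y < n" using bG by (auto simp: u'_def col_tv_def)
    have 1: "(u * b) $$ (x,y) = b $$ (x,y) + t * b $$ (x,k) * b $$ (Suc i,y)"
      unfolding u_def using xy bG i1 by (simp add: row_tv_mult)
    have 2: "(b * u') $$ (x,y) = b $$ (x,y) + b $$ (x,k) * (if y = Suc i then t else 0)"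
      unfolding u'_def using xy bG k by (simp add: col_tv_mult)
    show "(u * b) $$ (x,y) = (b * u') $$ (x,y)"
      unfolding 1 2 using imax[of "Suc i" y] i1 xy by auto
  qed (use bG in \<open>auto simp: u_def u'_def row_tv_def col_tv_def\<close>)
  moreover have "B (u * b) = psiU psi n u * B b" using bessel(1) uU bG by (intro Wt_left)
  moreover have "B (b * u') = psiU psi n u' * B b" using bessel(2) u'U bG by (simp add: equivariant_def)
  moreover have "psiU psi n u = psi (t * b $$ (i,k))"
    by (rule psiU_single[of _ _ i]) (use i1 in \<open>auto simp: u_def row_tv_entry\<close>)
  moreover have "psiU psi n u' = psi (t * e)"
  proof (cases "i = k")
    case True
    then show ?thesis using i1 by (intro psiU_single[of _ _ i]) (auto simp: u'_def col_tv_entry e_def)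
  next
    case False
    then show ?thesis using i1 k by (subst psiU_trivial) (auto simp: u'_def col_tv_entry e_def psi_0)
  qed
  moreover have "psi (t * b $$ (i,k)) = psi t0 * psi (t * e)"
  proof -
    have "t * b $$ (i,k) = t0 + t * e" using k(2) by (simp add: t_def e_def field_simps)
    then show ?thesis by (simp add: psi_add)
  qed
  ultimately have "psi t0 * psi (t * e) * B b = psi (t * e) * B b" by simp
  then show ?thesis using t0 psi_nonzero[of "t * e"] by simp
qed

lemma W0: "W0 \<in> Wt" "W0 (1\<^sub>m n) = 1" "b \<in> Bop n \<Longrightarrow> rt n b W0 = W0"
proof -
  have n1: "n \<ge> 1" using n2 by simp
  show "W0 \<in> Wt"
    unfolding W0_def using Wt_sum[where I = "Bop n" and c = "\<lambda>_. 1" and F = "\<lambda>b. rt n b B"] bessel(1) n1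
    by (simp add: Wt_rt Bop_GLn)
  have "W0 (1\<^sub>m n) = (\<Sum>b\<in>(Bop n :: 'k mat set). if b = 1\<^sub>m n then 1 else 0)"
    unfolding W0_def
  proof (rule sum.cong[OF refl])
    fix b :: "'k mat" assume "b \<in> Bop n"
    then show "rt n b B (1\<^sub>m n) = (if b = 1\<^sub>m n then 1 else 0)"
      using n1 bessel_Bop[of b] bessel(3) by (auto simp: rt_apply GLn_one GLn_one_mult Bop_GLn)
  qed
  then show "W0 (1\<^sub>m n) = 1" using n1 by (simp add: finite_Bop Bop_one)
  assume b: "b \<in> Bop n"
  have inj: "inj_on ((*) b) (Bop n)"
  proof (rule inj_onI)
    fix x y assume xy: "x \<in> Bop n" "y \<in> Bop n" "b * x = b * y"
    have "x = ginv b * (b * x)"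
      by (rule ginv_cancel(2)[OF Bop_GLn[OF b n1] Bop_GLn[OF xy(1) n1], symmetric])
    also have "\<dots> = y" unfolding xy(3)
      by (rule ginv_cancel(2)[OF Bop_GLn[OF b n1] Bop_GLn[OF xy(2) n1]])
    finally show "x = y" .
  qed
  then have "(*) b ` Bop n = Bop n"
    using Bop_mult[OF b _ n1] by (intro endo_inj_surj[OF finite_Bop]) auto
  then have "bij_betw ((*) b) (Bop n) (Bop n)" using inj by (simp add: bij_betw_def)
  then have "(\<Sum>b'\<in>Bop n. rt n (b * b') B y) = W0 y" for y
    unfolding W0_def by (rule sum.reindex_bij_betw)
  moreover have "rt n b W0 y = (\<Sum>b'\<in>Bop n. rt n (b * b') B y)" for y
    unfolding W0_def using rt_lincomb[where I = "Bop n" and c = "\<lambda>_. 1" and F = "\<lambda>b. rt n b B"] b n1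
    by (simp add: rt_rt Bop_GLn)
  ultimately show "rt n b W0 = W0" by auto
qed

lemma Bop_invariant_eq:
  assumes W: "W \<in> Wt" "\<And>b. b \<in> Bop n \<Longrightarrow> rt n b W = W"
  shows "W = (\<lambda>y. W (1\<^sub>m n) * W0 y)"
proof -
  define Z where "Z = (\<lambda>y. W y + (- W (1\<^sub>m n)) * W0 y)"
  have "Z = 0"
  proof (rule Bop_invariant_zero)
    show "Z \<in> Wt" unfolding Z_def using W W0 by (intro Wt_add Wt_scale)
    show "Z (1\<^sub>m n) = 0" using W0(2) by (simp add: Z_def)
    fix b :: "'k mat" assume b: "b \<in> Bop n"
    show "rt n b Z = Z"
    proof
      fix x
      show "rt n b Z x = Z x"
        using fun_cong[OF W(2)[OF b], of x] fun_cong[OF W0(3)[OF b], of x]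
        by (cases "x \<in> GLn n") (simp_all add: Z_def rt_def)
    qed
  qed
  show ?thesis
  proof
    fix y
    have "W y = Z y + W (1\<^sub>m n) * W0 y" by (simp add: Z_def)
    then show "W y = W (1\<^sub>m n) * W0 y" by (simp only: \<open>Z = 0\<close> zero_fun_apply add_0)
  qed
qed

end

section \<open>Unipotent radicals in non-standard position\<close>

definition pm :: "nat \<Rightarrow> (nat \<Rightarrow> nat) \<Rightarrow> 'a::field mat" where
  "pm n p = mat n n (\<lambda>(i,j). if i = p j then 1 else 0)"

lemma pm_carrier [simp]: "pm n p \<in> carrier_mat n n"
  by (simp add: pm_def)

lemma pm_right:
  assumes "A \<in> carrier_mat n n" "p permutes {..<n}" "i < n" "j < n"
  shows "(A * pm n p) $$ (i,j) = A $$ (i, p j)"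
proof -
  have pj: "p j < n" using permutes_in_image[OF assms(2), of j] assms(4) by simp
  have "(A * pm n p) $$ (i,j) = (\<Sum>k<n. A $$ (i,k) * pm n p $$ (k,j))"
    using assms by (intro mat_mult_entry) auto
  also have "\<dots> = (\<Sum>k<n. if k = p j then A $$ (i,k) else 0)"
    using assms by (intro sum.cong) (auto simp: pm_def)
  finally show ?thesis using pj by simp
qed

lemma pm_left:
  assumes "A \<in> carrier_mat n n" "p permutes {..<n}" "i < n" "j < n"
  shows "(pm n p * A) $$ (p i,j) = A $$ (i, j)"
proof -
  have pi: "p i < n" using permutes_in_image[OF assms(2), of i] assms(3) by simp
  have "(pm n p * A) $$ (p i,j) = (\<Sum>k<n. pm n p $$ (p i,k) * A $$ (k,j))"
    using assms pi by (intro mat_mult_entry) auto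
  also have "\<dots> = (\<Sum>k<n. if k = i then A $$ (k,j) else 0)"
    using assms pi permutes_inj[OF assms(2)] by (intro sum.cong) (auto simp: pm_def dest: injD)
  finally show ?thesis using assms by simp
qed

lemma pm_inverse:
  assumes "p permutes {..<n}"
  shows "pm n p * pm n (inv_into UNIV p) = (1\<^sub>m n :: 'a::field mat)"
proof (rule eq_matI)
  fix i j assume "i < dim_row (1\<^sub>m n :: 'a mat)" "j < dim_col (1\<^sub>m n :: 'a mat)"
  then have ij: "i < n" "j < n" by auto
  have ip: "inv_into UNIV p j < n" using permutes_in_image[OF permutes_inv[OF assms], of j] ij by simp
  have "(pm n p * pm n (inv_into UNIV p)) $$ (i,j) = (pm n p :: 'a mat) $$ (i, inv_into UNIV p j)"
    using assms ij by (intro pm_right permutes_inv) auto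
  also have "\<dots> = 1\<^sub>m n $$ (i,j)"
    using ij ip permutes_inverses[OF assms] by (simp add: pm_def)
  finally show "(pm n p * pm n (inv_into UNIV p)) $$ (i,j) = (1\<^sub>m n :: 'a mat) $$ (i,j)" .
qed (auto simp: pm_def)

lemma pm_GLn: "p permutes {..<n} \<Longrightarrow> pm n p \<in> GLn n"
  by (rule GLn_I_right[OF _ _ pm_inverse]) auto

text \<open>The unipotent radical of the stabiliser of the coordinate subspace indexed by
  \<open>I\<close>. Stabilisers over the local field produce such sets \<open>I\<close> in no
  particular order.\<close>

definition radI :: "nat \<Rightarrow> nat set \<Rightarrow> 'a::field mat set" where
  "radI n I = {u \<in> carrier_mat n n. \<forall>i<n. \<forall>j<n. \<not> (i \<in> I \<and> j \<notin> I) \<longrightarrow> u $$ (i,j) = (if i = j then 1 else 0)}"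

lemma initial_segment_perm:
  assumes "I \<subseteq> {..<n}"
  obtains p where "p permutes {..<n}" "\<And>i. i < n \<Longrightarrow> i \<in> I \<longleftrightarrow> p i < card I"
proof -
  have fin: "finite I" "card I \<le> n" using assms finite_subset card_mono[of "{..<n}" I] by auto
  obtain g where g: "bij_betw g I {..<card I}"
    using fin by (metis bij_betw_iff_card card_lessThan finite_lessThan)
  have "card ({..<n} - I) = card {card I..<n}" using assms fin by (simp add: card_Diff_subset)
  then obtain h where h: "bij_betw h ({..<n} - I) {card I..<n}"
    by (metis bij_betw_iff_card finite_Diff finite_lessThan finite_atLeastLessThan)
  define p where "p i = (if i \<in> I then g i else if i < n then h i else i)" for i
  have gi: "g i < card I" if "i \<in> I" for i using bij_betwE[OF g] that by auto
  have hi: "card I \<le> h i" "h i < n" if "i \<notin> I" "i < n" for i using bij_betwE[OF h] that by auto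
  have "bij_betw p (I \<union> ({..<n} - I)) ({..<card I} \<union> {card I..<n})"
  proof (rule bij_betw_combine)
    show "bij_betw p I {..<card I}" using g by (rule bij_betw_cong[THEN iffD1, rotated]) (auto simp: p_def)
    show "bij_betw p ({..<n} - I) {card I..<n}"
      using h by (rule bij_betw_cong[THEN iffD1, rotated]) (auto simp: p_def)
  qed auto
  moreover have "I \<union> ({..<n} - I) = {..<n}" "{..<card I} \<union> {card I..<n} = {..<n}" using assms fin by auto
  ultimately have "bij_betw p {..<n} {..<n}" by simp
  then have "p permutes {..<n}" by (rule bij_imp_permutes) (use assms in \<open>auto simp: p_def\<close>)
  moreover have "i \<in> I \<longleftrightarrow> p i < card I" if "i < n" for i using that gi hi by (auto simp: p_def not_less)
  ultimately show ?thesis using that by blast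
qed

context cuspidal_model
begin

text \<open>A permutation moving \<open>I\<close> to an initial segment conjugates this radical to
  that of a standard maximal parabolic, where cuspidality is assumed.\<close>

lemma radI_invariant_zero:
  assumes I: "I \<subseteq> {..<n}" "I \<noteq> {}" "I \<noteq> {..<n}" and W: "W \<in> Wt"
    and inv: "\<And>u. u \<in> radI n I \<Longrightarrow> u \<in> GLn n \<Longrightarrow> rt n u W = W"
  shows "W = 0"
proof -
  obtain p where p: "p permutes {..<n}" "\<And>i. i < n \<Longrightarrow> i \<in> I \<longleftrightarrow> p i < card I"
    using initial_segment_perm[OF I(1)] by blast
  let ?P = "pm n p :: 'k mat"
  have PG: "?P \<in> GLn n" by (rule pm_GLn[OF p(1)])
  have fin: "finite I" using I finite_subset by auto
  have "I \<subset> {..<n}" using I by blast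
  then have "card I < n" using psubset_card_mono[of "{..<n}" I] by simp
  then have c: "1 \<le> card I" "card I \<le> n - 1" using I fin by (auto simp: Suc_le_eq card_gt_0_iff)
  have pn: "p i < n" if "i < n" for i using permutes_in_image[OF p(1), of i] that by simp
  have "rt n ?P W = 0"
  proof (rule cuspidal_radical[of "{card I}"])
    show "rt n ?P W \<in> Wt" using W PG by (intro Wt_rt)
    fix u :: "'k mat" assume u: "u \<in> unipRad n {card I}"
    then have uU: "u \<in> Uk n" "u \<in> carrier_mat n n" by (auto simp: unipRad_def Uk_carrier)
    define u' where "u' = mat n n (\<lambda>(i,j). u $$ (p i, p j))"
    have u'c: "u' \<in> carrier_mat n n" by (simp add: u'_def)
    have eq: "u * ?P = ?P * u'"
    proof (rule eq_matI)
      fix x j assume "x < dim_row (?P * u')" "j < dim_col (?P * u')"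
      then have xj: "x < n" "j < n" using u'c by (auto simp: pm_def)
      then obtain i where i: "i < n" "x = p i"
        using permutes_image[OF p(1)] by (metis imageE lessThan_iff)
      have "(?P * u') $$ (x,j) = u' $$ (i,j)" unfolding i(2) using u'c p(1) i(1) xj(2) by (rule pm_left)
      also have "\<dots> = u $$ (p i, p j)" using i xj by (simp add: u'_def)
      also have "\<dots> = (u * ?P) $$ (x,j)" using pm_right[OF uU(2) p(1) xj] i(2) by simp
      finally show "(u * ?P) $$ (x,j) = (?P * u') $$ (x,j)" by simp
    qed (use uU u'c in \<open>auto simp: pm_def\<close>)
    have u'G: "u' \<in> GLn n"
    proof -
      have "det u * det ?P = det ?P * det u'"
        using arg_cong[OF eq, of det] uU u'c by (simp add: det_mult[of _ n])
      then have "det u' \<noteq> 0" using Uk_GLn[OF uU(1)] PG by (auto simp: GLn_def)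
      then show ?thesis using u'c by (simp add: GLn_def)
    qed
    have "u' \<in> radI n I"
      unfolding radI_def
    proof (intro CollectI conjI allI impI u'c)
      fix i j assume ij: "i < n" "j < n" "\<not> (i \<in> I \<and> j \<notin> I)"
      then have "\<not> (p i < card I \<and> card I \<le> p j)" using p(2) by auto
      moreover have "p i = p j \<longleftrightarrow> i = j" using permutes_inj[OF p(1)] by (auto dest: injD)
      ultimately show "u' $$ (i,j) = (if i = j then 1 else 0)"
        using u ij pn[of i] pn[of j] Uk_entry[OF uU(1), of "p i"]
        by (cases "p i" "p j" rule: linorder_cases) (auto simp: u'_def unipRad_def)
    qed
    then have "rt n u' W = W" using inv u'G by blast
    then show "rt n u (rt n ?P W) = rt n ?P W"
      using PG u'G uU by (metis rt_rt Uk_GLn eq)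
  qed (use c in auto)
  then have "rt n (ginv ?P) (rt n ?P W) = 0" by (auto simp: rt_def fun_eq_iff)
  then show ?thesis using PG W by (simp add: rt_rt ginv Wt_rt_one)
qed

end

section \<open>Integral matrices over the local field\<close>

locale local_field =
  fixes v :: "'f::field \<Rightarrow> int" and red :: "'f \<Rightarrow> 'k::{field,finite}" and w :: 'f
  assumes lf: "nonarch_local_field v red w"
begin

text \<open>Membership in a fractional ideal; the integer threshold may be negative, which
  conjugation by diagonal matrices requires.\<close>

definition vge :: "int \<Rightarrow> 'f \<Rightarrow> bool" where
  "vge a x \<longleftrightarrow> x = 0 \<or> v x \<ge> a"

lemma inO_vge: "inO v x \<longleftrightarrow> vge 0 x" and inP_vge: "inP v m x \<longleftrightarrow> vge (int m) x"
  by (auto simp: inO_def inP_def vge_def)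

lemma v_mult: "x \<noteq> 0 \<Longrightarrow> y \<noteq> 0 \<Longrightarrow> v (x * y) = v x + v y"
  and v_add: "x \<noteq> 0 \<Longrightarrow> y \<noteq> 0 \<Longrightarrow> x + y \<noteq> 0 \<Longrightarrow> v (x + y) \<ge> min (v x) (v y)"
  and w0: "w \<noteq> 0" and vw: "v w = 1"
  and red_add: "vge 0 x \<Longrightarrow> vge 0 y \<Longrightarrow> red (x + y) = red x + red y"
  and red_mult: "vge 0 x \<Longrightarrow> vge 0 y \<Longrightarrow> red (x * y) = red x * red y"
  and red_1: "red 1 = 1"
  and red_surj: "\<exists>x. vge 0 x \<and> red x = a"
  and red_0_iff: "vge 0 x \<Longrightarrow> red x = 0 \<longleftrightarrow> vge 1 x"
  using lf unfolding nonarch_local_field_def inO_vge inP_vge by auto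

lemma complete:
  fixes s :: "nat \<Rightarrow> 'f"
  assumes "\<And>N::nat. \<exists>M. \<forall>i\<ge>M. \<forall>j\<ge>M. vge (int N) (s i - s j)"
  shows "\<exists>L. \<forall>N::nat. \<exists>M. \<forall>i\<ge>M. vge (int N) (s i - L)"
proof -
  have "\<forall>s::nat \<Rightarrow> 'f. (\<forall>N::nat. \<exists>M. \<forall>i\<ge>M. \<forall>j\<ge>M. vge (int N) (s i - s j)) \<longrightarrow>
        (\<exists>L. \<forall>N::nat. \<exists>M. \<forall>i\<ge>M. vge (int N) (s i - L))"
    using lf unfolding nonarch_local_field_def inO_vge inP_vge by (elim conjE) assumption
  then show ?thesis using assms by blast
qed

lemma vge_0 [simp]: "vge a 0"
  by (simp add: vge_def)

lemma v_1: "v 1 = 0"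
  using v_mult[of 1 1] by simp

lemma v_minus: "x \<noteq> 0 \<Longrightarrow> v (- x) = v x"
proof -
  have "v (-1) + v (-1) = 0" using v_mult[of "-1" "-1"] v_1 by simp
  then have "v (-1) = 0" by simp
  then show "x \<noteq> 0 \<Longrightarrow> v (- x) = v x" using v_mult[of "-1" x] by simp
qed

lemma vge_1 [simp]: "vge 0 1"
  by (simp add: vge_def v_1)

lemma vge_add: "vge a x \<Longrightarrow> vge a y \<Longrightarrow> vge a (x + y)"
  using v_add[of x y] by (cases "x = 0"; cases "y = 0"; cases "x + y = 0") (auto simp: vge_def)

lemma vge_minus: "vge a x \<Longrightarrow> vge a (- x)"
  by (cases "x = 0") (auto simp: vge_def v_minus)

lemma vge_diff: "vge a x \<Longrightarrow> vge a y \<Longrightarrow> vge a (x - y)"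
  using vge_add[of a x "- y"] vge_minus by simp

lemma vge_mult: "vge a x \<Longrightarrow> vge b y \<Longrightarrow> vge (a + b) (x * y)"
  by (cases "x = 0"; cases "y = 0") (auto simp: vge_def v_mult)

lemma vge_mult0: "vge 0 x \<Longrightarrow> vge b y \<Longrightarrow> vge b (x * y)" "vge b x \<Longrightarrow> vge 0 y \<Longrightarrow> vge b (x * y)"
  using vge_mult[of 0 x b y] vge_mult[of b x 0 y] by auto

lemma vge_mono: "vge a x \<Longrightarrow> b \<le> a \<Longrightarrow> vge b x"
  by (auto simp: vge_def)

lemma vge_sum: "(\<And>i. i \<in> A \<Longrightarrow> vge a (f i)) \<Longrightarrow> vge a (\<Sum>i\<in>A. f i)"
  by (induction A rule: infinite_finite_induct) (auto intro: vge_add)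

lemma vge_prod: "(\<And>i. i \<in> A \<Longrightarrow> vge 0 (f i)) \<Longrightarrow> vge 0 (\<Prod>i\<in>A. f i)"
  by (induction A rule: infinite_finite_induct) (auto intro: vge_mult0)

lemma v_inverse: "x \<noteq> 0 \<Longrightarrow> v (inverse x) = - v x"
  using v_mult[of x "inverse x"] v_1 by simp

lemma v_divide: "x \<noteq> 0 \<Longrightarrow> y \<noteq> 0 \<Longrightarrow> v (x / y) = v x - v y"
  by (simp add: divide_inverse v_mult v_inverse)

lemma v_power: "v (w ^ k) = int k"
  by (induction k) (auto simp: v_1 v_mult w0 vw)

lemma v_powi: "v (w powi a) = a"
  by (cases "a \<ge> 0") (auto simp: power_int_def v_power v_inverse w0 power_inverse)

lemma powi_0 [simp]: "w powi a \<noteq> 0"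
  using w0 by simp

lemma powi_diff: "w powi (a - b) = w powi a / w powi b"
  using w0 by (simp add: power_int_diff)

lemma vge_powi_mult: "vge a (w powi b * x) \<longleftrightarrow> vge (a - b) x"
  using w0 by (cases "x = 0") (auto simp: vge_def v_mult v_powi)

lemma red_0: "red 0 = 0"
  using red_0_iff[of 0] by simp

lemma red_minus: "vge 0 x \<Longrightarrow> red (- x) = - red x"
  using red_add[of x "- x"] vge_minus[of 0 x] red_0 by (simp add: eq_neg_iff_add_eq_0 add.commute)

lemma red_diff: "vge 0 x \<Longrightarrow> vge 0 y \<Longrightarrow> red (x - y) = red x - red y"
  using red_add[of x "- y"] vge_minus red_minus by simp

lemma red_eq_iff: "vge 0 x \<Longrightarrow> vge 0 y \<Longrightarrow> red x = red y \<longleftrightarrow> vge 1 (x - y)"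
  using red_0_iff[of "x - y"] vge_diff red_diff by auto

lemma red_sum: "(\<And>i. i \<in> A \<Longrightarrow> vge 0 (f i)) \<Longrightarrow> red (\<Sum>i\<in>A. f i) = (\<Sum>i\<in>A. red (f i))"
  by (induction A rule: infinite_finite_induct) (auto simp: red_0 red_add vge_sum)

lemma red_prod: "(\<And>i. i \<in> A \<Longrightarrow> vge 0 (f i)) \<Longrightarrow> red (\<Prod>i\<in>A. f i) = (\<Prod>i\<in>A. red (f i))"
  by (induction A rule: infinite_finite_induct) (auto simp: red_1 red_mult vge_prod)

lemma isUnit_iff: "isUnit v x \<longleftrightarrow> vge 0 x \<and> red x \<noteq> 0"
proof (cases "x = 0")
  case False
  then show ?thesis using red_0_iff[of x] by (auto simp: isUnit_def vge_def)
qed (simp add: isUnit_def red_0)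

lemma isUnit_inverse: "isUnit v x \<Longrightarrow> isUnit v (inverse x)"
  by (simp add: isUnit_def v_inverse)

lemma isUnit_vge: "isUnit v x \<Longrightarrow> vge 0 x"
  by (simp add: isUnit_iff)

text \<open>The values at 0 and 1 are fixed so that lifting a matrix entrywise keeps its zeros and
  ones exactly; last rows and triangular shapes then survive without congruences.\<close>

definition lift :: "'k \<Rightarrow> 'f" where
  "lift a = (if a = 0 then 0 else if a = 1 then 1 else (SOME x. vge 0 x \<and> red x = a))"

lemma lift: "vge 0 (lift a)" "red (lift a) = a" "lift 0 = 0" "lift 1 = 1"
  using someI_ex[OF red_surj[of a]] by (auto simp: lift_def red_0 red_1)

definition intg :: "nat \<Rightarrow> 'f mat \<Rightarrow> bool" where
  "intg N A \<longleftrightarrow> A \<in> carrier_mat N N \<and> (\<forall>i<N. \<forall>j<N. vge 0 (A $$ (i,j)))"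

lemma intg_mult: "intg N A \<Longrightarrow> intg N B \<Longrightarrow> intg N (A * B)"
  by (auto simp: intg_def mat_mult_entry simp del: index_mult_mat(1) intro!: vge_sum vge_mult0)

lemma intg_one: "intg N (1\<^sub>m N)"
  by (auto simp: intg_def)

lemma signof_vge: "vge 0 (signof p :: 'f)" "red (signof p) = signof p"
  using vge_minus[of 0 1] red_minus[of 1] by (auto simp: sign_def red_1)

lemma det_intg:
  assumes "intg N A"
  shows "vge 0 (det A)" "det (kbar red N A) = red (det A)"
proof -
  have A: "A \<in> carrier_mat N N" and e: "\<And>i j. i < N \<Longrightarrow> j < N \<Longrightarrow> vge 0 (A $$ (i,j))"
    using assms by (auto simp: intg_def)
  have en: "vge 0 (A $$ (i, p i))" if "p permutes {0..<N}" "i \<in> {0..<N}" for p i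
    using that permutes_in_image[OF that(1), of i] by (intro e) auto
  have d: "det A = (\<Sum>p | p permutes {0..<N}. signof p * (\<Prod>i = 0..<N. A $$ (i, p i)))"
    using A by (rule det_def')
  have t: "vge 0 (signof p * (\<Prod>i = 0..<N. A $$ (i, p i)))" if "p permutes {0..<N}" for p
    using that en by (intro vge_mult0(1) signof_vge vge_prod) auto
  show "vge 0 (det A)" unfolding d by (rule vge_sum) (use t in auto)
  have "red (det A) = (\<Sum>p | p permutes {0..<N}. signof p * (\<Prod>i = 0..<N. red (A $$ (i, p i))))"
  proof -
    have "red (signof p * (\<Prod>i = 0..<N. A $$ (i, p i))) = signof p * (\<Prod>i = 0..<N. red (A $$ (i, p i)))"
      if "p permutes {0..<N}" for p
      using red_mult[OF signof_vge(1) vge_prod[of "{0..<N}"]] red_prod[of "{0..<N}" "\<lambda>i. A $$ (i, p i)"] en[OF that]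
        signof_vge(2)[of p] by simp
    then show ?thesis unfolding d using t by (subst red_sum) auto
  qed
  also have "\<dots> = (\<Sum>p | p permutes {0..<N}. signof p * (\<Prod>i = 0..<N. kbar red N A $$ (i, p i)))"
    by (intro sum.cong refl arg_cong2[where f = "(*)"] prod.cong)
      (use permutes_in_image in \<open>fastforce simp: kbar_def\<close>)
  also have "\<dots> = det (kbar red N A)" by (rule det_def'[symmetric]) (simp add: kbar_def)
  finally show "det (kbar red N A) = red (det A)" by simp
qed

lemma kbar_carrier [simp]: "kbar red N A \<in> carrier_mat N N"
  by (simp add: kbar_def)

lemma kbar_entry: "i < N \<Longrightarrow> j < N \<Longrightarrow> kbar red N A $$ (i,j) = red (A $$ (i,j))"
  by (simp add: kbar_def)

lemma kbar_mult:
  assumes "intg N A" "intg N B"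
  shows "kbar red N (A * B) = kbar red N A * kbar red N B"
proof (rule eq_matI)
  fix i j assume "i < dim_row (kbar red N A * kbar red N B)" "j < dim_col (kbar red N A * kbar red N B)"
  then have ij: "i < N" "j < N" by (auto simp: kbar_def)
  have AB: "A \<in> carrier_mat N N" "B \<in> carrier_mat N N" using assms by (auto simp: intg_def)
  have "kbar red N (A * B) $$ (i,j) = red (\<Sum>k<N. A $$ (i,k) * B $$ (k,j))"
    using ij mat_mult_entry[OF AB ij] by (simp add: kbar_entry)
  also have "\<dots> = (\<Sum>k<N. red (A $$ (i,k)) * red (B $$ (k,j)))"
    using assms ij by (subst red_sum) (auto simp: intg_def red_mult intro: vge_mult0)
  also have "\<dots> = (\<Sum>k<N. kbar red N A $$ (i,k) * kbar red N B $$ (k,j))"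
    using ij by (intro sum.cong) (auto simp: kbar_entry)
  also have "\<dots> = (kbar red N A * kbar red N B) $$ (i,j)"
    using ij by (intro mat_mult_entry[symmetric]) auto
  finally show "kbar red N (A * B) $$ (i,j) = (kbar red N A * kbar red N B) $$ (i,j)" .
qed (auto simp: kbar_def)

lemma kbar_one: "kbar red N (1\<^sub>m N) = 1\<^sub>m N"
  by (rule eq_matI) (auto simp: kbar_def red_0 red_1)

lemma Kn_iff: "A \<in> Kn v N \<longleftrightarrow> intg N A \<and> det (kbar red N A) \<noteq> 0"
proof
  assume "A \<in> Kn v N"
  then have "intg N A" "isUnit v (det A)" by (auto simp: Kn_def GLn_def intg_def inO_vge)
  then show "intg N A \<and> det (kbar red N A) \<noteq> 0" using det_intg[of N A] by (auto simp: isUnit_iff)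
next
  assume A: "intg N A \<and> det (kbar red N A) \<noteq> 0"
  then have "isUnit v (det A)" using det_intg[of N A] by (auto simp: isUnit_iff)
  then show "A \<in> Kn v N" using A by (auto simp: Kn_def GLn_def intg_def inO_vge isUnit_def)
qed

lemma Kn_GLn: "A \<in> Kn v N \<Longrightarrow> A \<in> GLn N"
  by (simp add: Kn_def)

lemma Kn_intg: "A \<in> Kn v N \<Longrightarrow> intg N A"
  by (simp add: Kn_iff)

lemma Kn_entry: "A \<in> Kn v N \<Longrightarrow> i < N \<Longrightarrow> j < N \<Longrightarrow> vge 0 (A $$ (i,j))"
  by (auto simp: Kn_iff intg_def)

lemma kbar_GLn: "A \<in> Kn v N \<Longrightarrow> kbar red N A \<in> GLn N"
  by (simp add: Kn_iff GLn_def)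

lemma Kn_I:
  assumes "intg N A" "intg N B" "A * B = 1\<^sub>m N" shows "A \<in> Kn v N"
proof -
  have "kbar red N A * kbar red N B = 1\<^sub>m N" using kbar_mult[OF assms(1,2)] assms(3) kbar_one by simp
  then have "kbar red N A \<in> GLn N" by (intro GLn_I_right[of _ N "kbar red N B"]) auto
  then show ?thesis using assms by (simp add: Kn_iff GLn_def)
qed

lemma Kn_one: "1\<^sub>m N \<in> Kn v N"
  by (rule Kn_I[OF intg_one intg_one]) simp

lemma Kn_mult: "A \<in> Kn v N \<Longrightarrow> B \<in> Kn v N \<Longrightarrow> A * B \<in> Kn v N"
  by (auto simp: Kn_iff kbar_mult intg_mult det_mult[of _ N])

lemma Kn_ginv:
  assumes "A \<in> Kn v N" shows "ginv A \<in> Kn v N"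
proof -
  have A: "A \<in> carrier_mat N N" "isUnit v (det A)" and e: "\<And>i j. i < N \<Longrightarrow> j < N \<Longrightarrow> vge 0 (A $$ (i,j))"
    using assms Kn_entry[OF assms] by (auto simp: Kn_def GLn_def)
  have "vge 0 (1 / det A)" using isUnit_vge[OF isUnit_inverse[OF A(2)]] by (simp add: divide_inverse)
  moreover have "vge 0 (adj_mat A $$ (i,j))" if ij: "i < N" "j < N" for i j
  proof -
    have "intg (N - 1) (mat_delete A j i)"
      using A ij e by (auto simp: intg_def mat_delete_def)
    then have "vge 0 (det (mat_delete A j i))" by (rule det_intg)
    moreover have "vge 0 ((-1) ^ (j + i) :: 'f)"
      using vge_minus[of 0 1] by (cases "even (j + i)") auto
    ultimately show ?thesis using A ij by (simp add: adj_mat_def cofactor_def vge_mult0)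
  qed
  ultimately have "vge 0 ((1 / det A) * adj_mat A $$ (i,j))" if "i < N" "j < N" for i j
    using that by (intro vge_mult0(1))
  then have "intg N (ginv A)"
    using A adj_mat(1)[OF A(1)] by (auto simp: intg_def ginv_def)
  then show ?thesis using Kn_I[OF _ Kn_intg[OF assms]] ginv(2)[OF Kn_GLn[OF assms]] by blast
qed

lemma pm_intg: "intg N (pm N p)"
  by (auto simp: intg_def pm_def)

lemma pm_Kn: "p permutes {..<N} \<Longrightarrow> pm N p \<in> Kn v N"
  by (rule Kn_I[OF pm_intg pm_intg pm_inverse])

lemma row_tv_Kn:
  assumes "r < N" "c r = 0" "\<And>i. i < N \<Longrightarrow> vge 0 (c i)" shows "row_tv N r c \<in> Kn v N"
proof (rule Kn_I[OF _ _ row_tv_inverse[where c = c and r = r and n = N, OF assms(1,2)]])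
  show "intg N (row_tv N r c)" "intg N (row_tv N r (\<lambda>i. - c i))"
    using assms vge_minus by (auto simp: intg_def row_tv_entry intro!: vge_add)
qed

lemma col_tv_Kn:
  assumes "r < N" "c r = 0" "\<And>i. i < N \<Longrightarrow> vge 0 (c i)" shows "col_tv N r c \<in> Kn v N"
proof (rule Kn_I[OF _ _ col_tv_inverse[where c = c and r = r and n = N, OF assms(1,2)]])
  show "intg N (col_tv N r c)" "intg N (col_tv N r (\<lambda>i. - c i))"
    using assms vge_minus by (auto simp: intg_def col_tv_entry intro!: vge_add)
qed

section \<open>The groups K_N(m) and double cosets\<close>

text \<open>For \<open>m \<ge> 1\<close>, K_N(m) is the stabiliser in K_N of the row vector (0, ...,
  0, 1) modulo the m-th power of the maximal ideal. Closure under products and inverses is proved in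
  this form.\<close>

definition lastrow :: "nat \<Rightarrow> nat \<Rightarrow> 'f mat \<Rightarrow> bool" where
  "lastrow N m A \<longleftrightarrow> (\<forall>j<N. vge (int m) (A $$ (N-1,j) - (if j = N - 1 then 1 else 0)))"

lemma Knm_iff: "m \<ge> 1 \<Longrightarrow> N \<ge> 1 \<Longrightarrow> A \<in> Knm v N m \<longleftrightarrow> A \<in> Kn v N \<and> lastrow N m A"
proof -
  assume m: "m \<ge> 1" "N \<ge> 1"
  have "(\<forall>j<N-1. vge (int m) (A $$ (N-1,j))) \<and> vge (int m) (A $$ (N-1,N-1) - 1) \<longleftrightarrow> lastrow N m A"
  proof
    assume L: "lastrow N m A"
    have "vge (int m) (A $$ (N-1,j))" if "j < N - 1" for j
      using L that unfolding lastrow_def by (auto dest: spec[of _ j])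
    moreover have "vge (int m) (A $$ (N-1,N-1) - 1)"
      using L m unfolding lastrow_def by (auto dest: spec[of _ "N-1"])
    ultimately show "(\<forall>j<N-1. vge (int m) (A $$ (N-1,j))) \<and> vge (int m) (A $$ (N-1,N-1) - 1)" by blast
  next
    assume R: "(\<forall>j<N-1. vge (int m) (A $$ (N-1,j))) \<and> vge (int m) (A $$ (N-1,N-1) - 1)"
    show "lastrow N m A" unfolding lastrow_def
    proof (intro allI impI)
      fix j assume "j < N"
      then show "vge (int m) (A $$ (N-1,j) - (if j = N - 1 then 1 else 0))"
        using R by (cases "j = N - 1") auto
    qed
  qed
  then show ?thesis using m by (auto simp: Knm_def inP_vge)
qed

lemma Knm_Kn: "A \<in> Knm v N m \<Longrightarrow> A \<in> Kn v N"
  by (auto simp: Knm_def split: if_splits)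

lemma lastrow_mult:
  assumes N: "N \<ge> 1" and A: "A \<in> Kn v N" "lastrow N m A" and B: "B \<in> Kn v N" "lastrow N m B"
  shows "lastrow N m (A * B)"
  unfolding lastrow_def
proof (intro allI impI)
  fix j assume j: "j < N"
  define d where "d l = (if l = N - 1 then 1 else 0 :: 'f)" for l
  have "(A * B) $$ (N-1,j) = (\<Sum>l<N. A $$ (N-1,l) * B $$ (l,j))"
    using A B j N by (intro mat_mult_entry GLn_carrier Kn_GLn) auto
  also have "\<dots> = (\<Sum>l<N. (A $$ (N-1,l) - d l) * B $$ (l,j)) + (\<Sum>l<N. d l * B $$ (l,j))"
    by (simp add: algebra_simps sum.distrib[symmetric])
  also have "(\<Sum>l<N. d l * B $$ (l,j)) = B $$ (N-1,j)"
  proof -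
    have "(\<Sum>l<N. d l * B $$ (l,j)) = (\<Sum>l<N. if l = N - 1 then B $$ (l,j) else 0)"
      by (intro sum.cong) (auto simp: d_def)
    then show ?thesis using N by simp
  qed
  finally have "(A * B) $$ (N-1,j) - d j = (\<Sum>l<N. (A $$ (N-1,l) - d l) * B $$ (l,j)) + (B $$ (N-1,j) - d j)"
    by simp
  also have "vge (int m) \<dots>"
    using A B j by (intro vge_add vge_sum vge_mult0(2)) (auto simp: lastrow_def d_def Kn_entry)
  finally show "vge (int m) ((A * B) $$ (N-1,j) - (if j = N - 1 then 1 else 0))" by (simp add: d_def)
qed

lemma lastrow_ginv:
  assumes N: "N \<ge> 1" and A: "A \<in> Kn v N" "lastrow N m A"
  shows "lastrow N m (ginv A)"
  unfolding lastrow_def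
proof (intro allI impI)
  fix j assume j: "j < N"
  let ?B = "ginv A"
  have B: "?B \<in> Kn v N" using A(1) by (rule Kn_ginv)
  define d where "d l = (if l = N - 1 then 1 else 0 :: 'f)" for l
  have "(A * ?B) $$ (N-1,j) = (\<Sum>l<N. A $$ (N-1,l) * ?B $$ (l,j))"
    using A B j N by (intro mat_mult_entry GLn_carrier Kn_GLn) auto
  moreover have "(A * ?B) $$ (N-1,j) = d j" using ginv(1)[OF Kn_GLn[OF A(1)]] j N by (auto simp: d_def)
  ultimately have "d j = (\<Sum>l<N. (A $$ (N-1,l) - d l) * ?B $$ (l,j)) + (\<Sum>l<N. d l * ?B $$ (l,j))"
    by (simp add: algebra_simps sum.distrib[symmetric])
  also have "(\<Sum>l<N. d l * ?B $$ (l,j)) = ?B $$ (N-1,j)"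
  proof -
    have "(\<Sum>l<N. d l * ?B $$ (l,j)) = (\<Sum>l<N. if l = N - 1 then ?B $$ (l,j) else 0)"
      by (intro sum.cong) (auto simp: d_def)
    then show ?thesis using N by simp
  qed
  finally have "?B $$ (N-1,j) - d j = - (\<Sum>l<N. (A $$ (N-1,l) - d l) * ?B $$ (l,j))"
    by (simp add: algebra_simps)
  also have "vge (int m) \<dots>"
    using A B j by (intro vge_minus vge_sum vge_mult0(2)) (auto simp: lastrow_def d_def Kn_entry)
  finally show "vge (int m) (?B $$ (N-1,j) - (if j = N - 1 then 1 else 0))" by (simp add: d_def)
qed

lemma Knm_mult: "N \<ge> 1 \<Longrightarrow> A \<in> Knm v N m \<Longrightarrow> B \<in> Knm v N m \<Longrightarrow> A * B \<in> Knm v N m"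
  by (cases "m = 0") (auto simp: Knm_iff Suc_le_eq lastrow_mult Kn_mult, auto simp: Knm_def Kn_mult)

lemma Knm_ginv: "N \<ge> 1 \<Longrightarrow> A \<in> Knm v N m \<Longrightarrow> ginv A \<in> Knm v N m"
  by (cases "m = 0") (auto simp: Knm_iff Suc_le_eq lastrow_ginv Kn_ginv, auto simp: Knm_def Kn_ginv)

lemma Knm_one: "N \<ge> 1 \<Longrightarrow> 1\<^sub>m N \<in> Knm v N m"
  by (cases "m = 0") (auto simp: Knm_iff Suc_le_eq Kn_one lastrow_def, auto simp: Knm_def Kn_one)

lemma KnmI: "N \<ge> 1 \<Longrightarrow> A \<in> Kn v N \<Longrightarrow> (\<And>j. j < N \<Longrightarrow> A $$ (N-1,j) = (if j = N - 1 then 1 else 0)) \<Longrightarrow> A \<in> Knm v N m"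
  by (cases "m = 0") (auto simp: Knm_iff Suc_le_eq lastrow_def, auto simp: Knm_def)

lemma scal_mult_entry:
  assumes "A \<in> carrier_mat N N" "i < N" "j < N"
  shows "(scal N z * A) $$ (i,j) = z * A $$ (i,j)"
  using assms by (simp add: scal_def)

lemma scal_carrier [simp]: "scal N z \<in> carrier_mat N N"
  by (simp add: scal_def)

lemma scal_GLn: "z \<noteq> 0 \<Longrightarrow> scal N z \<in> GLn N"
  by (simp add: GLn_def scal_def)

lemma scal_mult: "scal N z * scal N z' = scal N (z * z')"
  by (rule eq_matI) (auto simp: scal_def)

lemma scal_commute: "A \<in> carrier_mat N N \<Longrightarrow> A * scal N z = scal N z * A"
  unfolding scal_def
  by (simp add: mult_smult_distrib[of A N N "1\<^sub>m N" N] mult_smult_assoc_mat[of "1\<^sub>m N" N N A N])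

lemma scal_one: "A \<in> carrier_mat N N \<Longrightarrow> scal N 1 * A = A"
  unfolding scal_def by (simp add: mult_smult_assoc_mat[of "1\<^sub>m N" N N A N]) (rule eq_matI, auto)

definition drel :: "nat \<Rightarrow> nat \<Rightarrow> 'f mat \<Rightarrow> 'f mat \<Rightarrow> bool" where
  "drel N m g h \<longleftrightarrow> (\<exists>z k k'. z \<noteq> 0 \<and> k \<in> Kn v N \<and> k' \<in> Knm v N m \<and> g = scal N z * k * h * k')"

lemma drelI: "z \<noteq> 0 \<Longrightarrow> k \<in> Kn v N \<Longrightarrow> k' \<in> Knm v N m \<Longrightarrow> g = scal N z * k * h * k' \<Longrightarrow> drel N m g h"
  by (auto simp: drel_def)

lemma drelI1: "k \<in> Kn v N \<Longrightarrow> k' \<in> Knm v N m \<Longrightarrow> h \<in> carrier_mat N N \<Longrightarrow> g = k * h * k' \<Longrightarrow> drel N m g h"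
  by (rule drelI[of 1]) (auto simp: scal_one Kn_GLn GLn_carrier)

lemma drel_refl: "N \<ge> 1 \<Longrightarrow> g \<in> GLn N \<Longrightarrow> drel N m g g"
  by (rule drelI1[OF Kn_one Knm_one]) (auto simp: GLn_one_mult GLn_carrier)

lemma drel_trans:
  assumes N: "N \<ge> 1" and 1: "drel N m g h" and 2: "drel N m h l" and l: "l \<in> GLn N"
  shows "drel N m g l"
proof -
  obtain z k k' where a: "z \<noteq> 0" "k \<in> Kn v N" "k' \<in> Knm v N m" "g = scal N z * k * h * k'"
    using 1 by (auto simp: drel_def)
  obtain y r r' where b: "y \<noteq> 0" "r \<in> Kn v N" "r' \<in> Knm v N m" "h = scal N y * r * l * r'"
    using 2 by (auto simp: drel_def)
  note G = scal_GLn[OF a(1), of N] scal_GLn[OF b(1), of N] Kn_GLn[OF a(2)] Kn_GLn[OF b(2)]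
    Kn_GLn[OF Knm_Kn[OF a(3)]] Kn_GLn[OF Knm_Kn[OF b(3)]] l
  have c: "k * (scal N y * A) = scal N y * (k * A)" if "A \<in> GLn N" for A
    using that G by (simp add: GLn_assoc[where n = N, symmetric] scal_commute GLn_carrier)
  have d: "scal N z * (scal N y * A) = scal N (z * y) * A" if "A \<in> GLn N" for A
    using that G by (simp add: GLn_assoc[where n = N, symmetric] scal_mult)
  have "g = scal N (z * y) * (k * r) * l * (r' * k')"
    unfolding a(4) b(4) using G a(1) b(1)
    by (simp add: GLn_assoc[where n = N] GLn_mult c d scal_GLn)
  then show ?thesis
    using a b N by (intro drelI[of "z * y" "k * r" N "r' * k'"]) (auto intro: Kn_mult Knm_mult)
qed

definition nf :: "nat \<Rightarrow> (nat \<Rightarrow> int) \<Rightarrow> (nat \<Rightarrow> 'f) \<Rightarrow> 'f mat" where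
  "nf N a x = mat N N (\<lambda>(i,j). if i = j then (if i < N - 1 then w powi a i else 1)
      else if j = N - 1 then x i else 0)"

lemma nf_carrier [simp]: "nf N a x \<in> carrier_mat N N"
  by (simp add: nf_def)

lemma nf_entry: "i < N \<Longrightarrow> j < N \<Longrightarrow> nf N a x $$ (i,j) =
   (if i = j then (if i < N - 1 then w powi a i else 1) else if j = N - 1 then x i else 0)"
  by (simp add: nf_def)

lemma nf_GLn: "nf N a x \<in> GLn N"
proof -
  have "det (nf N a x) = prod_list (diag_mat (nf N a x))"
    by (intro det_upper_triangular[of _ N]) (auto simp: nf_entry upper_triangular_def, auto simp: nf_def)
  also have "\<dots> \<noteq> 0" by (auto simp: diag_mat_def prod_list_zero_iff nf_def w0)
  finally show ?thesis by (simp add: GLn_def)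
qed

text \<open>Row operations may come from all of K, but column operations must lie in every K(m).
  They are therefore confined to the first \<open>N - 1\<close> columns, and the last column remains
  uncontrolled.\<close>

lemma smith_step:
  assumes N: "N \<ge> 2" and c: "c < N - 1" and g: "g \<in> GLn N"
    and S: "\<And>i j. i < N \<Longrightarrow> j < N - 1 \<Longrightarrow> i < c \<or> j < c \<Longrightarrow> i \<noteq> j \<Longrightarrow> g $$ (i,j) = 0"
  shows "\<exists>g'\<in>GLn N. drel N m g g' \<and>
    (\<forall>i j. i < N \<longrightarrow> j < N - 1 \<longrightarrow> i < Suc c \<or> j < Suc c \<longrightarrow> i \<noteq> j \<longrightarrow> g' $$ (i,j) = 0)"
proof -
  have N1: "N \<ge> 1" "c < N" using N c by auto
  define P where "P = {(i,j). c \<le> i \<and> i < N \<and> c \<le> j \<and> j < N - 1 \<and> g $$ (i,j) \<noteq> 0}"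
  have "finite P" by (rule finite_subset[of _ "{..<N} \<times> {..<N}"]) (auto simp: P_def)
  moreover have "P \<noteq> {}"
  proof -
    obtain i where i: "i < N" "g $$ (i,c) \<noteq> 0" using GLn_nonzero_col[OF g N1(2)] by blast
    then have "c \<le> i" using S[of i c] c by (cases "i < c") auto
    then have "(i,c) \<in> P" using i c by (auto simp: P_def)
    then show ?thesis by blast
  qed
  \<comment> \<open>Minimal valuation of the pivot makes all elimination quotients integral. The
    pivot is sought outside the last column, so the column transposition fixes index
    \<open>N - 1\<close> and lies in K(m).\<close>
  ultimately obtain r s where rs: "(r,s) \<in> P" and min: "\<And>i j. (i,j) \<in> P \<Longrightarrow> v (g $$ (r,s)) \<le> v (g $$ (i,j))"
    by (rule exists_minimizer[where f = "\<lambda>p. v (g $$ p)"]) auto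
  have rs': "c \<le> r" "r < N" "c \<le> s" "s < N - 1" "g $$ (r,s) \<noteq> 0" using rs by (auto simp: P_def)
  define p q where "p = Transposition.transpose r c" and "q = Transposition.transpose s c"
  have pp: "p permutes {..<N}" "q permutes {..<N}"
    unfolding p_def q_def using rs' N1 by (auto intro!: permutes_swap_id)
  have qp: "p i < N \<longleftrightarrow> i < N" "q i < N \<longleftrightarrow> i < N" for i
    using permutes_in_image[OF pp(1), of i] permutes_in_image[OF pp(2), of i] by auto
  have qn: "q j < N - 1" if "j < N - 1" for j using that rs' c by (auto simp: q_def Transposition.transpose_def)
  have qc: "q j = j" "p j = j" if "j < c" for j using that rs' by (auto simp: p_def q_def Transposition.transpose_def)
  have qge: "c \<le> q j" "c \<le> p j" if "c \<le> j" for j using that rs' by (auto simp: p_def q_def Transposition.transpose_def)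
  define g1 where "g1 = pm N p * g * pm N q"
  have P: "pm N p \<in> Kn v N" "pm N q \<in> Kn v N" using pp by (auto intro: pm_Kn)
  note PG = P[THEN Kn_GLn]
  have gc: "g \<in> carrier_mat N N" using g by (rule GLn_carrier)
  have g1e: "g1 $$ (i,j) = g $$ (p i, q j)" if "i < N" "j < N" for i j
  proof -
    have "g1 $$ (i,j) = (pm N p * g) $$ (i, q j)"
      unfolding g1_def using that pp by (intro pm_right mult_carrier_mat[of _ N N] gc) auto
    also have "i = p (p i)" by (simp add: p_def)
    also have "(pm N p * g) $$ (p (p i), q j) = g $$ (p i, q j)"
      using that qp by (intro pm_left gc pp) auto
    finally show ?thesis by (simp add: p_def)
  qed
  have g1G: "g1 \<in> GLn N" unfolding g1_def using PG g by (intro GLn_mult)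
  have inv: "pm N p * pm N p = (1\<^sub>m N :: 'f mat)" "pm N q * pm N q = (1\<^sub>m N :: 'f mat)"
    using pm_inverse[OF pp(1)] pm_inverse[OF pp(2)] by (auto simp: p_def q_def)
  have cancel: "A * (A * C) = C" if "A * A = 1\<^sub>m N" "A \<in> GLn N" "C \<in> GLn N" for A C :: "'f mat"
    using that by (simp add: GLn_assoc[where n = N, symmetric] GLn_one_mult)
  have "g = pm N p * g1 * pm N q"
    unfolding g1_def using PG g inv
    by (simp add: GLn_assoc[where n = N] GLn_mult cancel GLn_one_mult)
  moreover have "pm N q \<in> Knm v N m"
  proof (rule KnmI[OF N1(1) P(2)])
    fix j assume j: "j < N"
    have "q (N - 1) = N - 1" using rs' c by (auto simp: q_def Transposition.transpose_def)
    then have "N - 1 = q j \<longleftrightarrow> j = N - 1" using permutes_inj[OF pp(2)] by (metis injD)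
    then show "(pm N q :: 'f mat) $$ (N-1,j) = (if j = N - 1 then 1 else 0)" using j N1 by (simp add: pm_def)
  qed
  ultimately have d1: "drel N m g g1" using P g1G by (intro drelI1) (auto simp: GLn_carrier)
  define d where "d = g1 $$ (c,c)"
  have d: "d = g $$ (r,s)" "d \<noteq> 0" using g1e[of c c] N1 rs' by (auto simp: d_def p_def q_def)
  have S1: "g1 $$ (i,j) = 0" if "i < N" "j < N - 1" "i < c \<or> j < c" "i \<noteq> j" for i j
  proof -
    have "g $$ (p i, q j) = 0"
    proof (rule S)
      show "p i < N" "q j < N - 1" using that qp qn by auto
      show "p i < c \<or> q j < c" using that(3) qc by auto
      show "p i \<noteq> q j"
        using that(3,4) qc[of i] qc[of j] qge[of i] qge[of j] by (cases "i < c"; cases "j < c") (auto simp: not_less)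
    qed
    then show ?thesis using g1e that by simp
  qed
  have ratio: "vge 0 (- g1 $$ (i,j) / d)" if "c \<le> i" "i < N" "c \<le> j" "j < N - 1" for i j
  proof (cases "g1 $$ (i,j) = 0")
    case False
    then have "(p i, q j) \<in> P" using that qge qn qp g1e[of i j] by (auto simp: P_def)
    then have "v d \<le> v (g1 $$ (i,j))" using min d(1) g1e[of i j] that by simp
    then have "vge 0 (g1 $$ (i,j) / d)" using False d by (simp add: vge_def v_divide)
    then show ?thesis using vge_minus[of 0 "g1 $$ (i,j) / d"] by simp
  qed simp
  define L where "L = row_tv N c (\<lambda>i. if c < i then - g1 $$ (i,c) / d else 0)"
  define R where "R = col_tv N c (\<lambda>j. if c < j \<and> j < N - 1 then - g1 $$ (c,j) / d else 0)"
  have LK: "L \<in> Kn v N" unfolding L_def using N1 c ratio[of _ c] by (intro row_tv_Kn) auto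
  have RK: "R \<in> Kn v N" unfolding R_def using N1 c ratio[of c] by (intro col_tv_Kn) auto
  have RKm: "R \<in> Knm v N m"
    by (rule KnmI[OF N1(1) RK]) (use c N1 in \<open>auto simp: R_def col_tv_entry\<close>)
  define g2 where "g2 = L * g1 * R"
  have LG: "L \<in> GLn N" "R \<in> GLn N" using LK RK by (auto intro: Kn_GLn)
  have g2G: "g2 \<in> GLn N" unfolding g2_def using LG g1G by (intro GLn_mult)
  have Lg: "(L * g1) $$ (i,j) = g1 $$ (i,j) + (if c < i then - g1 $$ (i,c) / d else 0) * g1 $$ (c,j)"
    if "i < N" "j < N" for i j
    unfolding L_def using that g1G N1 by (intro row_tv_mult GLn_carrier)
  have g2e: "g2 $$ (i,j) = (L * g1) $$ (i,j) + (L * g1) $$ (i,c) * (if c < j \<and> j < N - 1 then - g1 $$ (c,j) / d else 0)"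
    if "i < N" "j < N" for i j
    unfolding g2_def R_def using that g1G LG N1 by (intro col_tv_mult GLn_carrier GLn_mult)
  have Lc: "(L * g1) $$ (i,c) = (if i = c then d else 0)" if "i < N" for i
    using Lg[of i c] that N1 d c S1[of i c] by (cases i c rule: linorder_cases) (auto simp: d_def)
  have Lcj: "(L * g1) $$ (c,j) = g1 $$ (c,j)" if "j < N" for j using Lg[of c j] that N1 by simp
  have "g2 $$ (i,j) = 0" if ij: "i < N" "j < N - 1" "i < Suc c \<or> j < Suc c" "i \<noteq> j" for i j
  proof -
    have jN: "j < N" using ij by simp
    consider "j = c" | "i = c" "c < j" | "i < c \<or> j < c" using ij by linarith
    then show ?thesis
    proof cases
      case 1
      then show ?thesis using ij Lc g2e[of i c] N1 by simp
    next
      case 2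
      then show ?thesis using ij jN Lc[of c] Lcj[OF jN] g2e[of c j] N1 d by simp
    next
      case 3
      have "(L * g1) $$ (i,j) = 0"
      proof -
        have "g1 $$ (i,j) = 0" using S1 ij 3 by blast
        moreover have "\<not> c < i \<or> g1 $$ (c,j) = 0" using S1[of c j] 3 ij N1 by auto
        ultimately show ?thesis using Lg[of i j] ij jN by auto
      qed
      moreover have "i < c \<Longrightarrow> (L * g1) $$ (i,c) = 0" using Lc[of i] ij by simp
      ultimately show ?thesis using g2e[of i j] ij jN 3 by auto
    qed
  qed
  moreover have "drel N m g1 g2"
  proof (rule drelI1)
    show "ginv L \<in> Kn v N" "ginv R \<in> Knm v N m" using LK RKm N1 by (auto intro: Kn_ginv Knm_ginv)
    show "g1 = ginv L * g2 * ginv R"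
      unfolding g2_def using LG g1G
      by (simp add: GLn_assoc[where n = N] GLn_mult ginv[where n = N] ginv_cancel[where n = N] GLn_one_mult)
  qed (use g2G in \<open>simp add: GLn_carrier\<close>)
  ultimately show ?thesis using g2G drel_trans[OF N1(1) d1 _ g2G] by blast
qed

text \<open>After all steps the matrix is upper triangular with off-diagonal entries only in the
  last column. A central scalar turns the corner into 1 and a diagonal unit matrix on the left turns
  the other diagonal entries into powers of the uniformiser.\<close>

theorem smith_normal_form:
  assumes N: "N \<ge> 2" and g: "g \<in> GLn N"
  obtains a x where "drel N m g (nf N a x)"
proof -
  have N1: "N \<ge> 1" using N by simp
  have "\<exists>g'\<in>GLn N. drel N m g g' \<and>
    (\<forall>i j. i < N \<longrightarrow> j < N - 1 \<longrightarrow> i < c \<or> j < c \<longrightarrow> i \<noteq> j \<longrightarrow> g' $$ (i,j) = 0)" if "c \<le> N - 1" for c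
    using that
  proof (induction c)
    case 0
    show ?case by (intro bexI[OF _ g] conjI drel_refl N1 g) auto
  next
    case (Suc c)
    then obtain g' where g': "g' \<in> GLn N" "drel N m g g'"
      "\<And>i j. i < N \<Longrightarrow> j < N - 1 \<Longrightarrow> i < c \<or> j < c \<Longrightarrow> i \<noteq> j \<Longrightarrow> g' $$ (i,j) = 0" by auto
    from smith_step[of N c g' m, OF N _ g'(1,3)] Suc.prems obtain g'' where g'': "g'' \<in> GLn N" "drel N m g' g''"
     "\<forall>i j. i < N \<longrightarrow> j < N - 1 \<longrightarrow> i < Suc c \<or> j < Suc c \<longrightarrow> i \<noteq> j \<longrightarrow> g'' $$ (i,j) = 0" by auto
    then show ?case using drel_trans[OF N1 g'(2) g''(2,1)] by blast
  qed
  from this[of "N - 1"] obtain h where h: "h \<in> GLn N" "drel N m g h"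
    "\<And>i j. i < N \<Longrightarrow> j < N - 1 \<Longrightarrow> i \<noteq> j \<Longrightarrow> h $$ (i,j) = 0" by auto
  have hc: "h \<in> carrier_mat N N" using h by (simp add: GLn_carrier)
  have ut: "h $$ (i,j) = 0" if "i < N" "j < i" for i j using that h(3)[of i j] by simp
  have "det h = prod_list (diag_mat h)"
    using hc ut by (intro det_upper_triangular[of _ N]) (auto simp: upper_triangular_def)
  then have "prod_list (diag_mat h) \<noteq> 0" using h by (simp add: GLn_def)
  then have diag: "h $$ (i,i) \<noteq> 0" if "i < N" for i using that hc by (auto simp: diag_mat_def prod_list_zero_iff)
  define y where "y = h $$ (N-1,N-1)"
  have y: "y \<noteq> 0" using diag N by (simp add: y_def)
  define a where "a i = v (h $$ (i,i) / y)" for i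
  \<comment> \<open>The unit parts of the diagonal entries, collected in the matrix
    \<open>E\<close>.\<close>
  define e where "e i = (if i < N - 1 then h $$ (i,i) / y / w powi a i else 1)" for i
  have e0: "e i \<noteq> 0" if "i < N" for i using diag[OF that] y w0 by (auto simp: e_def)
  have ve: "v (e i) = 0" if "i < N" for i
  proof (cases "i < N - 1")
    case True
    then have "v (e i) = v (h $$ (i,i) / y) - v (w powi a i)"
      unfolding e_def using diag[OF that] y w0 by (simp add: v_divide v_mult)
    then show ?thesis by (simp add: v_powi a_def)
  qed (simp add: e_def v_1)
  define x where "x i = h $$ (i,N-1) / (y * e i)" for i
  define E where "E = mat N N (\<lambda>(i,j). if i = j then e i else 0)"
  have Ec: "E \<in> carrier_mat N N" by (simp add: E_def)
  have EK: "E \<in> Kn v N"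
  proof (rule Kn_I)
    let ?E' = "mat N N (\<lambda>(i,j). if i = j then inverse (e i) else 0)"
    show "intg N E" using e0 ve by (auto simp: intg_def E_def vge_def)
    show "intg N ?E'" using e0 ve by (auto simp: intg_def vge_def v_inverse)
    show "E * ?E' = 1\<^sub>m N"
    proof (rule eq_matI)
      fix i j assume "i < dim_row (1\<^sub>m N :: 'f mat)" "j < dim_col (1\<^sub>m N :: 'f mat)"
      then have ij: "i < N" "j < N" by auto
      have "(E * ?E') $$ (i,j) = (\<Sum>k<N. E $$ (i,k) * ?E' $$ (k,j))" using Ec ij by (intro mat_mult_entry) auto
      also have "\<dots> = (\<Sum>k<N. if k = i then (if i = j then 1 else 0) else 0)"
        using ij e0 by (intro sum.cong) (auto simp: E_def)
      finally show "(E * ?E') $$ (i,j) = 1\<^sub>m N $$ (i,j)" using ij by simp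
    qed (auto simp: E_def)
  qed
  have "h = scal N y * E * nf N a x * 1\<^sub>m N"
  proof (rule eq_matI)
    fix i j assume "i < dim_row (scal N y * E * nf N a x * 1\<^sub>m N)" "j < dim_col (scal N y * E * nf N a x * 1\<^sub>m N)"
    then have ij: "i < N" "j < N" by (auto simp: scal_def)
    have "(E * nf N a x) $$ (i,j) = (\<Sum>k<N. E $$ (i,k) * nf N a x $$ (k,j))"
      using Ec ij by (intro mat_mult_entry) auto
    also have "\<dots> = (\<Sum>k<N. if k = i then e i * nf N a x $$ (i,j) else 0)"
      using ij by (intro sum.cong) (auto simp: E_def)
    also have "\<dots> = e i * nf N a x $$ (i,j)" using ij by simp
    finally have "(scal N y * (E * nf N a x)) $$ (i,j) = y * (e i * nf N a x $$ (i,j))"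
      using ij Ec by (subst scal_mult_entry) (auto intro: mult_carrier_mat[of _ N N])
    also have "\<dots> = h $$ (i,j)"
    proof (cases "i = j")
      case True
      then show ?thesis using ij y w0 by (cases "i = N - 1") (auto simp: nf_entry e_def y_def)
    next
      case False
      then show ?thesis using ij y e0[OF ij(1)] h(3)[of i j] by (cases "j = N - 1") (auto simp: nf_entry x_def)
    qed
    finally show "h $$ (i,j) = (scal N y * E * nf N a x * 1\<^sub>m N) $$ (i,j)"
      using Ec y EK nf_GLn[of N a x]
      by (simp add: GLn_assoc[where n = N] scal_GLn Kn_GLn GLn_mult GLn_one_mult GLn_one)
  qed (use hc in \<open>auto simp: scal_def\<close>)
  then have "drel N m h (nf N a x)" using y EK Knm_one[OF N1] by (intro drelI[of y E N "1\<^sub>m N"])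
  then have "drel N m g (nf N a x)" using drel_trans[OF N1 h(2) _ nf_GLn] by blast
  then show ?thesis using that by blast
qed

text \<open>Adding integral multiples of the last row changes \<open>x i\<close> by integers. Adding
  integral multiples of column \<open>i\<close> to the last column changes it by the ideal of
  exponent \<open>a i\<close>. The larger of the two ideals has exponent
  \<open>min 0 (a i)\<close>.\<close>

lemma nf_reduce:
  assumes N: "N \<ge> 2" and x: "\<And>i. i < N - 1 \<Longrightarrow> vge (min 0 (a i)) (x i - x' i)"
  shows "drel N m (nf N a x) (nf N a x')"
proof -
  have N1: "N \<ge> 1" "N - 1 < N" using N by auto
  define al where "al i = (if a i \<ge> 0 then x i - x' i else 0)" for i
  define be where "be i = (if a i \<ge> 0 then 0 else (x i - x' i) / w powi a i)" for i
  have al: "vge 0 (al i)" if "i < N - 1" for i using x[OF that] by (auto simp: al_def)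
  have be: "vge 0 (be i)" if "i < N - 1" for i
  proof (cases "a i \<ge> 0")
    case False
    then have "vge (a i) (w powi a i * be i)" using x[OF that] w0 by (simp add: be_def)
    then show ?thesis by (simp add: vge_powi_mult)
  qed (simp add: be_def)
  let ?t = "nf N a x'"
  let ?B = "Ncol N (N-1) be" and ?A = "Ncol N (N-1) al"
  have NK: "Ncol N (N-1) y \<in> Kn v N" if "\<And>i. i < N - 1 \<Longrightarrow> vge 0 (y i)" for y
    unfolding Ncol_def using N1 that by (intro row_tv_Kn) auto
  have NKm: "?B \<in> Knm v N m"
    using N1 by (intro KnmI NK be) (auto simp: Ncol_entry)
  have "nf N a x = ?A * ?t * ?B"
  proof (rule eq_matI)
    fix i j assume "i < dim_row (?A * ?t * ?B)" "j < dim_col (?A * ?t * ?B)"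
    then have ij: "i < N" "j < N" by (auto simp: Ncol_def row_tv_def)
    have C: "?t * ?B \<in> carrier_mat N N" by (auto intro!: mult_carrier_mat[of _ N N])
    have e: "(?t * ?B) $$ (l,j) = ?t $$ (l,j) + (if j = N - 1 \<and> l < N - 1 then w powi a l * be l else 0)" if l: "l < N" for l
    proof -
      have "(?t * ?B) $$ (l,j) = (\<Sum>k<N. ?t $$ (l,k) * ?B $$ (k,j))"
        using ij l by (intro mat_mult_entry) auto
      also have "\<dots> = (\<Sum>k<N. (if k = j then ?t $$ (l,j) else 0) +
          (if k = l then (if j = N - 1 \<and> l < N - 1 then w powi a l * be l else 0) else 0))"
        using l ij N1 by (intro sum.cong) (auto simp: nf_entry Ncol_entry algebra_simps)
      finally show ?thesis using l ij by (simp add: sum.distrib)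
    qed
    have "(?A * (?t * ?B)) $$ (i,j) =
       (?t * ?B) $$ (i,j) + (if i < N - 1 then al i * (?t * ?B) $$ (N-1,j) else 0)"
      using C N1 ij by (intro Ncol_mult_entry) auto
    also have "\<dots> = nf N a x $$ (i,j)"
      unfolding e[OF ij(1)] e[OF N1(2)] using ij N1 w0
      by (auto simp: nf_entry al_def be_def)
    finally show "nf N a x $$ (i,j) = (?A * ?t * ?B) $$ (i,j)"
      by (simp add: assoc_mult_mat[of _ N N _ N _ N])
  qed (auto simp: Ncol_def row_tv_def nf_def)
  then show ?thesis using NK[OF al] NKm by (intro drelI1) auto
qed

text \<open>The exponents of all n diagonal entries, with 0 for the corner entry 1.\<close>

definition ax :: "nat \<Rightarrow> (nat \<Rightarrow> int) \<Rightarrow> nat \<Rightarrow> int" where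
  "ax N a i = (if i < N - 1 then a i else 0)"

lemma diag_right:
  assumes "A \<in> carrier_mat N N" "i < N" "j < N"
  shows "(A * nf N a (\<lambda>_. 0)) $$ (i,j) = A $$ (i,j) * w powi ax N a j"
proof -
  have "(A * nf N a (\<lambda>_. 0)) $$ (i,j) = (\<Sum>k<N. A $$ (i,k) * nf N a (\<lambda>_. 0) $$ (k,j))"
    using assms by (intro mat_mult_entry) auto
  also have "\<dots> = (\<Sum>k<N. if k = j then A $$ (i,j) * w powi ax N a j else 0)"
    using assms by (intro sum.cong) (auto simp: nf_entry ax_def)
  finally show ?thesis using assms by simp
qed

lemma diag_left:
  assumes "A \<in> carrier_mat N N" "i < N" "j < N"
  shows "(nf N a (\<lambda>_. 0) * A) $$ (i,j) = w powi ax N a i * A $$ (i,j)"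
proof -
  have "(nf N a (\<lambda>_. 0) * A) $$ (i,j) = (\<Sum>k<N. nf N a (\<lambda>_. 0) $$ (i,k) * A $$ (k,j))"
    using assms by (intro mat_mult_entry) auto
  also have "\<dots> = (\<Sum>k<N. if k = i then w powi ax N a i * A $$ (i,j) else 0)"
    using assms by (intro sum.cong) (auto simp: nf_entry ax_def)
  finally show ?thesis using assms by simp
qed

text \<open>Conjugation by a permutation matrix fixing the last index, which lies in every K(m). The
  negated exponents are sorted because the wanted order is decreasing.\<close>

lemma diag_sort:
  assumes N: "N \<ge> 1"
  obtains b where "drel N m (nf N a (\<lambda>_. 0)) (nf N b (\<lambda>_. 0))"
    "\<And>i j. i < j \<Longrightarrow> j < N - 1 \<Longrightarrow> b j \<le> b i" "b ` {..<N-1} = a ` {..<N-1}"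
proof -
  define xs where "xs = map (\<lambda>i. - a i) [0..<N-1]"
  have len: "length xs = N - 1" by (simp add: xs_def)
  have "mset (sort xs) = mset xs" by simp
  then obtain p where p: "p permutes {..<length xs}" "permute_list p xs = sort xs"
    by (rule mset_eq_permutation)
  have pN1: "p permutes {..<N-1}" using p(1) len by simp
  have pN: "p permutes {..<N}" by (rule permutes_subset[OF pN1]) auto
  define b where "b i = a (p i)" for i
  have pi: "p i < N - 1" if "i < N - 1" for i using permutes_in_image[OF pN1, of i] that by simp
  have nth: "sort xs ! i = - b i" if "i < N - 1" for i
  proof -
    have "sort xs ! i = xs ! p i" using p that len by (metis permute_list_nth)
    then show ?thesis using pi[OF that] by (simp add: xs_def b_def)
  qed
  have "b j \<le> b i" if "i < j" "j < N - 1" for i j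
  proof -
    have "sort xs ! i \<le> sort xs ! j" using that len by (intro sorted_nth_mono) auto
    then show ?thesis using nth[of i] nth[of j] that by simp
  qed
  moreover have "b ` {..<N-1} = a ` {..<N-1}"
    unfolding b_def using permutes_image[OF pN1] by (metis image_image)
  moreover have "drel N m (nf N a (\<lambda>_. 0)) (nf N b (\<lambda>_. 0))"
  proof (rule drelI1)
    let ?P = "pm N p :: 'f mat"
    have PK: "?P \<in> Kn v N" by (rule pm_Kn[OF pN])
    have pl: "p (N - 1) = N - 1" using permutes_not_in[OF pN1, of "N - 1"] by simp
    have "?P \<in> Knm v N m"
    proof (rule KnmI[OF N PK])
      fix j assume j: "j < N"
      have "N - 1 = p j \<longleftrightarrow> j = N - 1" using pl permutes_inj[OF pN] by (metis injD)
      then show "?P $$ (N-1,j) = (if j = N - 1 then 1 else 0)" using j N by (simp add: pm_def)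
    qed
    then show "ginv ?P \<in> Knm v N m" by (rule Knm_ginv[OF N])
    show "?P \<in> Kn v N" by (rule PK)
    have "nf N a (\<lambda>_. 0) * ?P = ?P * nf N b (\<lambda>_. 0)"
    proof (rule eq_matI)
      fix i j assume "i < dim_row (?P * nf N b (\<lambda>_. 0))" "j < dim_col (?P * nf N b (\<lambda>_. 0))"
      then have ij: "i < N" "j < N" by (auto simp: pm_def nf_def)
      have "w powi ax N a i * ?P $$ (i,j) = ?P $$ (i,j) * w powi ax N b j"
      proof (cases "i = p j")
        case True
        have "ax N a (p j) = ax N b j"
          using pi[of j] pl ij by (cases "j < N - 1") (auto simp: ax_def b_def not_less dest: le_antisym)
        then show ?thesis using True by simp
      qed (use ij in \<open>simp add: pm_def\<close>)
      then show "(nf N a (\<lambda>_. 0) * ?P) $$ (i,j) = (?P * nf N b (\<lambda>_. 0)) $$ (i,j)"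
        using ij by (simp add: diag_left diag_right del: index_mult_mat(1))
    qed (auto simp: pm_def nf_def)
    then show "nf N a (\<lambda>_. 0) = ?P * nf N b (\<lambda>_. 0) * ginv ?P"
      using ginv_cancel(3)[OF Kn_GLn[OF PK] nf_GLn[of N a "\<lambda>_. 0"]] by simp
  qed simp
  ultimately show ?thesis using that by blast
qed

end

section \<open>Double cosets and fixed vectors\<close>

text \<open>The first \<open>c + 1\<close> rows are supported in only \<open>c\<close> columns, so
  by the pigeonhole principle each term of the Leibniz formula contains a zero.\<close>

lemma det_zero_block:
  fixes A :: "'a::comm_ring_1 mat"
  assumes A: "A \<in> carrier_mat N N" and c: "c < N"
    and z: "\<And>i j. i \<le> c \<Longrightarrow> c \<le> j \<Longrightarrow> j < N \<Longrightarrow> A $$ (i,j) = 0"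
  shows "det A = 0"
proof -
  have "(\<Prod>i = 0..<N. A $$ (i, p i)) = 0" if p: "p permutes {0..<N}" for p
  proof -
    have "\<exists>i\<le>c. c \<le> p i"
    proof (rule ccontr)
      assume "\<not> ?thesis"
      then have "\<forall>i\<le>c. p i < c" by (meson not_le)
      then have "p ` {..c} \<subseteq> {..<c}" by auto
      then have "card (p ` {..c}) \<le> c" using card_mono[of "{..<c}"] by simp
      moreover have "card (p ` {..c}) = Suc c"
        using permutes_inj[OF p] by (simp add: card_image inj_on_subset[OF _ subset_UNIV])
      ultimately show False by simp
    qed
    then obtain i where i: "i \<le> c" "c \<le> p i" by blast
    have "p i < N" using permutes_in_image[OF p, of i] i c by simp
    then have "A $$ (i, p i) = 0" using z i by blast
    then show ?thesis using i c by (intro prod_zero) auto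
  qed
  then show ?thesis unfolding det_def'[OF A] by (intro sum.neutral) auto
qed

section \<open>The support of fixed vectors\<close>

locale depth_zero = local_field v red w + cuspidal_model psi n Wt
  for v :: "'f::field \<Rightarrow> int" and red :: "'f \<Rightarrow> 'k::{field,finite}" and w
    and psi :: "'k \<Rightarrow> 'r::field" and n and Wt +
  fixes om :: "'f \<Rightarrow> 'r"
  assumes cc: "central_char_compatible v red n om Wt"
begin

lemma om_nonzero: "x \<noteq> 0 \<Longrightarrow> om x \<noteq> 0"
  and om_mult: "x \<noteq> 0 \<Longrightarrow> y \<noteq> 0 \<Longrightarrow> om (x * y) = om x * om y"
  and om_unit: "isUnit v x \<Longrightarrow> W \<in> Wt \<Longrightarrow> rt n (scal n (red x)) W = (\<lambda>y. om x * W y)"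
  using cc by (auto simp: central_char_compatible_def)

lemma om_1: "om 1 = 1"
  using om_mult[of 1 1] om_nonzero[of 1] by simp

lemma n1: "n \<ge> 1"
  using n2 by simp

abbreviation Fx :: "nat \<Rightarrow> ('f mat \<Rightarrow> 'k mat \<Rightarrow> 'r) set" where
  "Fx m \<equiv> fixed_vectors v red n om Wt m"

lemma Fx_Wt: "f \<in> Fx m \<Longrightarrow> f g \<in> Wt"
  using Wt_0 by (cases "g \<in> GLn n") (auto simp: fixed_vectors_def ind_space_def)

lemma Fx_outside: "f \<in> Fx m \<Longrightarrow> g \<notin> GLn n \<Longrightarrow> f g = 0"
  by (auto simp: fixed_vectors_def ind_space_def)

lemma Fx_left: "f \<in> Fx m \<Longrightarrow> z \<noteq> 0 \<Longrightarrow> k \<in> Kn v n \<Longrightarrow> g \<in> GLn n \<Longrightarrow>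
    f (scal n z * k * g) = (\<lambda>y. om z * rt n (kbar red n k) (f g) y)"
  by (auto simp: fixed_vectors_def ind_space_def)

lemma Fx_right: "f \<in> Fx m \<Longrightarrow> g \<in> GLn n \<Longrightarrow> k \<in> Knm v n m \<Longrightarrow> f (g * k) = f g"
  by (auto simp: fixed_vectors_def)

lemma Fx_drel:
  assumes f: "f \<in> Fx m" and h: "h \<in> GLn n" and z: "z \<noteq> 0" and k: "k \<in> Kn v n" and k': "k' \<in> Knm v n m"
  shows "f (scal n z * k * h * k') = (\<lambda>y. om z * rt n (kbar red n k) (f h) y)"
proof -
  have "scal n z * k * h \<in> GLn n" using z h Kn_GLn[OF k] by (intro GLn_mult scal_GLn)
  then show ?thesis using Fx_right[OF f _ k'] Fx_left[OF f z k h] by simp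
qed

lemma Fx_drel_zero:
  assumes "f \<in> Fx m" "h \<in> GLn n" "drel n m g h" "f h = 0"
  shows "f g = 0"
  using assms Fx_drel[OF assms(1,2)] by (auto simp: drel_def rt_def fun_eq_iff)

text \<open>The value of \<open>f\<close> at \<open>k * g\<close> is computed once from the left and
  once, as \<open>g * k'\<close>, from the right. So the value at \<open>g\<close> is fixed by the
  reduction of the stabiliser, and all vanishing results come from finding enough of that
  reduction.\<close>

lemma Fx_stab:
  assumes f: "f \<in> Fx m" and g: "g \<in> GLn n" and k: "k \<in> Kn v n" and k': "k' \<in> Knm v n m" and eq: "k * g = g * k'"
  shows "rt n (kbar red n k) (f g) = f g"
proof -
  have "f (scal n 1 * k * g) = rt n (kbar red n k) (f g)" using Fx_left[OF f _ k g, of 1] by (simp add: om_1)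
  moreover have "scal n 1 * k * g = g * k'" using eq k by (simp add: scal_one GLn_carrier Kn_GLn)
  ultimately show ?thesis using Fx_right[OF f g k'] by simp
qed

lemma Fx_radical_zero:
  assumes f: "f \<in> Fx m" and g: "g \<in> GLn n" and I: "I \<subseteq> {..<n}" "I \<noteq> {}" "I \<noteq> {..<n}"
    and ex: "\<And>u. u \<in> radI n I \<Longrightarrow> u \<in> GLn n \<Longrightarrow>
      \<exists>k\<in>Kn v n. \<exists>k'\<in>Knm v n m. k * g = g * k' \<and> kbar red n k = u"
  shows "f g = 0"
proof (rule radI_invariant_zero[OF I Fx_Wt[OF f]])
  fix u :: "'k mat" assume "u \<in> radI n I" "u \<in> GLn n"
  then obtain k k' where "k\<in>Kn v n" "k'\<in>Knm v n m" "k * g = g * k'" "kbar red n k = u" using ex by blast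
  then show "rt n u (f g) = f g" using Fx_stab[OF f g] by blast
qed

lemma lift_Kn:
  assumes u: "u \<in> GLn n"
  defines "A \<equiv> mat n n (\<lambda>(i,j). lift (u $$ (i,j)))"
  shows "A \<in> Kn v n" "kbar red n A = u" "\<And>i j. i < n \<Longrightarrow> j < n \<Longrightarrow> A $$ (i,j) = lift (u $$ (i,j))"
proof -
  show kb: "kbar red n A = u"
    using GLn_carrier[OF u] by (intro eq_matI) (auto simp: kbar_def A_def lift)
  have "intg n A" by (auto simp: intg_def A_def lift)
  then show "A \<in> Kn v n" using kb u by (simp add: Kn_iff GLn_def)
qed (simp add: A_def)

abbreviation tt :: "(nat \<Rightarrow> int) \<Rightarrow> 'f mat" where
  "tt a \<equiv> nf n a (\<lambda>_. 0)"

text \<open>The matrix \<open>k'\<close> is \<open>A\<close> conjugated by the inverse of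
  \<open>tt a\<close>, with entries scaled by the differences of exponents. Hypothesis
  \<open>e\<close> makes it integral, and \<open>l\<close> is the condition on its last row, where
  the row exponent is 0.\<close>

lemma diag_conj:
  assumes A: "A \<in> Kn v n" and m: "m \<ge> 1"
    and e: "\<And>i j. i < n \<Longrightarrow> j < n \<Longrightarrow> vge (ax n a i - ax n a j) (A $$ (i,j))"
    and l: "\<And>j. j < n \<Longrightarrow> vge (int m) (w powi ax n a j * A $$ (n-1,j) - (if j = n - 1 then 1 else 0))"
  shows "\<exists>k'\<in>Knm v n m. A * tt a = tt a * k'"
proof -
  define k' where "k' = mat n n (\<lambda>(i,j). w powi (ax n a j - ax n a i) * A $$ (i,j))"
  have k'c: "k' \<in> carrier_mat n n" by (simp add: k'_def)
  have Ac: "A \<in> carrier_mat n n" using A by (simp add: Kn_GLn GLn_carrier)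
  have eq: "A * tt a = tt a * k'"
  proof (rule eq_matI)
    fix i j assume "i < dim_row (tt a * k')" "j < dim_col (tt a * k')"
    then have ij: "i < n" "j < n" by (auto simp: k'_def nf_def)
    show "(A * tt a) $$ (i,j) = (tt a * k') $$ (i,j)"
      using ij w0 unfolding diag_right[OF Ac ij] diag_left[OF k'c ij] by (simp add: k'_def powi_diff)
  qed (use Ac k'c in \<open>auto simp: nf_def\<close>)
  have "det A * det (tt a) = det (tt a) * det k'"
    using arg_cong[OF eq, of det] Ac k'c by (simp add: det_mult[of _ n])
  then have "det k' = det A" using nf_GLn[of n a "\<lambda>_. 0"] by (simp add: GLn_def)
  moreover have "vge 0 (k' $$ (i,j))" if "i < n" "j < n" for i j
    using e[OF that] that by (simp add: k'_def vge_powi_mult)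
  ultimately have K: "k' \<in> Kn v n" using A k'c by (auto simp: Kn_def GLn_def inO_vge)
  have "k' $$ (n-1,j) = w powi ax n a j * A $$ (n-1,j)" if "j < n" for j
    using that by (simp add: k'_def ax_def)
  then have "k' \<in> Knm v n m" using K l m n1 by (simp add: Knm_iff lastrow_def)
  then show ?thesis using eq by blast
qed

text \<open>Every element of the radical attached to \<open>I\<close> lifts to the stabiliser:
  condition \<open>1\<close> keeps the scaled entries integral, and condition \<open>2\<close> is
  the last-row condition, relevant only if the last index belongs to \<open>I\<close>.\<close>

lemma diag_radical_zero:
  assumes f: "f \<in> Fx m" and m: "m \<ge> 1" and I: "I \<subseteq> {..<n}" "I \<noteq> {}" "I \<noteq> {..<n}"
    and 1: "\<And>i j. i \<in> I \<Longrightarrow> j < n \<Longrightarrow> j \<notin> I \<Longrightarrow> ax n a i \<le> ax n a j"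
    and 2: "\<And>j. n - 1 \<in> I \<Longrightarrow> j < n \<Longrightarrow> j \<notin> I \<Longrightarrow> int m \<le> ax n a j"
  shows "f (tt a) = 0"
proof (rule Fx_radical_zero[OF f nf_GLn I])
  fix u :: "'k mat" assume u: "u \<in> radI n I" "u \<in> GLn n"
  define A where "A = mat n n (\<lambda>(i,j). lift (u $$ (i,j)))"
  note A = lift_Kn[OF u(2), folded A_def]
  have off: "A $$ (i,j) = (if i = j then 1 else 0)" if "i < n" "j < n" "\<not> (i \<in> I \<and> j \<notin> I)" for i j
    using u(1) that A(3)[of i j] by (auto simp: radI_def lift)
  have "\<exists>k'\<in>Knm v n m. A * tt a = tt a * k'"
  proof (rule diag_conj[OF A(1) m])
    fix i j assume ij: "i < n" "j < n"
    show "vge (ax n a i - ax n a j) (A $$ (i,j))"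
    proof (cases "i \<in> I \<and> j \<notin> I")
      case True
      then show ?thesis using 1[of i j] ij A(1) by (intro vge_mono[OF Kn_entry]) auto
    qed (use off[OF ij] in auto)
  next
    fix j assume j: "j < n"
    show "vge (int m) (w powi ax n a j * A $$ (n-1,j) - (if j = n - 1 then 1 else 0))"
    proof (cases "n - 1 \<in> I \<and> j \<notin> I")
      case True
      then have "vge (int m) (w powi ax n a j * A $$ (n-1,j))"
        using 2[of j] j n1 A(1) unfolding vge_powi_mult by (intro vge_mono[OF Kn_entry]) auto
      then show ?thesis using True by auto
    next
      case False
      then show ?thesis using off[of "n-1" j] j n1 by (auto simp: ax_def)
    qed
  qed
  then show "\<exists>k\<in>Kn v n. \<exists>k'\<in>Knm v n m. k * tt a = tt a * k' \<and> kbar red n k = u" using A by blast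
qed

text \<open>The indices \<open>i\<close> with \<open>x i \<noteq> 0\<close> have \<open>v (x i) < min 0 (a i)\<close>. Let \<open>M\<close> be the maximum of
  \<open>a i - v (x i)\<close> over these, attained at \<open>r\<close>. For \<open>a i \<le> M\<close> the entry \<open>(i, n - 1)\<close> of the stabiliser is
  arbitrary modulo the maximal ideal: adding \<open>s\<close> in position \<open>(i, r)\<close> with \<open>s (x r)\<close> integral only costs
  an entry that reduces to \<open>0\<close>. So the stabiliser contains a unipotent radical.\<close>

lemma bad_zero:
  assumes f: "f \<in> Fx m" and x0: "\<And>i. i < n - 1 \<Longrightarrow> vge (min 0 (a i)) (x i) \<Longrightarrow> x i = 0"
    and ne: "\<exists>i<n-1. x i \<noteq> 0"
  shows "f (nf n a x) = 0"
proof -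
  define Bd where "Bd = {i. i < n - 1 \<and> x i \<noteq> 0}"
  have bad: "v (x i) < 0" "v (x i) < a i" if "i \<in> Bd" for i
  proof -
    have "\<not> vge (min 0 (a i)) (x i)" using that x0[of i] by (auto simp: Bd_def)
    then show "v (x i) < 0" "v (x i) < a i" by (auto simp: vge_def min_le_iff_disj not_le)
  qed
  have "finite Bd" "Bd \<noteq> {}" using ne by (auto simp: Bd_def)
  then obtain r where r: "r \<in> Bd" and rmin: "\<And>i. i \<in> Bd \<Longrightarrow> v (x r) - a r \<le> v (x i) - a i"
    by (rule exists_minimizer[where f = "\<lambda>i. v (x i) - a i"]) blast
  define M where "M = a r - v (x r)"
  define I where "I = {i. i < n - 1 \<and> a i \<le> M}"
  have rI: "r \<in> I" "r < n - 1" "x r \<noteq> 0" "r < n" using r bad[OF r] by (auto simp: I_def M_def Bd_def)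
  have BI: "i \<in> I" if "i \<in> Bd" for i using rmin[OF that] bad[OF that] that by (auto simp: I_def M_def Bd_def)
  let ?g = "nf n a x"
  show ?thesis
  proof (rule Fx_radical_zero[OF f nf_GLn, of I])
    show "I \<subseteq> {..<n}" "I \<noteq> {}" using rI by (auto simp: I_def)
    have "n - 1 \<notin> I" by (simp add: I_def)
    then show "I \<noteq> {..<n}" using n1 by auto
    fix u :: "'k mat" assume u: "u \<in> radI n I" "u \<in> GLn n"
    \<comment> \<open>The entry \<open>s i\<close> in column \<open>r\<close> cancels, after
      multiplication by \<open>x r\<close>, what \<open>u $$ (i,n-1)\<close> adds to the last
      column. Since \<open>x r\<close> has negative valuation, \<open>s i\<close> lies in the
      maximal ideal and is invisible after reduction.\<close>
    define s where "s i = (if i \<in> I then - lift (u $$ (i,n-1)) / x r else 0)" for i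
    define A where "A = mat n n (\<lambda>(i,j). lift (u $$ (i,j)) + (if j = r then s i else 0))"
    \<comment> \<open>Because of this cancellation the conjugate has trivial last column and last
      row, so it lies in K(m) as soon as it is integral.\<close>
    define k' where "k' = mat n n (\<lambda>(i,j). if i < n - 1 \<and> j < n - 1 then w powi (a j - a i) * A $$ (i,j) else if i = j then 1 else 0)"
    have off: "lift (u $$ (i,j)) = (if i = j then 1 else 0)" if "i < n" "j < n" "\<not> (i \<in> I \<and> j \<notin> I)" for i j
      using u(1) that by (auto simp: radI_def lift)
    have vs: "vge (- v (x r)) (s i)" for i
    proof (cases "i \<in> I \<and> lift (u $$ (i,n-1)) \<noteq> 0")
      case True
      then show ?thesis using lift(1)[of "u $$ (i,n-1)"] rI by (auto simp: s_def vge_def v_divide v_minus)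
    qed (auto simp: s_def)
    have vs1: "vge 1 (s i)" for i by (rule vge_mono[OF vs]) (use bad(1)[OF r] in simp)
    have vs0: "vge 0 (s i)" for i by (rule vge_mono[OF vs1]) simp
    have Ae: "A $$ (i,j) = lift (u $$ (i,j)) + (if j = r then s i else 0)" if "i < n" "j < n" for i j
      using that by (simp add: A_def)
    have Ac: "A \<in> carrier_mat n n" "k' \<in> carrier_mat n n" by (auto simp: A_def k'_def)
    have kb: "kbar red n A = u"
    proof (rule eq_matI)
      fix i j assume "i < dim_row u" "j < dim_col u"
      then have ij: "i < n" "j < n" using GLn_carrier[OF u(2)] by auto
      have "red (s i) = 0" using vs0 vs1 red_0_iff by blast
      then show "kbar red n A $$ (i,j) = u $$ (i,j)"
        using ij vs0[of i] by (auto simp: kbar_entry Ae red_add lift red_0)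
    qed (use GLn_carrier[OF u(2)] in \<open>auto simp: kbar_def\<close>)
    have "intg n A" using vs0 by (auto simp: intg_def A_def intro!: vge_add lift)
    then have AK: "A \<in> Kn v n" using kb u(2) by (simp add: Kn_iff GLn_def)
    have rowI: "A $$ (i,j) = (if i = j then 1 else 0)" if "i \<notin> I" "i < n" "j < n" for i j
      using that off[of i j] by (auto simp: Ae s_def)
    have k'e: "k' $$ (i,j) = (if i < n - 1 \<and> j < n - 1 then w powi (a j - a i) * A $$ (i,j) else if i = j then 1 else 0)"
      if "i < n" "j < n" for i j using that by (simp add: k'_def)
    have col: "(\<Sum>l<n-1. A $$ (i,l) * x l) + A $$ (i,n-1) = x i" if i: "i < n - 1" for i
    proof (cases "i \<in> I")
      case False
      then have "(\<Sum>l<n-1. A $$ (i,l) * x l) = (\<Sum>l<n-1. if l = i then x i else 0)"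
        using i by (intro sum.cong) (auto simp: rowI)
      then show ?thesis using i False rowI[of i "n-1"] by simp
    next
      case True
      have "(\<Sum>l<n-1. A $$ (i,l) * x l) = (\<Sum>l<n-1. (if l = i then x i else 0) + (if l = r then s i * x r else 0))"
      proof (rule sum.cong[OF refl])
        fix l assume "l \<in> {..<n-1}"
        then have l: "l < n - 1" "l < n" by auto
        show "A $$ (i,l) * x l = (if l = i then x i else 0) + (if l = r then s i * x r else 0)"
        proof (cases "l \<in> I")
          case lI: True
          then show ?thesis using off[of i l] i l by (auto simp: Ae algebra_simps)
        next
          case lI: False
          then have "x l = 0" using BI[of l] l by (auto simp: Bd_def)
          then show ?thesis using lI rI True by auto
        qed
      qed
      also have "\<dots> = x i + s i * x r" using i rI by (simp add: sum.distrib)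
      finally have "(\<Sum>l<n-1. A $$ (i,l) * x l) = x i + s i * x r" .
      moreover have "A $$ (i,n-1) = lift (u $$ (i,n-1))" using i rI by (simp add: Ae)
      ultimately show ?thesis using True rI by (simp add: s_def)
    qed
    have eq: "A * ?g = ?g * k'"
    proof (rule eq_matI)
      fix i j assume "i < dim_row (?g * k')" "j < dim_col (?g * k')"
      then have ij: "i < n" "j < n" by (auto simp: k'_def nf_def)
      obtain N where N: "n = Suc N" using n1 by (cases n) auto
      have L: "(A * ?g) $$ (i,j) = (\<Sum>l<n. A $$ (i,l) * ?g $$ (l,j))" using Ac ij by (intro mat_mult_entry) auto
      have R: "(?g * k') $$ (i,j) = (\<Sum>l<n. ?g $$ (i,l) * k' $$ (l,j))" using Ac ij by (intro mat_mult_entry) auto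
      have "(\<Sum>l<n. A $$ (i,l) * ?g $$ (l,j)) =
        (if j < n - 1 then A $$ (i,j) * w powi a j else (\<Sum>l<n-1. A $$ (i,l) * x l) + A $$ (i,n-1))"
      proof (cases "j < n - 1")
        case True
        have "(\<Sum>l<n. A $$ (i,l) * ?g $$ (l,j)) = (\<Sum>l<n. if l = j then A $$ (i,j) * w powi a j else 0)"
          using True ij by (intro sum.cong) (auto simp: nf_entry)
        then show ?thesis using True ij by simp
      next
        case False
        then have "j = N" using ij by (simp add: N)
        then show ?thesis by (simp add: N nf_entry)
      qed
      moreover have "(\<Sum>l<n. ?g $$ (i,l) * k' $$ (l,j)) =
        (if i < n - 1 then w powi a i * k' $$ (i,j) + x i * k' $$ (n-1,j) else k' $$ (n-1,j))"
      proof (cases "i < n - 1")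
        case True
        have "(\<Sum>l<n. ?g $$ (i,l) * k' $$ (l,j)) =
           (\<Sum>l<n. (if l = i then w powi a i * k' $$ (i,j) else 0) + (if l = n - 1 then x i * k' $$ (n-1,j) else 0))"
          using True ij by (intro sum.cong) (auto simp: nf_entry)
        then show ?thesis using True ij n1 by (simp add: sum.distrib)
      next
        case False
        have "(\<Sum>l<n. ?g $$ (i,l) * k' $$ (l,j)) = (\<Sum>l<n. if l = n - 1 then k' $$ (n-1,j) else 0)"
          using False ij by (intro sum.cong) (auto simp: nf_entry)
        then show ?thesis using False n1 by simp
      qed
      moreover have "(\<Sum>l<n-1. A $$ (n-1,l) * x l) = 0"
        using \<open>n - 1 \<notin> I\<close> by (intro sum.neutral) (auto simp: rowI)
      moreover have "A $$ (n-1,n-1) = 1" "j < n - 1 \<Longrightarrow> A $$ (n-1,j) = 0"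
        using \<open>n - 1 \<notin> I\<close> n1 by (auto simp: rowI)
      moreover have "i < n - 1 \<or> i = n - 1" "j < n - 1 \<or> j = n - 1" using ij by auto
      ultimately show "(A * ?g) $$ (i,j) = (?g * k') $$ (i,j)"
        unfolding L R using ij n1 col[of i] w0 by (elim disjE) (simp_all add: k'e powi_diff)
    qed (use Ac in \<open>auto simp: nf_def\<close>)
    have "det A * det ?g = det ?g * det k'"
      using arg_cong[OF eq, of det] Ac by (simp add: det_mult[of _ n])
    then have "det k' = det A" using nf_GLn[of n a x] by (simp add: GLn_def)
    moreover have "vge 0 (k' $$ (i,j))" if ij: "i < n" "j < n" for i j
    proof (cases "i < n - 1 \<and> j < n - 1")
      case True
      \<comment> \<open>Inside \<open>I\<close> only column \<open>r\<close> is affected, where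
        \<open>vs\<close> and \<open>a i \<le> M\<close> suffice. From \<open>I\<close> to its
        complement \<open>a i \<le> M < a j\<close>. Rows outside \<open>I\<close> are
        trivial.\<close>
      have "vge (a i - a j) (A $$ (i,j))"
      proof (cases "i = j")
        case False
        show ?thesis
        proof (cases "i \<in> I")
          case iI: True
          then have aM: "a i \<le> M" by (simp add: I_def)
          show ?thesis
          proof (cases "j \<in> I")
            case True
            then have "A $$ (i,j) = (if j = r then s i else 0)" using off[OF ij] False ij by (simp add: Ae)
            moreover have "vge (a i - a r) (s i)" by (rule vge_mono[OF vs]) (use aM in \<open>simp add: M_def\<close>)
            ultimately show ?thesis by simp
          next
            case jI: False
            then have "M < a j" using True by (auto simp: I_def)
            then show ?thesis using aM AK ij by (intro vge_mono[OF Kn_entry]) auto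
          qed
        qed (use rowI[of i j] ij False in auto)
      qed (use AK ij in \<open>auto intro: Kn_entry\<close>)
      then show ?thesis using True ij by (simp add: k'e vge_powi_mult)
    qed (use ij in \<open>auto simp: k'e\<close>)
    ultimately have "k' \<in> Kn v n" using AK Ac by (auto simp: Kn_def GLn_def inO_vge)
    then have "k' \<in> Knm v n m" using n1 by (intro KnmI) (auto simp: k'e)
    then show "\<exists>k\<in>Kn v n. \<exists>k'\<in>Knm v n m. k * ?g = ?g * k' \<and> kbar red n k = u" using AK eq kb by blast
  qed
qed

definition admissible :: "nat \<Rightarrow> (nat \<Rightarrow> int) \<Rightarrow> bool" where
  "admissible m a \<longleftrightarrow> (\<forall>i<n-1. 0 < a i \<and> a i < int m) \<and> (\<forall>i j. i < j \<longrightarrow> j < n - 1 \<longrightarrow> a j < a i)"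

text \<open>For decreasing exponents, conjugation by the inverse of \<open>tt a\<close> multiplies
  entries below the diagonal in the first \<open>n - 1\<close> rows by non-negative powers of the
  uniformiser, so the lifts of elements of B^op stay integral, with exact last row.\<close>

lemma Bop_stab:
  assumes f: "f \<in> Fx m" and m: "m \<ge> 1" and dec: "\<And>i j. i < j \<Longrightarrow> j < n - 1 \<Longrightarrow> a j \<le> a i"
    and b: "b \<in> Bop n"
  shows "rt n b (f (tt a)) = f (tt a)"
proof -
  have bG: "b \<in> GLn n" using b n1 by (rule Bop_GLn)
  define A where "A = mat n n (\<lambda>(i,j). lift (b $$ (i,j)))"
  note A = lift_Kn[OF bG, folded A_def]
  have last: "A $$ (n-1,j) = (if j = n - 1 then 1 else 0)" if "j < n" for j
    using that b n1 A(3)[of "n-1" j] by (cases "j = n - 1") (auto simp: Bop_def lift)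
  have "\<exists>k'\<in>Knm v n m. A * tt a = tt a * k'"
  proof (rule diag_conj[OF A(1) m])
    fix i j assume ij: "i < n" "j < n"
    show "vge (ax n a i - ax n a j) (A $$ (i,j))"
    proof (cases "i < j")
      case True
      then show ?thesis using ij b A(3)[of i j] by (auto simp: Bop_def lift)
    next
      case False
      show ?thesis
      proof (cases "i = n - 1 \<and> j \<noteq> n - 1")
        case True
        then show ?thesis using last[OF ij(2)] by simp
      next
        case no: False
        then have "ax n a i \<le> ax n a j" using False ij dec[of j i] by (cases "i = j") (auto simp: ax_def)
        then show ?thesis using ij A(1) by (intro vge_mono[OF Kn_entry]) auto
      qed
    qed
  next
    fix j assume "j < n"
    then show "vge (int m) (w powi ax n a j * A $$ (n-1,j) - (if j = n - 1 then 1 else 0))"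
      using last by (auto simp: ax_def)
  qed
  then show ?thesis using Fx_stab[OF f nf_GLn A(1)] A(2) by blast
qed

text \<open>A non-zero value rules out, one after the other, a surviving last column, exponents that
  are not positive, exponents at least m, and equal neighbouring exponents.\<close>

theorem support_classification:
  assumes f: "f \<in> Fx m" and m: "m \<ge> 1" and g: "g \<in> GLn n" and nz: "f g \<noteq> 0"
  shows "\<exists>a. admissible m a \<and> drel n m g (tt a)"
proof -
  obtain a x where 1: "drel n m g (nf n a x)" using smith_normal_form[OF n2 g] by blast
  \<comment> \<open>Removable coordinates are set to zero, so every remaining non-zero one meets the
    hypothesis of \<open>bad_zero\<close>.\<close>
  define x' where "x' i = (if vge (min 0 (a i)) (x i) then 0 else x i)" for i
  have "drel n m (nf n a x) (nf n a x')" by (rule nf_reduce[OF n2]) (simp add: x'_def)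
  then have 2: "drel n m g (nf n a x')" using drel_trans[OF n1 1 _ nf_GLn] by blast
  then have "f (nf n a x') \<noteq> 0" using Fx_drel_zero[OF f nf_GLn] nz by blast
  moreover have "\<And>i. i < n - 1 \<Longrightarrow> vge (min 0 (a i)) (x' i) \<Longrightarrow> x' i = 0"
    by (auto simp: x'_def split: if_splits)
  ultimately have "\<not> (\<exists>i<n-1. x' i \<noteq> 0)" using bad_zero[OF f] by blast
  then have "nf n a x' = tt a" by (intro eq_matI) (auto simp: nf_def)
  then have 3: "drel n m g (tt a)" using 2 by simp
  obtain b where b: "drel n m (tt a) (tt b)" "\<And>i j. i < j \<Longrightarrow> j < n - 1 \<Longrightarrow> b j \<le> b i"
    using diag_sort[OF n1] by metis
  have 4: "drel n m g (tt b)" using drel_trans[OF n1 3 b(1) nf_GLn] .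
  have fb: "f (tt b) \<noteq> 0" using Fx_drel_zero[OF f nf_GLn 4] nz by blast
  have pos: "0 < b i" if "i < n - 1" for i
  proof (rule ccontr)
    assume c: "\<not> 0 < b i"
    \<comment> \<open>Exponents in this set are at most 0, those outside are positive, and the
      corner has exponent 0 and lies outside.\<close>
    let ?I = "{i. i < n - 1 \<and> b i \<le> 0}"
    have "f (tt b) = 0"
    proof (rule diag_radical_zero[OF f m])
      show "?I \<subseteq> {..<n}" by auto
      have "i \<in> ?I" using c that by simp
      then show "?I \<noteq> {}" by blast
      have "n - 1 \<notin> ?I" "n - 1 \<in> {..<n}" using n1 by auto
      then show "?I \<noteq> {..<n}" by blast
      show "ax n b i \<le> ax n b j" if "i \<in> ?I" "j < n" "j \<notin> ?I" for i j
        using that by (cases "j < n - 1") (auto simp: ax_def)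
      show "int m \<le> ax n b j" if "n - 1 \<in> ?I" for j using that by simp
    qed
    then show False using fb by simp
  qed
  have lt: "b i < int m" if i: "i < n - 1" for i
  proof (rule ccontr)
    assume c: "\<not> b i < int m"
    \<comment> \<open>Here the last index belongs to the set, because its exponent 0 is below
      \<open>m\<close>. Outside the set all exponents are at least \<open>m\<close>, which is what
      the last row of K(m) demands.\<close>
    have "f (tt b) = 0"
    proof (rule diag_radical_zero[OF f m, of "{j. j < n \<and> ax n b j < int m}"])
      have "n - 1 \<in> {j. j < n \<and> ax n b j < int m}" using n1 m by (simp add: ax_def)
      then show "{j. j < n \<and> ax n b j < int m} \<noteq> {}" by blast
      have "i \<notin> {j. j < n \<and> ax n b j < int m}" "i \<in> {..<n}" using c i by (auto simp: ax_def)
      then show "{j. j < n \<and> ax n b j < int m} \<noteq> {..<n}" by blast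
    qed auto
    then show False using fb by simp
  qed
  have adj: "b (Suc i) < b i" if i: "Suc i < n - 1" for i
  proof (rule ccontr)
    assume "\<not> b (Suc i) < b i"
    then have be: "b (Suc i) = b i" using b(2)[of i "Suc i"] i by simp
    \<comment> \<open>With equal exponents the whole simple root subgroup at
      \<open>(i, Suc i)\<close> lifts to the stabiliser. Its invariance against the character psi
      kills the value at the identity, and a B^op-invariant function with that value zero
      vanishes.\<close>
    let ?W = "f (tt b)"
    have "?W (1\<^sub>m n) = 0"
    proof -
      obtain t where t: "psi t \<noteq> 1" using psi_nontriv by blast
      define u where "u = row_tv n (Suc i) (\<lambda>l. if l = i then t else 0)"
      have uU: "u \<in> Uk n" using i by (auto simp: u_def Uk_def row_tv_entry)
      have ue: "u $$ (x,y) = (if x = y then 1 else 0) + (if y = Suc i \<and> x = i then t else 0)" if "x < n" "y < n" for x y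
        using that by (auto simp: u_def row_tv_entry)
      have uG: "u \<in> GLn n" by (rule Uk_GLn[OF uU])
      define A where "A = mat n n (\<lambda>(i,j). lift (u $$ (i,j)))"
      note A = lift_Kn[OF uG, folded A_def]
      have "\<exists>k'\<in>Knm v n m. A * tt b = tt b * k'"
      proof (rule diag_conj[OF A(1) m])
        fix x y assume xy: "x < n" "y < n"
        show "vge (ax n b x - ax n b y) (A $$ (x,y))"
        proof (cases "x \<noteq> y \<and> \<not> (y = Suc i \<and> x = i)")
          case True
          then show ?thesis using xy A(3)[OF xy] ue[OF xy] by (auto simp: lift)
        next
          case False
          then have "ax n b x = ax n b y" using be i by (auto simp: ax_def)
          then show ?thesis using A(1) xy by (auto intro: Kn_entry)
        qed
      next
        fix j assume "j < n"
        then show "vge (int m) (w powi ax n b j * A $$ (n-1,j) - (if j = n - 1 then 1 else 0))"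
          using A(3)[of "n-1" j] ue[of "n-1" j] i by (auto simp: ax_def lift)
      qed
      then have "rt n u ?W = ?W" using Fx_stab[OF f nf_GLn A(1)] A(2) by blast
      then have "?W (1\<^sub>m n * u) = ?W (1\<^sub>m n)" using rt_apply[OF GLn_one, of n u ?W] by simp
      then have "?W (u * 1\<^sub>m n) = ?W (1\<^sub>m n)" using uG by (simp add: GLn_one_mult)
      moreover have "?W (u * 1\<^sub>m n) = psiU psi n u * ?W (1\<^sub>m n)"
        using Fx_Wt[OF f] uU GLn_one by (rule Wt_left)
      moreover have "psiU psi n u = psi t"
        by (rule psiU_single[of _ _ i]) (use i ue in auto)
      ultimately show ?thesis using t by simp
    qed
    moreover have "rt n b' ?W = ?W" if "b' \<in> Bop n" for b'
      using f m b(2) that by (rule Bop_stab)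
    ultimately have "?W = 0" using Bop_invariant_zero[OF Fx_Wt[OF f]] by blast
    then show False using fb by simp
  qed
  have "b j < b i" if "i < j" "j < n - 1" for i j
    using adj[of i] b(2)[of "Suc i" j] that by (cases "Suc i = j") auto
  then have "admissible m b" using pos lt by (auto simp: admissible_def)
  then show ?thesis using 4 by blast
qed

end

section \<open>Residue classes modulo powers of the maximal ideal\<close>

context local_field
begin

text \<open>A canonical representative of \<open>x\<close> modulo the \<open>j\<close>-th power of the maximal ideal.\<close>

primrec rs :: "nat \<Rightarrow> 'f \<Rightarrow> 'f" where
  "rs 0 x = 0"
| "rs (Suc j) x = lift (red x) + w * rs j ((x - lift (red x)) / w)"

lemma vge_div_w: "vge (a + 1) y \<Longrightarrow> vge a (y / w)"
  using w0 vw by (cases "y = 0") (auto simp: vge_def v_divide)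

lemma vge_mult_w: "vge a y \<Longrightarrow> vge (a + 1) (w * y)"
  using w0 vw by (cases "y = 0") (auto simp: vge_def v_mult)

lemma rs_div: "vge 0 x \<Longrightarrow> vge 0 ((x - lift (red x)) / w)"
  using red_eq_iff[of x "lift (red x)"] lift by (intro vge_div_w) simp

lemma rs: "vge 0 x \<Longrightarrow> vge 0 (rs j x) \<and> vge (int j) (x - rs j x)"
proof (induction j arbitrary: x)
  case (Suc j)
  define y where "y = (x - lift (red x)) / w"
  have y: "vge 0 y" unfolding y_def using Suc.prems by (rule rs_div)
  note IH = Suc.IH[OF y]
  have "vge 0 (w * rs j y)" using IH vge_mult_w[of 0 "rs j y"] vge_mono[of 1 _ 0] by auto
  then have 1: "vge 0 (rs (Suc j) x)" using lift(1) by (auto simp: y_def intro: vge_add)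
  have "x - rs (Suc j) x = w * (y - rs j y)" using w0 by (simp add: y_def field_simps)
  then have "vge (int (Suc j)) (x - rs (Suc j) x)" using IH vge_mult_w[of "int j" "y - rs j y"] by (simp add: add.commute)
  then show ?case using 1 by blast
qed simp

lemma rs_eq_iff:
  assumes "vge 0 x" "vge 0 y"
  shows "rs j x = rs j y \<longleftrightarrow> vge (int j) (x - y)"
proof
  assume "rs j x = rs j y"
  then have "x - y = (x - rs j x) - (y - rs j y)" by simp
  also have "vge (int j) \<dots>" using rs[OF assms(1), of j] rs[OF assms(2), of j] by (intro conjunct2[THEN vge_diff, OF _ conjunct2])
  finally show "vge (int j) (x - y)" .
next
  show "vge (int j) (x - y) \<Longrightarrow> rs j x = rs j y"
    using assms
  proof (induction j arbitrary: x y)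
    case (Suc j)
    have "vge 1 (x - y)" using Suc.prems(1) by (rule vge_mono) simp
    then have r: "red x = red y" using red_eq_iff Suc.prems by blast
    have "vge (int j) ((x - y) / w)" using Suc.prems(1) by (intro vge_div_w) (simp add: add.commute)
    moreover have "(x - lift (red x)) / w - (y - lift (red y)) / w = (x - y) / w"
      unfolding r by (simp add: diff_divide_distrib)
    ultimately have "rs j ((x - lift (red x)) / w) = rs j ((y - lift (red y)) / w)"
      using Suc.prems by (intro Suc.IH rs_div) auto
    then show ?case using r by simp
  qed simp
qed

text \<open>A representative at level \<open>Suc j\<close> is a first digit and a representative at
  level \<open>j\<close>; reduction recovers the digit, so the two are independent.\<close>

lemma card_rs: "finite (rs j ` {x. vge 0 x}) \<and> card (rs j ` {x. vge 0 x}) = card (UNIV :: 'k set) ^ j"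
proof (induction j)
  case 0
  have "rs 0 ` {x. vge 0 x} = {0}" using vge_1 by (auto intro!: image_eqI[of _ _ 1])
  then show ?case by simp
next
  case (Suc j)
  let ?O = "{x. vge 0 x}"
  let ?h = "\<lambda>(a,r). lift a + w * r"
  have "rs (Suc j) ` ?O = ?h ` (UNIV \<times> rs j ` ?O)"
  proof (intro equalityI subsetI)
    fix u assume "u \<in> rs (Suc j) ` ?O"
    then obtain x where x: "vge 0 x" "u = rs (Suc j) x" by auto
    then show "u \<in> ?h ` (UNIV \<times> rs j ` ?O)"
      by (intro image_eqI[of _ _ "(red x, rs j ((x - lift (red x)) / w))"]) (auto intro: rs_div)
  next
    fix u assume "u \<in> ?h ` (UNIV \<times> rs j ` ?O)"
    then obtain a y where y: "vge 0 y" "u = lift a + w * rs j y" by auto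
    have wy: "vge 1 (w * y)" using vge_mult_w[OF y(1)] by simp
    then have wy0: "vge 0 (w * y)" by (rule vge_mono) simp
    have "red (lift a + w * y) = a" using wy wy0 red_0_iff[OF wy0] by (simp add: red_add lift)
    then have "rs (Suc j) (lift a + w * y) = u" using y w0 by simp
    moreover have "vge 0 (lift a + w * y)" using wy0 lift by (intro vge_add) auto
    ultimately show "u \<in> rs (Suc j) ` ?O" by (intro image_eqI[of _ _ "lift a + w * y"]) auto
  qed
  moreover have "inj_on ?h (UNIV \<times> rs j ` ?O)"
  proof (rule inj_onI, clarify)
    fix a y a' y' assume yy: "vge 0 y" "vge 0 y'" "lift a + w * rs j y = lift a' + w * rs j y'"
    have *: "red (lift a + w * rs j y) = a" if "vge 0 y" for a y
    proof -
      have 1: "vge 1 (w * rs j y)" using vge_mult_w[of 0 "rs j y"] rs[OF that] by simp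
      then have 0: "vge 0 (w * rs j y)" by (rule vge_mono) simp
      show ?thesis using 1 0 red_0_iff[OF 0] by (simp add: red_add lift)
    qed
    have "a = a'" using *[OF yy(1), of a] *[OF yy(2), of a'] yy(3) by simp
    then show "a = a' \<and> rs j y = rs j y'" using yy(3) w0 by simp
  qed
  ultimately show ?case using Suc by (simp add: card_image card_cartesian_product)
qed

lemma vge_power_mult: "vge a (w ^ e * x) \<longleftrightarrow> vge (a - int e) x"
  using vge_powi_mult[of a "int e" x] by simp

text \<open>Translation and rescaling by \<open>w ^ e\<close> identify the ball with the ring of
  integers, with \<open>j - e\<close> digits left to choose.\<close>

lemma card_rs_ball:
  assumes c: "vge 0 c" and e: "e \<le> j"
  shows "finite (rs j ` {x. vge (int e) (x - c)})"
    "card (rs j ` {x. vge (int e) (x - c)}) = card (UNIV :: 'k set) ^ (j - e)"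
proof -
  let ?O = "{x. vge 0 x}"
  have img: "{x. vge (int e) (x - c)} = (\<lambda>y. c + w ^ e * y) ` ?O"
  proof (intro equalityI subsetI)
    fix x assume "x \<in> {x. vge (int e) (x - c)}"
    then have "vge (int e) (w ^ e * ((x - c) / w ^ e))" using w0 by simp
    then have "vge 0 ((x - c) / w ^ e)" unfolding vge_power_mult by simp
    then show "x \<in> (\<lambda>y. c + w ^ e * y) ` ?O"
      using w0 by (intro image_eqI[of _ _ "(x - c) / w ^ e"]) auto
  qed (auto simp: vge_power_mult)
  have O: "vge 0 (c + w ^ e * y)" if "vge 0 y" for y
    by (rule vge_add[OF c], unfold vge_power_mult, rule vge_mono[OF that]) simp
  have key: "rs j (c + w ^ e * y) = rs j (c + w ^ e * y') \<longleftrightarrow> rs (j - e) y = rs (j - e) y'"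
    if "y \<in> ?O" "y' \<in> ?O" for y y'
  proof -
    have "(c + w ^ e * y) - (c + w ^ e * y') = w ^ e * (y - y')" by (simp add: algebra_simps)
    then show ?thesis using that O e by (simp add: rs_eq_iff vge_power_mult of_nat_diff)
  qed
  have "(\<lambda>y. rs j (c + w ^ e * y)) ` ?O = rs j ` {x. vge (int e) (x - c)}"
    unfolding img by (simp add: image_image)
  then show "finite (rs j ` {x. vge (int e) (x - c)})"
    "card (rs j ` {x. vge (int e) (x - c)}) = card (UNIV :: 'k set) ^ (j - e)"
    using card_image_eq_card_image[of ?O "\<lambda>y. rs j (c + w ^ e * y)" "rs (j - e)"] key card_rs[of "j - e"]
    by auto
qed

definition mcong :: "nat \<Rightarrow> nat \<Rightarrow> 'f mat \<Rightarrow> 'f mat \<Rightarrow> bool" where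
  "mcong N j A B \<longleftrightarrow> (\<forall>i<N. \<forall>l<N. vge (int j) (A $$ (i,l) - B $$ (i,l)))"

text \<open>A residue class is represented by an actual matrix, so that numbers of classes are
  cardinalities of image sets.\<close>

definition cls :: "nat \<Rightarrow> nat \<Rightarrow> 'f mat \<Rightarrow> 'f mat" where
  "cls N j A = mat N N (\<lambda>(i,l). rs j (A $$ (i,l)))"

lemma cls_eq_iff: "intg N A \<Longrightarrow> intg N B \<Longrightarrow> cls N j A = cls N j B \<longleftrightarrow> mcong N j A B"
proof -
  assume AB: "intg N A" "intg N B"
  have "cls N j A = cls N j B \<longleftrightarrow> (\<forall>i<N. \<forall>l<N. rs j (A $$ (i,l)) = rs j (B $$ (i,l)))"
    by (auto simp: cls_def mat_eq_iff)
  then show ?thesis using AB by (auto simp: rs_eq_iff intg_def mcong_def)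
qed

lemma finite_cls: "finite (cls N j ` {A. intg N A})"
proof -
  let ?I = "{..<N} \<times> {..<N}"
  have "cls N j ` {A. intg N A} \<subseteq> mat N N ` (?I \<rightarrow>\<^sub>E rs j ` {x. vge 0 x})"
  proof
    fix u assume "u \<in> cls N j ` {A. intg N A}"
    then obtain A where A: "intg N A" "u = cls N j A" by auto
    have "u = mat N N (restrict (\<lambda>p. rs j (A $$ p)) ?I)" unfolding A(2) cls_def by (intro eq_matI) auto
    moreover have "restrict (\<lambda>p. rs j (A $$ p)) ?I \<in> ?I \<rightarrow>\<^sub>E rs j ` {x. vge 0 x}"
      using A(1) by (auto simp: intg_def)
    ultimately show "u \<in> mat N N ` (?I \<rightarrow>\<^sub>E rs j ` {x. vge 0 x})" by blast
  qed
  moreover have "finite (?I \<rightarrow>\<^sub>E rs j ` {x. vge 0 x})" using card_rs by (intro finite_PiE) auto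
  ultimately show ?thesis by (meson finite_imageI finite_subset)
qed

lemma mcong_sym: "mcong N j A B \<Longrightarrow> mcong N j B A"
  unfolding mcong_def by (metis minus_diff_eq vge_minus)

lemma mcong_mult_left:
  assumes "intg N K" "A \<in> carrier_mat N N" "B \<in> carrier_mat N N" "mcong N j A B"
  shows "mcong N j (K * A) (K * B)"
  unfolding mcong_def
proof (intro allI impI)
  fix i l assume il: "i < N" "l < N"
  have K: "K \<in> carrier_mat N N" using assms by (simp add: intg_def)
  have "(K * A) $$ (i,l) - (K * B) $$ (i,l) = (\<Sum>k<N. K $$ (i,k) * (A $$ (k,l) - B $$ (k,l)))"
    unfolding mat_mult_entry[OF K assms(2) il] mat_mult_entry[OF K assms(3) il]
    by (simp add: sum_subtractf[symmetric] right_diff_distrib)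
  also have "vge (int j) \<dots>"
    using assms il by (intro vge_sum vge_mult0(1)) (auto simp: intg_def mcong_def)
  finally show "vge (int j) ((K * A) $$ (i,l) - (K * B) $$ (i,l))" .
qed

lemma mcong_mult_right:
  assumes "intg N K" "A \<in> carrier_mat N N" "B \<in> carrier_mat N N" "mcong N j A B"
  shows "mcong N j (A * K) (B * K)"
  unfolding mcong_def
proof (intro allI impI)
  fix i l assume il: "i < N" "l < N"
  have K: "K \<in> carrier_mat N N" using assms by (simp add: intg_def)
  have "(A * K) $$ (i,l) - (B * K) $$ (i,l) = (\<Sum>k<N. (A $$ (i,k) - B $$ (i,k)) * K $$ (k,l))"
    unfolding mat_mult_entry[OF assms(2) K il] mat_mult_entry[OF assms(3) K il]
    by (simp add: sum_subtractf[symmetric] left_diff_distrib)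
  also have "vge (int j) \<dots>"
    using assms il by (intro vge_sum vge_mult0(2)) (auto simp: intg_def mcong_def)
  finally show "vge (int j) ((A * K) $$ (i,l) - (B * K) $$ (i,l))" .
qed

lemma Kcong_iff: "A \<in> Kcong v N j \<longleftrightarrow> A \<in> Kn v N \<and> mcong N j A (1\<^sub>m N)"
proof -
  have "(A - 1\<^sub>m N) $$ (i,l) = A $$ (i,l) - 1\<^sub>m N $$ (i,l)" if "i < N" "l < N" for i l
    using that by simp
  then show ?thesis unfolding Kcong_def mcong_def inP_vge by auto
qed

lemma mcong_Kcong:
  assumes "a \<in> Kn v N" "b \<in> Kn v N"
  shows "mcong N j b a \<longleftrightarrow> b \<in> (\<lambda>k. a * k) ` Kcong v N j" "mcong N j b a \<Longrightarrow> b * ginv a \<in> Kcong v N j"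
proof -
  note G = assms[THEN Kn_GLn] and C = assms[THEN Kn_GLn, THEN GLn_carrier]
  have i: "ginv a \<in> Kn v N" using assms by (intro Kn_ginv)
  show "mcong N j b a \<longleftrightarrow> b \<in> (\<lambda>k. a * k) ` Kcong v N j"
  proof
    assume c: "mcong N j b a"
    have "mcong N j (ginv a * b) (ginv a * a)" using c C i by (intro mcong_mult_left Kn_intg)
    then have "ginv a * b \<in> Kcong v N j" using i assms ginv[OF G(1)] by (simp add: Kcong_iff Kn_mult)
    moreover have "b = a * (ginv a * b)" using G by (simp add: ginv_cancel[where n = N])
    ultimately show "b \<in> (\<lambda>k. a * k) ` Kcong v N j" by blast
  next
    assume "b \<in> (\<lambda>k. a * k) ` Kcong v N j"
    then obtain k where k: "k \<in> Kcong v N j" "b = a * k" by blast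
    have "mcong N j (a * k) (a * 1\<^sub>m N)"
      using k assms by (intro mcong_mult_left Kn_intg) (auto simp: Kcong_iff Kn_GLn GLn_carrier)
    then show "mcong N j b a" using k G by (simp add: GLn_one_mult)
  qed
  assume c: "mcong N j b a"
  have "mcong N j (b * ginv a) (a * ginv a)" using c C i by (intro mcong_mult_right Kn_intg)
  then show "b * ginv a \<in> Kcong v N j" using i assms ginv[OF G(1)] by (simp add: Kcong_iff Kn_mult)
qed

lemma mcong_mono: "mcong N j A B \<Longrightarrow> i \<le> j \<Longrightarrow> mcong N i A B"
  unfolding mcong_def by (auto intro: vge_mono[where a = "int j"])

lemma Kcong_Knm: "j \<ge> m \<Longrightarrow> m \<ge> 1 \<Longrightarrow> N \<ge> 1 \<Longrightarrow> A \<in> Kcong v N j \<Longrightarrow> A \<in> Knm v N m"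
proof -
  assume j: "j \<ge> m" and m: "m \<ge> 1" "N \<ge> 1" and A: "A \<in> Kcong v N j"
  have c: "mcong N m A (1\<^sub>m N)" using A j by (auto simp: Kcong_iff intro: mcong_mono)
  have "lastrow N m A"
    unfolding lastrow_def
  proof (intro allI impI)
    fix l assume l: "l < N"
    have "vge (int m) (A $$ (N-1,l) - 1\<^sub>m N $$ (N-1,l))" using c l m unfolding mcong_def by simp
    then show "vge (int m) (A $$ (N-1,l) - (if l = N - 1 then 1 else 0))"
      using l m by (cases "l = N - 1") auto
  qed
  then show ?thesis using A m by (simp add: Knm_iff Kcong_iff)
qed

lemma finite_reps:
  obtains R where "finite R" "R \<subseteq> Kn v N" "\<And>k. k \<in> Kn v N \<Longrightarrow> \<exists>r\<in>R. k * ginv r \<in> Kcong v N j"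
proof -
  define R where "R = (\<lambda>u. SOME k. k \<in> Kn v N \<and> cls N j k = u) ` (cls N j ` Kn v N)"
  have sel: "(SOME k'. k' \<in> Kn v N \<and> cls N j k' = cls N j k) \<in> Kn v N \<and>
      cls N j (SOME k'. k' \<in> Kn v N \<and> cls N j k' = cls N j k) = cls N j k" if "k \<in> Kn v N" for k
    by (rule someI[of _ k]) (use that in simp)
  have "finite (cls N j ` Kn v N)"
    by (rule finite_subset[OF _ finite_cls]) (auto simp: Kn_iff)
  then have "finite R" by (simp add: R_def)
  moreover have "R \<subseteq> Kn v N" using sel by (auto simp: R_def)
  moreover have "\<exists>r\<in>R. k * ginv r \<in> Kcong v N j" if k: "k \<in> Kn v N" for k
  proof -
    define r where "r = (SOME k'. k' \<in> Kn v N \<and> cls N j k' = cls N j k)"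
    have r: "r \<in> R" "r \<in> Kn v N" "cls N j r = cls N j k" using sel[OF k] k by (auto simp: r_def R_def)
    then have "mcong N j k r" using k cls_eq_iff[of N k r j] by (simp add: Kn_intg)
    then show ?thesis using mcong_Kcong(2)[OF r(2) k] r(1) by blast
  qed
  ultimately show ?thesis using that by blast
qed

end

section \<open>Uniqueness of representatives and the basis of fixed vectors\<close>

context depth_zero
begin

lemma scal_Kn:
  assumes z: "isUnit v z"
  shows "scal n z \<in> Kn v n" "kbar red n (scal n z) = scal n (red z)"
proof -
  show kb: "kbar red n (scal n z) = scal n (red z)"
    by (rule eq_matI) (auto simp: kbar_def scal_def red_0)
  have "intg n (scal n z)" using isUnit_vge[OF z] by (auto simp: intg_def scal_def)
  moreover have "det (kbar red n (scal n z)) \<noteq> 0"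
    using z scal_GLn[of "red z" n] by (simp add: kb isUnit_iff GLn_def)
  ultimately show "scal n z \<in> Kn v n" by (simp add: Kn_iff)
qed

lemma Knm_last:
  "m \<ge> 1 \<Longrightarrow> k \<in> Knm v n m \<Longrightarrow> vge (int m) (k $$ (n-1,n-1) - 1) \<and> (\<forall>j<n-1. vge (int m) (k $$ (n-1,j)))"
  by (auto simp: Knm_def inP_vge)

text \<open>The corner entries give \<open>z\<close> times an integral element equal to a unit.
  Applied to the inverse relation as well, this forces \<open>z\<close> to be a unit.\<close>

lemma coset_scalar_le:
  assumes m: "m \<ge> 1" and z: "z \<noteq> 0" and k: "k \<in> Kn v n" and k': "k' \<in> Knm v n m"
    and eq: "scal n z * k * tt a = tt b * k'"
  shows "v z \<le> 0"
proof -
  have kc: "k \<in> carrier_mat n n" "k' \<in> carrier_mat n n" using k k' by (auto simp: Kn_GLn GLn_carrier Knm_Kn)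
  have l: "n - 1 < n" using n1 by simp
  have zk: "scal n z * k \<in> carrier_mat n n" using kc by (intro mult_carrier_mat[of _ n n]) auto
  have "(scal n z * k * tt a) $$ (n-1,n-1) = z * k $$ (n-1,n-1)"
    unfolding diag_right[OF zk l l] scal_mult_entry[OF kc(1) l l] by (simp add: ax_def)
  moreover have "(tt b * k') $$ (n-1,n-1) = k' $$ (n-1,n-1)"
    unfolding diag_left[OF kc(2) l l] by (simp add: ax_def)
  ultimately have e: "z * k $$ (n-1,n-1) = k' $$ (n-1,n-1)" using eq by simp
  have "vge (int m) (k' $$ (n-1,n-1) - 1)" using Knm_last[OF m k'] by blast
  then have "vge 1 (k' $$ (n-1,n-1) - 1)" by (rule vge_mono) (use m in simp)
  then have "red (k' $$ (n-1,n-1)) = 1"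
    using red_eq_iff[of "k' $$ (n-1,n-1)" 1] Kn_entry[OF Knm_Kn[OF k'] l l] by (simp add: red_1)
  then have "isUnit v (k' $$ (n-1,n-1))" using Kn_entry[OF Knm_Kn[OF k'] l l] by (simp add: isUnit_iff)
  then have u: "k' $$ (n-1,n-1) \<noteq> 0" "v (k' $$ (n-1,n-1)) = 0" by (auto simp: isUnit_def)
  then have "k $$ (n-1,n-1) \<noteq> 0" using e by auto
  then have "v z + v (k $$ (n-1,n-1)) = 0" "v (k $$ (n-1,n-1)) \<ge> 0"
    using u e v_mult[OF z, of "k $$ (n-1,n-1)"] Kn_entry[OF k l l] by (auto simp: vge_def)
  then show ?thesis by simp
qed

lemma coset_inverse:
  assumes z: "z \<noteq> 0" and k: "k \<in> Kn v n" and k': "k' \<in> Knm v n m"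
    and eq: "scal n z * k * tt a = tt b * k'"
  shows "scal n (inverse z) * ginv k * tt b = tt a * ginv k'"
proof -
  note G = scal_GLn[OF z, of n] Kn_GLn[OF k] Kn_GLn[OF Knm_Kn[OF k']] nf_GLn[of n a "\<lambda>_. 0"] nf_GLn[of n b "\<lambda>_. 0"]
    scal_GLn[of "inverse z" n]
  have iz: "inverse z \<noteq> 0" using z by simp
  note Gi = ginv(3)[OF G(2)] ginv(3)[OF G(3)] scal_GLn[OF iz, of n]
  have "tt b = scal n z * k * tt a * ginv k'" unfolding eq using G by (simp add: ginv_cancel[where n = n])
  then have "scal n (inverse z) * ginv k * tt b = scal n (inverse z) * (ginv k * scal n z) * (k * (tt a * ginv k'))"
    using G Gi by (simp add: GLn_assoc[where n = n] GLn_mult)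
  also have "ginv k * scal n z = scal n z * ginv k" using Gi by (simp add: scal_commute GLn_carrier)
  also have "scal n (inverse z) * (scal n z * ginv k) * (k * (tt a * ginv k'))
      = (scal n (inverse z) * scal n z) * (ginv k * (k * (tt a * ginv k')))"
    using G Gi by (simp add: GLn_assoc[where n = n] GLn_mult)
  also have "\<dots> = tt a * ginv k'"
    using G Gi z by (simp add: ginv_cancel[where n = n] GLn_mult scal_mult scal_one GLn_carrier)
  finally show ?thesis .
qed

text \<open>If \<open>b i\<close> exceeded \<open>a i\<close>, monotonicity of both sequences would
  push all entries of \<open>k\<close> in rows up to \<open>i\<close> and columns from
  \<open>i\<close> on into the maximal ideal, and the reduction of \<open>k\<close> would be
  singular.\<close>

lemma coset_exponents_le:
  assumes k: "k \<in> Kn v n" and k': "k' \<in> Kn v n" and eq: "k * tt a = tt b * k'"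
    and a: "admissible m a" and b: "admissible m b" and i: "i < n - 1"
  shows "b i \<le> a i"
proof (rule ccontr)
  assume c: "\<not> b i \<le> a i"
  have kc: "k \<in> carrier_mat n n" "k' \<in> carrier_mat n n" using k k' by (auto simp: Kn_GLn GLn_carrier)
  have "kbar red n k $$ (r,s) = 0" if rs: "r \<le> i" "i \<le> s" "s < n" for r s
  proof -
    have rn: "r < n" "r < n - 1" using rs i by auto
    have "k $$ (r,s) * w powi ax n a s = w powi ax n b r * k' $$ (r,s)"
      using diag_right[OF kc(1) rn(1) rs(3), of a] diag_left[OF kc(2) rn(1) rs(3), of b] eq by simp
    then have "k $$ (r,s) = w powi (ax n b r - ax n a s) * k' $$ (r,s)"
      using w0 by (simp add: powi_diff field_simps)
    moreover have "vge 1 (w powi (ax n b r - ax n a s) * k' $$ (r,s))"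
    proof -
      have "b i \<le> b r" using b rs i by (cases "r = i") (auto simp: admissible_def intro: less_imp_le)
      moreover have "ax n a s < b i"
      proof (cases "s < n - 1")
        case True
        then have "a s \<le> a i" using a rs by (cases "s = i") (auto simp: admissible_def intro: less_imp_le)
        then show ?thesis using True c by (simp add: ax_def)
      next
        case False
        then show ?thesis using b i by (simp add: ax_def admissible_def)
      qed
      ultimately have "1 \<le> ax n b r - ax n a s" using rn by (simp add: ax_def)
      then show ?thesis unfolding vge_powi_mult
        by (intro vge_mono[OF Kn_entry[OF k' rn(1) rs(3)]]) simp
    qed
    ultimately have "vge 1 (k $$ (r,s))" by simp
    then show ?thesis using red_0_iff[OF Kn_entry[OF k rn(1) rs(3)]] rn rs by (simp add: kbar_entry)
  qed
  then have "det (kbar red n k) = 0" using i by (intro det_zero_block[of _ n i]) auto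
  then show False using k by (simp add: Kn_iff)
qed

text \<open>Strictly decreasing exponents force the entries above the diagonal into the maximal
  ideal. In the last row, divisibility by the m-th power of the maximal ideal outweighs the factor
  with exponent \<open>- a j\<close>, since \<open>a j < m\<close>. So the reduction of the
  stabiliser is contained in B^op, with corner 1 inherited from K(m).\<close>

theorem coset_unique:
  assumes m: "m \<ge> 1" and z: "z \<noteq> 0" and k: "k \<in> Kn v n" and k': "k' \<in> Knm v n m"
    and eq: "scal n z * k * tt a = tt b * k'" and a: "admissible m a" and b: "admissible m b"
  shows "isUnit v z" "\<And>i. i < n - 1 \<Longrightarrow> a i = b i" "scal n (red z) * kbar red n k \<in> Bop n"
proof -
  have "v z \<le> 0" using coset_scalar_le[OF m z k k' eq] .
  moreover have "v (inverse z) \<le> 0"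
    using coset_scalar_le[OF m _ Kn_ginv[OF k] Knm_ginv[OF n1 k'] coset_inverse[OF z k k' eq]] z by simp
  ultimately show u: "isUnit v z" using z v_inverse[OF z] by (simp add: isUnit_def)
  define K where "K = scal n z * k"
  have K: "K \<in> Kn v n" unfolding K_def using scal_Kn(1)[OF u] k by (rule Kn_mult)
  have K': "k' \<in> Kn v n" using k' by (rule Knm_Kn)
  have eqK: "K * tt a = tt b * k'" using eq by (simp add: K_def)
  have eqI: "ginv K * tt b = tt a * ginv k'"
  proof -
    note G = Kn_GLn[OF K] Kn_GLn[OF K'] nf_GLn[of n a "\<lambda>_. 0"] nf_GLn[of n b "\<lambda>_. 0"]
    have "tt b = K * (tt a * ginv k')"
      using G eqK by (simp add: GLn_assoc[where n = n, symmetric] ginv ginv_cancel[where n = n])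
    then show ?thesis using G by (simp add: ginv_cancel[where n = n] GLn_mult ginv)
  qed
  show ab: "a i = b i" if "i < n - 1" for i
    using coset_exponents_le[OF K K' eqK a b that] coset_exponents_le[OF Kn_ginv[OF K] Kn_ginv[OF K'] eqI b a that] by simp
  have kb: "kbar red n K = scal n (red z) * kbar red n k"
    unfolding K_def using scal_Kn[OF u] k by (simp add: kbar_mult Kn_intg)
  have Kc: "K \<in> carrier_mat n n" "k' \<in> carrier_mat n n" using K K' by (auto simp: Kn_GLn GLn_carrier)
  have e: "K $$ (i,j) = w powi (ax n a i - ax n a j) * k' $$ (i,j)" if "i < n" "j < n" for i j
  proof -
    have "ax n a i = ax n b i" using ab by (simp add: ax_def)
    then have "K $$ (i,j) * w powi ax n a j = w powi ax n a i * k' $$ (i,j)"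
      using diag_right[OF Kc(1) that, of a] diag_left[OF Kc(2) that, of b] eqK by simp
    then show ?thesis using w0 by (simp add: powi_diff field_simps)
  qed
  have zero: "kbar red n K $$ (i,j) = 0" if "i < n" "j < n" "vge 1 (K $$ (i,j))" for i j
    using that red_0_iff[OF Kn_entry[OF K that(1,2)]] by (simp add: kbar_entry)
  have up: "kbar red n K $$ (i,j) = 0" if ij: "i < n" "j < n" "i < j" for i j
  proof (rule zero[OF ij(1,2)])
    have "ax n a j < ax n a i" using a ij by (auto simp: ax_def admissible_def)
    then show "vge 1 (K $$ (i,j))" unfolding e[OF ij(1,2)] vge_powi_mult
      by (intro vge_mono[OF Kn_entry[OF K' ij(1,2)]]) simp
  qed
  have l: "n - 1 < n" using n1 by simp
  have last: "kbar red n K $$ (n-1,j) = 0" if j: "j < n - 1" for j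
  proof (rule zero)
    have vj: "vge (int m) (k' $$ (n-1,j))" using Knm_last[OF m k'] j by blast
    have "a j < int m" using a j by (simp add: admissible_def)
    then have "1 - (ax n a (n-1) - ax n a j) \<le> int m" using j by (simp add: ax_def)
    then have "vge 1 (w powi (ax n a (n-1) - ax n a j) * k' $$ (n-1,j))"
      unfolding vge_powi_mult by (rule vge_mono[OF vj])
    then show "vge 1 (K $$ (n-1,j))" using e[of "n-1" j] j by simp
  qed (use j in auto)
  have corner: "kbar red n K $$ (n-1,n-1) = 1"
  proof -
    have "vge (int m) (k' $$ (n-1,n-1) - 1)" using Knm_last[OF m k'] by blast
    then have "vge 1 (k' $$ (n-1,n-1) - 1)" by (rule vge_mono) (use m in simp)
    then show ?thesis using red_eq_iff[of "k' $$ (n-1,n-1)" 1] Kn_entry[OF K' l l] e[OF l l] l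
      by (simp add: red_1 kbar_entry)
  qed
  have "det (kbar red n K) = prod_list (diag_mat (kbar red n K))"
    by (rule det_lower_triangular[of n]) (auto simp: up)
  then have "prod_list (diag_mat (kbar red n K)) \<noteq> 0" using K by (simp add: Kn_iff)
  then have dg: "kbar red n K $$ (i,i) \<noteq> 0" if "i < n" for i
    using that by (auto simp: diag_mat_def prod_list_zero_iff kbar_def)
  show "scal n (red z) * kbar red n k \<in> Bop n"
    unfolding kb[symmetric] Bop_def using up last corner dg by auto
qed

text \<open>\<open>Rp m a g V\<close> says that \<open>V\<close> is the value at \<open>g\<close> of the vector supported on the double coset of
  \<open>tt a\<close> that takes the value \<open>W0\<close> at \<open>tt a\<close>.\<close>

definition Rp :: "nat \<Rightarrow> (nat \<Rightarrow> int) \<Rightarrow> 'f mat \<Rightarrow> ('k mat \<Rightarrow> 'r) \<Rightarrow> bool" where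
  "Rp m a g V \<longleftrightarrow> (\<exists>z k k'. z \<noteq> 0 \<and> k \<in> Kn v n \<and> k' \<in> Knm v n m \<and> g = scal n z * k * tt a * k' \<and>
     V = (\<lambda>y. om z * rt n (kbar red n k) W0 y))"

text \<open>The value is picked out of the relation \<open>Rp\<close>; independence of the chosen
  factorisation of \<open>g\<close> is \<open>Rp_unique\<close>, and only for admissible
  \<open>a\<close>.\<close>

definition Fa :: "nat \<Rightarrow> (nat \<Rightarrow> int) \<Rightarrow> 'f mat \<Rightarrow> 'k mat \<Rightarrow> 'r" where
  "Fa m a g = (if \<exists>V. Rp m a g V then THE V. Rp m a g V else 0)"

lemma Rp_ex_iff: "(\<exists>V. Rp m a g V) \<longleftrightarrow> drel n m g (tt a)"
  by (auto simp: Rp_def drel_def)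

text \<open>The unit scalar \<open>z\<close> acts through the central character as the scalar matrix
  of its reduction, so the stabiliser acts on \<open>W0\<close> through a single element of
  B^op.\<close>

lemma W0_stab:
  assumes m: "m \<ge> 1" and z: "z \<noteq> 0" and k: "k \<in> Kn v n" and k': "k' \<in> Knm v n m"
    and eq: "scal n z * k * tt a = tt a * k'" and a: "admissible m a"
  shows "(\<lambda>y. om z * rt n (kbar red n k) W0 y) = W0"
proof -
  note c = coset_unique[OF m z k k' eq a a]
  have r: "rt n (kbar red n k) W0 \<in> Wt" using kbar_GLn[OF k] W0(1) by (rule Wt_rt)
  have "(\<lambda>y. om z * rt n (kbar red n k) W0 y) = rt n (scal n (red z)) (rt n (kbar red n k) W0)"
    using om_unit[OF c(1) r] by simp
  also have "\<dots> = rt n (scal n (red z) * kbar red n k) W0"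
    using c(1) kbar_GLn[OF k] by (intro rt_rt) (auto simp: isUnit_iff scal_GLn)
  also have "\<dots> = W0" by (rule W0(3)[OF c(3)])
  finally show ?thesis .
qed

text \<open>Two factorisations of \<open>g\<close> differ by an element of the stabiliser of
  \<open>tt a\<close>, which does not move \<open>W0\<close>.\<close>

lemma Rp_unique:
  assumes m: "m \<ge> 1" and a: "admissible m a" and 1: "Rp m a g V1" and 2: "Rp m a g V2"
  shows "V1 = V2"
proof -
  obtain z1 k1 k1' where r1: "z1 \<noteq> 0" "k1 \<in> Kn v n" "k1' \<in> Knm v n m" "g = scal n z1 * k1 * tt a * k1'"
    "V1 = (\<lambda>y. om z1 * rt n (kbar red n k1) W0 y)" using 1 by (auto simp: Rp_def)
  obtain z2 k2 k2' where r2: "z2 \<noteq> 0" "k2 \<in> Kn v n" "k2' \<in> Knm v n m" "g = scal n z2 * k2 * tt a * k2'"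
    "V2 = (\<lambda>y. om z2 * rt n (kbar red n k2) W0 y)" using 2 by (auto simp: Rp_def)
  define z k k' where "z = z1 / z2" and "k = ginv k2 * k1" and "k' = k2' * ginv k1'"
  note G = scal_GLn[OF r1(1), of n] scal_GLn[OF r2(1), of n] Kn_GLn[OF r1(2)] Kn_GLn[OF r2(2)]
    Kn_GLn[OF Knm_Kn[OF r1(3)]] Kn_GLn[OF Knm_Kn[OF r2(3)]] nf_GLn[of n a "\<lambda>_. 0"]
  have iz: "inverse z2 \<noteq> 0" using r2 by simp
  note Gi = ginv(3)[OF G(3)] ginv(3)[OF G(4)] ginv(3)[OF G(5)] ginv(3)[OF G(6)] scal_GLn[OF iz, of n]
  have z: "z \<noteq> 0" using r1 r2 by (simp add: z_def)
  have kk: "k \<in> Kn v n" "k' \<in> Knm v n m" 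
    unfolding k_def k'_def using Kn_mult[OF Kn_ginv[OF r2(2)] r1(2)] Knm_mult[OF n1 r2(3) Knm_ginv[OF n1 r1(3)]] by auto
  have c1: "scal n z1 * (k1 * tt a) = scal n z2 * (k2 * (tt a * (k2' * ginv k1')))"
  proof -
    have "scal n z1 * (k1 * tt a) = scal n z1 * k1 * tt a * k1' * ginv k1'"
      using G Gi by (simp add: GLn_assoc[where n = n] GLn_mult ginv[where n = n] GLn_one_mult)
    also have "\<dots> = scal n z2 * k2 * tt a * k2' * ginv k1'" using r1(4) r2(4) by simp
    finally show ?thesis using G Gi by (simp add: GLn_assoc[where n = n] GLn_mult)
  qed
  have "scal n z = scal n (inverse z2) * scal n z1" by (simp add: scal_mult z_def divide_inverse mult.commute)
  then have "scal n z * k * tt a = scal n (inverse z2) * (scal n z1 * ginv k2) * (k1 * tt a)"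
    unfolding k_def using G Gi by (simp add: GLn_assoc[where n = n] GLn_mult)
  also have "scal n z1 * ginv k2 = ginv k2 * scal n z1" using Gi by (simp add: scal_commute GLn_carrier)
  also have "scal n (inverse z2) * (ginv k2 * scal n z1) * (k1 * tt a) = scal n (inverse z2) * (ginv k2 * (scal n z1 * (k1 * tt a)))"
    using G Gi by (simp add: GLn_assoc[where n = n] GLn_mult)
  also have "\<dots> = scal n (inverse z2) * ((ginv k2 * scal n z2) * (k2 * (tt a * k')))"
    unfolding c1 k'_def using G Gi by (simp add: GLn_assoc[where n = n] GLn_mult)
  also have "ginv k2 * scal n z2 = scal n z2 * ginv k2" using Gi by (simp add: scal_commute GLn_carrier)
  also have "scal n (inverse z2) * ((scal n z2 * ginv k2) * (k2 * (tt a * k'))) =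
     (scal n (inverse z2) * scal n z2) * (ginv k2 * (k2 * (tt a * k')))"
    unfolding k'_def using G Gi by (simp add: GLn_assoc[where n = n] GLn_mult)
  also have "\<dots> = tt a * k'"
    unfolding k'_def using G Gi r2 by (simp add: ginv_cancel[where n = n] GLn_mult scal_mult scal_one GLn_carrier)
  finally have eq: "scal n z * k * tt a = tt a * k'" .
  note st = W0_stab[OF m z kk eq a]
  have kb: "kbar red n k1 = kbar red n k2 * kbar red n k"
  proof -
    have "k1 = k2 * k" unfolding k_def using G by (simp add: ginv_cancel[where n = n])
    then show ?thesis using r2(2) kk(1) by (simp add: kbar_mult Kn_intg)
  qed
  have om: "om z1 = om z2 * om z" using om_mult[OF r2(1) z] r2 by (simp add: z_def)
  have "V1 = (\<lambda>y. om z2 * (om z * rt n (kbar red n k2) (rt n (kbar red n k) W0) y))"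
    unfolding r1(5) kb om using kbar_GLn[OF r2(2)] kbar_GLn[OF kk(1)] by (simp add: rt_rt mult.assoc)
  also have "\<dots> = (\<lambda>y. om z2 * rt n (kbar red n k2) (\<lambda>y. om z * rt n (kbar red n k) W0 y) y)"
    by (simp add: rt_fun_scale)
  also have "\<dots> = V2" unfolding st r2(5) ..
  finally show ?thesis .
qed

lemma Fa_eq: "m \<ge> 1 \<Longrightarrow> admissible m a \<Longrightarrow> Rp m a g V \<Longrightarrow> Fa m a g = V"
  unfolding Fa_def using Rp_unique by (metis (no_types, lifting) the_equality)

lemma Fa_zero: "\<not> drel n m g (tt a) \<Longrightarrow> Fa m a g = 0"
  unfolding Fa_def Rp_ex_iff by simp

lemma Fa_tt: assumes "m \<ge> 1" "admissible m a" shows "Fa m a (tt a) = W0"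
proof (rule Fa_eq[OF assms])
  have "W0 = (\<lambda>y. om 1 * rt n (kbar red n (1\<^sub>m n)) W0 y)"
    using W0(1) by (simp add: om_1 kbar_one Wt_rt_one)
  moreover have "tt a = scal n 1 * 1\<^sub>m n * tt a * 1\<^sub>m n"
    by (simp add: scal_one GLn_one_mult nf_GLn)
  ultimately show "Rp m a (tt a) W0"
    unfolding Rp_def using Kn_one Knm_one[OF n1] by (metis zero_neq_one)
qed

lemma Fa_tt_other:
  assumes m: "m \<ge> 1" and a: "admissible m a" "admissible m b" and ne: "i < n - 1" "a i \<noteq> b i"
  shows "Fa m a (tt b) = 0"
proof (rule Fa_zero)
  show "\<not> drel n m (tt b) (tt a)"
  proof
    assume "drel n m (tt b) (tt a)"
    then obtain z k k' where r: "z \<noteq> 0" "k \<in> Kn v n" "k' \<in> Knm v n m" "tt b = scal n z * k * tt a * k'"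
      by (auto simp: drel_def)
    have G: "scal n z * k * tt a \<in> GLn n"
      using r Kn_GLn[OF r(2)] by (intro GLn_mult scal_GLn nf_GLn)
    have "scal n z * k * tt a = tt b * ginv k'"
      unfolding r(4) using ginv_cancel(3)[OF Kn_GLn[OF Knm_Kn[OF r(3)]] G] by simp
    from coset_unique(2)[OF m r(1,2) Knm_ginv[OF n1 r(3)] this a ne(1)] ne(2) show False by simp
  qed
qed

lemma Rp_shift:
  assumes z: "z \<noteq> 0" and k: "k \<in> Kn v n" and R: "Rp m a g V"
  shows "Rp m a (scal n z * k * g) (\<lambda>y. om z * rt n (kbar red n k) V y)"
proof -
  obtain z1 k1 k1' where r: "z1 \<noteq> 0" "k1 \<in> Kn v n" "k1' \<in> Knm v n m" "g = scal n z1 * k1 * tt a * k1'"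
    "V = (\<lambda>y. om z1 * rt n (kbar red n k1) W0 y)" using R by (auto simp: Rp_def)
  note G = scal_GLn[OF r(1), of n] scal_GLn[OF z, of n] Kn_GLn[OF r(2)] Kn_GLn[OF k]
    Kn_GLn[OF Knm_Kn[OF r(3)]] nf_GLn[of n a "\<lambda>_. 0"]
  have "scal n z * k * g = scal n z * (k * scal n z1) * (k1 * (tt a * k1'))"
    unfolding r(4) using G by (simp add: GLn_assoc[where n = n] GLn_mult)
  also have "k * scal n z1 = scal n z1 * k" using G by (simp add: scal_commute GLn_carrier)
  also have "scal n z * (scal n z1 * k) * (k1 * (tt a * k1')) = (scal n z * scal n z1) * (k * k1) * tt a * k1'"
    using G by (simp add: GLn_assoc[where n = n] GLn_mult)
  also have "scal n z * scal n z1 = scal n (z * z1)" by (rule scal_mult)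
  finally have g: "scal n z * k * g = scal n (z * z1) * (k * k1) * tt a * k1'" .
  have "(\<lambda>y. om z * rt n (kbar red n k) V y) = (\<lambda>y. om (z * z1) * rt n (kbar red n (k * k1)) W0 y)"
    unfolding r(5) rt_fun_scale using k r z
    by (simp add: om_mult kbar_mult Kn_intg rt_rt[symmetric] kbar_GLn mult.assoc)
  then show ?thesis unfolding Rp_def using g z r k
    by (intro exI[of _ "z * z1"] exI[of _ "k * k1"] exI[of _ k1']) (auto intro: Kn_mult)
qed

lemma drel_shift:
  assumes z: "z \<noteq> 0" and k: "k \<in> Kn v n" and g: "g \<in> GLn n" and h: "h \<in> GLn n"
  shows "drel n m (scal n z * k * g) h \<longleftrightarrow> drel n m g h"
proof
  have 1: "drel n m (scal n z * k * g) g"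
  proof (rule drelI[OF z k Knm_one[OF n1]])
    show "scal n z * k * g = scal n z * k * g * 1\<^sub>m n"
      using Kn_GLn[OF k] z g by (simp add: GLn_one_mult GLn_mult scal_GLn)
  qed
  show "drel n m g h \<Longrightarrow> drel n m (scal n z * k * g) h" using drel_trans[OF n1 1 _ h] .
  have iz: "inverse z \<noteq> 0" using z by simp
  have 2: "drel n m g (scal n z * k * g)"
  proof (rule drelI[OF iz Kn_ginv[OF k] Knm_one[OF n1]])
    note G = scal_GLn[OF z, of n] scal_GLn[OF iz, of n] Kn_GLn[OF k] ginv(3)[OF Kn_GLn[OF k]] g
    have "scal n (inverse z) * ginv k * (scal n z * k * g) * 1\<^sub>m n = scal n (inverse z) * (ginv k * scal n z) * (k * g)"
      using G by (simp add: GLn_assoc[where n = n] GLn_mult GLn_one_mult)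
    also have "ginv k * scal n z = scal n z * ginv k" using G by (simp add: scal_commute GLn_carrier)
    also have "scal n (inverse z) * (scal n z * ginv k) * (k * g) = (scal n (inverse z) * scal n z) * (ginv k * (k * g))"
      using G by (simp add: GLn_assoc[where n = n] GLn_mult)
    also have "\<dots> = g" using G z by (simp add: ginv_cancel[where n = n] scal_mult scal_one GLn_carrier)
    finally show "g = scal n (inverse z) * ginv k * (scal n z * k * g) * 1\<^sub>m n" by simp
  qed
  show "drel n m (scal n z * k * g) h \<Longrightarrow> drel n m g h" using drel_trans[OF n1 2 _ h] .
qed

lemma Fa_left:
  assumes m: "m \<ge> 1" and a: "admissible m a" and z: "z \<noteq> 0" and k: "k \<in> Kn v n" and g: "g \<in> GLn n"
  shows "Fa m a (scal n z * k * g) = (\<lambda>y. om z * rt n (kbar red n k) (Fa m a g) y)"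
proof (cases "drel n m g (tt a)")
  case True
  then obtain V where V: "Rp m a g V" using Rp_ex_iff by blast
  then show ?thesis using Fa_eq[OF m a V] Fa_eq[OF m a Rp_shift[OF z k V]] by simp
next
  case False
  then have "\<not> drel n m (scal n z * k * g) (tt a)" using drel_shift[OF z k g nf_GLn] by blast
  then show ?thesis using Fa_zero False by (auto simp: rt_def fun_eq_iff)
qed

lemma Fa_right:
  assumes m: "m \<ge> 1" and a: "admissible m a" and g: "g \<in> GLn n" and h: "h \<in> Knm v n m"
  shows "Fa m a (g * h) = Fa m a g"
proof -
  have hG: "h \<in> GLn n" using Kn_GLn[OF Knm_Kn[OF h]] .
  have sh: "Rp m a (x * l) V" if R: "Rp m a x V" and l: "l \<in> Knm v n m" for x l V
  proof -
    obtain z k k' where r: "z \<noteq> 0" "k \<in> Kn v n" "k' \<in> Knm v n m" "x = scal n z * k * tt a * k'"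
      "V = (\<lambda>y. om z * rt n (kbar red n k) W0 y)" using R by (auto simp: Rp_def)
    have "x * l = scal n z * k * tt a * (k' * l)"
      unfolding r(4) using Kn_GLn[OF r(2)] Kn_GLn[OF Knm_Kn[OF r(3)]] Kn_GLn[OF Knm_Kn[OF l]] r(1) nf_GLn[of n a "\<lambda>_. 0"]
      by (simp add: GLn_assoc[where n = n] GLn_mult scal_GLn)
    then show ?thesis unfolding Rp_def using r Knm_mult[OF n1 r(3) l] by blast
  qed
  show ?thesis
  proof (cases "\<exists>V. Rp m a g V")
    case True
    then obtain V where V: "Rp m a g V" by blast
    then show ?thesis using Fa_eq[OF m a V] Fa_eq[OF m a sh[OF V h]] by simp
  next
    case False
    have "\<not> (\<exists>V. Rp m a (g * h) V)"
    proof
      assume "\<exists>V. Rp m a (g * h) V"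
      then obtain V where "Rp m a (g * h) V" by blast
      from sh[OF this Knm_ginv[OF n1 h]] have "Rp m a g V" using g hG by (simp add: ginv_cancel[where n = n])
      then show False using False by blast
    qed
    then show ?thesis using False by (simp add: Fa_def)
  qed
qed

text \<open>Write \<open>k' = c * s\<close> with \<open>s\<close> from finitely many representatives
  and \<open>c\<close> congruent to 1 modulo the m-th power of the maximal ideal. Exponents of
  \<open>tt a\<close> differ by less than m, so moving \<open>c\<close> to the left across
  \<open>tt a\<close> keeps it in K, and only the translates \<open>tt a * s\<close> are
  left.\<close>

lemma Fa_support_finite:
  assumes m: "m \<ge> 1" and a: "admissible m a"
  obtains T where "finite T" "T \<subseteq> GLn n"
    "\<And>g. drel n m g (tt a) \<Longrightarrow> \<exists>z k t. z \<noteq> 0 \<and> k \<in> Kn v n \<and> t \<in> T \<and> g = scal n z * k * t"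
proof -
  obtain R where R: "finite R" "R \<subseteq> Kn v n" "\<And>k. k \<in> Kn v n \<Longrightarrow> \<exists>r\<in>R. k * ginv r \<in> Kcong v n m"
    using finite_reps by blast
  have "\<exists>z k t. z \<noteq> 0 \<and> k \<in> Kn v n \<and> t \<in> (\<lambda>r. tt a * r) ` R \<and> g = scal n z * k * t" if dr: "drel n m g (tt a)" for g
  proof -
    obtain z k k' where r: "z \<noteq> 0" "k \<in> Kn v n" "k' \<in> Knm v n m" "g = scal n z * k * tt a * k'"
      using dr by (auto simp: drel_def)
    obtain s where s: "s \<in> R" "k' * ginv s \<in> Kcong v n m" using R(3)[OF Knm_Kn[OF r(3)]] by blast
    define c where "c = k' * ginv s"
    have c: "c \<in> Kn v n" "mcong n m c (1\<^sub>m n)" "c \<in> carrier_mat n n"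
      using s(2) by (auto simp: c_def Kcong_iff Kn_GLn GLn_carrier)
    define d where "d = tt a * c * ginv (tt a)"
    note G = Kn_GLn[OF r(2)] Kn_GLn[OF Knm_Kn[OF r(3)]] Kn_GLn[OF c(1)] nf_GLn[of n a "\<lambda>_. 0"] scal_GLn[OF r(1), of n]
      Kn_GLn[OF subsetD[OF R(2) s(1)]] ginv(3)[OF nf_GLn[of n a "\<lambda>_. 0"]]
    have dG: "d \<in> GLn n" unfolding d_def using G by (intro GLn_mult)
    have dt: "d * tt a = tt a * c" unfolding d_def using G by (simp add: ginv_cancel[where n = n] GLn_mult)
    have de: "d $$ (i,j) = w powi (ax n a i - ax n a j) * c $$ (i,j)" if "i < n" "j < n" for i j
    proof -
      have "d $$ (i,j) * w powi ax n a j = w powi ax n a i * c $$ (i,j)"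
        using diag_right[OF GLn_carrier[OF dG] that, of a] diag_left[OF c(3) that, of a] dt by simp
      then show ?thesis using w0 by (simp add: powi_diff field_simps)
    qed
    have ub: "0 \<le> ax n a i" "ax n a i < int m" if "i < n" for i
      using a m that by (auto simp: ax_def admissible_def intro: less_imp_le)
    have "vge 0 (d $$ (i,j))" if ij: "i < n" "j < n" for i j
    proof (cases "i = j")
      case True
      then show ?thesis using de[OF ij] Kn_entry[OF c(1) ij] by simp
    next
      case False
      have "vge (int m) (c $$ (i,j) - 1\<^sub>m n $$ (i,j))" using c(2) ij unfolding mcong_def by blast
      then have "vge (int m) (c $$ (i,j))" using False ij by simp
      then show ?thesis unfolding de[OF ij] vge_powi_mult
        by (rule vge_mono) (use ub[OF ij(1)] ub[OF ij(2)] in simp)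
    qed
    moreover have "det d = det c"
    proof -
      have "det d * det (tt a) = det (tt a) * det c"
        using arg_cong[OF dt, of det] GLn_carrier[OF dG] c(3) by (simp add: det_mult[of _ n])
      then show ?thesis using G(4) by (simp add: GLn_def)
    qed
    ultimately have dK: "d \<in> Kn v n" using c(1) dG by (auto simp: Kn_def inO_vge)
    have "k' = c * s" unfolding c_def using G by (simp add: ginv_cancel[where n = n])
    then have "g = scal n z * (k * d) * (tt a * s)"
      unfolding r(4) using G dG dt by (simp add: GLn_assoc[where n = n] GLn_mult)
        (simp add: GLn_assoc[where n = n, symmetric] GLn_mult)
    then show ?thesis using r dK s by (intro exI[of _ z] exI[of _ "k * d"] exI[of _ "tt a * s"]) (auto intro: Kn_mult)
  qed
  moreover have "finite ((\<lambda>r. tt a * r) ` R)" using R by simp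
  moreover have "(\<lambda>r. tt a * r) ` R \<subseteq> GLn n" using R(2) GLn_mult[OF nf_GLn Kn_GLn] by blast
  ultimately show ?thesis using that by blast
qed

lemma Fa_Fx:
  assumes m: "m \<ge> 1" and a: "admissible m a"
  shows "Fa m a \<in> Fx m"
proof -
  have drG: "g \<in> GLn n" if dr: "drel n m g (tt a)" for g
  proof -
    obtain z k k' where r: "z \<noteq> 0" "k \<in> Kn v n" "k' \<in> Knm v n m" "g = scal n z * k * tt a * k'"
      using dr by (auto simp: drel_def)
    show ?thesis unfolding r(4) using r(1) Kn_GLn[OF r(2)] Kn_GLn[OF Knm_Kn[OF r(3)]] by (intro GLn_mult scal_GLn nf_GLn)
  qed
  have inWt: "Fa m a g \<in> Wt" for g
  proof (cases "drel n m g (tt a)")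
    case True
    then obtain V where V: "Rp m a g V" using Rp_ex_iff by blast
    then obtain z k where "k \<in> Kn v n" and V': "V = (\<lambda>y. om z * rt n (kbar red n k) W0 y)"
      by (auto simp: Rp_def)
    then have "V \<in> Wt" unfolding V' by (intro Wt_scale[OF Wt_rt[OF kbar_GLn W0(1)]])
    then show ?thesis using Fa_eq[OF m a V] by simp
  qed (simp add: Fa_zero Wt_0)
  obtain T where T: "finite T" "T \<subseteq> GLn n"
    "\<And>g. drel n m g (tt a) \<Longrightarrow> \<exists>z k t. z \<noteq> 0 \<and> k \<in> Kn v n \<and> t \<in> T \<and> g = scal n z * k * t"
    using Fa_support_finite[OF m a] by metis
  show ?thesis
    unfolding fixed_vectors_def ind_space_def
  proof (intro CollectI conjI allI impI ballI)
    show "Fa m a g = 0" if "g \<notin> GLn n" for g using that drG Fa_zero by blast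
    show "Fa m a g \<in> Wt" for g by (rule inWt)
    show "Fa m a (scal n z * k * g) = (\<lambda>y. om z * rt n (kbar red n k) (Fa m a g) y)"
      if "z \<noteq> 0" "k \<in> Kn v n" "g \<in> GLn n" for z k g using Fa_left[OF m a that] .
    show "\<exists>j\<ge>1. \<forall>g\<in>GLn n. \<forall>k\<in>Kcong v n j. Fa m a (g * k) = Fa m a g"
      using m Fa_right[OF m a] Kcong_Knm[OF order_refl m n1] by blast
    show "\<exists>T. finite T \<and> T \<subseteq> GLn n \<and> (\<forall>g\<in>GLn n. Fa m a g \<noteq> 0 \<longrightarrow>
        (\<exists>z k t. z \<noteq> 0 \<and> k \<in> Kn v n \<and> t \<in> T \<and> g = scal n z * k * t))"
    proof (intro exI[of _ T] conjI ballI impI T(1,2))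
      fix g :: "'f mat" assume "Fa m a g \<noteq> 0"
      then have "drel n m g (tt a)" using Fa_zero by blast
      then show "\<exists>z k t. z \<noteq> 0 \<and> k \<in> Kn v n \<and> t \<in> T \<and> g = scal n z * k * t" by (rule T(3))
    qed
    show "Fa m a (g * k) = Fa m a g" if "g \<in> GLn n" "k \<in> Knm v n m" for g k
      using Fa_right[OF m a that] .
  qed
qed

section \<open>Counting the representatives\<close>

text \<open>An admissible sequence is a set of \<open>n - 1\<close> numbers in
  \<open>{1..m-1}\<close> listed in decreasing order.\<close>

definition aof :: "nat set \<Rightarrow> nat \<Rightarrow> int" where
  "aof A i = int (rev (sorted_list_of_set A) ! i)"

definition Sx :: "nat \<Rightarrow> nat set set" where
  "Sx m = {A. A \<subseteq> {1..m-1} \<and> card A = n - 1}"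

lemma finite_Sx: "finite (Sx m)"
  by (rule finite_subset[of _ "Pow {1..m-1}"]) (auto simp: Sx_def)

lemma card_Sx: "card (Sx m) = (m - 1) choose (n - 1)"
  unfolding Sx_def using n_subsets[of "{1..m-1}" "n - 1"] by simp

lemma aof_list: "A \<in> Sx m \<Longrightarrow> finite A \<and> length (sorted_list_of_set A) = n - 1 \<and> set (sorted_list_of_set A) = A"
  using finite_subset[of A "{1..m-1}"] by (auto simp: Sx_def)

lemma admissible_aof:
  assumes A: "A \<in> Sx m" shows "admissible m (aof A)"
proof -
  note L = aof_list[OF A]
  let ?l = "rev (sorted_list_of_set A)"
  have "?l ! i \<in> A" if "i < n - 1" for i
    using nth_mem[of i ?l] L that by simp
  then have "0 < aof A i \<and> aof A i < int m" if "i < n - 1" for i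
    using A that by (fastforce simp: Sx_def aof_def)
  moreover have "aof A j < aof A i" if "i < j" "j < n - 1" for i j
  proof -
    have "sorted_list_of_set A ! (n - 1 - Suc j) < sorted_list_of_set A ! (n - 1 - Suc i)"
      using L that by (intro strict_sorted_list_of_set[THEN sorted_wrt_nth_less]) auto
    then show ?thesis using L that by (simp add: aof_def rev_nth)
  qed
  ultimately show ?thesis by (simp add: admissible_def)
qed

text \<open>The conclusion compares matrices, because \<open>a\<close> and \<open>aof A\<close> are
  matched only at the indices below \<open>n - 1\<close>.\<close>

lemma admissible_ex:
  assumes a: "admissible m a" and m: "m \<ge> 1"
  shows "\<exists>A\<in>Sx m. tt a = tt (aof A)"
proof -
  define xs where "xs = map (\<lambda>i. nat (a i)) [0..<n-1]"
  have len: "length xs = n - 1" by (simp add: xs_def)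
  have nth: "xs ! i = nat (a i)" if "i < n - 1" for i using that by (simp add: xs_def)
  have "sorted_wrt (>) xs"
    unfolding sorted_wrt_iff_nth_less using a by (auto simp: len nth admissible_def)
  then have s: "sorted_wrt (<) (rev xs)" by (simp add: sorted_wrt_rev)
  define A where "A = set xs"
  have sl: "sorted_list_of_set A = rev xs"
    using s sorted_list_of_set.idem_if_sorted_distinct[of "rev xs"] by (simp add: A_def strict_sorted_iff)
  have "distinct xs" using s by (simp add: strict_sorted_iff)
  then have "card A = n - 1" using len by (simp add: A_def distinct_card)
  moreover have "A \<subseteq> {1..m-1}"
  proof -
    have "nat (a i) \<in> {1..m-1}" if "i < n - 1" for i
    proof -
      have "0 < a i" "a i < int m" using a that by (auto simp: admissible_def)
      then show ?thesis by auto
    qed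
    then show ?thesis by (auto simp: A_def xs_def)
  qed
  moreover have "aof A i = a i" if "i < n - 1" for i
  proof -
    have "0 < a i" using a that by (simp add: admissible_def)
    then show ?thesis using that by (simp add: aof_def sl nth)
  qed
  then have "tt a = tt (aof A)" by (intro eq_matI) (auto simp: nf_def)
  ultimately show ?thesis by (auto simp: Sx_def)
qed

lemma aof_inj:
  assumes "A \<in> Sx m" "A' \<in> Sx m" "A \<noteq> A'"
  shows "\<exists>i<n-1. aof A i \<noteq> aof A' i"
proof (rule ccontr)
  assume "\<not> ?thesis"
  then have "\<And>i. i < n - 1 \<Longrightarrow> rev (sorted_list_of_set A) ! i = rev (sorted_list_of_set A') ! i" by (auto simp: aof_def)
  then have "rev (sorted_list_of_set A) = rev (sorted_list_of_set A')"
    using aof_list[OF assms(1)] aof_list[OF assms(2)] by (intro nth_equalityI) auto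
  then show False using aof_list[OF assms(1)] aof_list[OF assms(2)] assms(3) by (metis rev_rev_ident)
qed

abbreviation FA :: "nat \<Rightarrow> nat set \<Rightarrow> 'f mat \<Rightarrow> 'k mat \<Rightarrow> 'r" where
  "FA m A \<equiv> Fa m (aof A)"

lemma Fx_at_tt:
  assumes f: "f \<in> Fx m" and m: "m \<ge> 1" and a: "admissible m a"
  shows "f (tt a) = (\<lambda>y. f (tt a) (1\<^sub>m n) * W0 y)"
proof (rule Bop_invariant_eq[OF Fx_Wt[OF f]])
  fix b :: "'k mat" assume b: "b \<in> Bop n"
  show "rt n b (f (tt a)) = f (tt a)"
    by (rule Bop_stab[OF f m _ b]) (use a in \<open>auto simp: admissible_def intro: less_imp_le\<close>)
qed

lemma FA_at_tt:
  assumes "m \<ge> 1" "A \<in> Sx m" "A' \<in> Sx m"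
  shows "FA m A (tt (aof A')) (1\<^sub>m n) = (if A = A' then 1 else 0)"
proof (cases "A = A'")
  case True
  then show ?thesis using Fa_tt[OF assms(1) admissible_aof[OF assms(2)]] W0(2) by simp
next
  case False
  then obtain i where "i < n - 1" "aof A i \<noteq> aof A' i" using aof_inj assms by blast
  then show ?thesis
    using Fa_tt_other[OF assms(1) admissible_aof[OF assms(2)] admissible_aof[OF assms(3)]] False by simp
qed

text \<open>At a representative, the value of \<open>f\<close> is invariant under B^op and hence a
  multiple of \<open>W0\<close>, with the factor read off at the identity. Equivariance extends this
  to the double coset, and outside these cosets both sides vanish.\<close>

theorem Fx_expand:
  assumes f: "f \<in> Fx m" and m: "m \<ge> 1"
  shows "f g y = (\<Sum>A\<in>Sx m. f (tt (aof A)) (1\<^sub>m n) * FA m A g y)"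
proof (cases "\<exists>A\<in>Sx m. drel n m g (tt (aof A))")
  case True
  then obtain A where A: "A \<in> Sx m" "drel n m g (tt (aof A))" by blast
  obtain z k k' where r: "z \<noteq> 0" "k \<in> Kn v n" "k' \<in> Knm v n m" "g = scal n z * k * tt (aof A) * k'"
    using A(2) by (auto simp: drel_def)
  let ?c = "\<lambda>A. f (tt (aof A)) (1\<^sub>m n)"
  have zero: "FA m A' g y = 0" if A': "A' \<in> Sx m" "A' \<noteq> A" for A'
  proof -
    obtain i where i: "i < n - 1" "aof A' i \<noteq> aof A i" using aof_inj[OF A'(1) A(1) A'(2)] by blast
    have "FA m A' (tt (aof A)) = 0"
      by (rule Fa_tt_other[OF m admissible_aof[OF A'(1)] admissible_aof[OF A(1)] i])
    then show ?thesis
      using Fx_drel[OF Fa_Fx[OF m admissible_aof[OF A'(1)]] nf_GLn r(1-3)] r(4) by (simp add: rt_def)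
  qed
  have "(\<Sum>A'\<in>Sx m. ?c A' * FA m A' g y) = (\<Sum>A'\<in>Sx m. if A' = A then ?c A * FA m A g y else 0)"
    using zero by (intro sum.cong) auto
  also have "\<dots> = ?c A * FA m A g y" using A(1) finite_Sx by simp
  also have "FA m A g y = om z * rt n (kbar red n k) W0 y"
    using Fx_drel[OF Fa_Fx[OF m admissible_aof[OF A(1)]] nf_GLn r(1-3)] r(4)
      Fa_tt[OF m admissible_aof[OF A(1)]] by simp
  also have "?c A * \<dots> = om z * rt n (kbar red n k) (\<lambda>y. ?c A * W0 y) y"
    by (simp add: rt_fun_scale)
  also have "(\<lambda>y. ?c A * W0 y) = f (tt (aof A))"
    by (rule Fx_at_tt[OF f m admissible_aof[OF A(1)], symmetric])
  also have "om z * rt n (kbar red n k) (f (tt (aof A))) y = f g y"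
    unfolding r(4) Fx_drel[OF f nf_GLn r(1-3)] ..
  finally show ?thesis by simp
next
  case False
  then have "FA m A g = 0" if "A \<in> Sx m" for A using that Fa_zero by blast
  moreover have "f g = 0"
  proof (cases "g \<in> GLn n")
    case True
    show ?thesis
    proof (rule ccontr)
      assume "f g \<noteq> 0"
      then obtain a where a: "admissible m a" "drel n m g (tt a)"
        using support_classification[OF f m True] by blast
      then show False using admissible_ex[OF a(1) m] False by auto
    qed
  qed (use Fx_outside[OF f] in blast)
  ultimately show ?thesis by simp
qed

text \<open>Evaluation at the representatives and then at the identity is dual to the family
  \<open>FA m A\<close>, which gives independence; spanning is \<open>Fx_expand\<close>.\<close>

theorem dim_Fx:
  assumes m: "m \<ge> 1"
  shows "fun_dim (Fx m) = (m - 1) choose (n - 1)"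
proof -
  interpret vs: vector_space "\<lambda>c (f :: 'f mat \<Rightarrow> 'k mat \<Rightarrow> 'r) g y. c * f g y" by (rule vector_space_fun2)
  let ?B = "FA m ` Sx m"
  have inj: "inj_on (FA m) (Sx m)"
  proof (rule inj_onI)
    fix A A' assume AA: "A \<in> Sx m" "A' \<in> Sx m" "FA m A = FA m A'"
    show "A = A'"
    proof (rule ccontr)
      assume ne: "A \<noteq> A'"
      have "FA m A (tt (aof A')) (1\<^sub>m n) = 0" using FA_at_tt[OF m AA(1,2)] ne by simp
      moreover have "FA m A' (tt (aof A')) (1\<^sub>m n) = 1" using FA_at_tt[OF m AA(2,2)] by simp
      ultimately show False using AA(3) by simp
    qed
  qed
  have "vs.dim (Fx m) = (m - 1) choose (n - 1)"
  proof (rule vs.dim_unique)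
    show "?B \<subseteq> Fx m" using Fa_Fx[OF m] admissible_aof by blast
    show "card ?B = (m - 1) choose (n - 1)" using inj by (simp add: card_image card_Sx)
    show "Fx m \<subseteq> vs.span ?B"
    proof
      fix f assume f: "f \<in> Fx m"
      have "f = (\<Sum>A\<in>Sx m. (\<lambda>g y. f (tt (aof A)) (1\<^sub>m n) * FA m A g y))"
        by (intro ext) (simp only: sum_fun_apply, rule Fx_expand[OF f m])
      also have "\<dots> \<in> vs.span ?B"
        by (intro vs.span_sum vs.span_scale vs.span_base) auto
      finally show "f \<in> vs.span ?B" .
    qed
    show "vs.independent ?B"
    proof
      assume "vs.dependent ?B"
      then obtain u b where u: "b \<in> ?B" "u b \<noteq> 0" "(\<Sum>b\<in>?B. (\<lambda>g y. u b * b g y)) = 0"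
        using vs.dependent_finite[of ?B] finite_Sx by auto
      obtain A where A: "A \<in> Sx m" "b = FA m A" using u(1) by blast
      have "0 = (\<Sum>b\<in>?B. (\<lambda>g y. u b * b g y)) (tt (aof A)) (1\<^sub>m n)" using u(3) by simp
      also have "\<dots> = (\<Sum>A'\<in>Sx m. u (FA m A') * FA m A' (tt (aof A)) (1\<^sub>m n))"
        using inj by (simp add: sum_fun_apply sum.reindex)
      also have "\<dots> = (\<Sum>A'\<in>Sx m. if A' = A then u (FA m A) else 0)"
        using FA_at_tt[OF m _ A(1)] by (intro sum.cong) auto
      also have "\<dots> = u b" using A finite_Sx by simp
      finally show False using u(2) by simp
    qed
  qed
  then show ?thesis by (simp add: fun_dim_def)
qed

text \<open>For \<open>m < n\<close> the set \<open>{1..m-1}\<close> has fewer than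
  \<open>n - 1\<close> elements, so the expansion is an empty sum. Level 0 is covered by level 1,
  whose group is smaller.\<close>

lemma Fx_small: assumes "m < n" shows "Fx m = {0}"
proof -
  have zero: "Fx m' \<subseteq> {0}" if m': "1 \<le> m'" "m' < n" for m'
  proof
    fix f assume f: "f \<in> Fx m'"
    have "A \<notin> Sx m'" for A
    proof
      assume A: "A \<in> Sx m'"
      then have "card A \<le> card {1..m'-1}" by (intro card_mono) (auto simp: Sx_def)
      then show False using A m' by (simp add: Sx_def)
    qed
    then have "Sx m' = {}" by blast
    then have "f g y = 0" for g y using Fx_expand[OF f m'(1), of g y] by simp
    then show "f \<in> {0}" by (simp add: fun_eq_iff)
  qed
  have "Fx m \<subseteq> {0}"
  proof (cases "m = 0")
    case True
    have "Fx 0 \<subseteq> Fx 1" by (auto simp: fixed_vectors_def Knm_def)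
    then show ?thesis using zero[of 1] n2 True by auto
  next
    case False
    then show ?thesis using zero assms by simp
  qed
  moreover have "0 \<in> Fx m"
    unfolding fixed_vectors_def ind_space_def
  proof (intro CollectI conjI allI impI ballI)
    show "\<exists>j\<ge>1. \<forall>g\<in>GLn n. \<forall>k\<in>Kcong v n j. (0 :: 'f mat \<Rightarrow> 'k mat \<Rightarrow> 'r) (g * k) = 0 g"
      by (intro exI[of _ 1]) simp
    show "\<exists>T. finite T \<and> T \<subseteq> GLn n \<and> (\<forall>g\<in>GLn n. (0 :: 'f mat \<Rightarrow> 'k mat \<Rightarrow> 'r) g \<noteq> 0 \<longrightarrow>
        (\<exists>z k t. z \<noteq> 0 \<and> k \<in> Kn v n \<and> t \<in> T \<and> g = scal n z * k * t))"
      by (intro exI[of _ "{}"]) simp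
  qed (auto simp: Wt_0 rt_def fun_eq_iff)
  ultimately show ?thesis by blast
qed

section \<open>Level n and the newform\<close>

definition a0 :: "nat \<Rightarrow> int" where "a0 i = int (n - 1 - i)"

lemma a0: "admissible n a0" "tt a0 = Sigma w n"
proof -
  show "admissible n a0" by (auto simp: admissible_def a0_def)
  have "w powi a0 i = w ^ (n - 1 - i)" for i unfolding a0_def by (rule power_int_of_nat)
  then show "tt a0 = Sigma w n" by (intro eq_matI) (auto simp: nf_def Sigma_def not_less)
qed

lemma admissible_n: assumes "admissible n a" shows "tt a = Sigma w n"
proof -
  have "a i = a0 i" if "i < n - 1" for i
  proof -
    \<comment> \<open>Reversed and shifted by one, the exponents become a strictly increasing
      self-map of \<open>{0..n-2}\<close>, hence the identity.\<close>
    define q where "q j = nat (a (n - 2 - j)) - 1" for j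
    have "q j = j" if "j < n - 1" for j
    proof (rule perm_no_descent_id[OF _ _ that])
      show "q j < n - 1" if "j < n - 1" for j
      proof -
        have "n - 2 - j < n - 1" using n2 by simp
        then have "0 < a (n - 2 - j)" "a (n - 2 - j) < int n" using assms by (auto simp: admissible_def)
        then show ?thesis by (auto simp: q_def)
      qed
      show "q j < q (Suc j)" if "Suc j < n - 1" for j
      proof -
        have i: "n - 2 - j < n - 1" "n - 2 - Suc j < n - 2 - j" using that by auto
        then have "a (n - 2 - j) < a (n - 2 - Suc j)" "0 < a (n - 2 - j)" using assms by (auto simp: admissible_def)
        then show ?thesis by (auto simp: q_def)
      qed
    qed
    moreover have "n - 2 - (n - 2 - i) = i" "n - 2 - i < n - 1" using that by auto
    ultimately have "nat (a i) - 1 = n - 2 - i" by (metis q_def)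
    moreover have "0 < a i" using assms that by (simp add: admissible_def)
    ultimately show ?thesis using that by (simp add: a0_def)
  qed
  then have "tt a = tt a0" by (intro eq_matI) (auto simp: nf_def)
  then show ?thesis by (simp add: a0)
qed

lemma Fx_n_expand:
  assumes f: "f \<in> Fx n" shows "f = (\<lambda>g y. f (Sigma w n) (1\<^sub>m n) * Fa n a0 g y)"
proof -
  have "Sx n = {{1..n-1}}"
  proof -
    have "A = {1..n-1}" if "A \<subseteq> {1..n-1}" "card A = n - 1" for A :: "nat set"
      using card_subset_eq[of "{1..n-1}" A] that by simp
    then show ?thesis by (auto simp: Sx_def)
  qed
  note SxE = this
  have ttE: "tt (aof {1..n-1}) = Sigma w n"
    by (rule admissible_n, rule admissible_aof) (simp add: SxE)
  have S: "f = (\<lambda>g y. f (Sigma w n) (1\<^sub>m n) * FA n {1..n-1} g y)" if f: "f \<in> Fx n" for f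
  proof (intro ext)
    fix g y
    have "f g y = (\<Sum>A\<in>Sx n. f (tt (aof A)) (1\<^sub>m n) * FA n A g y)" by (rule Fx_expand[OF f n1])
    also have "\<dots> = f (Sigma w n) (1\<^sub>m n) * FA n {1..n-1} g y"
      unfolding SxE by (simp only: ttE[symmetric], simp)
    finally show "f g y = f (Sigma w n) (1\<^sub>m n) * FA n {1..n-1} g y" .
  qed
  have one: "Fa n a0 (Sigma w n) (1\<^sub>m n) = 1" using Fa_tt[OF n1 a0(1)] W0(2) by (simp add: a0(2))
  have "Fa n a0 = (\<lambda>g y. Fa n a0 (Sigma w n) (1\<^sub>m n) * FA n {1..n-1} g y)"
    by (rule S[OF Fa_Fx[OF n1 a0(1)]])
  also have "\<dots> = FA n {1..n-1}" unfolding one by simp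
  finally have eq: "Fa n a0 = FA n {1..n-1}" .
  show ?thesis unfolding eq by (rule S[OF f])
qed

lemma conductor_eq: "conductor v red n om Wt = n"
  unfolding conductor_def
proof (rule Least_equality)
  have "Fa n a0 (Sigma w n) = W0" using Fa_tt[OF n1 a0(1)] by (simp add: a0(2))
  moreover have "W0 \<noteq> 0" using W0(2) by auto
  ultimately have "Fa n a0 \<noteq> 0" by auto
  then show "Fx n \<noteq> {0}" using Fa_Fx[OF n1 a0(1)] by blast
  show "n \<le> m" if "Fx m \<noteq> {0}" for m using that Fx_small by (meson not_le)
qed

lemma newform_unique: "f \<in> Fx n \<and> f (Sigma w n) = W0 \<longleftrightarrow> f = Fa n a0"
proof
  assume f: "f \<in> Fx n \<and> f (Sigma w n) = W0"
  then have "f = (\<lambda>g y. f (Sigma w n) (1\<^sub>m n) * Fa n a0 g y)" by (intro Fx_n_expand) simp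
  also have "\<dots> = Fa n a0" using f W0(2) by simp
  finally show "f = Fa n a0" .
next
  assume "f = Fa n a0"
  then show "f \<in> Fx n \<and> f (Sigma w n) = W0" using Fa_Fx[OF n1 a0(1)] Fa_tt[OF n1 a0(1)] by (simp add: a0(2))
qed

end

section \<open>Congruences of matrices and compactness\<close>

context local_field
begin

lemma mcong_refl: "mcong N j A A"
  by (simp add: mcong_def)

lemma mcong_trans: "mcong N j A B \<Longrightarrow> mcong N j B C \<Longrightarrow> mcong N j A C"
proof -
  assume 1: "mcong N j A B" and 2: "mcong N j B C"
  have "vge (int j) (A $$ (i,l) - C $$ (i,l))" if il: "i < N" "l < N" for i l
  proof -
    have "vge (int j) ((A $$ (i,l) - B $$ (i,l)) + (B $$ (i,l) - C $$ (i,l)))"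
      using 1 2 il unfolding mcong_def by (intro vge_add) auto
    then show ?thesis by simp
  qed
  then show ?thesis by (simp add: mcong_def)
qed

lemma mcong_Kn:
  assumes A: "A \<in> Kn v N" and B: "B \<in> carrier_mat N N" and c: "mcong N j B A" and j: "j \<ge> 1"
  shows "B \<in> Kn v N" "kbar red N B = kbar red N A"
proof -
  have c': "vge (int j) (B $$ (i,l) - A $$ (i,l))" if "i < N" "l < N" for i l using c that by (simp add: mcong_def)
  have B0: "vge 0 (B $$ (i,l))" if il: "i < N" "l < N" for i l
  proof -
    have "vge 0 (B $$ (i,l) - A $$ (i,l))" by (rule vge_mono[OF c'[OF il]]) simp
    then have "vge 0 ((B $$ (i,l) - A $$ (i,l)) + A $$ (i,l))" by (rule vge_add) (rule Kn_entry[OF A il])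
    then show ?thesis by simp
  qed
  have int: "intg N B" using B B0 by (simp add: intg_def)
  show kb: "kbar red N B = kbar red N A"
  proof (rule eq_matI)
    fix i l assume "i < dim_row (kbar red N A)" "l < dim_col (kbar red N A)"
    then have il: "i < N" "l < N" by (auto simp: kbar_def)
    have "vge 1 (B $$ (i,l) - A $$ (i,l))" by (rule vge_mono[OF c'[OF il]]) (use j in simp)
    then show "kbar red N B $$ (i,l) = kbar red N A $$ (i,l)"
      using red_eq_iff[OF B0[OF il] Kn_entry[OF A il]] il by (simp add: kbar_entry)
  qed (auto simp: kbar_def)
  show "B \<in> Kn v N" using int A by (simp add: Kn_iff kb)
qed

lemma mcong_Knm:
  assumes A: "A \<in> Knm v N m" and B: "B \<in> carrier_mat N N" and c: "mcong N j B A" and j: "j \<ge> m" "m \<ge> 1" "N \<ge> 1"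
  shows "B \<in> Knm v N m"
proof -
  have K: "B \<in> Kn v N" using mcong_Kn[OF Knm_Kn[OF A] B c] j by simp
  have "vge (int m) (B $$ (N-1,l) - (if l = N - 1 then 1 else 0))" if l: "l < N" for l
  proof -
    have l': "N - 1 < N" using j by simp
    have "vge (int j) (B $$ (N-1,l) - A $$ (N-1,l))" using c l l' by (simp add: mcong_def)
    then have 1: "vge (int m) (B $$ (N-1,l) - A $$ (N-1,l))" by (rule vge_mono) (use j in simp)
    have 2: "vge (int m) (A $$ (N-1,l) - (if l = N - 1 then 1 else 0))"
      using A l unfolding Knm_iff[OF j(2,3)] lastrow_def by blast
    show ?thesis using vge_add[OF 1 2] by simp
  qed
  then show ?thesis using K unfolding Knm_iff[OF j(2,3)] lastrow_def by blast
qed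

lemma cls_mono:
  assumes "intg N A" "intg N B" "j \<le> J" "cls N J A = cls N J B" shows "cls N j A = cls N j B"
  using assms by (simp add: cls_eq_iff mcong_mono)

text \<open>Congruence to \<open>c\<close> with a separate level for each entry; the normalising set
  for the Haar measure has this shape.\<close>

definition box :: "nat \<Rightarrow> (nat \<Rightarrow> nat \<Rightarrow> nat) \<Rightarrow> 'f mat \<Rightarrow> 'f mat set" where
  "box N e c = {B \<in> carrier_mat N N. \<forall>i<N. \<forall>l<N. vge (int (e i l)) (B $$ (i,l) - c $$ (i,l))}"

lemma card_cls_box:
  assumes c: "intg N c" and e: "\<And>i l. i < N \<Longrightarrow> l < N \<Longrightarrow> e i l \<le> j"
  shows "finite (cls N j ` box N e c)"
    "card (cls N j ` box N e c) = card (UNIV :: 'k set) ^ (\<Sum>i<N. \<Sum>l<N. j - e i l)"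
proof -
  let ?I = "{..<N} \<times> {..<N}"
  define P where "P = (\<lambda>(i,l). rs j ` {x. vge (int (e i l)) (x - c $$ (i,l))})"
  have img: "cls N j ` box N e c = mat N N ` (\<Pi>\<^sub>E p\<in>?I. P p)"
  proof (intro equalityI subsetI)
    fix u assume "u \<in> cls N j ` box N e c"
    then obtain A where A: "A \<in> box N e c" "u = cls N j A" by auto
    have "u = mat N N (restrict (\<lambda>p. rs j (A $$ p)) ?I)" unfolding A(2) cls_def by (intro eq_matI) auto
    moreover have "restrict (\<lambda>p. rs j (A $$ p)) ?I \<in> (\<Pi>\<^sub>E p\<in>?I. P p)"
      using A(1) by (auto simp: box_def P_def)
    ultimately show "u \<in> mat N N ` (\<Pi>\<^sub>E p\<in>?I. P p)" by blast
  next
    fix u assume "u \<in> mat N N ` (\<Pi>\<^sub>E p\<in>?I. P p)"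
    then obtain f where f: "f \<in> (\<Pi>\<^sub>E p\<in>?I. P p)" "u = mat N N f" by auto
    have "\<forall>p\<in>?I. \<exists>x. vge (int (e (fst p) (snd p))) (x - c $$ p) \<and> f p = rs j x"
    proof
      fix p assume p: "p \<in> ?I"
      then have "f p \<in> P p" using f(1) by (rule PiE_mem[rotated])
      then show "\<exists>x. vge (int (e (fst p) (snd p))) (x - c $$ p) \<and> f p = rs j x"
        by (cases p) (auto simp: P_def)
    qed
    then obtain x where x: "\<And>p. p \<in> ?I \<Longrightarrow> vge (int (e (fst p) (snd p))) (x p - c $$ p) \<and> f p = rs j (x p)"
      by metis
    have "mat N N x \<in> box N e c" using x by (auto simp: box_def)
    moreover have "u = cls N j (mat N N x)" unfolding f(2) cls_def using x by (intro eq_matI) auto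
    ultimately show "u \<in> cls N j ` box N e c" by blast
  qed
  have inj: "inj_on (mat N N) (\<Pi>\<^sub>E p\<in>?I. P p)"
  proof (rule inj_onI)
    fix f g assume fg: "f \<in> (\<Pi>\<^sub>E p\<in>?I. P p)" "g \<in> (\<Pi>\<^sub>E p\<in>?I. P p)" "mat N N f = mat N N g"
    show "f = g"
    proof (rule PiE_ext[OF fg(1,2)])
      fix p assume "p \<in> ?I"
      then obtain i l where p: "p = (i,l)" "i < N" "l < N" by auto
      have "mat N N f $$ (i,l) = mat N N g $$ (i,l)" using fg(3) by simp
      then show "f p = g p" using p by simp
    qed
  qed
  have ball: "finite (P p)" "card (P p) = card (UNIV :: 'k set) ^ (j - e (fst p) (snd p))" if "p \<in> ?I" for p
    using that card_rs_ball[of "c $$ p" "e (fst p) (snd p)" j] c e by (auto simp: P_def intg_def)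
  show "finite (cls N j ` box N e c)" unfolding img using ball by (intro finite_imageI finite_PiE) auto
  have "card (cls N j ` box N e c) = (\<Prod>p\<in>?I. card (P p))"
    unfolding img using inj by (simp add: card_image card_PiE)
  also have "\<dots> = (\<Prod>p\<in>?I. card (UNIV :: 'k set) ^ (j - e (fst p) (snd p)))"
    using ball by (intro prod.cong) auto
  also have "\<dots> = card (UNIV :: 'k set) ^ (\<Sum>p\<in>?I. j - e (fst p) (snd p))" by (rule power_sum[symmetric])
  also have "(\<Sum>p\<in>?I. j - e (fst p) (snd p)) = (\<Sum>i<N. \<Sum>l<N. j - e i l)"
    by (simp add: sum.cartesian_product case_prod_unfold)
  finally show "card (cls N j ` box N e c) = card (UNIV :: 'k set) ^ (\<Sum>i<N. \<Sum>l<N. j - e i l)" .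
qed

text \<open>Completeness of the field, in the form of compactness of \<open>K\<^sub>N(m)\<close>: a locally constant
  property is uniformly locally constant.\<close>

lemma uniform_local_constancy:
  assumes m: "m \<ge> 1" "N \<ge> 1"
    and loc: "\<And>x. x \<in> Knm v N m \<Longrightarrow> \<exists>j. \<forall>y\<in>Knm v N m. mcong N j y x \<longrightarrow> (Q y \<longleftrightarrow> Q x)"
  shows "\<exists>J\<ge>m. \<forall>x\<in>Knm v N m. \<forall>y\<in>Knm v N m. mcong N J y x \<longrightarrow> (Q y \<longleftrightarrow> Q x)"
proof (rule ccontr)
  let ?H = "Knm v N m"
  assume no: "\<not> ?thesis"
  \<comment> \<open>Near \<open>x\<close> to precision \<open>j\<close>, no single level
    \<open>J\<close> separates the two values of \<open>Q\<close>.\<close>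
  define bad where "bad x j \<longleftrightarrow> (\<forall>J. \<exists>a\<in>?H. \<exists>b\<in>?H. mcong N j a x \<and> mcong N J b a \<and> (Q b \<noteq> Q a))" for x j
  have HC: "x \<in> carrier_mat N N" "intg N x" "x \<in> Kn v N" if "x \<in> ?H" for x
    using that Knm_Kn by (auto simp: Kn_GLn GLn_carrier Kn_intg)
  have start: "bad (1\<^sub>m N) 0"
    unfolding bad_def
  proof
    fix J
    have "\<not> (\<forall>x\<in>?H. \<forall>y\<in>?H. mcong N (max J m) y x \<longrightarrow> (Q y \<longleftrightarrow> Q x))"
    proof
      assume "\<forall>x\<in>?H. \<forall>y\<in>?H. mcong N (max J m) y x \<longrightarrow> (Q y \<longleftrightarrow> Q x)"
      then show False using no by (meson max.cobounded2)
    qed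
    then obtain a b where ab: "a \<in> ?H" "b \<in> ?H" "mcong N (max J m) b a" "Q b \<noteq> Q a" by blast
    have "mcong N 0 a (1\<^sub>m N)"
      unfolding mcong_def using HC(2)[OF ab(1)] intg_one[of N] by (auto simp: intg_def intro!: vge_diff)
    moreover have "mcong N J b a" using ab(3) by (rule mcong_mono) simp
    ultimately show "\<exists>a\<in>?H. \<exists>b\<in>?H. mcong N 0 a (1\<^sub>m N) \<and> mcong N J b a \<and> (Q b \<noteq> Q a)" using ab by blast
  qed
  have step: "\<exists>y\<in>?H. mcong N j y x \<and> bad y (Suc j)" if bx: "bad x j" for x j
  proof (rule ccontr)
    assume c: "\<not> ?thesis"
    define S where "S = {y \<in> ?H. mcong N j y x}"
    have "finite (cls N (Suc j) ` S)"
      by (rule finite_subset[OF _ finite_cls[of N "Suc j"]]) (use HC(2) in \<open>auto simp: S_def\<close>)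
    have "\<exists>J. \<forall>a\<in>?H. \<forall>b\<in>?H. mcong N (Suc j) a y \<longrightarrow> mcong N J b a \<longrightarrow> (Q b \<longleftrightarrow> Q a)" if y: "y \<in> S" for y
    proof -
      have "\<not> bad y (Suc j)" using c y by (auto simp: S_def)
      then show ?thesis unfolding bad_def by blast
    qed
    then obtain Jf where Jf: "\<And>y a b. y \<in> S \<Longrightarrow> a \<in> ?H \<Longrightarrow> b \<in> ?H \<Longrightarrow> mcong N (Suc j) a y \<Longrightarrow> mcong N (Jf y) b a \<Longrightarrow> (Q b \<longleftrightarrow> Q a)"
      by metis
    define R where "R = (\<lambda>u. SOME y. y \<in> S \<and> cls N (Suc j) y = u) ` (cls N (Suc j) ` S)"
    have finR: "finite R" unfolding R_def using \<open>finite (cls N (Suc j) ` S)\<close> by simp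
    have sel: "\<exists>r\<in>R. r \<in> S \<and> cls N (Suc j) r = cls N (Suc j) y" if y: "y \<in> S" for y
    proof -
      have "(SOME z. z \<in> S \<and> cls N (Suc j) z = cls N (Suc j) y) \<in> S \<and>
        cls N (Suc j) (SOME z. z \<in> S \<and> cls N (Suc j) z = cls N (Suc j) y) = cls N (Suc j) y"
        by (rule someI[of _ y]) (use y in simp)
      then show ?thesis using y unfolding R_def by blast
    qed
    define J where "J = Max (insert 0 (Jf ` R))"
    obtain a b where ab: "a \<in> ?H" "b \<in> ?H" "mcong N j a x" "mcong N J b a" "Q b \<noteq> Q a"
      using bx unfolding bad_def by blast
    have aS: "a \<in> S" using ab by (simp add: S_def)
    obtain r where r: "r \<in> R" "r \<in> S" "cls N (Suc j) r = cls N (Suc j) a" using sel[OF aS] by blast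
    have rH: "r \<in> ?H" using r by (simp add: S_def)
    have "mcong N (Suc j) a r" using r(3) cls_eq_iff[OF HC(2)[OF ab(1)] HC(2)[OF rH]] by metis
    moreover have "Jf r \<le> J" unfolding J_def using finR r(1) by (intro Max_ge) auto
    then have "mcong N (Jf r) b a" using mcong_mono[OF ab(4)] by blast
    ultimately show False using Jf[OF r(2) ab(1,2)] ab(5) by blast
  qed
  have "\<exists>s. \<forall>j. (s j \<in> ?H \<and> bad (s j) j) \<and> mcong N j (s (Suc j)) (s j)"
  proof (rule dependent_nat_choice)
    show "\<exists>x. x \<in> ?H \<and> bad x 0" using start Knm_one[OF m(2)] by blast
    show "\<exists>y. (y \<in> ?H \<and> bad y (Suc j)) \<and> mcong N j y x" if "x \<in> ?H \<and> bad x j" for x j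
      using step[of x j] that by blast
  qed
  then obtain s where s: "\<And>j. s j \<in> ?H" "\<And>j. bad (s j) j" "\<And>j. mcong N j (s (Suc j)) (s j)" by blast
  have cauchy: "mcong N j (s i) (s j)" if "j \<le> i" for i j
    using that
  proof (induction i rule: dec_induct)
    case (step i)
    have "mcong N j (s (Suc i)) (s i)" by (rule mcong_mono[OF s(3)]) (use step in simp)
    then show ?case using step.IH by (rule mcong_trans)
  qed (rule mcong_refl)
  have "\<exists>L. \<forall>M::nat. \<exists>K. \<forall>i\<ge>K. vge (int M) (s i $$ p - L)" if p: "p \<in> {..<N} \<times> {..<N}" for p
  proof (rule complete)
    fix M :: nat
    have "vge (int M) (s i $$ p - s j $$ p)" if ij: "i \<ge> M" "j \<ge> M" for i j
    proof -
      have "mcong N M (s i) (s j)" using mcong_trans[OF cauchy[OF ij(1)] mcong_sym[OF cauchy[OF ij(2)]]] .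
      then show ?thesis using p by (auto simp: mcong_def)
    qed
    then show "\<exists>K. \<forall>i\<ge>K. \<forall>j\<ge>K. vge (int M) (s i $$ p - s j $$ p)" by blast
  qed
  then obtain Lf where Lf: "\<And>p M. p \<in> {..<N} \<times> {..<N} \<Longrightarrow> \<exists>K. \<forall>i\<ge>K. vge (int (M::nat)) (s i $$ p - Lf p)"
    by metis
  \<comment> \<open>The bad points form a Cauchy sequence, and \<open>L\<close> is its entrywise
    limit. It lies in K_N(m) because that group is closed under sufficiently fine
    congruence.\<close>
  define L where "L = mat N N Lf"
  have Lc: "L \<in> carrier_mat N N" by (simp add: L_def)
  have conv: "mcong N j L (s j)" for j
    unfolding mcong_def
  proof (intro allI impI)
    fix i l assume il: "i < N" "l < N"
    obtain K where K: "\<And>r. r \<ge> K \<Longrightarrow> vge (int j) (s r $$ (i,l) - Lf (i,l))"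
      using Lf[of "(i,l)" j] il by auto
    define r where "r = max K j"
    have 1: "vge (int j) (Lf (i,l) - s r $$ (i,l))" using vge_minus[OF K[of r]] by (simp add: r_def)
    have 2: "vge (int j) (s r $$ (i,l) - s j $$ (i,l))" using cauchy[of j r] il by (simp add: mcong_def r_def)
    show "vge (int j) (L $$ (i,l) - s j $$ (i,l))" using vge_add[OF 1 2] il by (simp add: L_def)
  qed
  have LH: "L \<in> ?H" by (rule mcong_Knm[OF s(1)[of m] Lc conv[of m] order_refl m])
  obtain jL where jL: "\<And>y. y \<in> ?H \<Longrightarrow> mcong N jL y L \<Longrightarrow> (Q y \<longleftrightarrow> Q L)" using loc[OF LH] by blast
  \<comment> \<open>Bad points near \<open>L\<close> yield two elements close to \<open>L\<close>
    with different \<open>Q\<close>, against local constancy at \<open>L\<close>.\<close>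
  obtain a b where ab: "a \<in> ?H" "b \<in> ?H" "mcong N jL a (s jL)" "mcong N jL b a" "Q b \<noteq> Q a"
    using s(2)[of jL] unfolding bad_def by blast
  have aL: "mcong N jL a L" using mcong_trans[OF ab(3) mcong_sym[OF conv]] .
  have bL: "mcong N jL b L" using mcong_trans[OF ab(4) aL] .
  show False using jL[OF ab(1) aL] jL[OF ab(2) bL] ab(5) by simp
qed

end

section \<open>Haar measure on K(n)\<close>

context depth_zero
begin

abbreviation H :: "'f mat set" where "H \<equiv> Knm v n n"

text \<open>\<open>A\<close> is a union of residue classes of level \<open>j\<close>. The bound
  \<open>j \<ge> n\<close> guarantees that a matrix congruent to an element of \<open>H\<close>
  again lies in \<open>H\<close>.\<close>

definition unif :: "nat \<Rightarrow> 'f mat set \<Rightarrow> bool" where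
  "unif j A \<longleftrightarrow> j \<ge> n \<and> A \<subseteq> H \<and> (\<forall>a\<in>A. \<forall>b\<in>H. mcong n j b a \<longrightarrow> b \<in> A)"

lemma H_facts: assumes "x \<in> H" shows "x \<in> Kn v n" "x \<in> GLn n" "x \<in> carrier_mat n n" "intg n x"
  using Knm_Kn[OF assms] by (auto simp: Kn_GLn GLn_carrier Kn_intg)

lemma H_closed: "x \<in> H \<Longrightarrow> y \<in> carrier_mat n n \<Longrightarrow> mcong n j y x \<Longrightarrow> j \<ge> n \<Longrightarrow> y \<in> H"
  by (rule mcong_Knm[OF _ _ _ _ n1 n1])

lemma ball_eq:
  assumes a: "a \<in> H" and j: "j \<ge> n"
  shows "(\<lambda>k. a * k) ` Kcong v n j = {b \<in> H. mcong n j b a}"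
proof (intro equalityI subsetI)
  fix b assume b: "b \<in> (\<lambda>k. a * k) ` Kcong v n j"
  then obtain k where k: "k \<in> Kcong v n j" "b = a * k" by blast
  have "b \<in> H" unfolding k(2) using Knm_mult[OF n1 a Kcong_Knm[OF j n1 n1 k(1)]] .
  moreover have "mcong n j b a" using b mcong_Kcong(1)[OF H_facts(1)[OF a] H_facts(1)[OF \<open>b \<in> H\<close>]] by blast
  ultimately show "b \<in> {b \<in> H. mcong n j b a}" by blast
next
  fix b assume "b \<in> {b \<in> H. mcong n j b a}"
  then show "b \<in> (\<lambda>k. a * k) ` Kcong v n j"
    using mcong_Kcong(1)[OF H_facts(1)[OF a] H_facts(1)] by blast
qed

text \<open>Openness of \<open>A\<close> and of its complement says that membership is locally
  constant, and compactness makes the level uniform. Measures can then be computed by counting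
  classes at one finite level.\<close>

lemma compact_open_iff: "compact_open_in v n H A \<longleftrightarrow> (\<exists>j. unif j A)"
proof
  assume "\<exists>j. unif j A"
  then obtain j where j: "j \<ge> n" "A \<subseteq> H" "\<And>a b. a \<in> A \<Longrightarrow> b \<in> H \<Longrightarrow> mcong n j b a \<Longrightarrow> b \<in> A"
    unfolding unif_def by blast
  have j1: "j \<ge> 1" using j n1 by simp
  show "compact_open_in v n H A"
    unfolding compact_open_in_def
  proof (intro conjI ballI)
    show "A \<subseteq> H" by (rule j(2))
    fix a assume a: "a \<in> A"
    have "(\<lambda>k. a * k) ` Kcong v n j \<subseteq> A" unfolding ball_eq[OF subsetD[OF j(2) a] j(1)] using j(3)[OF a] by blast
    then show "\<exists>j\<ge>1. (\<lambda>k. a * k) ` Kcong v n j \<subseteq> A" using j1 by blast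
  next
    fix a assume a: "a \<in> H - A"
    have "(\<lambda>k. a * k) ` Kcong v n j \<subseteq> H - A"
    proof
      fix b assume "b \<in> (\<lambda>k. a * k) ` Kcong v n j"
      then have b: "b \<in> H" "mcong n j b a" using ball_eq[OF _ j(1)] a by auto
      have "b \<notin> A" using j(3)[of b a] a mcong_sym[OF b(2)] by blast
      then show "b \<in> H - A" using b by blast
    qed
    then show "\<exists>j\<ge>1. (\<lambda>k. a * k) ` Kcong v n j \<subseteq> H - A" using j1 by blast
  qed
next
  assume c: "compact_open_in v n H A"
  have AH: "A \<subseteq> H" using c by (simp add: compact_open_in_def)
  have "\<exists>j. \<forall>y\<in>H. mcong n j y x \<longrightarrow> (y \<in> A \<longleftrightarrow> x \<in> A)" if x: "x \<in> H" for x
  proof -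
    have "\<exists>i. (x \<in> A \<longrightarrow> (\<lambda>k. x * k) ` Kcong v n i \<subseteq> A) \<and> (x \<notin> A \<longrightarrow> (\<lambda>k. x * k) ` Kcong v n i \<subseteq> H - A)"
    proof (cases "x \<in> A")
      case True
      then obtain i where "(\<lambda>k. x * k) ` Kcong v n i \<subseteq> A" using c unfolding compact_open_in_def by blast
      then show ?thesis using True by blast
    next
      case False
      then obtain i where "(\<lambda>k. x * k) ` Kcong v n i \<subseteq> H - A" using c x unfolding compact_open_in_def by blast
      then show ?thesis using False by blast
    qed
    then obtain i where i: "(x \<in> A \<longrightarrow> (\<lambda>k. x * k) ` Kcong v n i \<subseteq> A) \<and> (x \<notin> A \<longrightarrow> (\<lambda>k. x * k) ` Kcong v n i \<subseteq> H - A)"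
      by blast
    have "y \<in> A \<longleftrightarrow> x \<in> A" if y: "y \<in> H" "mcong n i y x" for y
    proof -
      have "y \<in> (\<lambda>k. x * k) ` Kcong v n i" using y mcong_Kcong(1)[OF H_facts(1)[OF x] H_facts(1)[OF y(1)]] by blast
      then show ?thesis using i by blast
    qed
    then show ?thesis by blast
  qed
  from uniform_local_constancy[OF n1 n1, where Q = "\<lambda>x. x \<in> A", OF this]
  obtain J where J: "J \<ge> n" "\<forall>x\<in>H. \<forall>y\<in>H. mcong n J y x \<longrightarrow> (y \<in> A \<longleftrightarrow> x \<in> A)" by blast
  have "unif J A" unfolding unif_def using J AH by blast
  then show "\<exists>j. unif j A" by blast
qed

lemma unif_mono: assumes A: "unif j A" and i: "j \<le> i" shows "unif i A"
  unfolding unif_def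
proof (intro conjI ballI impI)
  show "n \<le> i" "A \<subseteq> H" using A i unfolding unif_def by auto
  fix a b assume ab: "a \<in> A" "b \<in> H" "mcong n i b a"
  have "mcong n j b a" by (rule mcong_mono[OF ab(3) i])
  then show "b \<in> A" using A ab unfolding unif_def by blast
qed

definition Nc :: "nat \<Rightarrow> 'f mat set \<Rightarrow> nat" where
  "Nc j A = card (cls n j ` A)"

lemma finite_cls_H: "A \<subseteq> H \<Longrightarrow> finite (cls n j ` A)"
  by (rule finite_subset[OF _ finite_cls[of n j]]) (use H_facts(4) in blast)

lemma cls_H_iff: "x \<in> H \<Longrightarrow> y \<in> H \<Longrightarrow> cls n j x = cls n j y \<longleftrightarrow> mcong n j x y"
  using cls_eq_iff H_facts(4) by blast

text \<open>Each class of level \<open>j\<close> splits into the same number of classes of level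
  \<open>J\<close>: each of the \<open>n * n\<close> entries gains \<open>J - j\<close> free
  digits.\<close>

lemma Nc_scale:
  assumes A: "unif j A" and J: "j \<le> J"
  shows "Nc J A = Nc j A * card (UNIV :: 'k set) ^ (n * n * (J - j))"
proof -
  have j: "j \<ge> n" "A \<subseteq> H" "\<And>a b. a \<in> A \<Longrightarrow> b \<in> H \<Longrightarrow> mcong n j b a \<Longrightarrow> b \<in> A"
    using A unfolding unif_def by blast+
  define fib where "fib u = cls n J ` {b \<in> A. cls n j b = u}" for u
  have fibc: "card (fib u) = card (UNIV :: 'k set) ^ (n * n * (J - j))" if u: "u \<in> cls n j ` A" for u
  proof -
    obtain a where a: "a \<in> A" "u = cls n j a" using u by blast
    have aH: "a \<in> H" using a j by blast
    have "{b \<in> A. cls n j b = u} = box n (\<lambda>_ _. j) a"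
    proof (intro equalityI subsetI)
      fix b assume b: "b \<in> {b \<in> A. cls n j b = u}"
      then have bH: "b \<in> H" using j by blast
      then have "mcong n j b a" using b a cls_H_iff[OF bH aH] by blast
      then show "b \<in> box n (\<lambda>_ _. j) a" using H_facts(3)[OF bH] by (simp add: box_def mcong_def)
    next
      fix b assume "b \<in> box n (\<lambda>_ _. j) a"
      then have b: "b \<in> carrier_mat n n" "mcong n j b a" by (auto simp: box_def mcong_def)
      have bH: "b \<in> H" using H_closed[OF aH b j(1)] .
      then show "b \<in> {b \<in> A. cls n j b = u}" using j(3)[OF a(1) bH b(2)] cls_H_iff[OF bH aH] b(2) a(2) by blast
    qed
    then show ?thesis
      unfolding fib_def using card_cls_box(2)[OF H_facts(4)[OF aH], of "\<lambda>_ _. j" J] J by (simp add: mult.assoc)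
  qed
  have un: "cls n J ` A = (\<Union>u\<in>cls n j ` A. fib u)" unfolding fib_def by blast
  have "Nc J A = (\<Sum>u\<in>cls n j ` A. card (fib u))"
    unfolding Nc_def un
  proof (rule card_UN_disjoint)
    show "finite (cls n j ` A)" by (rule finite_cls_H[OF j(2)])
    show "\<forall>u\<in>cls n j ` A. finite (fib u)"
    proof
      fix u :: "'f mat"
      have "{b \<in> A. cls n j b = u} \<subseteq> H" using j(2) by blast
      then show "finite (fib u)" unfolding fib_def by (rule finite_cls_H)
    qed
    show "\<forall>u\<in>cls n j ` A. \<forall>u'\<in>cls n j ` A. u \<noteq> u' \<longrightarrow> fib u \<inter> fib u' = {}"
    proof (intro ballI impI)
      fix u u' :: "'f mat" assume ne: "u \<noteq> u'"
      show "fib u \<inter> fib u' = {}"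
      proof (rule ccontr)
        assume "fib u \<inter> fib u' \<noteq> {}"
        then obtain b b' where b: "b \<in> A" "cls n j b = u" "b' \<in> A" "cls n j b' = u'" "cls n J b = cls n J b'"
          unfolding fib_def by blast
        have "b \<in> H" "b' \<in> H" using b j by blast+
        then have "cls n j b = cls n j b'" using cls_mono[OF H_facts(4) H_facts(4) J b(5)] by blast
        then show False using b ne by simp
      qed
    qed
  qed
  also have "\<dots> = (\<Sum>u\<in>cls n j ` A. card (UNIV :: 'k set) ^ (n * n * (J - j)))" using fibc by (intro sum.cong) auto
  finally show ?thesis by (simp add: Nc_def)
qed

lemma card_residue_field_neq_0: "of_nat (card (UNIV :: 'k set)) \<noteq> (0 :: 'r)"
  using of_nat_card_neq_0[OF char_neq] .

text \<open>The restriction to \<open>K\<^sub>n(n)\<close> of the additive Haar measure of the matrix ring; it is invariant because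
  multiplication by an element of \<open>K\<^sub>n\<close> permutes the residue classes. It takes values in \<open>R\<close> because
  only powers of \<open>q\<close> are inverted.\<close>

definition mu0 :: "'f mat set \<Rightarrow> 'r" where
  "mu0 A = (if \<exists>j. unif j A then of_nat (Nc (SOME j. unif j A) A) / (of_nat (card (UNIV :: 'k set)) :: 'r) ^ (n * n * (SOME j. unif j A)) else 0)"

text \<open>The growth of the number of classes is matched by the power of q in the denominator, so
  any admissible level computes the same value; two levels are compared through their
  maximum.\<close>

lemma mu0_eq:
  assumes j: "unif j A" shows "mu0 A = of_nat (Nc j A) / (of_nat (card (UNIV :: 'k set)) :: 'r) ^ (n * n * j)"
proof -
  have norm: "of_nat (Nc i A) / (of_nat (card (UNIV :: 'k set)) :: 'r) ^ (n * n * i) = of_nat (Nc J A) / (of_nat (card (UNIV :: 'k set)) :: 'r) ^ (n * n * J)" if i: "unif i A" "i \<le> J" for i J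
  proof -
    have "n * n * J = n * n * i + n * n * (J - i)" using i(2) by (simp add: distrib_left[symmetric])
    then have "(of_nat (card (UNIV :: 'k set)) :: 'r) ^ (n * n * J) = (of_nat (card (UNIV :: 'k set)) :: 'r) ^ (n * n * i) * (of_nat (card (UNIV :: 'k set)) :: 'r) ^ (n * n * (J - i))" by (metis power_add)
    moreover have "of_nat (Nc J A) = of_nat (Nc i A) * (of_nat (card (UNIV :: 'k set)) :: 'r) ^ (n * n * (J - i))" unfolding Nc_scale[OF i] by simp
    ultimately show ?thesis using card_residue_field_neq_0 by simp
  qed
  define i where "i = (SOME j. unif j A)"
  have i: "unif i A" unfolding i_def using j by (rule someI)
  have "mu0 A = of_nat (Nc i A) / (of_nat (card (UNIV :: 'k set)) :: 'r) ^ (n * n * i)" unfolding mu0_def i_def using j by auto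
  also have "\<dots> = of_nat (Nc (max i j) A) / (of_nat (card (UNIV :: 'k set)) :: 'r) ^ (n * n * max i j)" by (rule norm[OF i]) simp
  also have "\<dots> = of_nat (Nc j A) / (of_nat (card (UNIV :: 'k set)) :: 'r) ^ (n * n * j)" by (rule norm[OF j, symmetric]) simp
  finally show ?thesis .
qed

lemma unif_Un:
  assumes A: "unif j A" and D: "unif j D" shows "unif j (A \<union> D)"
  using A D unfolding unif_def by blast

lemma Nc_Un:
  assumes A: "unif j A" and D: "unif j D" and d: "A \<inter> D = {}"
  shows "Nc j (A \<union> D) = Nc j A + Nc j D"
proof -
  have AH: "A \<subseteq> H" "D \<subseteq> H" using A D unfolding unif_def by blast+
  have "cls n j ` A \<inter> cls n j ` D = {}"
  proof (rule ccontr)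
    assume "cls n j ` A \<inter> cls n j ` D \<noteq> {}"
    then obtain u where "u \<in> cls n j ` A" "u \<in> cls n j ` D" by blast
    then obtain a b where ab: "a \<in> A" "b \<in> D" "cls n j b = cls n j a" by auto
    have H: "a \<in> H" "b \<in> H" using ab AH by blast+
    have "mcong n j b a" using ab(3) cls_H_iff[OF H(2,1)] by blast
    then have "b \<in> A" using A ab(1) H(2) unfolding unif_def by blast
    then show False using ab d by blast
  qed
  then show ?thesis unfolding Nc_def image_Un using finite_cls_H AH by (simp add: card_Un_disjoint)
qed

lemma H_translate:
  assumes h: "h \<in> H" and A: "unif j A" shows "unif j ((\<lambda>k. h * k) ` A)" "Nc j ((\<lambda>k. h * k) ` A) = Nc j A"
proof -
  have AH: "A \<subseteq> H" and jn: "j \<ge> n" and cl: "\<And>a b. a \<in> A \<Longrightarrow> b \<in> H \<Longrightarrow> mcong n j b a \<Longrightarrow> b \<in> A"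
    using A unfolding unif_def by blast+
  have hi: "ginv h \<in> H" using Knm_ginv[OF n1 h] .
  have iff: "mcong n j (h * x) (h * y) \<longleftrightarrow> mcong n j x y" if xy: "x \<in> H" "y \<in> H" for x y
  proof
    assume "mcong n j x y"
    then show "mcong n j (h * x) (h * y)" using mcong_mult_left[OF H_facts(4)[OF h] H_facts(3)[OF xy(1)] H_facts(3)[OF xy(2)]] by blast
  next
    assume c: "mcong n j (h * x) (h * y)"
    have "mcong n j (ginv h * (h * x)) (ginv h * (h * y))"
      using mcong_mult_left[OF H_facts(4)[OF hi] _ _ c] H_facts(3)[OF Knm_mult[OF n1 h xy(1)]] H_facts(3)[OF Knm_mult[OF n1 h xy(2)]] by blast
    then show "mcong n j x y"
      using ginv_cancel(2)[OF H_facts(2)[OF h] H_facts(2)[OF xy(1)]] ginv_cancel(2)[OF H_facts(2)[OF h] H_facts(2)[OF xy(2)]] by simp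
  qed
  show "unif j ((\<lambda>k. h * k) ` A)"
    unfolding unif_def
  proof (intro conjI ballI impI jn)
    show "(\<lambda>k. h * k) ` A \<subseteq> H" using Knm_mult[OF n1 h] AH by blast
    fix x b assume x: "x \<in> (\<lambda>k. h * k) ` A" and b: "b \<in> H" and c: "mcong n j b x"
    obtain a where a: "a \<in> A" "x = h * a" using x by blast
    have b': "ginv h * b \<in> H" using Knm_mult[OF n1 hi b] .
    have hb: "h * (ginv h * b) = b" using ginv_cancel(1)[OF H_facts(2)[OF h] H_facts(2)[OF b]] .
    have aH: "a \<in> H" using a AH by blast
    have "mcong n j (h * (ginv h * b)) (h * a)" using c hb a by simp
    then have "mcong n j (ginv h * b) a" using iff[OF b' aH] by blast
    then have "ginv h * b \<in> A" using cl[OF a(1) b'] by blast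
    then show "b \<in> (\<lambda>k. h * k) ` A" using hb by (metis imageI)
  qed
  have "cls n j (h * x) = cls n j (h * y) \<longleftrightarrow> cls n j x = cls n j y" if xy: "x \<in> A" "y \<in> A" for x y
  proof -
    have H: "x \<in> H" "y \<in> H" using xy AH by blast+
    show ?thesis using cls_H_iff[OF H] cls_H_iff[OF Knm_mult[OF n1 h H(1)] Knm_mult[OF n1 h H(2)]] iff[OF H] by blast
  qed
  then have "card ((\<lambda>x. cls n j (h * x)) ` A) = card (cls n j ` A)" by (rule card_image_eq_card_image(1))
  then show "Nc j ((\<lambda>k. h * k) ` A) = Nc j A" unfolding Nc_def image_image .
qed

text \<open>\<open>H'\<close> is the set of \<open>k\<close> in \<open>K\<^sub>n(n)\<close> for which \<open>\<Sigma> k \<Sigma>\<^sup>-\<^sup>1\<close> is integral and reduces to the identity; its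
  measure is a power of \<open>q\<close>, whereas the measure of \<open>K\<^sub>n(n)\<close> itself may vanish in \<open>R\<close>.\<close>

definition eH :: "nat \<Rightarrow> nat \<Rightarrow> nat" where
  "eH i l = (if i = n - 1 then n else if i < l then 0 else i - l + 1)"

definition H' :: "'f mat set" where "H' = box n eH (1\<^sub>m n)"

lemma eH_le: "i < n \<Longrightarrow> l < n \<Longrightarrow> eH i l \<le> n"
  by (auto simp: eH_def)

text \<open>The prescribed congruences make the reduction upper unitriangular, which gives
  invertibility, and the level \<open>n\<close> in the last row is the defining condition of
  K(n).\<close>

lemma H'_H: "H' \<subseteq> H"
proof
  fix k assume "k \<in> H'"
  then have k: "k \<in> carrier_mat n n" and e: "\<And>i l. i < n \<Longrightarrow> l < n \<Longrightarrow> vge (int (eH i l)) (k $$ (i,l) - 1\<^sub>m n $$ (i,l))"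
    by (auto simp: H'_def box_def)
  have k0: "vge 0 (k $$ (i,l))" if il: "i < n" "l < n" for i l
  proof -
    have "vge 0 (k $$ (i,l) - 1\<^sub>m n $$ (i,l))" by (rule vge_mono[OF e[OF il]]) simp
    moreover have "vge 0 ((1\<^sub>m n :: 'f mat) $$ (i,l))" using il by simp
    ultimately have "vge 0 ((k $$ (i,l) - 1\<^sub>m n $$ (i,l)) + 1\<^sub>m n $$ (i,l))" by (rule vge_add)
    then show ?thesis by simp
  qed
  have r: "red (k $$ (i,l)) = (if i = l then 1 else 0)" if il: "i < n" "l < n" "l \<le> i" for i l
  proof -
    have "1 \<le> eH i l" using il n1 by (simp add: eH_def)
    then have "vge 1 (k $$ (i,l) - 1\<^sub>m n $$ (i,l))" by (intro vge_mono[OF e[OF il(1,2)]]) simp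
    moreover have "vge 0 ((1\<^sub>m n :: 'f mat) $$ (i,l))" using il by simp
    ultimately have "red (k $$ (i,l)) = red ((1\<^sub>m n :: 'f mat) $$ (i,l))" using red_eq_iff[OF k0[OF il(1,2)]] by blast
    then show ?thesis using il by (simp add: red_0 red_1)
  qed
  have "kbar red n k \<in> Uk n" unfolding Uk_def using r by (auto simp: kbar_entry)
  then have "det (kbar red n k) \<noteq> 0" using Uk_GLn by (auto simp: GLn_def)
  then have K: "k \<in> Kn v n" using k k0 by (simp add: Kn_iff intg_def)
  have "vge (int n) (k $$ (n-1,l) - (if l = n - 1 then 1 else 0))" if l: "l < n" for l
  proof -
    have l': "n - 1 < n" using n1 by simp
    have "vge (int n) (k $$ (n-1,l) - 1\<^sub>m n $$ (n-1,l))" using e[OF l' l] by (simp add: eH_def)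
    then show ?thesis using l l' by (cases "l = n - 1") auto
  qed
  then show "k \<in> H" using K unfolding Knm_iff[OF n1 n1] lastrow_def by blast
qed

lemma unif_H': "unif n H'"
  unfolding unif_def
proof (intro conjI ballI impI order_refl H'_H)
  fix a b assume a: "a \<in> H'" and b: "b \<in> H" and c: "mcong n n b a"
  show "b \<in> H'"
    unfolding H'_def box_def
  proof (intro CollectI conjI allI impI H_facts(3)[OF b])
    fix i l assume il: "i < n" "l < n"
    have 1: "vge (int (eH i l)) (a $$ (i,l) - 1\<^sub>m n $$ (i,l))" using a il unfolding H'_def box_def by blast
    have "vge (int n) (b $$ (i,l) - a $$ (i,l))" using c il unfolding mcong_def by blast
    then have 2: "vge (int (eH i l)) (b $$ (i,l) - a $$ (i,l))" by (rule vge_mono) (use eH_le[OF il] in simp)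
    show "vge (int (eH i l)) (b $$ (i,l) - 1\<^sub>m n $$ (i,l))" using vge_add[OF 2 1] by simp
  qed
qed

lemma mu0_H': "mu0 H' \<noteq> 0"
proof -
  have "Nc n H' = card (UNIV :: 'k set) ^ (\<Sum>i<n. \<Sum>l<n. n - eH i l)"
    unfolding Nc_def H'_def by (rule card_cls_box(2)[OF intg_one eH_le])
  then have "of_nat (Nc n H') \<noteq> (0::'r)" using card_residue_field_neq_0 by simp
  then show ?thesis unfolding mu0_eq[OF unif_H'] using card_residue_field_neq_0 by simp
qed

lemma haar_mu0: assumes c: "c \<noteq> 0" shows "haar_measure v n H (\<lambda>A. c * mu0 A)"
  unfolding haar_measure_def compact_open_iff
proof (intro conjI allI impI ballI)
  show "c * mu0 A = 0" if "\<not> (\<exists>j. unif j A)" for A using that by (simp add: mu0_def)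
  show "\<exists>A. c * mu0 A \<noteq> 0" using c mu0_H' by (intro exI[of _ H']) simp
next
  fix A D assume A: "\<exists>j. unif j A" and D: "\<exists>j. unif j D" and d: "A \<inter> D = {}"
  obtain i j where ij: "unif i A" "unif j D" using A D by blast
  have u: "unif (max i j) A" "unif (max i j) D" using unif_mono[OF ij(1)] unif_mono[OF ij(2)] by auto
  show "c * mu0 (A \<union> D) = c * mu0 A + c * mu0 D"
    unfolding mu0_eq[OF u(1)] mu0_eq[OF u(2)] mu0_eq[OF unif_Un[OF u]] Nc_Un[OF u d]
    by (simp add: add_divide_distrib distrib_left)
next
  fix h A assume h: "h \<in> H" and "\<exists>j. unif j A"
  then obtain j where j: "unif j A" by blast
  show "c * mu0 ((\<lambda>k. h * k) ` A) = c * mu0 A"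
    unfolding mu0_eq[OF j] mu0_eq[OF H_translate(1)[OF h j]] H_translate(2)[OF h j] ..
qed

lemma haar_additive:
  assumes mu: "haar_measure v n H mu" and fin: "finite I"
    and co: "\<And>i. i \<in> I \<Longrightarrow> compact_open_in v n H (A i)"
    and d: "\<And>i i'. i \<in> I \<Longrightarrow> i' \<in> I \<Longrightarrow> i \<noteq> i' \<Longrightarrow> A i \<inter> A i' = {}"
  shows "compact_open_in v n H (\<Union>i\<in>I. A i) \<and> mu (\<Union>i\<in>I. A i) = (\<Sum>i\<in>I. mu (A i))"
  using fin co d
proof (induction I)
  case empty
  have co0: "compact_open_in v n H {}" unfolding compact_open_iff unif_def by blast
  then have "mu ({} \<union> {}) = mu {} + mu {}" using mu unfolding haar_measure_def by blast
  then have "mu {} = mu {} + mu {}" by simp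
  then have "mu {} = 0" by (rule add_cancel_right_right[THEN iffD1])
  then show ?case using co0 by simp
next
  case (insert i I)
  have IH: "compact_open_in v n H (\<Union>i\<in>I. A i)" "mu (\<Union>i\<in>I. A i) = (\<Sum>i\<in>I. mu (A i))"
    using insert.IH insert.prems by blast+
  have ci: "compact_open_in v n H (A i)" using insert.prems(1) by blast
  have dj: "A i \<inter> (\<Union>i\<in>I. A i) = {}" using insert.prems(2)[of i] insert.hyps by blast
  obtain a b where ab: "unif a (A i)" "unif b (\<Union>i\<in>I. A i)" using IH(1) ci unfolding compact_open_iff by blast
  have "unif (max a b) (A i)" "unif (max a b) (\<Union>i\<in>I. A i)" using unif_mono[OF ab(1)] unif_mono[OF ab(2)] by auto
  then have "compact_open_in v n H (A i \<union> (\<Union>i\<in>I. A i))" unfolding compact_open_iff using unif_Un by blast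
  moreover have "mu (A i \<union> (\<Union>i\<in>I. A i)) = mu (A i) + mu (\<Union>i\<in>I. A i)"
    using mu IH(1) ci dj unfolding haar_measure_def by blast
  ultimately show ?case using insert.hyps IH(2) by simp
qed

lemma Kcong_unif: assumes j: "j \<ge> n" shows "unif j (Kcong v n j)"
proof -
  have oneH: "1\<^sub>m n \<in> H" using Knm_one[OF n1] .
  have "(\<lambda>k. 1\<^sub>m n * k) ` Kcong v n j = Kcong v n j"
  proof -
    have "(\<lambda>k. 1\<^sub>m n * k) ` Kcong v n j = (\<lambda>k. k) ` Kcong v n j"
      by (rule image_cong) (auto simp: Kcong_iff Kn_GLn GLn_one_mult)
    then show ?thesis by simp
  qed
  then have eq: "Kcong v n j = {b \<in> H. mcong n j b (1\<^sub>m n)}" using ball_eq[OF oneH j] by simp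
  show ?thesis unfolding unif_def eq
  proof (intro conjI ballI impI j)
    fix a b assume ab: "a \<in> {b \<in> H. mcong n j b (1\<^sub>m n)}" "b \<in> H" "mcong n j b a"
    have "mcong n j b (1\<^sub>m n)" by (rule mcong_trans[OF ab(3)]) (use ab(1) in blast)
    then show "b \<in> {b \<in> H. mcong n j b (1\<^sub>m n)}" using ab(2) by blast
  qed blast
qed

text \<open>A set of level \<open>j\<close> is a disjoint union of left translates of the congruence
  subgroup of level \<open>j\<close>, so invariance and additivity leave the volume of that subgroup
  as the only unknown.\<close>

lemma haar_value:
  assumes mu: "haar_measure v n H mu" and j: "unif j A"
  shows "mu A = of_nat (Nc j A) * mu (Kcong v n j)"
proof -
  have jn: "j \<ge> n" and AH: "A \<subseteq> H" and cl: "\<And>a b. a \<in> A \<Longrightarrow> b \<in> H \<Longrightarrow> mcong n j b a \<Longrightarrow> b \<in> A"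
    using j unfolding unif_def by blast+
  define C where "C u = {b \<in> A. cls n j b = u}" for u
  have Cu: "C (cls n j a) = (\<lambda>k. a * k) ` Kcong v n j" if a: "a \<in> A" for a
  proof -
    have aH: "a \<in> H" using a AH by blast
    show ?thesis unfolding C_def ball_eq[OF aH jn]
    proof (intro equalityI subsetI)
      fix b assume b: "b \<in> {b \<in> A. cls n j b = cls n j a}"
      then have bH: "b \<in> H" using AH by blast
      then show "b \<in> {b \<in> H. mcong n j b a}" using b cls_H_iff[OF bH aH] by blast
    next
      fix b assume b: "b \<in> {b \<in> H. mcong n j b a}"
      then have bH: "b \<in> H" by blast
      then show "b \<in> {b \<in> A. cls n j b = cls n j a}" using b cls_H_iff[OF bH aH] cl[OF a bH] by blast
    qed
  qed
  have tr: "mu ((\<lambda>k. a * k) ` Kcong v n j) = mu (Kcong v n j)" "compact_open_in v n H ((\<lambda>k. a * k) ` Kcong v n j)"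
    if a: "a \<in> A" for a
  proof -
    have aH: "a \<in> H" using a AH by blast
    have "compact_open_in v n H (Kcong v n j)" unfolding compact_open_iff using Kcong_unif[OF jn] by blast
    then show "mu ((\<lambda>k. a * k) ` Kcong v n j) = mu (Kcong v n j)" using mu aH unfolding haar_measure_def by blast
    show "compact_open_in v n H ((\<lambda>k. a * k) ` Kcong v n j)"
      unfolding compact_open_iff using H_translate(1)[OF aH Kcong_unif[OF jn]] by blast
  qed
  have un: "A = (\<Union>u\<in>cls n j ` A. C u)" unfolding C_def by blast
  have "mu (\<Union>u\<in>cls n j ` A. C u) = (\<Sum>u\<in>cls n j ` A. mu (C u))"
  proof (rule conjunct2[OF haar_additive[OF mu finite_cls_H[OF AH]]])
    show "compact_open_in v n H (C u)" if "u \<in> cls n j ` A" for u using that Cu tr(2) by auto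
    show "C u \<inter> C u' = {}" if "u \<noteq> u'" for u u' using that unfolding C_def by blast
  qed
  also have "\<dots> = (\<Sum>u\<in>cls n j ` A. mu (Kcong v n j))" by (rule sum.cong) (use Cu tr(1) in auto)
  finally show ?thesis unfolding un[symmetric] by (simp add: Nc_def)
qed

text \<open>The value 1 on \<open>H'\<close> exhibits its number of classes as invertible in R, so
  the volume of each congruence subgroup of level at least n is determined.\<close>

theorem haar_unique:
  assumes mu: "haar_measure v n H mu" "mu H' = 1" and nu: "haar_measure v n H nu" "nu H' = 1"
  shows "mu = nu"
proof
  fix A
  show "mu A = nu A"
  proof (cases "\<exists>j. unif j A")
    case False
    then show ?thesis using mu(1) nu(1) unfolding haar_measure_def compact_open_iff by metis
  next
    case True
    then obtain j where j: "unif j A" by blast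
    then have jn: "n \<le> j" unfolding unif_def by blast
    have u: "unif j H'" by (rule unif_mono[OF unif_H' jn])
    have "of_nat (Nc j H') * mu (Kcong v n j) = of_nat (Nc j H') * nu (Kcong v n j)"
      "of_nat (Nc j H') * mu (Kcong v n j) = 1"
      using haar_value[OF mu(1) u] haar_value[OF nu(1) u] mu(2) nu(2) by auto
    then have "mu (Kcong v n j) = nu (Kcong v n j)" by (metis mult_cancel_left mult_zero_left zero_neq_one)
    then show ?thesis using haar_value[OF mu(1) j] haar_value[OF nu(1) j] by simp
  qed
qed

lemma haar_exists: "\<exists>mu :: 'f mat set \<Rightarrow> 'r. haar_measure v n H mu \<and> mu H' = 1"
  using haar_mu0[of "inverse (mu0 H')"] mu0_H' by (intro exI[of _ "\<lambda>A. inverse (mu0 H') * mu0 A"]) simp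

section \<open>The Bessel vector and its integral\<close>

text \<open>Two factorisations differ by a scalar \<open>u\<close> in K. Comparing determinants
  shows that \<open>u\<close> is a unit, and then compatibility of the central characters gives
  equal values. This makes the choice in the Bessel vector harmless.\<close>

lemma zk_unique:
  assumes z: "z \<noteq> 0" "z' \<noteq> 0" and k: "k \<in> Kn v n" "k' \<in> Kn v n" and eq: "scal n z * k = scal n z' * k'"
  shows "(\<lambda>y. om z * rt n (kbar red n k) B y) = (\<lambda>y. om z' * rt n (kbar red n k') B y)"
proof -
  define u where "u = z / z'"
  have u0: "u \<noteq> 0" using z by (simp add: u_def)
  have iz: "inverse z' \<noteq> 0" using z by simp
  note G = Kn_GLn[OF k(1)] Kn_GLn[OF k(2)] scal_GLn[OF z(1), of n] scal_GLn[OF z(2), of n] scal_GLn[OF iz, of n]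
  have "k' = scal n (inverse z') * (scal n z' * k')"
    using G z by (simp add: GLn_assoc[where n = n, symmetric] scal_mult scal_one GLn_carrier)
  also have "\<dots> = scal n (inverse z') * (scal n z * k)" by (simp only: eq)
  also have "\<dots> = scal n u * k"
    using G by (simp add: GLn_assoc[where n = n, symmetric] scal_mult u_def divide_inverse mult.commute)
  finally have k': "k' = scal n u * k" .
  have "det k' = u ^ n * det k"
    unfolding k' using det_mult[of "scal n u" n k] G(1) by (simp add: GLn_carrier scal_def)
  moreover have "isUnit v (det k)" "isUnit v (det k')" using k by (auto simp: Kn_def)
  moreover have "v (u ^ i) = int i * v u" for i by (induction i) (auto simp: v_1 v_mult u0 algebra_simps)
  ultimately have "int n * v u = 0" using v_mult[of "u ^ n" "det k"] u0 by (auto simp: isUnit_def)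
  then have uu: "isUnit v u" using u0 n1 by (simp add: isUnit_def)
  have "kbar red n k' = scal n (red u) * kbar red n k"
    unfolding k' using scal_Kn[OF uu] k(1) by (simp add: kbar_mult Kn_intg)
  then have "rt n (kbar red n k') B = rt n (scal n (red u)) (rt n (kbar red n k) B)"
    using kbar_GLn[OF k(1)] uu by (simp add: rt_rt scal_GLn isUnit_iff)
  also have "\<dots> = (\<lambda>y. om u * rt n (kbar red n k) B y)"
    using om_unit[OF uu Wt_rt[OF kbar_GLn[OF k(1)] bessel(1)]] .
  finally have "rt n (kbar red n k') B = (\<lambda>y. om u * rt n (kbar red n k) B y)" .
  moreover have "om z = om z' * om u" using om_mult[OF z(2) u0] z by (simp add: u_def)
  ultimately show ?thesis by (simp add: mult.assoc)
qed

abbreviation BV :: "'f mat \<Rightarrow> 'k mat \<Rightarrow> 'r" where "BV \<equiv> bessel_vector v red n om psi Wt"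

lemma BV_eq:
  assumes z: "z \<noteq> 0" and k: "k \<in> Kn v n"
  shows "BV (scal n z * k) = (\<lambda>y. om z * rt n (kbar red n k) B y)"
proof -
  let ?P = "\<lambda>W. \<exists>z' k'. z' \<noteq> 0 \<and> k' \<in> Kn v n \<and> scal n z * k = scal n z' * k' \<and>
              W = (\<lambda>y. om z' * rt n (kbar red n k') B y)"
  have "?P (\<lambda>y. om z * rt n (kbar red n k) B y)" using z k by blast
  then have s: "?P (SOME W. ?P W)" by (rule someI[of ?P])
  have ex: "\<exists>z' k'. z' \<noteq> 0 \<and> k' \<in> Kn v n \<and> scal n z * k = scal n z' * k'" using z k by blast
  have "BV (scal n z * k) = (SOME W. ?P W)" unfolding bessel_vector_def if_P[OF ex] ..
  moreover from s obtain z' k' where r: "z' \<noteq> 0" "k' \<in> Kn v n" "scal n z * k = scal n z' * k'"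
    "(SOME W. ?P W) = (\<lambda>y. om z' * rt n (kbar red n k') B y)" by (elim exE conjE)
  ultimately show ?thesis using zk_unique[OF z r(1) k r(2,3)] by simp
qed

lemma BV_zero: "\<not> (\<exists>z k. z \<noteq> 0 \<and> k \<in> Kn v n \<and> g = scal n z * k) \<Longrightarrow> BV g = 0"
  unfolding bessel_vector_def by (rule if_not_P)

lemma Sigma_inverse: "SigmaInv w n = ginv (Sigma w n)" "Sigma w n \<in> GLn n"
proof -
  show S: "Sigma w n \<in> GLn n" using nf_GLn[of n a0 "\<lambda>_. 0"] by (simp add: a0(2))
  have Ic: "SigmaInv w n \<in> carrier_mat n n" by (simp add: SigmaInv_def)
  have "Sigma w n * SigmaInv w n = 1\<^sub>m n"
  proof (rule eq_matI)
    fix i j assume "i < dim_row (1\<^sub>m n :: 'f mat)" "j < dim_col (1\<^sub>m n :: 'f mat)"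
    then have ij: "i < n" "j < n" by auto
    have "(Sigma w n * SigmaInv w n) $$ (i,j) = (\<Sum>k<n. Sigma w n $$ (i,k) * SigmaInv w n $$ (k,j))"
      using GLn_carrier[OF S] Ic ij by (rule mat_mult_entry)
    also have "\<dots> = (\<Sum>k<n. if k = i then (if i = j then 1 else 0) else 0)"
      using ij w0 by (intro sum.cong) (auto simp: Sigma_def SigmaInv_def power_mult_distrib[symmetric])
    finally show "(Sigma w n * SigmaInv w n) $$ (i,j) = 1\<^sub>m n $$ (i,j)" using ij by simp
  qed (auto simp: Sigma_def SigmaInv_def)
  moreover have "SigmaInv w n \<in> GLn n"
    using GLn_I_left[OF Ic GLn_carrier[OF S] calculation] .
  ultimately show "SigmaInv w n = ginv (Sigma w n)"
    using ginv_cancel(2)[OF S, of "SigmaInv w n"] ginv(3)[OF S] by (simp add: GLn_one_mult)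
qed

definition St :: "'f mat \<Rightarrow> 'f mat" where "St k = Sigma w n * k * SigmaInv w n"

lemma St_GLn: "k \<in> GLn n \<Longrightarrow> St k \<in> GLn n"
  unfolding St_def Sigma_inverse(1) using Sigma_inverse(2) ginv(3)[OF Sigma_inverse(2)] by (intro GLn_mult)

lemma St_mult: "k \<in> GLn n \<Longrightarrow> St k * Sigma w n = Sigma w n * k"
  unfolding St_def Sigma_inverse(1) using Sigma_inverse(2) by (simp add: ginv_cancel[where n = n] GLn_mult)

lemma St_hom: "k \<in> GLn n \<Longrightarrow> l \<in> GLn n \<Longrightarrow> St (k * l) = St k * St l"
  unfolding St_def Sigma_inverse(1) using Sigma_inverse(2) ginv(3)[OF Sigma_inverse(2)]
  by (simp add: GLn_assoc[where n = n] GLn_mult ginv_cancel[where n = n])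

lemma St_unique: "k \<in> GLn n \<Longrightarrow> A \<in> GLn n \<Longrightarrow> A * Sigma w n = Sigma w n * k \<Longrightarrow> St k = A"
  unfolding St_def Sigma_inverse(1) using ginv_cancel(3)[OF Sigma_inverse(2)] by metis

lemma ax_a0: "i < n \<Longrightarrow> ax n a0 i = int (n - 1) - int i"
  by (auto simp: ax_def a0_def of_nat_diff)

lemma St_entry:
  assumes k: "k \<in> GLn n" and ij: "i < n" "j < n"
  shows "St k $$ (i,j) = w powi (int j - int i) * k $$ (i,j)"
proof -
  have "St k $$ (i,j) * w powi ax n a0 j = w powi ax n a0 i * k $$ (i,j)"
    using diag_right[OF GLn_carrier[OF St_GLn[OF k]] ij, of a0] diag_left[OF GLn_carrier[OF k] ij, of a0]
      St_mult[OF k] by (simp add: a0(2))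
  then have "St k $$ (i,j) = w powi (ax n a0 i - ax n a0 j) * k $$ (i,j)"
    using w0 by (simp add: powi_diff field_simps)
  then show ?thesis using ij by (simp add: ax_a0)
qed

text \<open>The entry \<open>(i,l)\<close> of \<open>St k\<close> is that of \<open>k\<close> scaled
  by the exponent \<open>l - i\<close>. The levels \<open>eH\<close> are those that place
  \<open>St k - 1\<close> in the maximal ideal, raised in the last row to the level \<open>n\<close>
  that membership in K(n) supplies.\<close>

lemma H'_iff:
  assumes k: "k \<in> H" shows "k \<in> H' \<longleftrightarrow> St k \<in> Kn v n \<and> kbar red n (St k) = 1\<^sub>m n"
proof
  note kG = H_facts(2)[OF k]
  assume "k \<in> H'"
  then have e: "vge (int (eH i l)) (k $$ (i,l) - 1\<^sub>m n $$ (i,l))" if "i < n" "l < n" for i l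
    using that unfolding H'_def box_def by blast
  have 1: "vge 1 (St k $$ (i,l) - 1\<^sub>m n $$ (i,l))" if il: "i < n" "l < n" for i l
  proof (cases "i = l")
    case True
    have "1 \<le> eH i l" using True n1 by (simp add: eH_def)
    then have "vge 1 (k $$ (i,l) - 1\<^sub>m n $$ (i,l))" by (intro vge_mono[OF e[OF il]]) simp
    then show ?thesis using True St_entry[OF kG il] by simp
  next
    case False
    have "1 - (int l - int i) \<le> int (eH i l)" using False il by (auto simp: eH_def)
    then have "vge (1 - (int l - int i)) (k $$ (i,l) - 1\<^sub>m n $$ (i,l))" by (rule vge_mono[OF e[OF il]])
    then have "vge (1 - (int l - int i)) (k $$ (i,l))" using False il by simp
    then have "vge 1 (St k $$ (i,l))" unfolding St_entry[OF kG il] vge_powi_mult .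
    then show ?thesis using False il by simp
  qed
  have "mcong n 1 (St k) (1\<^sub>m n)" unfolding mcong_def using 1 by simp
  from mcong_Kn[OF Kn_one GLn_carrier[OF St_GLn[OF kG]] this order_refl]
  show "St k \<in> Kn v n \<and> kbar red n (St k) = 1\<^sub>m n" by (simp add: kbar_one)
next
  note kG = H_facts(2)[OF k]
  assume a: "St k \<in> Kn v n \<and> kbar red n (St k) = 1\<^sub>m n"
  have 1: "vge 1 (St k $$ (i,l) - 1\<^sub>m n $$ (i,l))" if il: "i < n" "l < n" for i l
  proof -
    have "kbar red n (St k) $$ (i,l) = 1\<^sub>m n $$ (i,l)" using a by simp
    then have "red (St k $$ (i,l)) = red ((1\<^sub>m n :: 'f mat) $$ (i,l))" using il by (simp add: kbar_entry red_0 red_1)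
    moreover have "vge 0 (St k $$ (i,l))" "vge 0 ((1\<^sub>m n :: 'f mat) $$ (i,l))" using a il Kn_entry by auto
    ultimately show ?thesis using red_eq_iff by blast
  qed
  show "k \<in> H'"
    unfolding H'_def box_def
  proof (intro CollectI conjI allI impI H_facts(3)[OF k])
    fix i l assume il: "i < n" "l < n"
    show "vge (int (eH i l)) (k $$ (i,l) - 1\<^sub>m n $$ (i,l))"
    proof (cases "i = n - 1")
      case True
      have "vge (int n) (k $$ (n-1,l) - (if l = n - 1 then 1 else 0))"
        using k il unfolding Knm_iff[OF n1 n1] lastrow_def by blast
      then show ?thesis using True il by (cases "l = n - 1") (auto simp: eH_def)
    next
      case False
      show ?thesis
      proof (cases i l rule: linorder_cases)
        case less
        then show ?thesis using False il Kn_entry[OF H_facts(1)[OF k] il] by (simp add: eH_def)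
      next
        case equal
        then show ?thesis using False il 1[OF il] St_entry[OF kG il] by (simp add: eH_def)
      next
        case greater
        then have "vge 1 (St k $$ (i,l))" using 1[OF il] il by simp
        then have "vge (1 - (int l - int i)) (k $$ (i,l))" unfolding St_entry[OF kG il] vge_powi_mult .
        moreover have "int (eH i l) = 1 - (int l - int i)" using greater False by (simp add: eH_def)
        ultimately show ?thesis using greater il by simp
      qed
    qed
  qed
qed

text \<open>The entrywise lift of \<open>b\<close> is conjugated into K(n) by Sigma, whose exponents
  decrease. So the stabiliser of the coset of Sigma reduces onto all of B^op.\<close>

lemma Bop_lift:
  assumes b: "b \<in> Bop n"
  shows "\<exists>l\<in>H. St l \<in> Kn v n \<and> kbar red n (St l) = b"
proof -
  have bG: "b \<in> GLn n" using b n1 by (rule Bop_GLn)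
  define A where "A = mat n n (\<lambda>(i,j). lift (b $$ (i,j)))"
  note A = lift_Kn[OF bG, folded A_def]
  have last: "A $$ (n-1,j) = (if j = n - 1 then 1 else 0)" if "j < n" for j
    using that b n1 A(3)[of "n-1" j] by (cases "j = n - 1") (auto simp: Bop_def lift)
  have "\<exists>k'\<in>Knm v n n. A * tt a0 = tt a0 * k'"
  proof (rule diag_conj[OF A(1) n1])
    fix i j assume ij: "i < n" "j < n"
    show "vge (ax n a0 i - ax n a0 j) (A $$ (i,j))"
    proof (cases "i < j")
      case True
      then show ?thesis using ij b A(3)[of i j] by (auto simp: Bop_def lift)
    next
      case False
      then show ?thesis using ij by (intro vge_mono[OF Kn_entry[OF A(1) ij]]) (simp add: ax_a0)
    qed
  next
    fix j assume "j < n"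
    then show "vge (int n) (w powi ax n a0 j * A $$ (n-1,j) - (if j = n - 1 then 1 else 0))"
      using last by (auto simp: ax_def)
  qed
  then obtain l where l: "l \<in> H" "A * Sigma w n = Sigma w n * l" by (auto simp: a0(2))
  have "St l = A" using St_unique[OF H_facts(2)[OF l(1)] Kn_GLn[OF A(1)] l(2)] .
  then show ?thesis using l(1) A by blast
qed

text \<open>The integral is defined through level sets, and several pieces may share a value. Each
  level set of a non-zero value is a union of pieces; summing over values and then over the pieces
  with that value gives the sum over all pieces.\<close>

lemma haar_integral_eq:
  fixes mu :: "'f mat set \<Rightarrow> 'r"
  assumes mu: "haar_measure v n H mu" and fin: "finite I"
    and co: "\<And>i. i \<in> I \<Longrightarrow> compact_open_in v n H (A i)" and mA: "\<And>i. i \<in> I \<Longrightarrow> mu (A i) = M"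
    and ne: "\<And>i. i \<in> I \<Longrightarrow> A i \<noteq> {}"
    and d: "\<And>i i'. i \<in> I \<Longrightarrow> i' \<in> I \<Longrightarrow> i \<noteq> i' \<Longrightarrow> A i \<inter> A i' = {}"
    and val: "\<And>i k. i \<in> I \<Longrightarrow> k \<in> A i \<Longrightarrow> phi k = c i"
    and zero: "\<And>k. k \<in> H \<Longrightarrow> k \<notin> (\<Union>i\<in>I. A i) \<Longrightarrow> phi k = 0"
  shows "haar_integral H mu phi = M * (\<Sum>i\<in>I. c i)"
proof -
  have AH: "A i \<subseteq> H" if "i \<in> I" for i using co[OF that] by (simp add: compact_open_in_def)
  have sub: "c ` I \<subseteq> phi ` H"
  proof
    fix x assume "x \<in> c ` I"
    then obtain i where i: "i \<in> I" "x = c i" by blast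
    obtain k where k: "k \<in> A i" using ne[OF i(1)] by blast
    then have "k \<in> H" "phi k = x" using AH[OF i(1)] val[OF i(1) k] i(2) by auto
    then show "x \<in> phi ` H" by blast
  qed
  have sup: "phi ` H \<subseteq> insert 0 (c ` I)"
  proof
    fix x assume "x \<in> phi ` H"
    then obtain k where k: "k \<in> H" "x = phi k" by blast
    show "x \<in> insert 0 (c ` I)"
    proof (cases "k \<in> (\<Union>i\<in>I. A i)")
      case True
      then obtain i where "i \<in> I" "k \<in> A i" by blast
      then show ?thesis using val k(2) by blast
    qed (use zero[OF k(1)] k(2) in blast)
  qed
  have finp: "finite (phi ` H)" by (rule finite_subset[OF sup]) (use fin in simp)
  have lev: "x * mu {k \<in> H. phi k = x} = (\<Sum>i\<in>{i \<in> I. c i = x}. c i * M)" if x: "x \<in> c ` I" for x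
  \<comment> \<open>The level set of 0 may contain points outside all pieces, but its contribution
    carries the factor 0.\<close>
  proof (cases "x = 0")
    case True
    then show ?thesis by simp
  next
    case False
    have "{k \<in> H. phi k = x} = (\<Union>i\<in>{i \<in> I. c i = x}. A i)"
    proof (intro equalityI subsetI)
      fix k assume k: "k \<in> {k \<in> H. phi k = x}"
      have "k \<in> (\<Union>i\<in>I. A i)" using zero[of k] k False by blast
      then obtain i where i: "i \<in> I" "k \<in> A i" by blast
      then have "c i = x" using val[OF i] k by simp
      then show "k \<in> (\<Union>i\<in>{i \<in> I. c i = x}. A i)" using i by blast
    next
      fix k assume "k \<in> (\<Union>i\<in>{i \<in> I. c i = x}. A i)"
      then obtain i where i: "i \<in> I" "c i = x" "k \<in> A i" by blast
      then show "k \<in> {k \<in> H. phi k = x}" using AH[OF i(1)] val[OF i(1,3)] by auto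
    qed
    moreover have "mu (\<Union>i\<in>{i \<in> I. c i = x}. A i) = (\<Sum>i\<in>{i \<in> I. c i = x}. mu (A i))"
    proof (rule conjunct2[OF haar_additive[OF mu]])
      show "finite {i \<in> I. c i = x}" using fin by simp
      show "compact_open_in v n H (A i)" if "i \<in> {i \<in> I. c i = x}" for i using that co by simp
      show "A i \<inter> A i' = {}" if "i \<in> {i \<in> I. c i = x}" "i' \<in> {i \<in> I. c i = x}" "i \<noteq> i'" for i i'
        using that by (intro d) auto
    qed
    ultimately show ?thesis using mA by (simp add: sum_distrib_left)
  qed
  have "haar_integral H mu phi = (\<Sum>x\<in>c ` I. x * mu {k \<in> H. phi k = x})"
    unfolding haar_integral_def by (rule sum.mono_neutral_right[OF finp sub]) (use sup in auto)
  also have "\<dots> = (\<Sum>x\<in>c ` I. \<Sum>i\<in>{i \<in> I. c i = x}. c i * M)" by (rule sum.cong) (auto simp: lev)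
  also have "\<dots> = (\<Sum>i\<in>I. c i * M)" by (rule sum.image_gen[OF fin, symmetric])
  finally show ?thesis by (simp add: sum_distrib_left mult.commute)
qed

text \<open>The formula is proved for every Haar measure with the factor \<open>mu H'\<close>, so
  that it yields both the existence and the uniqueness of the normalised one.\<close>

theorem bessel_integral:
  fixes mu :: "'f mat set \<Rightarrow> 'r"
  assumes mu: "haar_measure v n H mu" and g: "g \<in> GLn n"
  shows "haar_integral H mu (\<lambda>k. BV (g * k * SigmaInv w n) y) = mu H' * Fa n a0 g y"
proof (cases "drel n n g (Sigma w n)")
  case False
  have "BV (g * k * SigmaInv w n) = 0" if k: "k \<in> H" for k
  proof (rule BV_zero, rule notI, elim exE conjE)
    fix z l assume r: "z \<noteq> 0" "l \<in> Kn v n" "g * k * SigmaInv w n = scal n z * l"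
    have kG: "k \<in> GLn n" using H_facts(2)[OF k] .
    have "g * k = scal n z * l * Sigma w n"
      unfolding r(3)[symmetric] Sigma_inverse(1) using ginv_cancel(4)[OF Sigma_inverse(2) GLn_mult[OF g kG]] by simp
    then have "g = scal n z * l * Sigma w n * ginv k"
      using ginv_cancel(3)[OF kG g] by simp
    then show False using False drelI[OF r(1,2) Knm_ginv[OF n1 k]] by blast
  qed
  then have z: "BV (g * k * SigmaInv w n) y = 0" if "k \<in> H" for k using that by simp
  have "haar_integral H mu (\<lambda>k. BV (g * k * SigmaInv w n) y) = 0"
    unfolding haar_integral_def by (rule sum.neutral) (use z in auto)
  moreover have "Fa n a0 g = 0" using Fa_zero[of n g a0] False by (simp add: a0(2))
  ultimately show ?thesis by simp
next
  case True
  then obtain z l h where r: "z \<noteq> 0" "l \<in> Kn v n" "h \<in> H" "g = scal n z * l * Sigma w n * h"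
    by (auto simp: drel_def)
  have hG: "h \<in> GLn n" using H_facts(2)[OF r(3)] .
  have gs: "g * k * SigmaInv w n = scal n z * (l * St (h * k))" if k: "k \<in> GLn n" for k
    unfolding r(4) St_def Sigma_inverse(1)
    using scal_GLn[OF r(1), of n] Kn_GLn[OF r(2)] hG k Sigma_inverse(2) ginv(3)[OF Sigma_inverse(2)]
    by (simp add: GLn_assoc[where n = n] GLn_mult)
  \<comment> \<open>The part of \<open>H\<close> on which the integrand is the Bessel function
    translated by \<open>b\<close>, up to the outer action of \<open>z\<close> and
    \<open>l\<close>.\<close>
  define A where "A b = {k \<in> H. St (h * k) \<in> Kn v n \<and> kbar red n (St (h * k)) = b}" for b
  define c where "c b = om z * rt n (kbar red n l) (rt n b B) y" for b
  \<comment> \<open>If \<open>St (h * k)\<close> lies in the product of the centre and K at all,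
    then \<open>h * k\<close> stabilises the coset of Sigma, so the scalar is a unit and the
    reduction is in B^op. Hence the integrand vanishes outside the pieces
    \<open>A b\<close>.\<close>
  have ZK: "St (h * k) \<in> Kn v n \<and> kbar red n (St (h * k)) \<in> Bop n"
    if k: "k \<in> H" and x: "x \<noteq> 0" "X \<in> Kn v n" "St (h * k) = scal n x * X" for k x X
  proof -
    have hk: "h * k \<in> H" using Knm_mult[OF n1 r(3) k] .
    have "scal n x * X * tt a0 = tt a0 * (h * k)" using St_mult[OF H_facts(2)[OF hk]] x(3) by (simp add: a0(2))
    note u = coset_unique[OF n1 x(1,2) hk this a0(1) a0(1)]
    have "St (h * k) \<in> Kn v n" unfolding x(3) by (rule Kn_mult[OF scal_Kn(1)[OF u(1)] x(2)])
    moreover have "kbar red n (St (h * k)) = scal n (red x) * kbar red n X"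
      unfolding x(3) using scal_Kn[OF u(1)] x(2) by (simp add: kbar_mult Kn_intg)
    ultimately show ?thesis using u(3) by simp
  qed
  \<comment> \<open>After correcting by a lift \<open>s\<close> of \<open>b\<close> and by
    \<open>h\<close>, the condition on \<open>k\<close> becomes trivial reduction. So every piece is
    a left translate of \<open>H'\<close>, and all pieces have the same volume.\<close>
  have Aeq: "\<exists>t\<in>H. A b = (\<lambda>k. t * k) ` H'" if b: "b \<in> Bop n" for b
  proof -
    obtain s where s: "s \<in> H" "St s \<in> Kn v n" "kbar red n (St s) = b" using Bop_lift[OF b] by blast
    have sG: "s \<in> GLn n" using H_facts(2)[OF s(1)] .
    define t where "t = ginv h * s"
    have t: "t \<in> H" unfolding t_def using Knm_mult[OF n1 Knm_ginv[OF n1 r(3)] s(1)] .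
    have tG: "t \<in> GLn n" using H_facts(2)[OF t] .
    have ht: "h * t = s" unfolding t_def using ginv_cancel(1)[OF hG sG] .
    have key: "t * k \<in> A b \<longleftrightarrow> k \<in> H'" if k: "k \<in> H" for k
    proof -
      have kG: "k \<in> GLn n" using H_facts(2)[OF k] .
      have tk: "t * k \<in> H" using Knm_mult[OF n1 t k] .
      have "St (h * (t * k)) = St (s * k)" using ht GLn_assoc[OF hG tG kG] by simp
      also have "\<dots> = St s * St k" by (rule St_hom[OF sG kG])
      finally have e: "St (h * (t * k)) = St s * St k" .
      have bG: "b \<in> GLn n" using Bop_GLn[OF b n1] .
      show ?thesis
      proof
        assume "t * k \<in> A b"
        then have "St (h * (t * k)) \<in> Kn v n \<and> kbar red n (St (h * (t * k))) = b" by (simp add: A_def)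
        then have a: "St s * St k \<in> Kn v n" "kbar red n (St s * St k) = b" unfolding e by blast+
        have "ginv (St s) * (St s * St k) = St k" using ginv_cancel(2)[OF St_GLn[OF sG] St_GLn[OF kG]] .
        then have K: "St k \<in> Kn v n" using Kn_mult[OF Kn_ginv[OF s(2)] a(1)] by simp
        have "b * kbar red n (St k) = b" using a(2) s(2,3) K by (simp add: kbar_mult Kn_intg)
        then have "ginv b * (b * kbar red n (St k)) = ginv b * b" by simp
        then have "kbar red n (St k) = 1\<^sub>m n"
          using ginv_cancel(2)[OF bG kbar_GLn[OF K]] ginv(2)[OF bG] by simp
        then show "k \<in> H'" using H'_iff[OF k] K by blast
      next
        assume "k \<in> H'"
        then have K: "St k \<in> Kn v n" "kbar red n (St k) = 1\<^sub>m n" using H'_iff[OF k] by blast+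
        have "kbar red n (St s * St k) = b"
          using s K bG by (simp add: kbar_mult Kn_intg GLn_one_mult)
        then have "St (h * (t * k)) \<in> Kn v n \<and> kbar red n (St (h * (t * k))) = b"
          unfolding e using Kn_mult[OF s(2) K(1)] by blast
        then show "t * k \<in> A b" using tk by (simp add: A_def)
      qed
    qed
    have "A b = (\<lambda>k. t * k) ` H'"
    proof (intro equalityI subsetI)
      fix k assume k: "k \<in> A b"
      then have kH: "k \<in> H" by (simp add: A_def)
      have i: "ginv t * k \<in> H" using Knm_mult[OF n1 Knm_ginv[OF n1 t] kH] .
      have tt: "t * (ginv t * k) = k" using ginv_cancel(1)[OF tG H_facts(2)[OF kH]] .
      have "ginv t * k \<in> H'" using key[OF i] k unfolding tt by blast
      then show "k \<in> (\<lambda>k. t * k) ` H'" using tt by (metis imageI)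
    next
      fix k assume "k \<in> (\<lambda>k. t * k) ` H'"
      then obtain k0 where "k0 \<in> H'" "k = t * k0" by blast
      then show "k \<in> A b" using key[of k0] H'_H by blast
    qed
    then show ?thesis using t by blast
  qed
  have "haar_integral H mu (\<lambda>k. BV (g * k * SigmaInv w n) y) = mu H' * (\<Sum>b\<in>Bop n. c b)"
  proof (rule haar_integral_eq[OF mu finite_Bop])
    fix b :: "'k mat" assume b: "b \<in> Bop n"
    obtain t where t: "t \<in> H" "A b = (\<lambda>k. t * k) ` H'" using Aeq[OF b] by blast
    show "compact_open_in v n H (A b)" unfolding t(2) compact_open_iff using H_translate(1)[OF t(1) unif_H'] by blast
    have "compact_open_in v n H H'" unfolding compact_open_iff using unif_H' by blast
    then show "mu (A b) = mu H'" unfolding t(2) using mu t(1) unfolding haar_measure_def by blast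
    have "1\<^sub>m n \<in> H'" by (simp add: H'_def box_def)
    then show "A b \<noteq> {}" unfolding t(2) by blast
  next
    fix b b' :: "'k mat" assume "b \<noteq> b'"
    then show "A b \<inter> A b' = {}" unfolding A_def by blast
  next
    fix b k assume b: "b \<in> Bop n" and k: "k \<in> A b"
    have kH: "k \<in> H" and K: "St (h * k) \<in> Kn v n" "kbar red n (St (h * k)) = b" using k by (auto simp: A_def)
    have "BV (g * k * SigmaInv w n) y = om z * rt n (kbar red n (l * St (h * k))) B y"
      unfolding gs[OF H_facts(2)[OF kH]] BV_eq[OF r(1) Kn_mult[OF r(2) K(1)]] ..
    also have "\<dots> = c b"
      unfolding c_def using r(2) K Bop_GLn[OF b n1] by (simp add: kbar_mult Kn_intg rt_rt kbar_GLn)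
    finally show "BV (g * k * SigmaInv w n) y = c b" .
  next
    fix k assume k: "k \<in> H" and no: "k \<notin> (\<Union>b\<in>Bop n. A b)"
    have "BV (g * k * SigmaInv w n) = 0"
    proof (rule BV_zero, rule notI, elim exE conjE)
      fix x X assume x: "x \<noteq> 0" "X \<in> Kn v n" "g * k * SigmaInv w n = scal n x * X"
      have hkG: "St (h * k) \<in> GLn n" by (rule St_GLn[OF GLn_mult[OF hG H_facts(2)[OF k]]])
      have e: "scal n z * (l * St (h * k)) = scal n x * X" using gs[OF H_facts(2)[OF k]] x(3) by simp
      have iz: "inverse z \<noteq> 0" using r(1) by simp
      note G = scal_GLn[OF r(1), of n] scal_GLn[OF iz, of n] scal_GLn[OF x(1), of n] Kn_GLn[OF r(2)] Kn_GLn[OF x(2)]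
        ginv(3)[OF Kn_GLn[OF r(2)]]
      have "l * St (h * k) = scal n (inverse z) * (scal n z * (l * St (h * k)))"
        using G hkG r(1) by (simp add: GLn_assoc[where n = n, symmetric] GLn_mult scal_mult scal_one GLn_carrier)
      also have "\<dots> = scal n (inverse z * x) * X"
        unfolding e using G by (simp add: GLn_assoc[where n = n, symmetric] scal_mult)
      finally have "ginv l * (l * St (h * k)) = ginv l * (scal n (inverse z * x) * X)" by simp
      then have "St (h * k) = ginv l * (scal n (inverse z * x) * X)"
        using ginv_cancel(2)[OF Kn_GLn[OF r(2)] hkG] by simp
      also have "\<dots> = (ginv l * scal n (inverse z * x)) * X"
        using G iz x(1) by (simp add: GLn_assoc[where n = n] scal_GLn)
      also have "ginv l * scal n (inverse z * x) = scal n (inverse z * x) * ginv l"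
        using G by (simp add: scal_commute GLn_carrier)
      also have "scal n (inverse z * x) * ginv l * X = scal n (inverse z * x) * (ginv l * X)"
        using G iz x(1) by (simp add: GLn_assoc[where n = n] scal_GLn)
      finally have s: "St (h * k) = scal n (inverse z * x) * (ginv l * X)" .
      have ix: "inverse z * x \<noteq> 0" using iz x(1) by simp
      note st = ZK[OF k ix Kn_mult[OF Kn_ginv[OF r(2)] x(2)] s]
      then have "k \<in> A (kbar red n (St (h * k)))" unfolding A_def using k by blast
      then show False using no st by blast
    qed
    then show "BV (g * k * SigmaInv w n) y = 0" by simp
  qed
  also have "(\<Sum>b\<in>Bop n. c b) = Fa n a0 g y"
  proof -
    have "Fa n a0 g = (\<lambda>y. om z * rt n (kbar red n l) W0 y)"
    proof (rule Fa_eq[OF n1 a0(1)])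
      show "Rp n a0 g (\<lambda>y. om z * rt n (kbar red n l) W0 y)"
        unfolding Rp_def a0(2) using r by blast
    qed
    moreover have "rt n (kbar red n l) W0 = (\<lambda>y. \<Sum>b\<in>Bop n. rt n (kbar red n l) (rt n b B) y)"
      unfolding W0_def by (auto simp: rt_def fun_eq_iff)
    ultimately show ?thesis unfolding c_def by (simp add: sum_distrib_left)
  qed
  finally show ?thesis .
qed

text \<open>Existence takes the Haar measure with \<open>mu H' = 1\<close>. Conversely, evaluating
  the identity at Sigma and then at the identity matrix, where the newform has value 1, forces this
  normalisation.\<close>

lemma newform_measure:
  "\<exists>!mu :: 'f mat set \<Rightarrow> 'r. haar_measure v n H mu \<and>
     (\<forall>g\<in>GLn n. Fa n a0 g = (\<lambda>y. haar_integral H mu (\<lambda>k. BV (g * k * SigmaInv w n) y)))"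
proof (rule ex_ex1I)
  obtain mu :: "'f mat set \<Rightarrow> 'r" where mu: "haar_measure v n H mu" "mu H' = 1" using haar_exists by blast
  have "Fa n a0 g = (\<lambda>y. haar_integral H mu (\<lambda>k. BV (g * k * SigmaInv w n) y))" if "g \<in> GLn n" for g
    unfolding bessel_integral[OF mu(1) that] mu(2) by simp
  then show "\<exists>mu :: 'f mat set \<Rightarrow> 'r. haar_measure v n H mu \<and>
     (\<forall>g\<in>GLn n. Fa n a0 g = (\<lambda>y. haar_integral H mu (\<lambda>k. BV (g * k * SigmaInv w n) y)))"
    using mu(1) by blast
next
  fix mu nu :: "'f mat set \<Rightarrow> 'r"
  have one: "mu H' = 1" if a: "haar_measure v n H mu \<and>
     (\<forall>g\<in>GLn n. Fa n a0 g = (\<lambda>y. haar_integral H mu (\<lambda>k. BV (g * k * SigmaInv w n) y)))" for mu :: "'f mat set \<Rightarrow> 'r"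
  proof -
    have one: "Fa n a0 (Sigma w n) (1\<^sub>m n) = 1" using Fa_tt[OF n1 a0(1)] W0(2) by (simp add: a0(2))
    have "Fa n a0 (Sigma w n) (1\<^sub>m n) =
        haar_integral H mu (\<lambda>k. BV (Sigma w n * k * SigmaInv w n) (1\<^sub>m n))"
      by (rule fun_cong[OF bspec[OF conjunct2[OF a] Sigma_inverse(2)]])
    also have "\<dots> = mu H' * Fa n a0 (Sigma w n) (1\<^sub>m n)"
      by (rule bessel_integral[OF conjunct1[OF a] Sigma_inverse(2)])
    finally show ?thesis unfolding one by simp
  qed
  assume mu: "haar_measure v n H mu \<and> (\<forall>g\<in>GLn n. Fa n a0 g = (\<lambda>y. haar_integral H mu (\<lambda>k. BV (g * k * SigmaInv w n) y)))"
    and nu: "haar_measure v n H nu \<and> (\<forall>g\<in>GLn n. Fa n a0 g = (\<lambda>y. haar_integral H nu (\<lambda>k. BV (g * k * SigmaInv w n) y)))"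
  show "mu = nu" by (rule haar_unique[OF conjunct1[OF mu] one[OF mu] conjunct1[OF nu] one[OF nu]])
qed

end

theorem theorem4p1:
  fixes v :: "'f::field \<Rightarrow> int" and red :: "'f \<Rightarrow> 'k::{field,finite}" and w :: 'f
    and n :: nat and psi :: "'k \<Rightarrow> 'r::field" and om :: "'f \<Rightarrow> 'r"
    and Wt :: "('k mat \<Rightarrow> 'r) set"
  assumes "n \<ge> 2"
    and "nonarch_local_field v red w"
    and "alg_closed TYPE('r)"
    and "CHAR('r) \<noteq> CHAR('k)"
    and "nontriv_add_char psi"
    and "cuspidal_whittaker_model n psi Wt"
    and "central_char_compatible v red n om Wt"
  shows
    "conductor v red n om Wt = n
     \<and> fun_dim (fixed_vectors v red n om Wt n) = 1
     \<and> (\<forall>f\<in>fixed_vectors v red n om Wt n. \<forall>g\<in>GLn n. f g \<noteq> 0 \<longrightarrow>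
          (\<exists>z k k'. z \<noteq> 0 \<and> k \<in> Kn v n \<and> k' \<in> Knm v n n \<and> g = scal n z * k * Sigma w n * k'))
     \<and> (\<forall>m>n. fun_dim (fixed_vectors v red n om Wt m) = (m - 1) choose (n - 1))
     \<and> (\<exists>!f. f \<in> fixed_vectors v red n om Wt n \<and>
          f (Sigma w n) = (\<lambda>y. \<Sum>b\<in>Bop n. rt n b (bessel n psi Wt) y))
     \<and> (\<forall>f. f \<in> fixed_vectors v red n om Wt n \<and>
          f (Sigma w n) = (\<lambda>y. \<Sum>b\<in>Bop n. rt n b (bessel n psi Wt) y) \<longrightarrow>
          f \<noteq> 0 \<and>
          (\<exists>!mu. haar_measure v n (Knm v n n) mu \<and>
             (\<forall>g\<in>GLn n. f g = (\<lambda>y. haar_integral (Knm v n n) mu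
                 (\<lambda>k. bessel_vector v red n om psi Wt (g * k * SigmaInv w n) y)))))"
proof -
  interpret depth_zero v red w psi n Wt om
    using assms by unfold_locales
  have supp: "\<exists>z k k'. z \<noteq> 0 \<and> k \<in> Kn v n \<and> k' \<in> Knm v n n \<and> g = scal n z * k * Sigma w n * k'"
    if fg: "f \<in> Fx n" "g \<in> GLn n" "f g \<noteq> 0" for f g
  proof -
    obtain a where a: "admissible n a" "drel n n g (tt a)" using support_classification[OF fg(1) n1 fg(2,3)] by blast
    then show ?thesis using admissible_n[OF a(1)] by (simp add: drel_def)
  qed
  have nz: "Fa n a0 \<noteq> 0"
  proof
    assume "Fa n a0 = 0"
    then have "Fa n a0 (Sigma w n) (1\<^sub>m n) = 0" by simp
    then show False using Fa_tt[OF n1 a0(1)] W0(2) by (simp add: a0(2))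
  qed
  have m1: "m \<ge> 1" if "m > n" for m using that by simp
  have dimn: "fun_dim (Fx n) = 1" using dim_Fx[OF n1] by simp
  \<comment> \<open>Rewriting with \<open>newform_unique\<close> turns both conditions on
    \<open>f\<close> into \<open>f = Fa n a0\<close>, which leaves its non-vanishing and the
    statement on the measure.\<close>
  show ?thesis
    unfolding W0_def[symmetric] newform_unique
    using conductor_eq dimn supp dim_Fx[OF m1] nz newform_measure by (intro conjI allI impI ballI) auto
qed

end
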